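(* Assume (H) and let $(\mathcal D_m)_{m\in\mathbb N}$ be a sequence of space-time gradient discretisations that is coercive, consistent, limit-conforming and compact. Assume that, for each $m$, $u_m$ is a solution of the gradient scheme with $\mathcal D=\mathcal D_m$ and that $\bar u$ is a solution of the continuous problem such that, as $m\to\infty$: $\Pi_{\mathcal D_m}\beta(u_m)\to\beta(\bar u)$ weakly in $L^2(\Omega)$ uniformly on $[0,T]$; $\Pi_{\mathcal D_m}\nu(u_m)\to\nu(\bar u)$ strongly in $L^1(\Omega\times(0,T))$; $\Pi_{\mathcal D_m}\zeta(u_m)\to\zeta(\bar u)$ weakly in $L^p(\Omega\times(0,T))$; $\nabla_{\mathcal D_m}\zeta(u_m)\to\nabla\zeta(\bar u)$ weakly in $L^p(\Omega\times(0,T))^d$. Assume moreover that $\mathbf a$ is strictly monotone: $(\mathbf a(x,s,\xi)-\mathbf a(x,s,\chi))\cdot(\xi-\chi)>0$ for a.e. $x\in\Omega$, all $s\in\mathbb R$ and all $\xi\neq\chi\in\mathbb R^d$. Then $\Pi_{\mathcal D_m}\zeta(u_m)\to\zeta(\bar u)$ strongly in $L^p(\Omega\times(0,T))$ and $\nabla_{\mathcal D_m}\zeta(u_m)\to\nabla\zeta(\bar u)$ strongly in $L^p(\Omega\times(0,T))^d$.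
   Context: Fix an open bounded set $\Omega\subset\mathbb R^d$ ($d\ge1$), $T>0$, $p\in(1,\infty)$, $p'=p/(p-1)$. Assumptions (H): $\zeta\in C^0(\mathbb R)$ is nondecreasing, Lipschitz with constant $L_\zeta>0$, $\zeta(0)=0$, and $|\zeta(s)|\ge M_0|s|-M_1$ for all $s$, for some $M_0,M_1>0$; $\beta\in C^0(\mathbb R)$ is nondecreasing, Lipschitz with constant $L_\beta>0$, $\beta(0)=0$; $\nu(s)=\int_0^s\zeta'(q)\beta'(q)\,dq$; $\mathbf a:\Omega\times\mathbb R\times\mathbb R^d\to\mathbb R^d$ is Carathéodory (measurable in $x$, continuous in $(s,\xi)$) and for a.e. $x$, all $s$, $\xi,\chi$: $\mathbf a(x,s,\xi)\cdot\xi\ge\underline a|\xi|^p$ for some $\underline a>0$; $(\mathbf a(x,s,\xi)-\mathbf a(x,s,\chi))\cdot(\xi-\chi)\ge0$; $|\mathbf a(x,s,\xi)|\le\overline a(x)+\mu|\xi|^{p-1}$ with $\overline a\in L^{p'}(\Omega)$, $\mu>0$; $u_{\rm ini}\in L^2(\Omega)$, $f\in L^{p'}(\Omega\times(0,T))$. Let $R_\beta$ be the range of $\beta$; for $s\in R_\beta$, $\beta_r(s)$ is the closest $t$ to $0$ with $\beta(t)=s$; $B(z)=\int_0^z\zeta(\beta_r(s))\,ds$ for $z\in R_\beta$, extended to $\overline{R_\beta}$ by its limits (possibly $+\infty$) at the endpoints. Continuous problem: a solution is a measurable $\bar u$ with $\bar u\in L^p(\Omega\times(0,T))$, $\zeta(\bar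 u)\in L^p(0,T;W^{1,p}_0(\Omega))$, $B(\beta(\bar u))\in L^\infty(0,T;L^1(\Omega))$, $\beta(\bar u)$ having an a.e. representative (denoted $\beta(\bar u)(\cdot,t)$) in $C([0,T];L^2(\Omega)\text{-w})$ (continuous into $L^2(\Omega)$ with its weak topology), distributional derivative $\partial_t\beta(\bar u)\in L^{p'}(0,T;W^{-1,p'}(\Omega))$, $\beta(\bar u)(\cdot,0)=\beta(u_{\rm ini})$, and $\int_0^T\langle\partial_t\beta(\bar u),\bar v\rangle_{W^{-1,p'},W^{1,p}_0}dt+\int_0^T\!\int_\Omega\mathbf a(x,\nu(\bar u),\nabla\zeta(\bar u))\cdot\nabla\bar v=\int_0^T\!\int_\Omega f\bar v$ for all $\bar v\in L^p(0,T;W^{1,p}_0(\Omega))$. Space-time gradient discretisation: $\mathcal D=(X_{\mathcal D,0},\Pi_{\mathcal D},\nabla_{\mathcal D},\mathcal I_{\mathcal D},(t^{(n)})_{n=0}^N)$ with $X_{\mathcal D,0}=\mathbb R^I$ ($I$ finite), a family $(\Omega_i)_{i\in I}$ of disjoint subsets with union $\Omega$ and $\Pi_{\mathcal D}u=u_i$ on $\Omega_i$; $\nabla_{\mathcal D}:X_{\mathcal D,0}\to L^p(\Omega)^d$ linear with $\|\nabla_{\mathcal D}\cdot\|_{L^p}$ a norm; $\mathcal I_{\mathcal D}:L^2(\Omega)\to X_{\mathcal D,0}$ linear; $0=t^{(0)}<\dots<t^{(N)}=T$, $\delta t^{(n+1/2)}=t^{(n+1)}-t^{(n)}$, $\delta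 t_{\mathcal D}=\max_n\delta t^{(n+1/2)}$. For $\chi:\mathbb R\to\mathbb R$, $\chi(u)=(\chi(u_i))_{i\in I}$. For $v=(v^{(n)})_n\subset X_{\mathcal D,0}$: $\Pi_{\mathcal D}v(\cdot,0)=\Pi_{\mathcal D}v^{(0)}$ and for $t\in(t^{(n)},t^{(n+1)}]$, $\Pi_{\mathcal D}v(\cdot,t)=\Pi_{\mathcal D}v^{(n+1)}$, $\nabla_{\mathcal D}v(\cdot,t)=\nabla_{\mathcal D}v^{(n+1)}$, $\delta_{\mathcal D}v(t)=(v^{(n+1)}-v^{(n)})/\delta t^{(n+1/2)}$. Properties of a sequence $(\mathcal D_m)$: coercive if $\sup_m C_{\mathcal D_m}<\infty$, $C_{\mathcal D}=\max_{v\neq0}\|\Pi_{\mathcal D}v\|_{L^p}/\|\nabla_{\mathcal D}v\|_{L^p}$; consistent if $\widehat S_{\mathcal D_m}(\varphi)\to0$ for all $\varphi\in L^2(\Omega)\cap W^{1,p}_0(\Omega)$, where $\widehat S_{\mathcal D}(\varphi)=\min_{w}(\|\Pi_{\mathcal D}w-\varphi\|_{L^{\max(p,2)}}+\|\nabla_{\mathcal D}w-\nabla\varphi\|_{L^p})$, $\Pi_{\mathcal D_m}\mathcal I_{\mathcal D_m}\varphi\to\varphi$ in $L^2$ for all $\varphi\in L^2(\Omega)$, and $\delta t_{\mathcal D_m}\to0$; limit-conforming if $W_{\mathcal D_m}(\boldsymbol\varphi)\to0$ for all $\boldsymbol\varphi\in L^{p'}(\Omega)^d$ with $\mathrm{div}\boldsymbol\varphi\in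 L^{p'}(\Omega)$, where $W_{\mathcal D}(\boldsymbol\varphi)=\max_{u\ne0}|\int_\Omega(\nabla_{\mathcal D}u\cdot\boldsymbol\varphi+\Pi_{\mathcal D}u\,\mathrm{div}\boldsymbol\varphi)|/\|\nabla_{\mathcal D}u\|_{L^p}$; compact if $\lim_{\xi\to0}\sup_mT_{\mathcal D_m}(\xi)=0$, where $T_{\mathcal D}(\xi)=\max_{v\ne0}\|\Pi_{\mathcal D}v(\cdot+\xi)-\Pi_{\mathcal D}v\|_{L^p(\mathbb R^d)}/\|\nabla_{\mathcal D}v\|_{L^p}$ ($\Pi_{\mathcal D}v$ extended by $0$ outside $\Omega$). Gradient scheme: $u=(u^{(n)})_{n=0}^N\subset X_{\mathcal D,0}$ with $u^{(0)}=\mathcal I_{\mathcal D}u_{\rm ini}$ and, for all $v=(v^{(n)})_{n=1}^N\subset X_{\mathcal D,0}$, $\int_0^T\!\int_\Omega[\Pi_{\mathcal D}\delta_{\mathcal D}\beta(u)\,\Pi_{\mathcal D}v+\mathbf a(x,\Pi_{\mathcal D}\nu(u),\nabla_{\mathcal D}\zeta(u))\cdot\nabla_{\mathcal D}v]=\int_0^T\!\int_\Omega f\,\Pi_{\mathcal D}v$. Uniform-in-time weak $L^2$ convergence: $w_m:[0,T]\to L^2(\Omega)$ converges to $w$ weakly in $L^2(\Omega)$ uniformly on $[0,T]$ if for every $\varphi\in L^2(\Omega)$, $t\mapsto\langle w_m(t),\varphi\rangle_{L^2}$ converges uniformly on $[0,T]$ to $t\mapsto\langle w(t),\varphi\rangle_{L^2}$.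 *)

theory Defs
  imports "HOL-Analysis.Analysis"
begin

definition Lp :: "'b measure \<Rightarrow> real \<Rightarrow> ('b \<Rightarrow> 'c::euclidean_space) set" where
  "Lp M p = {f. f \<in> borel_measurable M \<and> integrable M (\<lambda>x. norm (f x) powr p)}"

definition Lp_norm :: "'b measure \<Rightarrow> real \<Rightarrow> ('b \<Rightarrow> 'c::euclidean_space) \<Rightarrow> real" where
  "Lp_norm M p f = (\<integral>x. norm (f x) powr p \<partial>M) powr (1 / p)"

definition conj_exp :: "real \<Rightarrow> real" where
  "conj_exp p = p / (p - 1)"

definition Lp_strong :: "'b measure \<Rightarrow> real \<Rightarrow> (nat \<Rightarrow> 'b \<Rightarrow> 'c::euclidean_space) \<Rightarrow> ('b \<Rightarrow> 'c) \<Rightarrow> bool" where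
  "Lp_strong M p F f \<longleftrightarrow> (\<forall>m. F m \<in> Lp M p) \<and> f \<in> Lp M p \<and>
     (\<lambda>m. Lp_norm M p (\<lambda>x. F m x - f x)) \<longlonglongrightarrow> 0"

definition Lp_weak :: "'b measure \<Rightarrow> real \<Rightarrow> (nat \<Rightarrow> 'b \<Rightarrow> 'c::euclidean_space) \<Rightarrow> ('b \<Rightarrow> 'c) \<Rightarrow> bool" where
  "Lp_weak M p F f \<longleftrightarrow> (\<forall>m. F m \<in> Lp M p) \<and> f \<in> Lp M p \<and>
     (\<forall>g \<in> Lp M (conj_exp p). (\<lambda>m. \<integral>x. F m x \<bullet> g x \<partial>M) \<longlonglongrightarrow> (\<integral>x. f x \<bullet> g x \<partial>M))"

definition pderiv_dir :: "'a::euclidean_space \<Rightarrow> ('a \<Rightarrow> real) \<Rightarrow> 'a \<Rightarrow> real" where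
  "pderiv_dir e f = (\<lambda>x. frechet_derivative f (at x) e)"

definition smooth_fun :: "('a::euclidean_space \<Rightarrow> real) \<Rightarrow> bool" where
  "smooth_fun f \<longleftrightarrow> (\<forall>es. set es \<subseteq> Basis \<longrightarrow> (\<forall>x. fold pderiv_dir es f differentiable (at x)))"

definition test_fun :: "'a::euclidean_space set \<Rightarrow> ('a \<Rightarrow> real) \<Rightarrow> bool" where
  "test_fun U f \<longleftrightarrow> smooth_fun f \<and> compact (closure {x. f x \<noteq> 0}) \<and> closure {x. f x \<noteq> 0} \<subseteq> U"

definition grad :: "('a::euclidean_space \<Rightarrow> real) \<Rightarrow> 'a \<Rightarrow> 'a" where
  "grad f = (\<lambda>x. \<Sum>b\<in>Basis. frechet_derivative f (at x) b *\<^sub>R b)"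

text \<open>u belongs to W^{1,p}_0(Omega) (closure of C_c^infinity(Omega) in W^{1,p}) and g is its gradient\<close>
definition W0 :: "real \<Rightarrow> 'a::euclidean_space set \<Rightarrow> ('a \<Rightarrow> real) \<Rightarrow> ('a \<Rightarrow> 'a) \<Rightarrow> bool" where
  "W0 p \<Omega> u g \<longleftrightarrow> u \<in> Lp (lebesgue_on \<Omega>) p \<and> g \<in> Lp (lebesgue_on \<Omega>) p \<and>
     (\<exists>\<phi>. (\<forall>n. test_fun \<Omega> (\<phi> n)) \<and>
        (\<lambda>n. Lp_norm (lebesgue_on \<Omega>) p (\<lambda>x. \<phi> n x - u x)) \<longlonglongrightarrow> 0 \<and>
        (\<lambda>n. Lp_norm (lebesgue_on \<Omega>) p (\<lambda>x. grad (\<phi> n) x - g x)) \<longlonglongrightarrow> 0)"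

definition weak_div :: "'a::euclidean_space set \<Rightarrow> ('a \<Rightarrow> 'a) \<Rightarrow> ('a \<Rightarrow> real) \<Rightarrow> bool" where
  "weak_div \<Omega> \<phi> \<psi> \<longleftrightarrow> (\<forall>\<theta>. test_fun \<Omega> \<theta> \<longrightarrow>
     (\<integral>x. \<phi> x \<bullet> grad \<theta> x \<partial>lebesgue_on \<Omega>) = - (\<integral>x. \<psi> x * \<theta> x \<partial>lebesgue_on \<Omega>))"

definition beta_r :: "(real \<Rightarrow> real) \<Rightarrow> real \<Rightarrow> real" where
  "beta_r \<beta> s = (THE t. \<beta> t = s \<and> (\<forall>t'. \<beta> t' = s \<longrightarrow> \<bar>t\<bar> \<le> \<bar>t'\<bar>))"

text \<open>B on the range of beta (values of beta(u) always lie in the range)\<close>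
definition Bfun :: "(real \<Rightarrow> real) \<Rightarrow> (real \<Rightarrow> real) \<Rightarrow> real \<Rightarrow> real" where
  "Bfun \<zeta> \<beta> z = (LBINT s=0..z. \<zeta> (beta_r \<beta> s))"

definition nu_fun :: "(real \<Rightarrow> real) \<Rightarrow> (real \<Rightarrow> real) \<Rightarrow> real \<Rightarrow> real" where
  "nu_fun \<zeta> \<beta> s = interval_lebesgue_integral lebesgue 0 (ereal s) (\<lambda>q. deriv \<zeta> q * deriv \<beta> q)"

definition hyp_H :: "'a::euclidean_space set \<Rightarrow> real \<Rightarrow> real \<Rightarrow> (real \<Rightarrow> real) \<Rightarrow> (real \<Rightarrow> real) \<Rightarrow>
    ('a \<Rightarrow> real \<Rightarrow> 'a \<Rightarrow> 'a) \<Rightarrow> ('a \<Rightarrow> real) \<Rightarrow> ('a \<times> real \<Rightarrow> real) \<Rightarrow> bool" where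
  "hyp_H \<Omega> T p \<zeta> \<beta> a u_ini f \<longleftrightarrow>
     open \<Omega> \<and> bounded \<Omega> \<and> T > 0 \<and> p > 1 \<and>
     continuous_on UNIV \<zeta> \<and> mono \<zeta> \<and> (\<exists>L>0. L-lipschitz_on UNIV \<zeta>) \<and> \<zeta> 0 = 0 \<and>
     (\<exists>M0>0. \<exists>M1>0. \<forall>s. \<bar>\<zeta> s\<bar> \<ge> M0 * \<bar>s\<bar> - M1) \<and>
     continuous_on UNIV \<beta> \<and> mono \<beta> \<and> (\<exists>L>0. L-lipschitz_on UNIV \<beta>) \<and> \<beta> 0 = 0 \<and>
     (\<forall>s \<xi>. (\<lambda>x. a x s \<xi>) \<in> borel_measurable (lebesgue_on \<Omega>)) \<and>
     (AE x in lebesgue_on \<Omega>. continuous_on UNIV (\<lambda>(s, \<xi>). a x s \<xi>)) \<and>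
     (\<exists>a_low>0. AE x in lebesgue_on \<Omega>. \<forall>s \<xi>. a x s \<xi> \<bullet> \<xi> \<ge> a_low * norm \<xi> powr p) \<and>
     (AE x in lebesgue_on \<Omega>. \<forall>s \<xi> \<eta>. (a x s \<xi> - a x s \<eta>) \<bullet> (\<xi> - \<eta>) \<ge> 0) \<and>
     (\<exists>abar \<in> Lp (lebesgue_on \<Omega>) (conj_exp p). \<exists>\<mu>>0.
        AE x in lebesgue_on \<Omega>. \<forall>s \<xi>. norm (a x s \<xi>) \<le> abar x + \<mu> * norm \<xi> powr (p - 1)) \<and>
     u_ini \<in> Lp (lebesgue_on \<Omega>) 2 \<and>
     f \<in> Lp (lebesgue_on (\<Omega> \<times> {0<..<T})) (conj_exp p)"

text \<open>ub is a solution; w is the representative of beta(ub) in C([0,T];L^2-weak),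
  G is grad zeta(ub) (zeta(ub) in L^p(0,T;W^{1,p}_0)), Dt t is the value at time t of
  the time derivative of beta(ub) in L^{p'}(0,T;W^{-1,p'}), acting on W^{1,p}_0\<close>
definition cont_solution :: "'a::euclidean_space set \<Rightarrow> real \<Rightarrow> real \<Rightarrow> (real \<Rightarrow> real) \<Rightarrow> (real \<Rightarrow> real) \<Rightarrow>
    ('a \<Rightarrow> real \<Rightarrow> 'a \<Rightarrow> 'a) \<Rightarrow> ('a \<Rightarrow> real) \<Rightarrow> ('a \<times> real \<Rightarrow> real) \<Rightarrow>
    ('a \<times> real \<Rightarrow> real) \<Rightarrow> (real \<Rightarrow> 'a \<Rightarrow> real) \<Rightarrow> ('a \<times> real \<Rightarrow> 'a) \<Rightarrow> (real \<Rightarrow> ('a \<Rightarrow> real) \<Rightarrow> real) \<Rightarrow> bool"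
  where
  "cont_solution \<Omega> T p \<zeta> \<beta> a u_ini f ub w G Dt \<longleftrightarrow>
    (let Q = lebesgue_on (\<Omega> \<times> {0<..<T}); L = lebesgue_on \<Omega>; I = lebesgue_on {0<..<T} in
     ub \<in> borel_measurable Q \<and> ub \<in> Lp Q p \<and>
     \<comment> \<open>zeta(ub) in L^p(0,T;W^{1,p}_0(Omega)) with gradient G\<close>
     G \<in> Lp Q p \<and>
     (AE t in I. W0 p \<Omega> (\<lambda>x. \<zeta> (ub (x, t))) (\<lambda>x. G (x, t))) \<and>
     \<comment> \<open>B(beta(ub)) in L^infinity(0,T;L^1(Omega))\<close>
     (\<lambda>y. Bfun \<zeta> \<beta> (\<beta> (ub y))) \<in> borel_measurable Q \<and>
     (\<exists>C. AE t in I. integrable L (\<lambda>x. Bfun \<zeta> \<beta> (\<beta> (ub (x, t)))) \<and>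
          (\<integral>x. \<bar>Bfun \<zeta> \<beta> (\<beta> (ub (x, t)))\<bar> \<partial>L) \<le> C) \<and>
     \<comment> \<open>w is a representative of beta(ub) in C([0,T];L^2(Omega)-weak)\<close>
     (\<forall>t\<in>{0..T}. w t \<in> Lp L 2) \<and>
     (\<forall>\<phi>\<in>Lp L 2. continuous_on {0..T} (\<lambda>t. \<integral>x. w t x * \<phi> x \<partial>L)) \<and>
     (AE y in Q. w (snd y) (fst y) = \<beta> (ub y)) \<and>
     (AE x in L. w 0 x = \<beta> (u_ini x)) \<and>
     \<comment> \<open>Dt in L^{p'}(0,T;W^{-1,p'}(Omega))\<close>
     (\<forall>v g. W0 p \<Omega> v g \<longrightarrow> (\<lambda>t. Dt t v) \<in> borel_measurable I) \<and>
     (\<exists>h \<in> Lp I (conj_exp p). AE t in I.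
        (\<forall>v g. W0 p \<Omega> v g \<longrightarrow> \<bar>Dt t v\<bar> \<le> h t * Lp_norm L p g) \<and>
        (\<forall>v1 g1 v2 g2 c1 c2. W0 p \<Omega> v1 g1 \<longrightarrow> W0 p \<Omega> v2 g2 \<longrightarrow>
            Dt t (\<lambda>x. c1 * v1 x + c2 * v2 x) = c1 * Dt t v1 + c2 * Dt t v2)) \<and>
     \<comment> \<open>Dt is the distributional time derivative of beta(ub)\<close>
     (\<forall>\<phi>. test_fun (\<Omega> \<times> {0<..<T}) \<phi> \<longrightarrow>
        - (\<integral>y. \<beta> (ub y) * frechet_derivative \<phi> (at y) (0, 1) \<partial>Q)
          = (\<integral>t. Dt t (\<lambda>x. \<phi> (x, t)) \<partial>I)) \<and>
     \<comment> \<open>weak formulation\<close>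
     (\<forall>v Gv. v \<in> Lp Q p \<longrightarrow> Gv \<in> Lp Q p \<longrightarrow>
        (AE t in I. W0 p \<Omega> (\<lambda>x. v (x, t)) (\<lambda>x. Gv (x, t))) \<longrightarrow>
        (\<integral>t. Dt t (\<lambda>x. v (x, t)) \<partial>I)
          + (\<integral>y. a (fst y) (nu_fun \<zeta> \<beta> (ub y)) (G y) \<bullet> Gv y \<partial>Q)
          = (\<integral>y. f y * v y \<partial>Q)))"

record 'a stgd =
  gd_I :: "nat set"
  gd_cell :: "nat \<Rightarrow> 'a set"
  gd_grad :: "(nat \<Rightarrow> real) \<Rightarrow> 'a \<Rightarrow> 'a"
  gd_interp :: "('a \<Rightarrow> real) \<Rightarrow> nat \<Rightarrow> real"
  gd_N :: nat
  gd_t :: "nat \<Rightarrow> real"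

text \<open>X_{D,0} = R^I, realised as functions nat => real vanishing outside I\<close>
definition gd_X :: "'a stgd \<Rightarrow> (nat \<Rightarrow> real) set" where
  "gd_X D = {u. \<forall>i. i \<notin> gd_I D \<longrightarrow> u i = 0}"

definition gd_Pi :: "'a stgd \<Rightarrow> (nat \<Rightarrow> real) \<Rightarrow> 'a \<Rightarrow> real" where
  "gd_Pi D u = (\<lambda>x. \<Sum>i\<in>gd_I D. indicator (gd_cell D i) x * u i)"

definition is_stgd :: "real \<Rightarrow> 'a::euclidean_space set \<Rightarrow> real \<Rightarrow> 'a stgd \<Rightarrow> bool" where
  "is_stgd p \<Omega> T D \<longleftrightarrow>
     finite (gd_I D) \<and>
     (\<forall>i\<in>gd_I D. gd_cell D i \<in> sets lebesgue) \<and>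
     disjoint_family_on (gd_cell D) (gd_I D) \<and> (\<Union>i\<in>gd_I D. gd_cell D i) = \<Omega> \<and>
     (\<forall>u\<in>gd_X D. gd_grad D u \<in> Lp (lebesgue_on \<Omega>) p) \<and>
     (\<forall>u\<in>gd_X D. \<forall>v\<in>gd_X D. \<forall>c1 c2. AE x in lebesgue_on \<Omega>.
         gd_grad D (\<lambda>i. c1 * u i + c2 * v i) x = c1 *\<^sub>R gd_grad D u x + c2 *\<^sub>R gd_grad D v x) \<and>
     (\<forall>u\<in>gd_X D. Lp_norm (lebesgue_on \<Omega>) p (gd_grad D u) = 0 \<longrightarrow> u = (\<lambda>i. 0)) \<and>
     (\<forall>\<phi>\<in>Lp (lebesgue_on \<Omega>) 2. gd_interp D \<phi> \<in> gd_X D) \<and>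
     (\<forall>\<phi>\<in>Lp (lebesgue_on \<Omega>) 2. \<forall>\<psi>\<in>Lp (lebesgue_on \<Omega>) 2. \<forall>c1 c2.
         gd_interp D (\<lambda>x. c1 * \<phi> x + c2 * \<psi> x) = (\<lambda>i. c1 * gd_interp D \<phi> i + c2 * gd_interp D \<psi> i)) \<and>
     (\<forall>\<phi>\<in>Lp (lebesgue_on \<Omega>) 2. \<forall>\<psi>\<in>Lp (lebesgue_on \<Omega>) 2.
         (AE x in lebesgue_on \<Omega>. \<phi> x = \<psi> x) \<longrightarrow> gd_interp D \<phi> = gd_interp D \<psi>) \<and>
     gd_t D 0 = 0 \<and> (\<forall>n<gd_N D. gd_t D n < gd_t D (Suc n)) \<and> gd_t D (gd_N D) = T"

text \<open>time step containing t: 0 for t = 0 and n+1 for t in (t_n, t_{n+1}]\<close>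
definition gd_step :: "'a stgd \<Rightarrow> real \<Rightarrow> nat" where
  "gd_step D t = (LEAST n. t \<le> gd_t D n)"

definition gd_PiST :: "'a stgd \<Rightarrow> (nat \<Rightarrow> nat \<Rightarrow> real) \<Rightarrow> 'a \<times> real \<Rightarrow> real" where
  "gd_PiST D v = (\<lambda>(x, t). gd_Pi D (v (gd_step D t)) x)"

definition gd_gradST :: "'a stgd \<Rightarrow> (nat \<Rightarrow> nat \<Rightarrow> real) \<Rightarrow> 'a \<times> real \<Rightarrow> 'a" where
  "gd_gradST D v = (\<lambda>(x, t). gd_grad D (v (gd_step D t)) x)"

definition gd_delta :: "'a stgd \<Rightarrow> (nat \<Rightarrow> nat \<Rightarrow> real) \<Rightarrow> real \<Rightarrow> nat \<Rightarrow> real" where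
  "gd_delta D v t = (let n = gd_step D t in
     (\<lambda>i. (v n i - v (n - 1) i) / (gd_t D n - gd_t D (n - 1))))"

definition gd_app :: "'a stgd \<Rightarrow> (real \<Rightarrow> real) \<Rightarrow> (nat \<Rightarrow> nat \<Rightarrow> real) \<Rightarrow> nat \<Rightarrow> nat \<Rightarrow> real" where
  "gd_app D \<eta> u = (\<lambda>n i. if i \<in> gd_I D then \<eta> (u n i) else 0)"

definition gd_dtmax :: "'a stgd \<Rightarrow> real" where
  "gd_dtmax D = Max {gd_t D (Suc n) - gd_t D n | n. n < gd_N D}"

definition gd_CD :: "real \<Rightarrow> 'a::euclidean_space set \<Rightarrow> 'a stgd \<Rightarrow> real" where
  "gd_CD p \<Omega> D = Sup {Lp_norm (lebesgue_on \<Omega>) p (gd_Pi D v) / Lp_norm (lebesgue_on \<Omega>) p (gd_grad D v)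
                       | v. v \<in> gd_X D \<and> v \<noteq> (\<lambda>i. 0)}"

definition gd_Shat :: "real \<Rightarrow> 'a::euclidean_space set \<Rightarrow> 'a stgd \<Rightarrow> ('a \<Rightarrow> real) \<Rightarrow> ('a \<Rightarrow> 'a) \<Rightarrow> real" where
  "gd_Shat p \<Omega> D \<phi> g\<phi> = Inf {Lp_norm (lebesgue_on \<Omega>) (max p 2) (\<lambda>x. gd_Pi D w x - \<phi> x)
                               + Lp_norm (lebesgue_on \<Omega>) p (\<lambda>x. gd_grad D w x - g\<phi> x) | w. w \<in> gd_X D}"

definition gd_WD :: "real \<Rightarrow> 'a::euclidean_space set \<Rightarrow> 'a stgd \<Rightarrow> ('a \<Rightarrow> 'a) \<Rightarrow> ('a \<Rightarrow> real) \<Rightarrow> real" where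
  "gd_WD p \<Omega> D \<phi> div\<phi> = Sup {\<bar>\<integral>x. gd_grad D u x \<bullet> \<phi> x + gd_Pi D u x * div\<phi> x \<partial>lebesgue_on \<Omega>\<bar>
                       / Lp_norm (lebesgue_on \<Omega>) p (gd_grad D u) | u. u \<in> gd_X D \<and> u \<noteq> (\<lambda>i. 0)}"

definition gd_TD :: "real \<Rightarrow> 'a::euclidean_space set \<Rightarrow> 'a stgd \<Rightarrow> 'a \<Rightarrow> real" where
  "gd_TD p \<Omega> D \<xi> = Sup {Lp_norm lebesgue p (\<lambda>x. gd_Pi D v (x + \<xi>) - gd_Pi D v x)
                       / Lp_norm (lebesgue_on \<Omega>) p (gd_grad D v) | v. v \<in> gd_X D \<and> v \<noteq> (\<lambda>i. 0)}"

definition seq_coercive :: "real \<Rightarrow> 'a::euclidean_space set \<Rightarrow> (nat \<Rightarrow> 'a stgd) \<Rightarrow> bool" where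
  "seq_coercive p \<Omega> Ds \<longleftrightarrow> (\<exists>C. \<forall>m. gd_CD p \<Omega> (Ds m) \<le> C)"

definition seq_consistent :: "real \<Rightarrow> 'a::euclidean_space set \<Rightarrow> (nat \<Rightarrow> 'a stgd) \<Rightarrow> bool" where
  "seq_consistent p \<Omega> Ds \<longleftrightarrow>
     (\<forall>\<phi> g. \<phi> \<in> Lp (lebesgue_on \<Omega>) 2 \<longrightarrow> W0 p \<Omega> \<phi> g \<longrightarrow> (\<lambda>m. gd_Shat p \<Omega> (Ds m) \<phi> g) \<longlonglongrightarrow> 0) \<and>
     (\<forall>\<phi>\<in>Lp (lebesgue_on \<Omega>) 2.
        (\<lambda>m. Lp_norm (lebesgue_on \<Omega>) 2 (\<lambda>x. gd_Pi (Ds m) (gd_interp (Ds m) \<phi>) x - \<phi> x)) \<longlonglongrightarrow> 0) \<and>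
     (\<lambda>m. gd_dtmax (Ds m)) \<longlonglongrightarrow> 0"

definition seq_limit_conforming :: "real \<Rightarrow> 'a::euclidean_space set \<Rightarrow> (nat \<Rightarrow> 'a stgd) \<Rightarrow> bool" where
  "seq_limit_conforming p \<Omega> Ds \<longleftrightarrow>
     (\<forall>\<phi> \<psi>. \<phi> \<in> Lp (lebesgue_on \<Omega>) (conj_exp p) \<longrightarrow> \<psi> \<in> Lp (lebesgue_on \<Omega>) (conj_exp p) \<longrightarrow>
        weak_div \<Omega> \<phi> \<psi> \<longrightarrow> (\<lambda>m. gd_WD p \<Omega> (Ds m) \<phi> \<psi>) \<longlonglongrightarrow> 0)"

definition seq_compact_gd :: "real \<Rightarrow> 'a::euclidean_space set \<Rightarrow> (nat \<Rightarrow> 'a stgd) \<Rightarrow> bool" where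
  "seq_compact_gd p \<Omega> Ds \<longleftrightarrow>
     (\<forall>\<epsilon>>0. \<exists>\<delta>>0. \<forall>\<xi>. norm \<xi> < \<delta> \<longrightarrow> (\<forall>m. gd_TD p \<Omega> (Ds m) \<xi> \<le> \<epsilon>))"

definition gs_solution :: "'a::euclidean_space set \<Rightarrow> real \<Rightarrow> (real \<Rightarrow> real) \<Rightarrow> (real \<Rightarrow> real) \<Rightarrow>
    ('a \<Rightarrow> real \<Rightarrow> 'a \<Rightarrow> 'a) \<Rightarrow> ('a \<Rightarrow> real) \<Rightarrow> ('a \<times> real \<Rightarrow> real) \<Rightarrow> 'a stgd \<Rightarrow> (nat \<Rightarrow> nat \<Rightarrow> real) \<Rightarrow> bool"
  where
  "gs_solution \<Omega> T \<zeta> \<beta> a u_ini f D u \<longleftrightarrow>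
    (let Q = lebesgue_on (\<Omega> \<times> {0<..<T}) in
     (\<forall>n\<le>gd_N D. u n \<in> gd_X D) \<and> u 0 = gd_interp D u_ini \<and>
     (\<forall>v. (\<forall>n. 1 \<le> n \<longrightarrow> n \<le> gd_N D \<longrightarrow> v n \<in> gd_X D) \<longrightarrow>
        (\<integral>y. gd_Pi D (gd_delta D (gd_app D \<beta> u) (snd y)) (fst y) * gd_PiST D v y
             + a (fst y) (gd_PiST D (gd_app D (nu_fun \<zeta> \<beta>) u) y) (gd_gradST D (gd_app D \<zeta> u) y)
               \<bullet> gd_gradST D v y \<partial>Q)
        = (\<integral>y. f y * gd_PiST D v y \<partial>Q)))"

end

theory Submission
  imports Defs
begin

text \<open>
  Let \<open>E = B \<circ> \<beta>\<close>. The only property of \<open>E\<close> that matters is the subgradient inequality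
  \<open>\<zeta>(s) (\<beta>(r) - \<beta>(s)) \<le> E(r) - E(s)\<close>. Testing the scheme with \<open>\<zeta>(u\<^sub>m)\<close> and telescoping this
  inequality bounds the integral of \<open>a\<^sub>m \<bullet> \<nabla>\<zeta>(u\<^sub>m)\<close> from above by the initial energy minus the final energy
  plus the source term. To compare with the integral of \<open>a\<^sub>m \<bullet> \<nabla>\<zeta>(u)\<close>, the function \<open>\<zeta>(u)\<close> is approximated in
  \<open>L\<^sup>p(0,T;W\<^sub>0)\<close> by step functions in time whose values are those of \<open>\<zeta>(u)\<close> at suitable times; for such a
  step function the limit of the integral follows from the scheme, the consistency and the weak
  convergence of \<open>\<beta>(u\<^sub>m)\<close>, and the subgradient inequality between consecutive times makes the energies
  telescope to the same bound. Hence the limsup of the integral of \<open>a\<^sub>m \<bullet> (\<nabla>\<zeta>(u\<^sub>m) - \<nabla>\<zeta>(u))\<close> is at most 0.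
  The Leray-Lions argument then gives the strong convergence of the
  gradients, and coercivity transfers it to the functions.
\<close>

text \<open>No chain rule for the energy of the limit in time is proved. Two one-sided inequalities
  replace it, and their directions shape the construction. The scheme is implicit, so testing with
  the new value bounds the discrete energy increments from above. The limit needs the opposite
  direction, obtained by freezing \<open>\<zeta>(u)\<close> at the left end \<open>s k\<close> of
  each interval. Before the first node the step function is 0; this costs the energy lost up to
  \<open>s 1\<close>, small by weak continuity at time 0. The energy of the limit is evaluated only
  at the initial datum and at nodes before \<open>T\<close>: the final discrete energy is compared
  with the one at the last node by the same inequality and weak convergence at \<open>T\<close>, so
  no lower semicontinuity enters. The order of choices is grid, truncation level, index m.\<close>

lemma norm_add_powr_le:
  fixes a b :: "'b::real_normed_vector"
  assumes "p \<ge> 0"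
  shows "norm (a + b) powr p \<le> 2 powr p * (norm a powr p + norm b powr p)"
proof -
  have "norm (a + b) \<le> 2 * max (norm a) (norm b)"
    using norm_triangle_ineq[of a b] by linarith
  then have "norm (a + b) powr p \<le> (2 * max (norm a) (norm b)) powr p"
    using assms by (intro powr_mono2) auto
  also have "\<dots> = 2 powr p * max (norm a) (norm b) powr p"
    by (simp add: powr_mult)
  also have "\<dots> \<le> 2 powr p * (norm a powr p + norm b powr p)"
    by (intro mult_left_mono) (auto simp: max_def)
  finally show ?thesis .
qed

lemma norm_diff_powr_le:
  fixes a b :: "'b::real_normed_vector"
  assumes "p \<ge> 0"
  shows "norm (a - b) powr p \<le> 2 powr p * (norm a powr p + norm b powr p)"
  using norm_add_powr_le[OF assms, of a "- b"] by simp

section \<open>Lp spaces and Young's inequality\<close>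

lemma LpD:
  assumes "f \<in> Lp M p"
  shows "f \<in> borel_measurable M" "integrable M (\<lambda>x. norm (f x) powr p)"
  using assms by (auto simp: Lp_def)

lemma Lp_bound:
  assumes f: "f \<in> borel_measurable M" and h: "integrable M h"
    and le: "AE x in M. norm (f x) powr p \<le> h x"
  shows "f \<in> Lp M p"
  unfolding Lp_def
proof (intro CollectI conjI f)
  show "integrable M (\<lambda>x. norm (f x) powr p)"
    by (rule Bochner_Integration.integrable_bound[OF h])
       (use f le in \<open>auto elim!: eventually_mono\<close>)
qed

lemma Lp_add:
  assumes p: "p \<ge> 0" and f: "f \<in> Lp M p" and g: "g \<in> Lp M p"
  shows "(\<lambda>x. f x + g x) \<in> Lp M p"
proof (rule Lp_bound)
  show "integrable M (\<lambda>x. 2 powr p * (norm (f x) powr p + norm (g x) powr p))"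
    using LpD[OF f] LpD[OF g] by auto
qed (use LpD[OF f] LpD[OF g] norm_add_powr_le[OF p] in auto)

lemma Lp_scaleR:
  assumes f: "f \<in> Lp M p"
  shows "(\<lambda>x. c *\<^sub>R f x) \<in> Lp M p"
  using LpD[OF f] by (auto simp: Lp_def powr_mult)

lemma Lp_diff:
  assumes p: "p \<ge> 0" and f: "f \<in> Lp M p" and g: "g \<in> Lp M p"
  shows "(\<lambda>x. f x - g x) \<in> Lp M p"
  using Lp_add[OF p f Lp_scaleR[OF g, of "-1"]] by simp

lemma Lp_zero [simp]: "(\<lambda>x. 0) \<in> Lp M p"
  by (auto simp: Lp_def)

lemma Lp_sum:
  assumes p: "p \<ge> 0" and f: "\<And>i. i \<in> I \<Longrightarrow> f i \<in> Lp M p"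
  shows "(\<lambda>x. \<Sum>i\<in>I. f i x) \<in> Lp M p"
  using f by (induction I rule: infinite_finite_induct) (auto intro: Lp_add[OF p])

lemma conj_exp_props:
  assumes "p > 1"
  shows "conj_exp p > 1" "1 / p + 1 / conj_exp p = 1" "(p - 1) * conj_exp p = p"
  using assms by (auto simp: conj_exp_def field_simps)

text \<open>Takes the place of Hoelder's inequality throughout: the weight \<epsilon> first makes a
  merely bounded integral of powers harmless, and the constant \<open>C\<close> then multiplies a
  quantity that is small.\<close>

lemma inner_le_Young_eps:
  assumes pq: "p > 1" "q > 1" "1 / p + 1 / q = (1::real)" and e: "\<epsilon> > 0"
  obtains C where "C > 0"
    "\<And>x y::'b::real_inner. \<bar>x \<bullet> y\<bar> \<le> \<epsilon> * norm x powr p + C * norm y powr q"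
    "\<And>a b::real. 0 \<le> a \<Longrightarrow> 0 \<le> b \<Longrightarrow> a * b \<le> \<epsilon> * a powr p + C * b powr q"
proof -
  \<comment> \<open>Scaling by \<open>l\<close> turns \<open>(l * a) powr p\<close> into
    \<open>\<epsilon> * a powr p\<close>, while the product is unchanged when \<open>b\<close> is
    divided by \<open>l\<close>.\<close>
  define l where "l = \<epsilon> powr (1 / p)"
  have l: "l > 0" "l powr p = \<epsilon>"
    using e pq by (auto simp: l_def powr_powr)
  define C where "C = (1 / l) powr q"
  have *: "a * b \<le> \<epsilon> * a powr p + C * b powr q" if "0 \<le> a" "0 \<le> b" for a b :: real
  proof -
    have "a * b = (l * a) * (b / l)"
      using l by simp
    also have "\<dots> \<le> (l * a) powr p / p + (b / l) powr q / q"
      using Youngs_inequality[OF pq, of "l * a" "b / l"] that l by simp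
    also have "\<dots> \<le> (l * a) powr p + (b / l) powr q"
      using pq by (intro add_mono) (auto simp: divide_le_eq mult_le_cancel_left1)
    also have "\<dots> = \<epsilon> * a powr p + C * b powr q"
      using l that by (simp add: powr_mult powr_divide C_def)
    finally show ?thesis .
  qed
  have "\<bar>x \<bullet> y\<bar> \<le> \<epsilon> * norm x powr p + C * norm y powr q" for x y :: 'b
    using Cauchy_Schwarz_ineq2[of x y] *[of "norm x" "norm y"] by simp
  moreover have "C > 0" using l by (simp add: C_def)
  ultimately show thesis using * that by blast
qed

lemma integrable_inner_Lp:
  fixes f g :: "'b \<Rightarrow> 'c::euclidean_space"
  assumes pq: "p > 1" "q > 1" "1 / p + 1 / q = 1" and f: "f \<in> Lp M p" and g: "g \<in> Lp M q"
  shows "integrable M (\<lambda>x. f x \<bullet> g x)"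
proof -
  obtain C where C: "\<And>x y::'c. \<bar>x \<bullet> y\<bar> \<le> 1 * norm x powr p + C * norm y powr q"
    using inner_le_Young_eps[OF pq, of 1] zero_less_one by metis
  show ?thesis
    by (rule Bochner_Integration.integrable_bound
          [of M "\<lambda>x. 1 * norm (f x) powr p + C * norm (g x) powr q"])
       (use LpD[OF f] LpD[OF g] order_trans[OF C abs_ge_self] in auto)
qed

lemma integrable_mult_Lp:
  fixes f g :: "'b \<Rightarrow> real"
  assumes pq: "p > 1" "q > 1" "1 / p + 1 / q = 1" and f: "f \<in> Lp M p" and g: "g \<in> Lp M q"
  shows "integrable M (\<lambda>x. f x * g x)"
  using integrable_inner_Lp[OF assms] by simp

text \<open>Lets the arguments run on integrals of p-th powers, for which
  \<open>norm_add_powr_le\<close> replaces Minkowski's inequality; roots appear only where a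
  definition speaks of \<open>Lp_norm\<close>.\<close>

lemma Lp_norm_tendsto_0_iff:
  assumes "p > 0"
  shows "((\<lambda>m. Lp_norm M p (F m)) \<longlongrightarrow> 0) A \<longleftrightarrow> ((\<lambda>m. \<integral>x. norm (F m x) powr p \<partial>M) \<longlongrightarrow> 0) A"
proof
  assume "((\<lambda>m. Lp_norm M p (F m)) \<longlongrightarrow> 0) A"
  then have "((\<lambda>m. Lp_norm M p (F m) powr p) \<longlongrightarrow> 0 powr p) A"
    using assms by (intro tendsto_powr2) (auto simp: Lp_norm_def)
  then show "((\<lambda>m. \<integral>x. norm (F m x) powr p \<partial>M) \<longlongrightarrow> 0) A"
    using assms by (simp add: Lp_norm_def powr_powr)
next
  assume "((\<lambda>m. \<integral>x. norm (F m x) powr p \<partial>M) \<longlongrightarrow> 0) A"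
  then have "((\<lambda>m. (\<integral>x. norm (F m x) powr p \<partial>M) powr (1 / p)) \<longlongrightarrow> 0 powr (1 / p)) A"
    using assms by (intro tendsto_powr2) auto
  then show "((\<lambda>m. Lp_norm M p (F m)) \<longlongrightarrow> 0) A"
    using assms by (simp add: Lp_norm_def)
qed

text \<open>Below \<delta> the first term dominates; above \<delta> the factor
  \<open>z powr (q - r)\<close> is at most its value at \<delta>, the exponent being nonpositive. On
  a finite measure this lowers the exponent of a convergence.\<close>

lemma powr_le_interpolate:
  fixes z \<delta> :: real
  assumes "0 < q" "q \<le> r" "\<delta> > 0" "z \<ge> 0"
  shows "z powr q \<le> \<delta> powr q + \<delta> powr (q - r) * z powr r"
proof (cases "z \<le> \<delta>")
  case True
  then have "z powr q \<le> \<delta> powr q" using assms by (intro powr_mono2) auto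
  then show ?thesis by (simp add: add_increasing2)
next
  case False
  then have z: "z > \<delta>" "z > 0" using assms by auto
  have "z powr q = z powr (q - r) * z powr r"
    using z by (simp flip: powr_add)
  also have "\<dots> \<le> \<delta> powr (q - r) * z powr r"
    using z assms by (intro mult_right_mono powr_mono2') auto
  finally show ?thesis by (simp add: add_increasing)
qed

lemma Lp_mono_exponent:
  assumes M: "finite_measure M" and q: "0 < q" "q \<le> r" and f: "f \<in> Lp M r"
  shows "f \<in> Lp M q"
proof (rule Lp_bound)
  interpret finite_measure M by fact
  show "integrable M (\<lambda>x. 1 + norm (f x) powr r)"
    using LpD[OF f] by auto
qed (use LpD[OF f] powr_le_interpolate[OF q, of 1] in auto)

lemma tendsto_0_eventually_leI:
  fixes x :: "nat \<Rightarrow> real"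
  assumes "\<And>m. 0 \<le> x m" "\<And>e. e > 0 \<Longrightarrow> \<forall>\<^sub>F m in sequentially. x m \<le> e"
  shows "x \<longlonglongrightarrow> 0"
proof (rule order_tendstoI)
  fix a :: real assume "0 < a"
  then show "\<forall>\<^sub>F m in sequentially. x m < a"
    using assms(2)[of "a / 2"] by (auto elim!: eventually_mono)
qed (use assms(1) in \<open>auto intro!: always_eventually intro: less_le_trans\<close>)

lemma Lp_tendsto_mono_exponent:
  assumes M: "finite_measure M" and q: "0 < q" "q \<le> r" and f: "\<And>m::nat. F m \<in> Lp M r"
    and lim: "(\<lambda>m. \<integral>x. norm (F m x) powr r \<partial>M) \<longlonglongrightarrow> 0"
  shows "(\<lambda>m. \<integral>x. norm (F m x) powr q \<partial>M) \<longlonglongrightarrow> 0"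
proof (rule tendsto_0_eventually_leI)
  interpret finite_measure M by fact
  let ?V = "measure M (space M)"
  fix e :: real assume e: "e > 0"
  \<comment> \<open>Makes the constant part of the bound at most e / 2; the summand 1 keeps the
    denominator positive for a measure of total mass 0.\<close>
  define \<delta> where "\<delta> = (e / (2 * (?V + 1))) powr (1 / q)"
  have V: "?V \<ge> 0" by simp
  have V': "2 * ?V + 2 \<noteq> 0" using V by linarith
  have \<delta>: "\<delta> > 0" using e V V' by (simp add: \<delta>_def)
  have "\<delta> powr q * ?V = e / (2 * (?V + 1)) * ?V"
    using q e V by (simp add: \<delta>_def powr_powr)
  also have "\<dots> = e / 2 * (?V / (?V + 1))" using V' by (simp add: field_simps)
  also have "\<dots> \<le> e / 2 * 1" using e add_nonneg_pos[OF V zero_less_one] by (intro mult_left_mono) (auto simp: divide_le_eq_1)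
  finally have \<delta>V: "\<delta> powr q * ?V \<le> e / 2" by simp
  have "(\<lambda>m. \<delta> powr (q - r) * (\<integral>x. norm (F m x) powr r \<partial>M)) \<longlonglongrightarrow> \<delta> powr (q - r) * 0"
    by (intro tendsto_intros lim)
  then have "\<forall>\<^sub>F m in sequentially. \<delta> powr (q - r) * (\<integral>x. norm (F m x) powr r \<partial>M) < e / 2"
    using e by (auto dest: order_tendstoD(2)[where a = "e / 2"])
  then show "\<forall>\<^sub>F m in sequentially. (\<integral>x. norm (F m x) powr q \<partial>M) \<le> e"
  proof eventually_elim
    case (elim m)
    have "(\<integral>x. norm (F m x) powr q \<partial>M) \<le> (\<integral>x. \<delta> powr q + \<delta> powr (q - r) * norm (F m x) powr r \<partial>M)"
      using LpD[OF f] LpD[OF Lp_mono_exponent[OF M q f]] powr_le_interpolate[OF q \<delta>]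
      by (intro integral_mono) auto
    also have "\<dots> = \<delta> powr q * ?V + \<delta> powr (q - r) * (\<integral>x. norm (F m x) powr r \<partial>M)"
      using LpD[OF f] by (simp add: mult.commute)
    finally show ?case using elim \<delta>V by linarith
  qed
qed auto

lemma Lp_tendsto_add:
  assumes p: "p \<ge> 0" and F: "\<And>m::nat. F m \<in> Lp M p" and H: "\<And>m. H m \<in> Lp M p"
    and lF: "(\<lambda>m. \<integral>x. norm (F m x) powr p \<partial>M) \<longlonglongrightarrow> 0"
    and lH: "(\<lambda>m. \<integral>x. norm (H m x) powr p \<partial>M) \<longlonglongrightarrow> 0"
  shows "(\<lambda>m. \<integral>x. norm (F m x + H m x) powr p \<partial>M) \<longlonglongrightarrow> 0"
proof (rule tendsto_sandwich[OF _ _ tendsto_const])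
  show "(\<lambda>m. 2 powr p * ((\<integral>x. norm (F m x) powr p \<partial>M) + (\<integral>x. norm (H m x) powr p \<partial>M))) \<longlonglongrightarrow> 0"
    using tendsto_mult[OF tendsto_const tendsto_add[OF lF lH], of "2 powr p"] by simp
  have "(\<integral>x. norm (F m x + H m x) powr p \<partial>M)
      \<le> (\<integral>x. 2 powr p * (norm (F m x) powr p + norm (H m x) powr p) \<partial>M)" for m
    by (intro integral_mono norm_add_powr_le[OF p] LpD(2)[OF Lp_add[OF p F H]])
       (use LpD[OF F] LpD[OF H] in auto)
  then show "\<forall>\<^sub>F m in sequentially. (\<integral>x. norm (F m x + H m x) powr p \<partial>M)
     \<le> 2 powr p * ((\<integral>x. norm (F m x) powr p \<partial>M) + (\<integral>x. norm (H m x) powr p \<partial>M))"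
    using LpD[OF F] LpD[OF H] by (auto intro!: always_eventually)
qed auto

section \<open>Lebesgue measure on products\<close>

text \<open>Lebesgue measure on a product is the completion of the product measure, so the uses of
  Fubini below go through Borel representatives. The representative is built coordinate by
  coordinate from the real case.\<close>

lemma borel_representative:
  fixes f :: "'b::euclidean_space \<Rightarrow> 'c::euclidean_space"
  assumes "f \<in> borel_measurable lebesgue"
  obtains g where "g \<in> borel_measurable borel" "AE x in lebesgue. f x = g x"
proof -
  have "\<exists>g\<in>borel_measurable lborel. AE x in lborel. f x \<bullet> b = g x" for b
    using completion_ex_borel_measurable_real[of "\<lambda>x. f x \<bullet> b" lborel] assms by force
  then obtain g where g: "\<And>b. g b \<in> borel_measurable lborel" "\<And>b. AE x in lborel. f x \<bullet> b = g b x"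
    by metis
  have "AE x in lborel. \<forall>b\<in>Basis. f x \<bullet> b = g b x"
    using g(2) by (intro AE_finite_allI) auto
  then have "AE x in lborel. f x = (\<Sum>b\<in>Basis. g b x *\<^sub>R b)"
  proof eventually_elim
    case (elim x)
    have "f x = (\<Sum>b\<in>Basis. (f x \<bullet> b) *\<^sub>R b)" by (simp add: euclidean_representation)
    also have "\<dots> = (\<Sum>b\<in>Basis. g b x *\<^sub>R b)" using elim by simp
    finally show ?case .
  qed
  then have "AE x in lebesgue. f x = (\<Sum>b\<in>Basis. g b x *\<^sub>R b)"
    by (rule AE_completion)
  moreover have "(\<lambda>x. \<Sum>b\<in>Basis. g b x *\<^sub>R b) \<in> borel_measurable borel"
    using g(1) by auto
  ultimately show thesis using that by blast
qed

text \<open>Slices are taken at fixed time, the second coordinate, so the pair is swapped before the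
  iterated statement about null sets is applied.\<close>

lemma AE_lebesgue_prod_slice:
  fixes P :: "'a::euclidean_space \<times> 'b::euclidean_space \<Rightarrow> bool"
  assumes "AE y in lebesgue. P y"
  shows "AE t in lebesgue. AE x in lebesgue. P (x, t)"
proof -
  have "AE y in lborel. P y" using assms by (simp add: AE_completion_iff)
  then have "AE y in (lborel \<Otimes>\<^sub>M lborel). P y" by (subst lborel_prod)
  then have "AE z in (lborel \<Otimes>\<^sub>M lborel). P (case z of (t, x) \<Rightarrow> (x, t))"
    by (subst (asm) lborel_pair.distr_pair_swap) (auto dest!: AE_distrD[rotated])
  from lborel_pair.AE_pair[OF this]
  show ?thesis by (simp add: AE_completion_iff)
qed

text \<open>The exceptional set lies in a cylinder over a Borel null set, and such a cylinder is
  null although the second factor has infinite measure.\<close>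

lemma AE_lebesgue_fst:
  fixes P :: "'a::euclidean_space \<Rightarrow> bool"
  assumes "AE x in lebesgue. P x"
  shows "AE y in (lebesgue :: ('a \<times> 'b::euclidean_space) measure). P (fst y)"
proof -
  have "AE x in lborel. P x" using assms by (simp add: AE_completion_iff)
  then obtain N where N: "N \<in> sets lborel" "emeasure lborel N = 0" "{x. \<not> P x} \<subseteq> N"
    unfolding eventually_ae_filter null_sets_def by auto
  have "AE y in (lborel \<Otimes>\<^sub>M (lborel :: 'b measure)). fst y \<notin> N"
  proof (rule AE_I)
    show "emeasure (lborel \<Otimes>\<^sub>M (lborel :: 'b measure)) (N \<times> UNIV) = 0"
      using N by (subst lborel.emeasure_pair_measure_Times) auto
    show "N \<times> UNIV \<in> sets (lborel \<Otimes>\<^sub>M (lborel :: 'b measure))"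
      using N by auto
  qed auto
  then have "AE y in (lborel :: ('a \<times> 'b) measure). P (fst y)"
    using N by (subst (asm) lborel_prod, auto elim!: eventually_mono)
  then show ?thesis by (rule AE_completion)
qed

text \<open>A Lebesgue set is a Borel set together with part of a null set, and the projection pulls
  null sets back to null sets.\<close>

lemma measurable_lebesgue_fst:
  "fst \<in> measurable (lebesgue :: ('a::euclidean_space \<times> 'b::euclidean_space) measure) lebesgue"
proof (rule measurableI)
  fix A :: "'a set" assume "A \<in> sets lebesgue"
  then obtain S N N' where A: "A = S \<union> N" "N \<subseteq> N'" "N' \<in> null_sets lborel" "S \<in> sets lborel"
    by (auto elim: sets_completionE)
  have *: "fst -` S \<in> sets (lebesgue :: ('a \<times> 'b) measure)" if "S \<in> sets borel" for S
  proof -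
    have "fst -` S \<inter> space (borel :: ('a \<times> 'b) measure) \<in> sets borel"
      using that by (rule measurable_sets[OF borel_measurable_continuous_onI[OF continuous_on_fst[OF continuous_on_id]]])
    then show ?thesis by auto
  qed
  have "AE x in lebesgue. x \<notin> N'"
    using A(3) by (auto intro: AE_completion AE_not_in)
  from AE_lebesgue_fst[OF this]
  have "AE y in (lebesgue :: ('a \<times> 'b) measure). y \<notin> fst -` N'" by simp
  then have "fst -` N' \<in> null_sets (lebesgue :: ('a \<times> 'b) measure)"
    using *[of N'] A by (auto simp: AE_iff_null_sets)
  then have "fst -` N \<in> sets (lebesgue :: ('a \<times> 'b) measure)"
    using A(2) by (meson null_sets_completion_subset null_setsD2 vimage_mono)
  then show "fst -` A \<inter> space (lebesgue :: ('a \<times> 'b) measure) \<in> sets lebesgue"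
    using *[of S] A by (auto simp: vimage_Un)
qed auto

lemma borel_measurable_lebesgue_on_fst:
  fixes F :: "'a::euclidean_space \<Rightarrow> 'c::topological_space"
  assumes F: "F \<in> borel_measurable (lebesgue_on \<Omega>)"
  shows "(\<lambda>y. F (fst y)) \<in> borel_measurable (lebesgue_on (\<Omega> \<times> (J :: 'b::euclidean_space set)))"
proof -
  have "fst \<in> measurable (lebesgue_on (\<Omega> \<times> J)) (lebesgue_on \<Omega>)"
    by (rule measurable_restrict_space3[OF measurable_lebesgue_fst]) auto
  from measurable_compose[OF this F] show ?thesis .
qed

lemma AE_lebesgue_on_fst:
  assumes P: "AE x in lebesgue_on \<Omega>. P x" and \<Omega>: "\<Omega> \<in> sets lebesgue"
    and J: "\<Omega> \<times> (J :: 'b::euclidean_space set) \<in> sets lebesgue"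
  shows "AE y in lebesgue_on (\<Omega> \<times> J). P (fst y)"
proof -
  have "AE x in lebesgue. x \<in> \<Omega> \<longrightarrow> P x"
    using P \<Omega> by (simp add: AE_restrict_space_iff)
  from AE_lebesgue_fst[OF this, where 'b='b] show ?thesis
    using J by (auto simp: AE_restrict_space_iff elim!: eventually_mono)
qed

text \<open>\<open>F\<close> is extended by 0 outside \<Omega> and replaced by a Borel
  representative \<open>F'\<close>. Fubini is applied to \<open>H\<close>, and the a.e. equality of
  \<open>H\<close> and \<open>K\<close> carries the value back to the strip.\<close>

lemma has_bochner_integral_strip:
  fixes F :: "'a::euclidean_space \<Rightarrow> 'c::euclidean_space" and A J :: "real set"
  assumes F: "integrable (lebesgue_on \<Omega>) F" and \<Omega>: "\<Omega> \<in> sets lebesgue"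
    and A: "A \<in> sets borel" "emeasure lborel A < \<infinity>" "A \<subseteq> J" and J: "\<Omega> \<times> J \<in> sets lebesgue"
  shows "has_bochner_integral (lebesgue_on (\<Omega> \<times> J)) (\<lambda>y. indicator A (snd y) *\<^sub>R F (fst y))
    (measure lebesgue A *\<^sub>R (\<integral>x. F x \<partial>lebesgue_on \<Omega>))"
proof -
  define F0 where "F0 x = indicator \<Omega> x *\<^sub>R F x" for x
  have F0: "integrable lebesgue F0" "(\<integral>x. F0 x \<partial>lebesgue) = (\<integral>x. F x \<partial>lebesgue_on \<Omega>)"
    using F \<Omega> integrable_restrict_space[of \<Omega> lebesgue F] integral_restrict_space[of \<Omega> lebesgue F]
    by (auto simp: F0_def[abs_def])
  obtain F' where F': "F' \<in> borel_measurable borel" "AE x in lebesgue. F0 x = F' x"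
    using borel_representative[of F0] F0(1) by (auto simp: integrable_iff_bounded)
  have iF': "integrable lborel F'"
  proof -
    have "integrable lebesgue F'"
      using F0(1) F' integrable_cong_AE[of F0 lebesgue F'] borel_measurable_integrable[OF F0(1)]
      by (auto simp: measurable_completion)
    then show ?thesis using F'(1) integrable_completion[of F' lborel] by auto
  qed
  have eF': "(\<integral>x. F' x \<partial>lborel) = (\<integral>x. F0 x \<partial>lebesgue)"
  proof -
    have "(\<integral>x. F0 x \<partial>lebesgue) = (\<integral>x. F' x \<partial>lebesgue)"
      using F' F0(1) by (intro integral_cong_AE) (auto simp: measurable_completion)
    also have "\<dots> = (\<integral>x. F' x \<partial>lborel)"
      using F'(1) by (intro integral_completion) auto
    finally show ?thesis by simp
  qed
  define H where "H = (\<lambda>y::'a \<times> real. indicator A (snd y) *\<^sub>R F' (fst y))"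
  have mH: "H \<in> borel_measurable (lborel \<Otimes>\<^sub>M lborel)"
  proof -
    note [measurable] = A(1) F'(1)
    show ?thesis unfolding H_def by measurable
  qed
  have iA: "integrable lborel (\<lambda>t. indicator A t *\<^sub>R c)" for c :: 'c
    using A by (intro integrable_scaleR_left impI integrable_real_indicator) auto
  have inner: "(\<integral>t. H (x, t) \<partial>lborel) = measure lebesgue A *\<^sub>R F' x" for x
    using A by (simp add: H_def)
  have iH: "integrable (lborel \<Otimes>\<^sub>M lborel) H"
  proof (rule lborel_pair.Fubini_integrable[OF mH])
    show "integrable lborel (\<lambda>x. \<integral>t. norm (H (x, t)) \<partial>lborel)"
    proof -
      have "(\<integral>t. norm (H (x, t)) \<partial>lborel) = measure lebesgue A * norm (F' x)" for x
        using A by (simp add: H_def)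
      then show ?thesis using iF' by simp
    qed
    show "AE x in lborel. integrable lborel (\<lambda>t. H (x, t))"
      using iA by (simp add: H_def)
  qed
  have eH: "integral\<^sup>L (lborel \<Otimes>\<^sub>M lborel) H = measure lebesgue A *\<^sub>R (\<integral>x. F x \<partial>lebesgue_on \<Omega>)"
    using lborel_pair.integral_fst'[OF iH] iF' by (simp add: inner eF' F0)
  have HL: "has_bochner_integral lebesgue H (measure lebesgue A *\<^sub>R (\<integral>x. F x \<partial>lebesgue_on \<Omega>))"
    using iH eH mH by (auto simp: lborel_prod has_bochner_integral_iff integrable_completion integral_completion)
  define K where "K = (\<lambda>y::'a \<times> real. indicator (\<Omega> \<times> J) y *\<^sub>R (indicator A (snd y) *\<^sub>R F (fst y)))"
  have "AE y in (lebesgue :: ('a \<times> real) measure). F0 (fst y) = F' (fst y)"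
    by (rule AE_lebesgue_fst[OF F'(2)])
  then have ae: "AE y in lebesgue. H y = K y"
  proof eventually_elim
    case (elim y)
    then show ?case
      using A(3) by (cases y) (auto simp: H_def K_def F0_def indicator_def split: if_splits)
  qed
  have mK: "K \<in> borel_measurable lebesgue"
    using ae has_bochner_integral_iff[of lebesgue H] HL borel_measurable_AE[of H K] by auto
  have "has_bochner_integral lebesgue K (measure lebesgue A *\<^sub>R (\<integral>x. F x \<partial>lebesgue_on \<Omega>))"
    using HL ae mK by (subst has_bochner_integral_cong_AE[of _ _ H]) (auto simp: has_bochner_integral_iff)
  then show ?thesis
    unfolding K_def using J by (subst has_bochner_integral_restrict_space) auto
qed

section \<open>Approximation by step functions in time\<close>

text \<open>A compact \<open>K\<close> inside \<open>A\<close> and an open \<open>U\<close> around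
  \<open>K\<close> are chosen with \<open>A - K\<close> and \<open>U - K\<close> of measure at most
  e / 4. A shift shorter than the distance from \<open>K\<close> to the complement of
  \<open>U\<close> keeps \<open>K\<close> inside \<open>U\<close>.\<close>

lemma integral_translation_indicator_tendsto:
  fixes A :: "'b::euclidean_space set"
  assumes A: "A \<in> sets borel" "emeasure lborel A < \<infinity>" and e: "e > 0"
  obtains \<delta> where "\<delta> > 0"
    "\<And>h. norm h < \<delta> \<Longrightarrow> (\<integral>x. \<bar>indicat_real A (x + h) - indicator A x\<bar> \<partial>lborel) \<le> e"
proof -
  have AL: "A \<in> sets lebesgue" using A by simp
  obtain F where F: "closed F" "F \<subseteq> A" "A - F \<in> lmeasurable" "emeasure lebesgue (A - F) < ennreal (e / 8)"
    using sets_lebesgue_inner_closed[OF AL, of "e / 8"] e by auto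
  have Fm: "F \<in> sets borel" "emeasure lborel F < \<infinity>"
    using F(1) apply simp
    by (rule le_less_trans[OF emeasure_mono[OF F(2)] A(2)]) (use A in auto)
  have "(\<lambda>n::nat. measure lborel (F - cball 0 (real n))) \<longlonglongrightarrow> measure lborel (\<Inter>n::nat. F - cball 0 (real n))"
  proof (rule Lim_measure_decseq)
    show "range (\<lambda>n::nat. F - cball 0 (real n)) \<subseteq> sets lborel" using Fm by auto
    show "decseq (\<lambda>n::nat. F - cball 0 (real n))" by (auto simp: decseq_def)
    fix n :: nat
    have "emeasure lborel (F - cball 0 (real n)) \<le> emeasure lborel F"
      using Fm by (intro emeasure_mono) auto
    then show "emeasure lborel (F - cball 0 (real n)) \<noteq> \<infinity>"
      using Fm by (auto simp: top_unique)
  qed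
  moreover have "(\<Inter>n::nat. F - cball 0 (real n)) = {}"
    using real_arch_simple by (force simp: not_le)
  ultimately have "(\<lambda>n::nat. measure lborel (F - cball 0 (real n))) \<longlonglongrightarrow> 0"
    by (simp del: Diff_eq_empty_iff INT_simps)
  then obtain n :: nat where n: "measure lborel (F - cball 0 (real n)) < e / 8"
    using e by (metis (no_types, lifting) order_tendstoD(2) eventually_sequentially order_refl zero_less_divide_iff zero_less_numeral)
  \<comment> \<open>The cut with a ball makes the closed set \<open>F\<close> compact; the parts cut
    off decrease to the empty set, so their measure is below e / 8 for suitable
    \<open>n\<close>.\<close>
  define K where "K = F \<inter> cball 0 (real n)"
  have K: "compact K" "K \<subseteq> A" "K \<in> sets borel"
    using F(1,2) by (auto simp: K_def compact_Int_closed closed_Int_compact intro!: borel_closed)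
  have AKfin: "emeasure lborel (A - K) < \<infinity>"
    by (rule le_less_trans[OF emeasure_mono A(2)]) (use A in auto)
  have AK: "measure lborel (A - K) \<le> e / 4"
  proof -
    have "A - K = (A - F) \<union> (F - cball 0 (real n))" using F(2) by (auto simp: K_def)
    then have "measure lborel (A - K) \<le> measure lborel (A - F) + measure lborel (F - cball 0 (real n))"
      using A Fm by (simp add: measure_Un_le)
    moreover have "measure lborel (A - F) < e / 8"
      proof -
      have "emeasure lborel (A - F) < ennreal (e / 8)"
        using F(4) A Fm by (simp add: emeasure_completion)
      then have "ennreal (measure lborel (A - F)) < ennreal (e / 8)"
        using emeasure_eq_ennreal_measure[of lborel "A - F"] by (metis order_less_irrefl top.not_eq_extremum top_greatest order_le_less_trans ennreal_less_top order_less_trans)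
      then show ?thesis by (simp add: ennreal_less_iff)
    qed
    ultimately show ?thesis using n by simp
  qed
  have KL: "K \<in> sets lebesgue" using K by simp
  obtain U where U: "open U" "K \<subseteq> U" "U - K \<in> lmeasurable" "emeasure lebesgue (U - K) < ennreal (e / 4)"
    using sets_lebesgue_outer_open[OF KL, of "e / 4"] e by auto
  have UKm: "U - K \<in> sets borel" using U K by auto
  have UKfin: "emeasure lborel (U - K) < \<infinity>"
    using U(4) UKm by (auto simp: emeasure_completion less_top[symmetric] dest: order.strict_trans)
  have UK: "measure lborel (U - K) \<le> e / 4"
    using U(4) e UKm unfolding measure_def by (intro enn2real_leI) (auto simp: emeasure_completion)
  obtain \<delta> where \<delta>: "\<delta> > 0" "(\<Union>x\<in>K. ball x \<delta>) \<subseteq> U"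
    using compact_subset_open_imp_ball_epsilon_subset[OF K(1) U(1,2)] by blast
  have "(\<integral>x. \<bar>indicat_real A (x + h) - indicator A x\<bar> \<partial>lborel) \<le> e" if h: "norm h < \<delta>" for h
  proof -
    have tr: "integrable lborel (\<lambda>x. indicat_real B (x + h))"
        "(\<integral>x. indicat_real B (x + h) \<partial>lborel) = measure lborel B"
      if "B \<in> sets borel" "emeasure lborel B < \<infinity>" for B
    proof -
      have i: "integrable lborel (indicat_real B)" using that by auto
      have "distr lborel borel (\<lambda>x. x + h) = lborel"
        using lborel_distr_plus[of h] by (metis (no_types, lifting) add.commute distr_cong)
      then show "integrable lborel (\<lambda>x. indicat_real B (x + h))"
        "(\<integral>x. indicat_real B (x + h) \<partial>lborel) = measure lborel B"
        using i that integrable_distr_eq[of "\<lambda>x. x + h" lborel borel "indicat_real B"]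
          integral_distr[of "\<lambda>x. x + h" lborel borel "indicat_real B"] by auto
    qed
    let ?R = "\<lambda>x. indicat_real (A - K) (x + h) + indicat_real (A - K) x
        + (indicat_real (U - K) (x + h) + indicat_real (U - K) x)"
    \<comment> \<open>If the indicators differ, exactly one of the two points lies in
      \<open>A\<close>. Either it lies in \<open>A - K\<close>, or it lies in \<open>K\<close>; then
      the other point lies in \<open>U\<close> and outside \<open>A\<close>, hence in
      \<open>U - K\<close>.\<close>
    have "\<bar>indicat_real A (x + h) - indicator A x\<bar> \<le> ?R x" for x
    proof -
      have "x \<in> U" if "x + h \<in> K"
        using \<delta>(2) that h by (auto simp: dist_norm intro!: subsetD[OF \<delta>(2)] bexI[of _ "x + h"])
      moreover have "x + h \<in> U" if "x \<in> K"
        using \<delta>(2) that h by (auto simp: dist_norm intro!: subsetD[OF \<delta>(2)] bexI[of _ x])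
      ultimately show ?thesis using K(2) by (auto simp: indicator_def)
    qed
    then have "(\<integral>x. \<bar>indicat_real A (x + h) - indicator A x\<bar> \<partial>lborel) \<le> (\<integral>x. ?R x \<partial>lborel)"
      using A K UKm UKfin AKfin tr[OF A] tr[of "A - K"] tr[of "U - K"]
      by (intro integral_mono Bochner_Integration.integrable_add integrable_abs Bochner_Integration.integrable_diff) auto
    also have "\<dots> = 2 * measure lborel (A - K) + 2 * measure lborel (U - K)"
      using A K UKm UKfin AKfin tr[of "A - K"] tr[of "U - K"] by simp
    finally show ?thesis using AK UK by simp
  qed
  then show thesis using that \<delta>(1) by blast
qed

text \<open>Density of simple functions, in the form of induction over integrable functions.
  Nonnegative integrals spare the bookkeeping of integrability for translated differences.\<close>

lemma integral_translation_tendsto: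
  fixes f :: "'b::euclidean_space \<Rightarrow> 'c::euclidean_space"
  assumes "integrable lborel f"
  shows "\<forall>e>0. \<exists>\<delta>>0. \<forall>h. norm h < \<delta> \<longrightarrow>
    (\<integral>\<^sup>+x. norm (f (x + h) - f x) \<partial>lborel) \<le> ennreal e"
  using assms
proof (induction rule: integrable_induct)
  case (base A c)
  show ?case
  proof (intro allI impI)
    fix e :: real assume e: "e > 0"
    have *: "e / (norm c + 1) > 0" using e by (simp add: add_nonneg_pos)
    have A: "A \<in> sets borel" "emeasure lborel A < \<infinity>" using base by auto
    obtain \<delta> where \<delta>: "\<delta> > 0"
      "\<And>h. norm h < \<delta> \<Longrightarrow> (\<integral>x. \<bar>indicat_real A (x + h) - indicator A x\<bar> \<partial>lborel) \<le> e / (norm c + 1)"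
      using integral_translation_indicator_tendsto[OF A *] by metis
    have "(\<integral>\<^sup>+x. norm (indicat_real A (x + h) *\<^sub>R c - indicat_real A x *\<^sub>R c) \<partial>lborel) \<le> ennreal e"
      if "norm h < \<delta>" for h
    proof -
      have "distr lborel borel (\<lambda>x. x + h) = lborel"
        using lborel_distr_plus[of h] by (metis (no_types, lifting) add.commute distr_cong)
      moreover have i: "integrable lborel (indicat_real A)" using A by auto
      ultimately have ih: "integrable lborel (\<lambda>x. indicat_real A (x + h))"
        using A integrable_distr_eq[of "\<lambda>x. x + h" lborel borel "indicat_real A"] by auto
      have "(\<integral>\<^sup>+x. norm (indicat_real A (x + h) *\<^sub>R c - indicat_real A x *\<^sub>R c) \<partial>lborel)
        = (\<integral>\<^sup>+x. ennreal (\<bar>indicat_real A (x + h) - indicator A x\<bar> * norm c) \<partial>lborel)"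
        by (simp flip: scaleR_diff_left)
      also have "\<dots> = ennreal (\<integral>x. \<bar>indicat_real A (x + h) - indicator A x\<bar> * norm c \<partial>lborel)"
        using i ih by (intro nn_integral_eq_integral) auto
      also have "\<dots> \<le> ennreal (e / (norm c + 1) * norm c)"
        using mult_right_mono[OF \<delta>(2)[OF that] norm_ge_zero[of c]] i ih by (auto intro!: ennreal_leI)
      also have "\<dots> \<le> ennreal e"
      proof (rule ennreal_leI)
        have "e / (norm c + 1) * norm c = e * (norm c / (norm c + 1))" by simp
        also have "\<dots> \<le> e * 1"
          using e add_nonneg_pos[of "norm c" 1] by (intro mult_left_mono) (auto simp: divide_le_eq_1)
        finally show "e / (norm c + 1) * norm c \<le> e" by simp
      qed
      finally show ?thesis .
    qed
    then show "\<exists>\<delta>>0. \<forall>h. norm h < \<delta> \<longrightarrow> (\<integral>\<^sup>+x. norm (indicat_real A (x + h) *\<^sub>R c - indicat_real A x *\<^sub>R c) \<partial>lborel) \<le> ennreal e"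
      using \<delta>(1) by auto
  qed
next
  case (add f g)
  show ?case
  proof (intro allI impI)
    fix e :: real assume e: "e > 0"
    obtain d1 where d1: "d1 > 0" "\<And>h. norm h < d1 \<Longrightarrow> (\<integral>\<^sup>+x. norm (f (x + h) - f x) \<partial>lborel) \<le> ennreal (e / 2)"
      using add.IH(1) e by (meson half_gt_zero)
    obtain d2 where d2: "d2 > 0" "\<And>h. norm h < d2 \<Longrightarrow> (\<integral>\<^sup>+x. norm (g (x + h) - g x) \<partial>lborel) \<le> ennreal (e / 2)"
      using add.IH(2) e by (meson half_gt_zero)
    have [measurable]: "f \<in> borel_measurable borel" "g \<in> borel_measurable borel"
      using borel_measurable_integrable[OF add.hyps(1)] borel_measurable_integrable[OF add.hyps(2)] by auto
    have "(\<integral>\<^sup>+x. norm (f (x + h) + g (x + h) - (f x + g x)) \<partial>lborel) \<le> ennreal e"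
      if "norm h < min d1 d2" for h
    proof -
      have "(\<integral>\<^sup>+x. norm (f (x + h) + g (x + h) - (f x + g x)) \<partial>lborel)
        \<le> (\<integral>\<^sup>+x. ennreal (norm (f (x + h) - f x)) + ennreal (norm (g (x + h) - g x)) \<partial>lborel)"
        using norm_diff_triangle_ineq
        by (intro nn_integral_mono) (simp add: ennreal_leI flip: ennreal_plus)
      also have "\<dots> = (\<integral>\<^sup>+x. norm (f (x + h) - f x) \<partial>lborel) + (\<integral>\<^sup>+x. norm (g (x + h) - g x) \<partial>lborel)"
        by (intro nn_integral_add) auto
      also have "\<dots> \<le> ennreal (e / 2) + ennreal (e / 2)"
        using d1(2) d2(2) that by (intro add_mono) auto
      finally show ?thesis using e by (simp flip: ennreal_plus)
    qed
    then show "\<exists>\<delta>>0. \<forall>h. norm h < \<delta> \<longrightarrow> (\<integral>\<^sup>+x. norm (f (x + h) + g (x + h) - (f x + g x)) \<partial>lborel) \<le> ennreal e"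
      using d1(1) d2(1) by (intro exI[of _ "min d1 d2"]) auto
  qed
next
  case (lim f s)
  show ?case
  proof (intro allI impI)
    fix e :: real assume e: "e > 0"
    have [measurable]: "f \<in> borel_measurable borel" "\<And>i. s i \<in> borel_measurable borel"
      using borel_measurable_integrable[OF lim.hyps(4)] borel_measurable_integrable[OF lim.hyps(1)] by auto
    have "(\<lambda>i. \<integral>x. norm (s i x - f x) \<partial>lborel) \<longlonglongrightarrow> (\<integral>x. norm (f x - f x) \<partial>lborel)"
    proof (rule integral_dominated_convergence[where w = "\<lambda>x. 3 * norm (f x)"])
      show "AE x in lborel. (\<lambda>i. norm (s i x - f x)) \<longlonglongrightarrow> norm (f x - f x)"
        using lim.hyps(2) by (intro AE_I2 tendsto_intros) auto
      fix i
      have "norm (s i x - f x) \<le> 3 * norm (f x)" for x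
        using norm_triangle_ineq4[of "s i x" "f x"] lim.hyps(3)[of x i] by simp
      then show "AE x in lborel. norm (norm (s i x - f x)) \<le> 3 * norm (f x)" by simp
    qed (use lim.hyps(4) in auto)
    then have "(\<lambda>i. \<integral>x. norm (s i x - f x) \<partial>lborel) \<longlonglongrightarrow> 0" by simp
    then have "\<forall>\<^sub>F i in sequentially. (\<integral>x. norm (s i x - f x) \<partial>lborel) < e / 3"
      using e by (auto dest!: order_tendstoD(2)[where a = "e / 3"])
    then obtain i where i: "(\<integral>x. norm (s i x - f x) \<partial>lborel) < e / 3"
      by (auto simp: eventually_sequentially)
    have ii: "integrable lborel (\<lambda>x. s i x - f x)" using lim.hyps(1,4) by auto
    have i': "(\<integral>\<^sup>+x. norm (s i x - f x) \<partial>lborel) \<le> ennreal (e / 3)"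
      using i ii by (subst nn_integral_eq_integral) (auto intro!: ennreal_leI)
    obtain \<delta> where \<delta>: "\<delta> > 0" "\<And>h. norm h < \<delta> \<Longrightarrow> (\<integral>\<^sup>+x. norm (s i (x + h) - s i x) \<partial>lborel) \<le> ennreal (e / 3)"
      using lim.IH[of i] e by (meson divide_pos_pos zero_less_numeral)
    have "(\<integral>\<^sup>+x. norm (f (x + h) - f x) \<partial>lborel) \<le> ennreal e" if "norm h < \<delta>" for h
    proof -
      have "distr lborel borel (\<lambda>x. x + h) = lborel"
        using lborel_distr_plus[of h] by (metis (no_types, lifting) add.commute distr_cong)
      then have th: "(\<integral>\<^sup>+x. norm (s i (x + h) - f (x + h)) \<partial>lborel) = (\<integral>\<^sup>+x. norm (s i x - f x) \<partial>lborel)"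
        using nn_integral_distr[of "\<lambda>x. x + h" lborel borel "\<lambda>x. ennreal (norm (s i x - f x))"] by auto
      have "(\<integral>\<^sup>+x. norm (f (x + h) - f x) \<partial>lborel)
        \<le> (\<integral>\<^sup>+x. ennreal (norm (s i (x + h) - f (x + h))) + (ennreal (norm (s i (x + h) - s i x)) + ennreal (norm (s i x - f x))) \<partial>lborel)"
      proof (intro nn_integral_mono)
        fix x
        have "norm (f (x + h) - f x) \<le> norm (s i (x + h) - f (x + h)) + (norm (s i (x + h) - s i x) + norm (s i x - f x))"
          using norm_triangle_ineq4[of "s i (x + h) - f (x + h)" "(s i (x + h) - s i x) + (s i x - f x)"]
            norm_triangle_ineq[of "s i (x + h) - s i x" "s i x - f x"]
          by (simp add: norm_minus_commute)
        then show "ennreal (norm (f (x + h) - f x)) \<le> ennreal (norm (s i (x + h) - f (x + h))) + (ennreal (norm (s i (x + h) - s i x)) + ennreal (norm (s i x - f x)))"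
          by (simp add: ennreal_leI flip: ennreal_plus)
      qed
      also have "\<dots> = (\<integral>\<^sup>+x. norm (s i (x + h) - f (x + h)) \<partial>lborel) + ((\<integral>\<^sup>+x. norm (s i (x + h) - s i x) \<partial>lborel) + (\<integral>\<^sup>+x. norm (s i x - f x) \<partial>lborel))"
        by (simp add: nn_integral_add)
      also have "\<dots> \<le> ennreal (e / 3) + (ennreal (e / 3) + ennreal (e / 3))"
        unfolding th using i' \<delta>(2)[OF that] by (intro add_mono)
      finally show ?thesis using e by (simp flip: ennreal_plus)
    qed
    then show "\<exists>\<delta>>0. \<forall>h. norm h < \<delta> \<longrightarrow> (\<integral>\<^sup>+x. norm (f (x + h) - f x) \<partial>lborel) \<le> ennreal e"
      using \<delta>(1) by auto
  qed
qed

text \<open>Reduction to the integrable case: a cut-off \<open>g k\<close> of \<open>f\<close> is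
  integrable and bounded by \<open>c\<close>, and an increment v of such a function satisfies |v|^p
  \<le> (2 c)^(p - 1) |v|.\<close>

lemma powr_integral_translation_tendsto:
  fixes f :: "'b::euclidean_space \<Rightarrow> 'c::euclidean_space"
  assumes f: "f \<in> Lp lborel p" and p: "p \<ge> 1" and e: "e > 0"
  obtains \<delta> where "\<delta> > 0"
    "\<And>h. norm h < \<delta> \<Longrightarrow> (\<integral>\<^sup>+x. norm (f (x + h) - f x) powr p \<partial>lborel) \<le> ennreal e"
proof -
  \<comment> \<open>The upper cut makes \<open>g k\<close> bounded. The lower cut makes it
    integrable: where it is nonzero, \<open>norm (f x) \<ge> 1 / c\<close>, so
    \<open>norm (f x)\<close> is at most \<open>c powr (p - 1) * norm (f x) powr p\<close>.\<close>
  define g where "g k x = (if 1 / real (Suc k) \<le> norm (f x) \<and> norm (f x) \<le> real (Suc k) then f x else 0)" for k :: nat and x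
  have fm[measurable]: "f \<in> borel_measurable borel" using LpD(1)[OF f] by simp
  have gm[measurable]: "g k \<in> borel_measurable borel" for k
    unfolding g_def[abs_def] by measurable
  have "(\<lambda>k. \<integral>x. norm (f x - g k x) powr p \<partial>lborel) \<longlonglongrightarrow> (\<integral>x. 0 \<partial>(lborel :: 'b measure))"
  proof (rule integral_dominated_convergence[where w = "\<lambda>x. norm (f x) powr p"])
    show "AE x in lborel. (\<lambda>k. norm (f x - g k x) powr p) \<longlonglongrightarrow> 0"
    proof (intro AE_I2)
      fix x
      have "\<forall>\<^sub>F k in sequentially. norm (f x - g k x) powr p = 0"
      proof (cases "f x = 0")
        case False
        obtain K1 :: nat where K1: "norm (f x) \<le> real K1" using real_arch_simple by blast
        obtain K2 :: nat where K2: "1 / norm (f x) \<le> real K2" using real_arch_simple by blast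
        have "g k x = f x" if "k \<ge> max K1 K2" for k
        proof -
          have "1 / norm (f x) \<le> real (Suc k)" using K2 that by simp
          then have "1 / real (Suc k) \<le> norm (f x)" using False by (simp add: field_simps)
          then show ?thesis using K1 that by (auto simp: g_def)
        qed
        then show ?thesis unfolding eventually_sequentially by (intro exI[of _ "max K1 K2"]) auto
      qed (simp add: g_def)
      then show "(\<lambda>k. norm (f x - g k x) powr p) \<longlonglongrightarrow> 0" by (rule tendsto_eventually)
    qed
    show "AE x in lborel. norm (norm (f x - g k x) powr p) \<le> norm (f x) powr p" for k
      using p by (intro AE_I2) (auto simp: g_def)
  qed (use LpD[OF f] in auto)
  then have lim: "(\<lambda>k. \<integral>x. norm (f x - g k x) powr p \<partial>lborel) \<longlonglongrightarrow> 0" by simp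
  \<comment> \<open>Three terms of size \<open>e'\<close> remain after two uses of
    \<open>norm_add_powr_le\<close>, each of which costs a factor \<open>2 powr p\<close>.\<close>
  define e' where "e' = e / (3 * 4 powr p)"
  have e': "e' > 0" using e by (simp add: e'_def)
  from order_tendstoD(2)[OF lim e'] obtain k where k: "(\<integral>x. norm (f x - g k x) powr p \<partial>lborel) < e'"
    by (auto simp: eventually_sequentially)
  have ifg: "integrable lborel (\<lambda>x. norm (f x - g k x) powr p)"
    by (rule Bochner_Integration.integrable_bound[OF LpD(2)[OF f]]) (auto simp: g_def)
  have k': "(\<integral>\<^sup>+x. norm (f x - g k x) powr p \<partial>lborel) \<le> ennreal e'"
    using k ifg by (subst nn_integral_eq_integral) (auto intro!: ennreal_leI)
  define c where "c = real (Suc k)"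
  have c: "c \<ge> 1" by (simp add: c_def)
  have gc: "norm (g k x) \<le> c" for x by (simp add: g_def c_def)
  have "norm (g k x) \<le> c powr (p - 1) * norm (f x) powr p" for x
  proof (cases "g k x = 0")
    case False
    then have x: "g k x = f x" "1 / c \<le> norm (f x)" by (auto simp: g_def c_def split: if_splits)
    then have pos: "norm (f x) > 0" using c by (smt (verit) divide_pos_pos)
    have "norm (f x) = norm (f x) powr (1 - p) * norm (f x) powr p"
      using pos by (simp flip: powr_add)
    also have "\<dots> \<le> (1 / c) powr (1 - p) * norm (f x) powr p"
      using x p c pos by (intro mult_right_mono powr_mono2') auto
    also have "(1 / c) powr (1 - p) = c powr (p - 1)"
      using c by (simp add: powr_divide powr_minus_divide[symmetric])
    finally show ?thesis using x by simp
  qed simp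
  then have "integrable lborel (g k)"
    using LpD(2)[OF f] by (intro Bochner_Integration.integrable_bound[of lborel "\<lambda>x. c powr (p - 1) * norm (f x) powr p" "g k"]) auto
  moreover define e'' where "e'' = e' / (2 * c) powr (p - 1)"
  moreover have "e'' > 0" using e' c by (simp add: e''_def)
  ultimately obtain \<delta> where \<delta>: "\<delta> > 0"
    "\<And>h. norm h < \<delta> \<Longrightarrow> (\<integral>\<^sup>+x. norm (g k (x + h) - g k x) \<partial>lborel) \<le> ennreal e''"
    using integral_translation_tendsto[of "g k"] by blast
  have "(\<integral>\<^sup>+x. norm (f (x + h) - f x) powr p \<partial>lborel) \<le> ennreal e" if h: "norm h < \<delta>" for h
  proof -
    have "distr lborel borel (\<lambda>x. x + h) = lborel"
      using lborel_distr_plus[of h] by (metis (no_types, lifting) add.commute distr_cong)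
    then have th: "(\<integral>\<^sup>+x. norm (f (x + h) - g k (x + h)) powr p \<partial>lborel) = (\<integral>\<^sup>+x. norm (f x - g k x) powr p \<partial>lborel)"
      using nn_integral_distr[of "\<lambda>x. x + h" lborel borel "\<lambda>x. ennreal (norm (f x - g k x) powr p)"] by auto
    let ?a = "\<lambda>x. norm (f (x + h) - g k (x + h)) powr p" and ?b = "\<lambda>x. (2 * c) powr (p - 1) * norm (g k (x + h) - g k x)"
      and ?d = "\<lambda>x. norm (f x - g k x) powr p"
    have pt: "norm (f (x + h) - f x) powr p \<le> 4 powr p * (?a x + (?b x + ?d x))" for x
    proof -
      let ?u = "f (x + h) - g k (x + h)" and ?v = "g k (x + h) - g k x" and ?w = "g k x - f x"
      have b: "norm ?v powr p \<le> ?b x"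
      proof (cases "?v = 0")
        case False
        have "norm ?v powr p = norm ?v powr (p - 1) * norm ?v"
          using False powr_add[of "norm ?v" "p - 1" 1] by simp
        also have "\<dots> \<le> ?b x"
          using p gc[of x] gc[of "x + h"] norm_triangle_ineq4[of "g k (x + h)" "g k x"]
          by (intro mult_right_mono powr_mono2) auto
        finally show ?thesis .
      qed simp
      have "norm (f (x + h) - f x) powr p = norm (?u + (?v + ?w)) powr p" by simp
      also have "\<dots> \<le> 2 powr p * (norm ?u powr p + norm (?v + ?w) powr p)"
        using p by (intro norm_add_powr_le) auto
      also have "\<dots> \<le> 2 powr p * (2 powr p * norm ?u powr p + 2 powr p * (norm ?v powr p + norm ?w powr p))"
        using p norm_add_powr_le[of p ?v ?w] ge_one_powr_ge_zero[of 2 p]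
        by (intro mult_left_mono add_mono) (auto simp: mult_le_cancel_right1)
      also have "\<dots> = 4 powr p * (norm ?u powr p + (norm ?v powr p + norm ?w powr p))"
        using powr_mult[of 2 2 p] by (simp add: algebra_simps)
      also have "\<dots> \<le> 4 powr p * (?a x + (?b x + ?d x))"
        using b by (intro mult_left_mono add_mono) (auto simp: norm_minus_commute)
      finally show ?thesis .
    qed
    have "(\<integral>\<^sup>+x. norm (f (x + h) - f x) powr p \<partial>lborel)
      \<le> (\<integral>\<^sup>+x. ennreal (4 powr p) * (ennreal (?a x) + (ennreal ((2 * c) powr (p - 1)) * ennreal (norm (g k (x + h) - g k x)) + ennreal (?d x))) \<partial>lborel)"
      using pt by (intro nn_integral_mono) (simp add: ennreal_leI flip: ennreal_plus ennreal_mult)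
    also have "\<dots> = ennreal (4 powr p) * ((\<integral>\<^sup>+x. ?a x \<partial>lborel) + (ennreal ((2 * c) powr (p - 1)) * (\<integral>\<^sup>+x. norm (g k (x + h) - g k x) \<partial>lborel) + (\<integral>\<^sup>+x. ?d x \<partial>lborel)))"
      by (simp add: nn_integral_add nn_integral_cmult)
    also have "\<dots> \<le> ennreal (4 powr p) * (ennreal e' + (ennreal ((2 * c) powr (p - 1)) * ennreal e'' + ennreal e'))"
      unfolding th using k' \<delta>(2)[OF h] by (intro mult_left_mono add_mono) auto
    also have "\<dots> = ennreal (4 powr p * (e' + ((2 * c) powr (p - 1) * e'' + e')))"
      using e' \<open>e'' > 0\<close> by (simp flip: ennreal_plus ennreal_mult)
    also have "4 powr p * (e' + ((2 * c) powr (p - 1) * e'' + e')) = e"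
      using c by (simp add: e''_def e'_def field_simps)
    finally show ?thesis .
  qed
  then show thesis using that \<delta>(1) by blast
qed

lemma nn_integral_lborel_translate_indicator:
  fixes a b c :: real and f :: "real \<Rightarrow> ennreal"
  assumes [measurable]: "f \<in> borel_measurable borel"
  shows "(\<integral>\<^sup>+r. indicator {a<..b} r * f (c + r) \<partial>lborel) = (\<integral>\<^sup>+r. indicator {c + a<..c + b} r * f r \<partial>lborel)"
proof -
  have "(\<integral>\<^sup>+r. indicator {c + a<..c + b} r * f r \<partial>lborel)
      = (\<integral>\<^sup>+r. indicator {c + a<..c + b} r * f r \<partial>distr lborel borel ((+) c))"
    by (simp add: lborel_distr_plus)
  also have "\<dots> = (\<integral>\<^sup>+r. indicator {c + a<..c + b} (c + r) * f (c + r) \<partial>lborel)"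
    by (subst nn_integral_distr) auto
  also have "\<dots> = (\<integral>\<^sup>+r. indicator {a<..b} r * f (c + r) \<partial>lborel)"
    by (intro nn_integral_cong) (auto simp: indicator_def)
  finally show ?thesis by simp
qed

lemma AE_lebesgue_translate:
  fixes c :: real
  assumes "AE t in lebesgue. P t"
  shows "AE t in lebesgue. P (c + t)"
proof -
  have "AE t in distr lborel borel ((+) c). P t"
    using assms by (subst lborel_distr_plus) (simp add: AE_completion_iff)
  then have "AE t in lborel. P (c + t)"
    by (rule AE_distrD[rotated]) auto
  then show ?thesis by (rule AE_completion)
qed

text \<open>Markov's inequality: were \<open>J\<close> above \<open>2 * e\<close> at all admissible
  points, its integral over the interval would be at least \<open>2 * e * h\<close>, twice what is
  allowed.\<close>

lemma AE_lebesgue_on_exists: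
  fixes h :: real
  assumes "AE r in lebesgue. P r" "h > 0" and J[measurable]: "J \<in> borel_measurable borel"
    and le: "(\<integral>\<^sup>+r. indicator {0<..h} r * J r \<partial>lborel) \<le> ennreal (h * e)" and e: "e > 0"
  obtains r where "0 < r" "r < h" "P r" "J r \<le> ennreal (2 * e)"
proof (rule ccontr)
  assume nt: "\<not> thesis"
  have n: "\<not> (J r \<le> ennreal (2 * e))" if "0 < r" "r < h" "P r" for r
    using nt \<open>\<And>r. 0 < r \<Longrightarrow> r < h \<Longrightarrow> P r \<Longrightarrow> J r \<le> ennreal (2 * e) \<Longrightarrow> thesis\<close> that by blast
  have "ennreal (2 * e) * emeasure lborel {0<..h} = (\<integral>\<^sup>+r. ennreal (2 * e) * indicator {0<..h} r \<partial>lborel)"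
    by (subst nn_integral_cmult_indicator) auto
  also have "\<dots> \<le> (\<integral>\<^sup>+r. indicator {0<..h} r * J r \<partial>lborel)"
  proof (rule nn_integral_mono_AE)
    have "AE r in lborel. P r" using assms(1) by (simp add: AE_completion_iff)
    moreover have "AE r in lborel. r \<noteq> h" by (simp add: AE_lborel_singleton)
    ultimately show "AE r in lborel. ennreal (2 * e) * indicator {0<..h} r \<le> indicator {0<..h} r * J r"
    proof eventually_elim
      case (elim r)
      then show ?case using n[of r] by (cases "r \<in> {0<..h}") auto
    qed
  qed
  also note le
  finally have "ennreal (2 * e) * ennreal h \<le> ennreal (h * e)" using assms(2) by simp
  then have "ennreal (2 * e * h) \<le> ennreal (h * e)"
    using assms(2) e by (simp add: ennreal_mult)
  then have "2 * e * h \<le> h * e"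
    using assms(2) e by (simp add: ennreal_le_iff)
  then show False using assms(2) e by (simp add: mult.commute)
qed

text \<open>
  Averaging the error over all shifts \<open>r\<close> of a uniform grid turns it into a modulus of translation of \<open>g\<close>, so
  some shift that also avoids the null set of bad times does at least half as well as the average.
\<close>

lemma step_function_approx:
  fixes g :: "'a::euclidean_space \<times> real \<Rightarrow> 'b::euclidean_space"
  assumes \<Omega>: "open \<Omega>" and T: "T > 0" and p: "p \<ge> 1"
    and g: "g \<in> Lp (lebesgue_on (\<Omega> \<times> {0<..<T})) p"
    and P: "AE t in lebesgue_on {0<..<T}. P t" and e: "e > 0"
  obtains N s where "1 \<le> (N::nat)" "0 < s 1" "s 1 < e" "\<And>k. k \<in> {1..N} \<Longrightarrow> s k < s (Suc k)" "s (Suc N) = T"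
    "\<And>k. k \<in> {1..N} \<Longrightarrow> 0 < s k \<and> s k < T \<and> P (s k)"
    "(\<integral>\<^sup>+y. norm (g y - (\<Sum>k=1..N. indicator {s k<..s (Suc k)} (snd y) *\<^sub>R g (fst y, s k))) powr p
       \<partial>lebesgue_on (\<Omega> \<times> {0<..<T})) \<le> ennreal e"
proof -
  define Q where "Q = \<Omega> \<times> {0<..<T}"
  have "open Q" using \<Omega> by (auto simp: Q_def intro!: open_Times)
  then have Q: "open Q" "Q \<in> sets lebesgue" "Q \<in> sets borel" by auto
  define g0 where "g0 y = indicator Q y *\<^sub>R g y" for y
  have "g0 \<in> borel_measurable lebesgue"
    using LpD(1)[OF g] Q(2) borel_measurable_restrict_space_iff[of Q lebesgue g]
    by (simp add: g0_def[abs_def] Q_def)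
  then obtain g' where g'[measurable]: "g' \<in> borel_measurable borel" and g0': "AE y in lebesgue. g0 y = g' y"
    using borel_representative by blast
  have "norm (g0 y) powr p = indicator Q y *\<^sub>R norm (g y) powr p" for y
    by (simp add: g0_def indicator_def)
  then have "integrable lebesgue (\<lambda>y. norm (g0 y) powr p)"
    using LpD(2)[OF g] Q(2) integrable_restrict_space[of Q lebesgue "\<lambda>y. norm (g y) powr p"] p
    by (simp add: Q_def)
  then have "integrable lebesgue (\<lambda>y. norm (g' y) powr p)"
    using g0' by (subst integrable_cong_AE[of _ _ "\<lambda>y. norm (g0 y) powr p"])
      (auto elim!: eventually_mono simp: measurable_completion borel_measurable_integrable)
  then have Lp': "g' \<in> Lp lborel p"
    using g' integrable_completion[of "\<lambda>y. norm (g' y) powr p" lborel] by (auto simp: Lp_def)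
  obtain \<delta> where \<delta>: "\<delta> > 0"
    "\<And>h. norm h < \<delta> \<Longrightarrow> (\<integral>\<^sup>+x. norm (g' (x + h) - g' x) powr p \<partial>lborel) \<le> ennreal (e / 2)"
    by (rule powr_integral_translation_tendsto[OF Lp' p half_gt_zero[OF e]]) blast
  \<comment> \<open>The mesh \<open>h\<close> has to be below \<delta> for the translation estimate
    and below \<open>e\<close> so that the first node satisfies \<open>s 1 < e\<close>.\<close>
  obtain n0 where n0: "inverse (real (Suc n0)) < min \<delta> e / T"
    using reals_Archimedean[of "min \<delta> e / T"] \<delta> e T by auto
  define N where "N = Suc n0"
  define h where "h = T / real N"
  have h: "h > 0" "h < \<delta>" "h < e" "real N * h = T"
    using T n0 by (auto simp: h_def N_def field_simps)
  define \<Theta> where "\<Theta> s \<tau> = (\<integral>\<^sup>+x. ennreal (norm (g' (x, s + \<tau>) - g' (x, s)) powr p) \<partial>lborel)" for s \<tau>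
  have \<Theta>m[measurable]: "case_prod \<Theta> \<in> borel_measurable (borel \<Otimes>\<^sub>M borel)"
    unfolding \<Theta>_def[abs_def] by measurable
  have \<Theta>le: "(\<integral>\<^sup>+s. \<Theta> s \<tau> \<partial>lborel) \<le> ennreal (e / 2)" if "\<tau> \<in> {0<..h}" for \<tau>
  proof -
    have "(\<integral>\<^sup>+s. \<Theta> s \<tau> \<partial>lborel) = (\<integral>\<^sup>+y. norm (g' (y + (0, \<tau>)) - g' y) powr p \<partial>(lborel \<Otimes>\<^sub>M lborel))"
    proof -
      have "(\<lambda>y. ennreal (norm (g' (y + (0, \<tau>)) - g' y) powr p)) \<in> borel_measurable borel"
        by measurable
      then have "(\<lambda>y. ennreal (norm (g' (y + (0, \<tau>)) - g' y) powr p)) \<in> borel_measurable (lborel \<Otimes>\<^sub>M lborel)"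
        by (subst lborel_prod) simp
      from lborel_pair.nn_integral_snd[OF this] show ?thesis by (simp add: \<Theta>_def)
    qed
    also have "\<dots> \<le> ennreal (e / 2)"
      using \<delta>(2)[of "(0, \<tau>)"] that h by (simp add: lborel_prod norm_Pair)
    finally show ?thesis .
  qed
  \<comment> \<open>The offsets start at \<open>- h\<close>: the cell with index 0 precedes the
    first node, and its reference time \<open>off 0 + r\<close> is negative, where \<open>g0\<close>
    vanishes. This accounts for the value 0 of the step function before \<open>s 1\<close>.\<close>
  define off where "off j = (real j - 1) * h" for j :: nat
  have off_Suc: "off (Suc j) = off j + h" for j by (simp add: off_def algebra_simps)
  define J where "J r = (\<Sum>j\<le>N. \<integral>\<^sup>+\<tau>. indicator {0<..h} \<tau> * \<Theta> (off j + r) \<tau> \<partial>lborel)" for r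
  have Jm[measurable]: "J \<in> borel_measurable borel"
    unfolding J_def[abs_def] by measurable
  have Jint: "(\<integral>\<^sup>+r. indicator {0<..h} r * J r \<partial>lborel) \<le> ennreal (h * (e / 2))"
  proof -
    have "(\<integral>\<^sup>+r. indicator {0<..h} r * J r \<partial>lborel)
      = (\<Sum>j\<le>N. \<integral>\<^sup>+r. (\<integral>\<^sup>+\<tau>. indicator {0<..h} \<tau> * (indicator {0<..h} r * \<Theta> (off j + r) \<tau>) \<partial>lborel) \<partial>lborel)"
      unfolding J_def
      by (simp add: sum_distrib_left nn_integral_sum nn_integral_cmult[symmetric] mult.left_commute)
    also have "\<dots> = (\<Sum>j\<le>N. \<integral>\<^sup>+\<tau>. (\<integral>\<^sup>+r. indicator {0<..h} \<tau> * (indicator {0<..h} r * \<Theta> (off j + r) \<tau>) \<partial>lborel) \<partial>lborel)"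
      by (intro sum.cong refl lborel_pair.Fubini') measurable
    also have "\<dots> = (\<Sum>j\<le>N. \<integral>\<^sup>+\<tau>. indicator {0<..h} \<tau> * (\<integral>\<^sup>+r. indicator {off j<..off j + h} r * \<Theta> r \<tau> \<partial>lborel) \<partial>lborel)"
      using nn_integral_lborel_translate_indicator[of "\<lambda>r. \<Theta> r \<tau>" 0 h "off j" for \<tau> j]
      by (simp add: nn_integral_cmult)
    also have "\<dots> = (\<integral>\<^sup>+\<tau>. indicator {0<..h} \<tau> * (\<integral>\<^sup>+r. (\<Sum>j\<le>N. indicator {off j<..off j + h} r) * \<Theta> r \<tau> \<partial>lborel) \<partial>lborel)"
      unfolding sum_distrib_right
      by (subst nn_integral_sum, measurable, subst sum_distrib_left, subst nn_integral_sum, measurable)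
    also have "\<dots> \<le> (\<integral>\<^sup>+\<tau>. ennreal (e / 2) * indicator {0<..h} \<tau> \<partial>lborel)"
    proof (rule nn_integral_mono)
      fix \<tau> :: real
      \<comment> \<open>For a fixed shift \<tau> the windows are disjoint, so summing over the cells
        costs at most one integral over all times, which \<open>\<Theta>le\<close> bounds.\<close>
      have one: "(\<Sum>j\<le>N. indicator {off j<..off j + h} r) \<le> (1::ennreal)" for r
      proof -
        have "(\<Sum>j\<le>N. indicator {off j<..off j + h} r :: ennreal) = indicator (\<Union>j\<le>N. {off j<..off j + h}) r"
        proof (rule indicator_UN_disjoint[symmetric])
          show "disjoint_family_on (\<lambda>j. {off j<..off j + h}) {..N}"
            unfolding disjoint_family_on_def
          proof (intro ballI impI)
            have *: "off i + h \<le> off j" if "i < j" for i j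
              using that h(1) mult_right_mono[of "real (Suc i)" "real j" h]
              by (simp add: off_def algebra_simps)
            fix i j :: nat assume "i \<noteq> j"
            then show "{off i<..off i + h} \<inter> {off j<..off j + h} = {}"
              using *[of i j] *[of j i] by (cases "i < j") auto
          qed
        qed simp
        then show ?thesis by (simp add: indicator_def)
      qed
      have "(\<integral>\<^sup>+r. (\<Sum>j\<le>N. indicator {off j<..off j + h} r) * \<Theta> r \<tau> \<partial>lborel) \<le> (\<integral>\<^sup>+r. 1 * \<Theta> r \<tau> \<partial>lborel)"
        by (intro nn_integral_mono mult_right_mono one) auto
      then show "indicator {0<..h} \<tau> * (\<integral>\<^sup>+r. (\<Sum>j\<le>N. indicator {off j<..off j + h} r) * \<Theta> r \<tau> \<partial>lborel)
          \<le> ennreal (e / 2) * indicator {0<..h} \<tau>"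
        using \<Theta>le[of \<tau>] by (cases "\<tau> \<in> {0<..h}") auto
    qed
    also have "\<dots> = ennreal (h * (e / 2))"
      using h e by (subst nn_integral_cmult_indicator) (auto simp: mult.commute simp flip: ennreal_mult)
    finally show ?thesis .
  qed
  \<comment> \<open>A node has to avoid the bad times of \<open>P\<close> and also the times whose
    slice of \<open>g0\<close> differs from that of the Borel representative, because the step
    function samples \<open>g\<close> itself.\<close>
  define good where "good t \<longleftrightarrow> (AE x in lebesgue. g0 (x, t) = g' (x, t)) \<and> (0 < t \<and> t < T \<longrightarrow> P t)" for t
  have "AE t in lebesgue. AE x in lebesgue. g0 (x, t) = g' (x, t)"
    by (rule AE_lebesgue_prod_slice[OF g0'])
  moreover have "AE t in lebesgue. 0 < t \<and> t < T \<longrightarrow> P t"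
    using P by (simp add: AE_restrict_space_iff)
  ultimately have "AE t in lebesgue. good t" unfolding good_def by eventually_elim auto
  then have aer: "AE r in lebesgue. \<forall>j\<in>{..N}. good (off j + r)"
    by (intro AE_finite_allI AE_lebesgue_translate) auto
  \<comment> \<open>The average of \<open>J\<close> over the shifts is at most e / 2, so some
    admissible shift has error at most e.\<close>
  obtain r where r: "0 < r" "r < h" "\<forall>j\<in>{..N}. good (off j + r)" "J r \<le> ennreal (2 * (e / 2))"
    by (rule AE_lebesgue_on_exists[OF aer h(1) Jm Jint half_gt_zero[OF e]])
  define s where "s j = (if j \<le> N then off j + r else T)" for j
  have sN: "s (Suc N) = T" by (simp add: s_def)
  have off1: "off 1 = 0" by (simp add: off_def)
  have offN: "off N = T - h" using h(4) by (simp add: off_def algebra_simps)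
  have N1: "1 \<le> N" by (simp add: N_def)
  have s_less: "s k < s (Suc k)" if "k \<in> {1..N}" for k
  proof (cases "k = N")
    case True then show ?thesis using offN r by (simp add: s_def)
  next
    case False then show ?thesis using that h off_Suc[of k] by (simp add: s_def)
  qed
  have s_in: "0 < s k \<and> s k < T" if "k \<in> {1..N}" for k
  proof -
    have "off 1 \<le> off k" "off k \<le> off N"
      unfolding off_def using that h by (auto intro!: mult_right_mono)
    then show ?thesis using that r offN off1 h by (simp add: s_def)
  qed
  have sP: "P (s k)" if "k \<in> {1..N}" for k
    using r(3) s_in[OF that] that by (auto simp: s_def good_def split: if_splits)
  let ?v = "\<lambda>y. \<Sum>k=1..N. indicator {s k<..s (Suc k)} (snd y) *\<^sub>R g (fst y, s k)"
  have ae: "AE y in (lebesgue :: ('a \<times> real) measure). \<forall>j\<in>{..N}. g0 (fst y, off j + r) = g' (fst y, off j + r)"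
    using r(3) by (intro AE_finite_allI AE_lebesgue_fst) (auto simp: good_def)
  have mj: "(\<lambda>y. indicator {off j + r<..off j + r + h} (snd y) * ennreal (norm (g' y - g' (fst y, off j + r)) powr p))
      \<in> borel_measurable (lborel \<Otimes>\<^sub>M lborel)" for j
  proof -
    have [measurable]: "g' \<in> borel_measurable (borel \<Otimes>\<^sub>M borel)" using g' by (simp add: borel_prod)
    have "(\<lambda>y. indicator {off j + r<..off j + r + h} (snd y) * ennreal (norm (g' y - g' (fst y, off j + r)) powr p))
      \<in> borel_measurable (borel \<Otimes>\<^sub>M borel)"
      by measurable
    then show ?thesis by (subst lborel_prod) (simp add: borel_prod)
  qed
  have "(\<integral>\<^sup>+y. norm (g y - ?v y) powr p \<partial>lebesgue_on Q)
     = (\<integral>\<^sup>+y. ennreal (norm (g y - ?v y) powr p) * indicator Q y \<partial>lebesgue)"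
    using Q by (subst nn_integral_restrict_space) auto
  also have "\<dots> \<le> (\<integral>\<^sup>+y. (\<Sum>j\<le>N. indicator {off j + r<..off j + r + h} (snd y) * ennreal (norm (g' y - g' (fst y, off j + r)) powr p)) \<partial>lebesgue)"
  proof (rule nn_integral_mono_AE)
    from g0' ae show "AE y in lebesgue. ennreal (norm (g y - ?v y) powr p) * indicator Q y
       \<le> (\<Sum>j\<le>N. indicator {off j + r<..off j + r + h} (snd y) * ennreal (norm (g' y - g' (fst y, off j + r)) powr p))"
    proof eventually_elim
      case (elim y)
      show ?case
      proof (cases "y \<in> Q")
        case True
        obtain x t where y: "y = (x, t)" by (cases y)
        have xt: "x \<in> \<Omega>" "0 < t" "t < T" using True y by (auto simp: Q_def)
        \<comment> \<open>Index of the cell that contains \<open>t\<close>; the value 0 means that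
          \<open>t\<close> lies before the first node, where no summand of the step function is
          active.\<close>
        define j where "j = (GREATEST j. j \<le> N \<and> off j + r < t)"
        have j0: "0 \<le> N \<and> off 0 + r < t" using r xt by (simp add: off_def)
        have j: "j \<le> N \<and> off j + r < t"
          unfolding j_def by (rule GreatestI_nat[of _ 0 N]) (use j0 in auto)
        have jmax: "i \<le> j" if "i \<le> N" "off i + r < t" for i
          unfolding j_def by (rule Greatest_le_nat[of _ _ N]) (use that in auto)
        have up: "t \<le> off j + r + h"
        proof (cases "j = N")
          case True then show ?thesis using xt offN r by simp
        next
          case False
          then show ?thesis using jmax[of "Suc j"] j off_Suc[of j] by force
        qed
        have offmono: "off a \<le> off b" if "a \<le> b" for a b
          unfolding off_def using that h by (intro mult_right_mono) auto
        have v: "?v y = g' (x, off j + r)"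
        proof -
          have ind: "indicat_real {s k<..s (Suc k)} t = (if k = j then 1 else 0)" if "k \<in> {1..N}" for k
          proof (cases "k = j")
            case True
            have "t \<le> s (Suc k)" using True up xt off_Suc[of j] by (simp add: s_def add_ac)
            then show ?thesis using True j by (simp add: s_def)
          next
            case False
            have "\<not> (s k < t \<and> t \<le> s (Suc k))"
            proof
              assume a: "s k < t \<and> t \<le> s (Suc k)"
              then have "k \<le> j" using jmax[of k] that by (simp add: s_def)
              then have kj: "Suc k \<le> j" using False by simp
              then have "s (Suc k) \<le> off j + r" using offmono[OF kj] j by (simp add: s_def)
              then show False using a j by simp
            qed
            then show ?thesis using False by (simp add: indicator_def)
          qed
          have "?v y = (\<Sum>k=1..N. if k = j then g (x, s k) else 0)"
            using y by (intro sum.cong) (auto simp: ind)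
          also have "\<dots> = (if j \<in> {1..N} then g (x, s j) else 0)" by simp
          also have "\<dots> = g0 (x, off j + r)"
          proof (cases "j = 0")
            case True
            then have "off j + r \<le> 0" using r by (simp add: off_def)
            then show ?thesis using True by (auto simp: g0_def Q_def)
          next
            case False
            then have jin: "j \<in> {1..N}" using j by auto
            then have "s j = off j + r" by (simp add: s_def)
            then show ?thesis using s_in[OF jin] jin xt by (auto simp: g0_def Q_def)
          qed
          also have "\<dots> = g' (x, off j + r)" using elim(2) j y by auto
          finally show ?thesis .
        qed
        have "ennreal (norm (g y - ?v y) powr p) * indicator Q y
          = indicator {off j + r<..off j + r + h} (snd y) * ennreal (norm (g' y - g' (fst y, off j + r)) powr p)"
          using elim(1) True v j up y by (simp add: g0_def)
        also have "\<dots> \<le> (\<Sum>j\<le>N. indicator {off j + r<..off j + r + h} (snd y) * ennreal (norm (g' y - g' (fst y, off j + r)) powr p))"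
          using j by (intro member_le_sum) auto
        finally show ?thesis .
      qed auto
    qed
  qed
  also have "\<dots> = (\<integral>\<^sup>+y. (\<Sum>j\<le>N. indicator {off j + r<..off j + r + h} (snd y) * ennreal (norm (g' y - g' (fst y, off j + r)) powr p)) \<partial>(lborel \<Otimes>\<^sub>M lborel))" (is "_ = ?I")
    by (simp add: nn_integral_completion lborel_prod)
  also have "?I = (\<Sum>j\<le>N. \<integral>\<^sup>+y. indicator {off j + r<..off j + r + h} (snd y) * ennreal (norm (g' y - g' (fst y, off j + r)) powr p) \<partial>(lborel \<Otimes>\<^sub>M lborel))"
    by (rule nn_integral_sum) (rule mj)
  also have "\<dots> = (\<Sum>j\<le>N. \<integral>\<^sup>+t. indicator {off j + r<..off j + r + h} t * (\<integral>\<^sup>+x. ennreal (norm (g' (x, t) - g' (x, off j + r)) powr p) \<partial>lborel) \<partial>lborel)"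
    by (intro sum.cong refl, subst lborel_pair.nn_integral_snd[OF mj, symmetric]) (auto simp: nn_integral_cmult)
  also have "\<dots> = J r"
    unfolding J_def
  proof (intro sum.cong refl)
    fix j
    show "(\<integral>\<^sup>+t. indicator {off j + r<..off j + r + h} t * (\<integral>\<^sup>+x. ennreal (norm (g' (x, t) - g' (x, off j + r)) powr p) \<partial>lborel) \<partial>lborel)
      = (\<integral>\<^sup>+\<tau>. indicator {0<..h} \<tau> * \<Theta> (off j + r) \<tau> \<partial>lborel)"
      using nn_integral_lborel_translate_indicator[of "\<lambda>t. \<integral>\<^sup>+x. ennreal (norm (g' (x, t) - g' (x, off j + r)) powr p) \<partial>lborel" 0 h "off j + r"]
      by (simp add: \<Theta>_def)
  qed
  also have "\<dots> \<le> ennreal e" using r(4) by simp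
  finally have fin: "(\<integral>\<^sup>+y. norm (g y - ?v y) powr p \<partial>lebesgue_on Q) \<le> ennreal e" .
  have s1: "0 < s 1" "s 1 < e" using r h off1 N1 by (auto simp: s_def)
  show thesis
    using that[OF N1 s1 s_less sN _ fin[unfolded Q_def]] s_in sP by blast
qed

section \<open>Smooth truncation in \<open>W\<^sub>0\<close>\<close>

text \<open>
  Truncated elements of \<open>W\<^sub>0\<close> are bounded, hence in \<open>L\<^sup>2\<close> even if \<open>p < 2\<close>. The factor \<open>trunc k z / z\<close> lies in
  \<open>[0, 1]\<close>, so the subgradient inequality may be multiplied by it; and the truncation is rational, so it maps
  test functions to test functions.
\<close>

definition trunc :: "real \<Rightarrow> real \<Rightarrow> real" where
  "trunc k z = z / (1 + (z / k)\<^sup>2)"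

definition trunc_deriv :: "real \<Rightarrow> real \<Rightarrow> real" where
  "trunc_deriv k z = (1 - (z / k)\<^sup>2) / (1 + (z / k)\<^sup>2)\<^sup>2"

lemma one_plus_sq_pos: "0 < 1 + (z::real)\<^sup>2" "1 \<le> 1 + (z::real)\<^sup>2" "1 + (z::real)\<^sup>2 \<noteq> 0"
proof -
  show "0 < 1 + z\<^sup>2" by (simp add: add_pos_nonneg)
  then show "1 + z\<^sup>2 \<noteq> 0" by linarith
qed simp

lemma trunc_0 [simp]: "trunc k 0 = 0"
  by (simp add: trunc_def)

lemma abs_trunc_le: "\<bar>trunc k z\<bar> \<le> \<bar>z\<bar>"
proof -
  have "\<bar>z\<bar> / (1 + (z / k)\<^sup>2) \<le> \<bar>z\<bar> / 1"
    by (intro divide_left_mono) (auto simp: one_plus_sq_pos)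
  then show ?thesis
    by (simp add: trunc_def abs_divide one_plus_sq_pos abs_of_pos)
qed

lemma abs_trunc_bounded:
  assumes "k > 0"
  shows "\<bar>trunc k z\<bar> \<le> k"
proof -
  have "2 * \<bar>z / k\<bar> \<le> 1 + (z / k)\<^sup>2"
    using sum_squares_bound[of 1 "\<bar>z / k\<bar>"] unfolding power2_abs by simp
  then have "\<bar>z / k\<bar> \<le> 1 + (z / k)\<^sup>2" by linarith
  then have "k * \<bar>z / k\<bar> \<le> k * (1 + (z / k)\<^sup>2)"
    using assms by (intro mult_left_mono) auto
  then have "\<bar>z\<bar> \<le> k * (1 + (z / k)\<^sup>2)"
    using assms by (simp add: abs_divide)
  then show ?thesis
    by (simp add: trunc_def abs_divide pos_divide_le_eq mult.commute one_plus_sq_pos abs_of_pos)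
qed

lemma abs_trunc_deriv_le: "\<bar>trunc_deriv k z\<bar> \<le> 1"
proof -
  have "\<bar>1 - (z / k)\<^sup>2\<bar> \<le> 1 + (z / k)\<^sup>2"
    by (simp add: abs_le_iff)
  also have "\<dots> \<le> (1 + (z / k)\<^sup>2)\<^sup>2"
    using one_plus_sq_pos[of "z / k"] by (simp add: power2_eq_square mult_le_cancel_left1)
  finally show ?thesis
    using one_plus_sq_pos[of "z / k"] by (simp add: trunc_deriv_def abs_divide divide_le_eq_1)
qed

text \<open>The difference factors explicitly through \<open>a - b\<close>. With x = a / k and y = b
  / k the remaining factor has modulus |1 - x y| / ((1 + x^2) (1 + y^2)), and |1 - x y| \<le> 1 +
  x^2 + y^2.\<close>

lemma abs_trunc_diff_le: "\<bar>trunc k a - trunc k b\<bar> \<le> \<bar>a - b\<bar>"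
proof -
  let ?A = "1 + (a / k)\<^sup>2" and ?B = "1 + (b / k)\<^sup>2"
  have pos: "?A > 0" "?B > 0" by (rule one_plus_sq_pos)+
  have "trunc k a - trunc k b = (a * ?B - b * ?A) / (?A * ?B)"
    using one_plus_sq_pos(3)[of "a / k"] one_plus_sq_pos(3)[of "b / k"] by (simp add: trunc_def diff_frac_eq)
  also have "a * ?B - b * ?A = (a - b) * (1 - (a / k) * (b / k))"
    by (simp add: divide_inverse power2_eq_square algebra_simps)
  finally have eq: "trunc k a - trunc k b = (a - b) * ((1 - (a / k) * (b / k)) / (?A * ?B))" by simp
  have "\<bar>1 - (a / k) * (b / k)\<bar> \<le> 1 + \<bar>a / k\<bar> * \<bar>b / k\<bar>"
    using abs_triangle_ineq4[of 1 "(a / k) * (b / k)"] by (simp add: abs_mult)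
  also have "\<dots> \<le> 1 + ((a / k)\<^sup>2 + (b / k)\<^sup>2)"
    using sum_squares_bound[of "\<bar>a / k\<bar>" "\<bar>b / k\<bar>"] mult_nonneg_nonneg[OF abs_ge_zero[of "a / k"] abs_ge_zero[of "b / k"]]
    unfolding power2_abs by linarith
  also have "\<dots> \<le> ?A * ?B"
    by (simp add: algebra_simps)
  finally have "\<bar>(1 - (a / k) * (b / k)) / (?A * ?B)\<bar> \<le> 1"
    using pos by (simp add: abs_divide abs_mult)
  then show ?thesis
    unfolding eq abs_mult by (intro mult_left_le) auto
qed

lemma trunc_continuous: "continuous_on UNIV (trunc k)" "continuous_on UNIV (trunc_deriv k)"
  unfolding trunc_def[abs_def] trunc_deriv_def[abs_def]
  using one_plus_sq_pos(3) by (auto intro!: continuous_intros simp: divide_inverse)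

lemma trunc_measurable [measurable]:
  "trunc k \<in> borel_measurable borel" "trunc_deriv k \<in> borel_measurable borel"
  using trunc_continuous by (auto intro: borel_measurable_continuous_onI)

lemma trunc_has_real_derivative: "(trunc k has_real_derivative trunc_deriv k z) (at z)"
proof -
  let ?A = "1 + (z / k)\<^sup>2"
  have nz: "?A \<noteq> 0" by (rule one_plus_sq_pos)
  have "(trunc k has_real_derivative (1 * ?A - z * (2 * (z / k) * (1 / k))) / (?A * ?A)) (at z)"
    unfolding trunc_def[abs_def]
  proof (rule DERIV_divide)
    show "((\<lambda>z. 1 + (z / k)\<^sup>2) has_real_derivative 2 * (z / k) * (1 / k)) (at z)"
      unfolding divide_inverse by (auto intro!: derivative_eq_intros)
  qed (use nz in auto)
  moreover have "(1 * ?A - z * (2 * (z / k) * (1 / k))) / (?A * ?A) = trunc_deriv k z"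
    unfolding trunc_deriv_def by (simp add: power2_eq_square)
  ultimately show ?thesis by simp
qed

lemma trunc_tendsto:
  "(\<lambda>n. trunc (real (Suc n)) z) \<longlonglongrightarrow> z" "(\<lambda>n. trunc_deriv (real (Suc n)) z) \<longlonglongrightarrow> 1"
  "(\<lambda>n. 1 / (1 + (z / real (Suc n))\<^sup>2)) \<longlonglongrightarrow> 1"
proof -
  have z: "(\<lambda>n. (z / real (Suc n))\<^sup>2) \<longlonglongrightarrow> 0\<^sup>2"
    by (intro tendsto_power LIMSEQ_Suc lim_const_over_n)
  show "(\<lambda>n. 1 / (1 + (z / real (Suc n))\<^sup>2)) \<longlonglongrightarrow> 1"
    using tendsto_divide[OF tendsto_const tendsto_add[OF tendsto_const z], of 1 1] by simp
  show "(\<lambda>n. trunc (real (Suc n)) z) \<longlonglongrightarrow> z"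
    unfolding trunc_def using tendsto_divide[OF tendsto_const tendsto_add[OF tendsto_const z], of 1 z] by simp
  show "(\<lambda>n. trunc_deriv (real (Suc n)) z) \<longlonglongrightarrow> 1"
    unfolding trunc_deriv_def
    using tendsto_divide[OF tendsto_diff[OF tendsto_const z] tendsto_power[OF tendsto_add[OF tendsto_const z], of _ 2], of 1 1] by simp
qed

text \<open>Smoothness quantifies over lists of directions; a class of differentiable functions
  closed under partial derivatives survives every list.\<close>

lemma smooth_fun_coinduct:
  assumes "f \<in> X"
    and d: "\<And>f x. f \<in> X \<Longrightarrow> f differentiable (at x)"
    and p: "\<And>f b. f \<in> X \<Longrightarrow> b \<in> Basis \<Longrightarrow> pderiv_dir b f \<in> X"
  shows "smooth_fun f"
proof -
  have "fold pderiv_dir es f differentiable (at x)" if "set es \<subseteq> Basis" "f \<in> X" for es f x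
    using that by (induction es arbitrary: f) (auto intro: d p)
  then show ?thesis using assms(1) by (auto simp: smooth_fun_def)
qed

lemma smooth_fun_differentiable: "smooth_fun f \<Longrightarrow> f differentiable (at x)"
  unfolding smooth_fun_def by (metis empty_subsetI fold_simps(1) list.set(1))

lemma smooth_fun_pderiv_dir:
  assumes "smooth_fun f" "b \<in> Basis"
  shows "smooth_fun (pderiv_dir b f)"
  unfolding smooth_fun_def
proof (intro allI impI)
  fix es x assume "set es \<subseteq> (Basis :: 'a set)"
  then have "set (b # es) \<subseteq> Basis" using assms by simp
  then have "fold pderiv_dir (b # es) f differentiable (at x)" using assms(1) unfolding smooth_fun_def by blast
  then show "fold pderiv_dir es (pderiv_dir b f) differentiable (at x)" by simp
qed

text \<open>Closed under partial derivatives, which avoids a Faa di Bruno formula for compositions.\<close>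

inductive_set smooth_alg :: "('a::euclidean_space \<Rightarrow> real) set" where
  smooth: "smooth_fun f \<Longrightarrow> f \<in> smooth_alg"
| const: "(\<lambda>x. c) \<in> smooth_alg"
| add: "f \<in> smooth_alg \<Longrightarrow> g \<in> smooth_alg \<Longrightarrow> (\<lambda>x. f x + g x) \<in> smooth_alg"
| mult: "f \<in> smooth_alg \<Longrightarrow> g \<in> smooth_alg \<Longrightarrow> (\<lambda>x. f x * g x) \<in> smooth_alg"
| inverse: "f \<in> smooth_alg \<Longrightarrow> (\<And>x. f x \<noteq> 0) \<Longrightarrow> (\<lambda>x. inverse (f x)) \<in> smooth_alg"

lemma smooth_alg_derivative:
  assumes "f \<in> smooth_alg"
  shows "(\<forall>x. f differentiable (at x)) \<and> (\<forall>b\<in>Basis. pderiv_dir b f \<in> smooth_alg)"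
  using assms
proof induction
  case (smooth f)
  then show ?case
    using smooth_fun_differentiable smooth_fun_pderiv_dir smooth_alg.smooth by blast
next
  case (const c)
  have "pderiv_dir b (\<lambda>x. c) = (\<lambda>x. 0)" for b :: 'a
    by (simp add: pderiv_dir_def)
  then show ?case using smooth_alg.const by auto
next
  case (add f g)
  then have "pderiv_dir b (\<lambda>x. f x + g x) = (\<lambda>x. pderiv_dir b f x + pderiv_dir b g x)" for b
    unfolding pderiv_dir_def
    by (intro ext, subst frechet_derivative_at[symmetric, OF has_derivative_add])
       (auto simp: frechet_derivative_works)
  then show ?case using add by (auto intro: smooth_alg.add)
next
  case (mult f g)
  then have "pderiv_dir b (\<lambda>x. f x * g x) = (\<lambda>x. f x * pderiv_dir b g x + pderiv_dir b f x * g x)" for b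
    unfolding pderiv_dir_def
    by (intro ext, subst frechet_derivative_at[symmetric, OF has_derivative_mult])
       (auto simp: frechet_derivative_works)
  then show ?case using mult by (auto intro!: smooth_alg.add smooth_alg.mult[of f] smooth_alg.mult[of _ g])
next
  case (inverse f)
  \<comment> \<open>Written as a product of generators, without a square or a quotient, so that
    membership in the algebra is visible.\<close>
  have "pderiv_dir b (\<lambda>x. inverse (f x)) = (\<lambda>x. (- 1) * (inverse (f x) * pderiv_dir b f x * inverse (f x)))" for b
  proof (rule ext)
    fix x
    have "(f has_derivative frechet_derivative f (at x)) (at x)"
      using inverse.IH frechet_derivative_works by blast
    from frechet_derivative_at[OF Deriv.has_derivative_inverse[OF inverse.hyps(2) this], symmetric]
    show "pderiv_dir b (\<lambda>x. inverse (f x)) x = (- 1) * (inverse (f x) * pderiv_dir b f x * inverse (f x))"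
      by (simp add: pderiv_dir_def)
  qed
  moreover have "(\<lambda>x. (- 1) * (inverse (f x) * pderiv_dir b f x * inverse (f x))) \<in> smooth_alg" if "b \<in> Basis" for b
    using inverse that by (intro smooth_alg.mult smooth_alg.const smooth_alg.inverse[of f]) auto
  ultimately show ?case
    using inverse.hyps(2) inverse.IH by (simp add: differentiable_inverse)
qed

lemma smooth_alg_imp_smooth_fun: "f \<in> smooth_alg \<Longrightarrow> smooth_fun f"
  by (rule smooth_fun_coinduct[of f smooth_alg]) (auto dest: smooth_alg_derivative)

lemma test_fun_trunc:
  assumes "test_fun U f"
  shows "test_fun U (\<lambda>x. trunc k (f x))"
proof -
  \<comment> \<open>Form that matches the generators of \<open>smooth_alg\<close>: a product with
    the inverse of a nowhere vanishing element.\<close>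
  have eq: "(\<lambda>x. trunc k (f x)) = (\<lambda>x. f x * inverse (1 + (1 / k\<^sup>2) * (f x * f x)))"
    by (simp add: trunc_def field_simps power2_eq_square)
  have "1 + (1 / k\<^sup>2) * (f x * f x) \<noteq> 0" for x
    using one_plus_sq_pos(3)[of "f x / k"] by (simp add: power2_eq_square)
  then have "(\<lambda>x. trunc k (f x)) \<in> smooth_alg"
    unfolding eq using assms by (intro smooth_alg.intros) (auto simp: test_fun_def)
  then have "smooth_fun (\<lambda>x. trunc k (f x))" by (rule smooth_alg_imp_smooth_fun)
  \<comment> \<open>Truncation keeps the zeros, hence the support.\<close>
  moreover have "trunc k z = 0 \<longleftrightarrow> z = 0" for z
    using one_plus_sq_pos(3)[of "z / k"] by (auto simp: trunc_def)
  ultimately show ?thesis using assms by (simp add: test_fun_def)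
qed

lemma grad_trunc:
  assumes "smooth_fun f"
  shows "grad (\<lambda>x. trunc k (f x)) x = trunc_deriv k (f x) *\<^sub>R grad f x"
proof -
  have f: "(f has_derivative frechet_derivative f (at x)) (at x)"
    using smooth_fun_differentiable[OF assms] frechet_derivative_works by blast
  have "((\<lambda>x. trunc k (f x)) has_derivative (\<lambda>h. trunc_deriv k (f x) * frechet_derivative f (at x) h)) (at x)"
    using has_derivative_compose[OF f, of "trunc k" "(*) (trunc_deriv k (f x))"] trunc_has_real_derivative[of k "f x"]
    by (simp add: has_field_derivative_def)
  from frechet_derivative_at[OF this, symmetric] show ?thesis
    unfolding grad_def by (simp add: scaleR_sum_right)
qed

lemma smooth_fun_Lp:
  assumes f: "smooth_fun f" and \<Omega>: "open \<Omega>" "bounded \<Omega>" and p: "p \<ge> 0"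
  shows "f \<in> Lp (lebesgue_on \<Omega>) p" "grad f \<in> Lp (lebesgue_on \<Omega>) p"
proof -
  have fin: "finite_measure (lebesgue_on \<Omega>)"
    using \<Omega> by (intro finite_measure_lebesgue_on) (simp add: bounded_set_imp_lmeasurable)
  have *: "h \<in> Lp (lebesgue_on \<Omega>) p" if h: "continuous_on UNIV h" for h :: "'a \<Rightarrow> 'b::euclidean_space"
  proof -
    have "compact (h ` closure \<Omega>)"
      using \<Omega>(2) h by (intro compact_continuous_image) (auto intro: continuous_on_subset)
    then obtain C where C: "\<And>x. x \<in> closure \<Omega> \<Longrightarrow> norm (h x) \<le> C"
      unfolding compact_eq_bounded_closed bounded_iff by auto
    have m: "h \<in> borel_measurable (lebesgue_on \<Omega>)"
      using h \<Omega>(1) by (intro continuous_imp_measurable_on_sets_lebesgue) (auto intro: continuous_on_subset)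
    show ?thesis
    proof (rule Lp_bound[OF m])
      show "integrable (lebesgue_on \<Omega>) (\<lambda>x. C powr p)"
        using finite_measure.integrable_const[OF fin] by auto
      show "AE x in lebesgue_on \<Omega>. norm (h x) powr p \<le> C powr p"
        using p C closure_subset by (intro AE_I2 powr_mono2) auto
    qed
  qed
  have cont: "continuous_on UNIV h" if "smooth_fun h" for h :: "'a \<Rightarrow> real"
    using smooth_fun_differentiable[OF that] differentiable_imp_continuous_within
    by (intro continuous_at_imp_continuous_on) auto
  show "f \<in> Lp (lebesgue_on \<Omega>) p" using * cont f by blast
  have "continuous_on UNIV (grad f)"
    unfolding grad_def using cont[OF smooth_fun_pderiv_dir[OF f]]
    by (auto intro!: continuous_intros simp: pderiv_dir_def)
  then show "grad f \<in> Lp (lebesgue_on \<Omega>) p" using * by blast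
qed

text \<open>The truncated test functions approximate the truncated limit. The gradient error splits
  into \<open>?F\<close>, controlled by the original error because \<open>trunc_deriv\<close> is at
  most 1 in modulus, and \<open>?H\<close>, which carries the fixed factor \<open>g\<close> and
  tends to 0 by dominated convergence along an a.e. convergent subsequence.\<close>

lemma W0_trunc:
  assumes \<Omega>: "open \<Omega>" "bounded \<Omega>" and p: "p > 1" and W: "W0 p \<Omega> u g"
  shows "W0 p \<Omega> (\<lambda>x. trunc k (u x)) (\<lambda>x. trunc_deriv k (u x) *\<^sub>R g x)"
proof -
  let ?L = "lebesgue_on \<Omega>"
  have p0: "p > 0" "p \<ge> 0" using p by auto
  obtain \<phi> where u: "u \<in> Lp ?L p" and g: "g \<in> Lp ?L p" and \<phi>: "\<And>n. test_fun \<Omega> (\<phi> n)"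
    and l1: "(\<lambda>n. Lp_norm ?L p (\<lambda>x. \<phi> n x - u x)) \<longlonglongrightarrow> 0"
    and l2: "(\<lambda>n. Lp_norm ?L p (\<lambda>x. grad (\<phi> n) x - g x)) \<longlonglongrightarrow> 0"
    using W unfolding W0_def by blast
  have sm: "smooth_fun (\<phi> n)" for n using \<phi>[of n] by (simp add: test_fun_def)
  have \<phi>L: "\<phi> n \<in> Lp ?L p" "grad (\<phi> n) \<in> Lp ?L p" for n
    using smooth_fun_Lp[OF sm \<Omega> p0(2)] by auto
  note [measurable] = LpD(1)[OF u] LpD(1)[OF g] LpD(1)[OF \<phi>L(1)] LpD(1)[OF \<phi>L(2)]
  note l1 = l1[unfolded Lp_norm_tendsto_0_iff[OF p0(1)]] and l2 = l2[unfolded Lp_norm_tendsto_0_iff[OF p0(1)]]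
  have "\<exists>r::nat\<Rightarrow>nat. strict_mono r \<and> (AE x in ?L. (\<lambda>n. norm (\<phi> (r n) x - u x) powr p) \<longlonglongrightarrow> 0)"
    using l1 LpD(2)[OF Lp_diff[OF p0(2) \<phi>L(1) u]] by (intro tendsto_L1_AE_subseq) auto
  then obtain r :: "nat \<Rightarrow> nat" where r: "strict_mono r" "AE x in ?L. (\<lambda>n. norm (\<phi> (r n) x - u x) powr p) \<longlonglongrightarrow> 0" by blast
  have ae: "AE x in ?L. (\<lambda>n. \<phi> (r n) x) \<longlonglongrightarrow> u x"
    using r(2)
  proof eventually_elim
    case (elim x)
    have "(\<lambda>n. (norm (\<phi> (r n) x - u x) powr p) powr (1 / p)) \<longlonglongrightarrow> 0 powr (1 / p)"
      using elim p0 by (intro tendsto_powr2) auto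
    then have "(\<lambda>n. norm (\<phi> (r n) x - u x)) \<longlonglongrightarrow> 0" using p0 by (simp add: powr_powr)
    then show ?case by (rule LIM_zero_cancel[OF tendsto_norm_zero_cancel])
  qed
  note l1r = LIMSEQ_subseq_LIMSEQ[OF l1 r(1), unfolded o_def] and l2r = LIMSEQ_subseq_LIMSEQ[OF l2 r(1), unfolded o_def]
  have uT: "(\<lambda>x. trunc k (u x)) \<in> Lp ?L p"
    using p0 by (intro Lp_bound[OF _ LpD(2)[OF u]]) (auto intro!: powr_mono2 AE_I2 abs_trunc_le)
  have scale: "norm (trunc_deriv k z *\<^sub>R v) powr p \<le> norm v powr p" for z and v :: 'a
    using abs_trunc_deriv_le[of k z] p0 by (intro powr_mono2) (auto simp: mult_left_le_one_le)
  have gT: "(\<lambda>x. trunc_deriv k (u x) *\<^sub>R g x) \<in> Lp ?L p"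
    using scale by (intro Lp_bound[OF _ LpD(2)[OF g]]) auto
  have m1: "(\<lambda>n. \<integral>x. norm (trunc k (\<phi> (r n) x) - trunc k (u x)) powr p \<partial>?L) \<longlonglongrightarrow> 0"
  proof (rule tendsto_sandwich[OF _ _ tendsto_const l1r])
    show "\<forall>\<^sub>F n in sequentially. (\<integral>x. norm (trunc k (\<phi> (r n) x) - trunc k (u x)) powr p \<partial>?L) \<le> (\<integral>x. norm (\<phi> (r n) x - u x) powr p \<partial>?L)"
    proof (intro always_eventually allI integral_mono)
      fix n x
      show "integrable ?L (\<lambda>x. norm (\<phi> (r n) x - u x) powr p)"
        by (rule LpD(2)[OF Lp_diff[OF p0(2) \<phi>L(1) u]])
      show le: "norm (trunc k (\<phi> (r n) x) - trunc k (u x)) powr p \<le> norm (\<phi> (r n) x - u x) powr p" for x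
        using p0 abs_trunc_diff_le by (intro powr_mono2) auto
      show "integrable ?L (\<lambda>x. norm (trunc k (\<phi> (r n) x) - trunc k (u x)) powr p)"
        by (rule Bochner_Integration.integrable_bound[OF LpD(2)[OF Lp_diff[OF p0(2) \<phi>L(1)[of "r n"] u]]])
           (use le in auto)
    qed
  qed auto
  let ?F = "\<lambda>n x. trunc_deriv k (\<phi> (r n) x) *\<^sub>R (grad (\<phi> (r n)) x - g x)"
  let ?H = "\<lambda>n x. (trunc_deriv k (\<phi> (r n) x) - trunc_deriv k (u x)) *\<^sub>R g x"
  have FL: "?F n \<in> Lp ?L p" for n
    using scale by (intro Lp_bound[OF _ LpD(2)[OF Lp_diff[OF p0(2) \<phi>L(2)[of "r n"] g]]]) auto
  have Hle: "norm (?H n x) powr p \<le> 2 powr p * norm (g x) powr p" for n x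
  proof -
    have "\<bar>trunc_deriv k (\<phi> (r n) x) - trunc_deriv k (u x)\<bar> \<le> 2"
      using abs_trunc_deriv_le[of k "\<phi> (r n) x"] abs_trunc_deriv_le[of k "u x"] by linarith
    then have "norm (?H n x) powr p \<le> (2 * norm (g x)) powr p"
      using p0 by (intro powr_mono2) (auto intro!: mult_right_mono)
    then show ?thesis by (simp add: powr_mult)
  qed
  have HL: "?H n \<in> Lp ?L p" for n
    by (rule Lp_bound[OF _ integrable_mult_right[OF LpD(2)[OF g], of "2 powr p"]]) (use Hle in auto)
  have lF: "(\<lambda>n. \<integral>x. norm (?F n x) powr p \<partial>?L) \<longlonglongrightarrow> 0"
  proof (rule tendsto_sandwich[OF _ _ tendsto_const l2r])
    show "\<forall>\<^sub>F n in sequentially. (\<integral>x. norm (?F n x) powr p \<partial>?L) \<le> (\<integral>x. norm (grad (\<phi> (r n)) x - g x) powr p \<partial>?L)"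
      by (intro always_eventually allI integral_mono scale LpD(2)[OF FL] LpD(2)[OF Lp_diff[OF p0(2) \<phi>L(2) g]])
  qed auto
  have "(\<lambda>n. \<integral>x. norm (?H n x) powr p \<partial>?L) \<longlonglongrightarrow> (\<integral>x. 0 \<partial>?L)"
  proof (rule integral_dominated_convergence[where w = "\<lambda>x. 2 powr p * norm (g x) powr p"])
    show "AE x in ?L. (\<lambda>n. norm (?H n x) powr p) \<longlonglongrightarrow> 0"
      using ae
    proof eventually_elim
      case (elim x)
      have "(\<lambda>n. trunc_deriv k (\<phi> (r n) x)) \<longlonglongrightarrow> trunc_deriv k (u x)"
        using trunc_continuous(2)[of k] elim by (auto intro: continuous_on_tendsto_compose)
      then have "(\<lambda>n. norm (?H n x) powr p) \<longlonglongrightarrow> norm ((trunc_deriv k (u x) - trunc_deriv k (u x)) *\<^sub>R g x) powr p"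
        using p0 by (intro tendsto_powr2 tendsto_intros) auto
      then show ?case using p0 by simp
    qed
    show "AE x in ?L. norm (norm (?H n x) powr p) \<le> 2 powr p * norm (g x) powr p" for n
      using Hle by auto
  qed (use LpD(2)[OF g] in auto)
  then have lH: "(\<lambda>n. \<integral>x. norm (?H n x) powr p \<partial>?L) \<longlonglongrightarrow> 0" by simp
  have eq: "?F n x + ?H n x = trunc_deriv k (\<phi> (r n) x) *\<^sub>R grad (\<phi> (r n)) x - trunc_deriv k (u x) *\<^sub>R g x" for n x
    by (simp add: algebra_simps)
  have m2: "(\<lambda>n. \<integral>x. norm (trunc_deriv k (\<phi> (r n) x) *\<^sub>R grad (\<phi> (r n)) x - trunc_deriv k (u x) *\<^sub>R g x) powr p \<partial>?L) \<longlonglongrightarrow> 0"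
    using Lp_tendsto_add[OF p0(2) FL HL lF lH] by (simp add: eq)
  show ?thesis
    unfolding W0_def Lp_norm_tendsto_0_iff[OF p0(1)]
  proof (intro conjI uT gT exI[of _ "\<lambda>n x. trunc k (\<phi> (r n) x)"] allI test_fun_trunc \<phi>)
    show "(\<lambda>n. \<integral>x. norm (trunc k (\<phi> (r n) x) - trunc k (u x)) powr p \<partial>?L) \<longlonglongrightarrow> 0" by (rule m1)
    show "(\<lambda>n. \<integral>x. norm (grad (\<lambda>x. trunc k (\<phi> (r n) x)) x - trunc_deriv k (u x) *\<^sub>R g x) powr p \<partial>?L) \<longlonglongrightarrow> 0"
      using m2 by (simp add: grad_trunc[OF sm])
  qed
qed

lemma trunc_Lp_tendsto:
  fixes v :: "'b \<Rightarrow> real" and G :: "'b \<Rightarrow> 'c::euclidean_space"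
  assumes p: "p > 0" and v: "v \<in> Lp M p" and G: "G \<in> Lp M p"
  shows "(\<lambda>n. \<integral>x. norm (trunc (real (Suc n)) (v x) - v x) powr p \<partial>M) \<longlonglongrightarrow> 0"
    "(\<lambda>n. \<integral>x. norm (trunc_deriv (real (Suc n)) (v x) *\<^sub>R G x - G x) powr p \<partial>M) \<longlonglongrightarrow> 0"
proof -
  note [measurable] = LpD(1)[OF v] LpD(1)[OF G]
  have "(\<lambda>n. \<integral>x. norm (trunc (real (Suc n)) (v x) - v x) powr p \<partial>M) \<longlonglongrightarrow> (\<integral>x. 0 \<partial>M)"
  proof (rule integral_dominated_convergence[where w = "\<lambda>x. 2 powr p * norm (v x) powr p"])
    show "AE x in M. (\<lambda>n. norm (trunc (real (Suc n)) (v x) - v x) powr p) \<longlonglongrightarrow> 0"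
    proof (intro AE_I2)
      fix x
      have "(\<lambda>n. norm (trunc (real (Suc n)) (v x) - v x) powr p) \<longlonglongrightarrow> norm (v x - v x) powr p"
        using p by (intro tendsto_powr2 tendsto_intros trunc_tendsto) auto
      then show "(\<lambda>n. norm (trunc (real (Suc n)) (v x) - v x) powr p) \<longlonglongrightarrow> 0" using p by simp
    qed
    have "norm (trunc (real (Suc n)) (v x) - v x) powr p \<le> (2 * norm (v x)) powr p" for n x
      using p abs_trunc_le[of "real (Suc n)" "v x"] by (intro powr_mono2) auto
    then show "AE x in M. norm (norm (trunc (real (Suc n)) (v x) - v x) powr p) \<le> 2 powr p * norm (v x) powr p" for n
      by (simp add: powr_mult)
  qed (use LpD(2)[OF v] in auto)
  then show "(\<lambda>n. \<integral>x. norm (trunc (real (Suc n)) (v x) - v x) powr p \<partial>M) \<longlonglongrightarrow> 0" by simp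
  have "(\<lambda>n. \<integral>x. norm (trunc_deriv (real (Suc n)) (v x) *\<^sub>R G x - G x) powr p \<partial>M) \<longlonglongrightarrow> (\<integral>x. 0 \<partial>M)"
  proof (rule integral_dominated_convergence[where w = "\<lambda>x. 2 powr p * norm (G x) powr p"])
    show "AE x in M. (\<lambda>n. norm (trunc_deriv (real (Suc n)) (v x) *\<^sub>R G x - G x) powr p) \<longlonglongrightarrow> 0"
    proof (intro AE_I2)
      fix x
      have "(\<lambda>n. norm (trunc_deriv (real (Suc n)) (v x) *\<^sub>R G x - G x) powr p) \<longlonglongrightarrow> norm (1 *\<^sub>R G x - G x) powr p"
        using p by (intro tendsto_powr2 tendsto_intros trunc_tendsto) auto
      then show "(\<lambda>n. norm (trunc_deriv (real (Suc n)) (v x) *\<^sub>R G x - G x) powr p) \<longlonglongrightarrow> 0" using p by simp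
    qed
    have "norm (trunc_deriv (real (Suc n)) (v x) *\<^sub>R G x - G x) powr p \<le> (2 * norm (G x)) powr p" for n x
    proof (rule powr_mono2)
      have "norm (trunc_deriv (real (Suc n)) (v x) *\<^sub>R G x - G x) = \<bar>trunc_deriv (real (Suc n)) (v x) - 1\<bar> * norm (G x)"
        by (metis norm_scaleR scaleR_left_diff_distrib scaleR_one)
      also have "\<dots> \<le> 2 * norm (G x)"
        using abs_trunc_deriv_le[of "real (Suc n)" "v x"] by (intro mult_right_mono) (linarith, simp)
      finally show "norm (trunc_deriv (real (Suc n)) (v x) *\<^sub>R G x - G x) \<le> 2 * norm (G x)" .
    qed (use p in auto)
    then show "AE x in M. norm (norm (trunc_deriv (real (Suc n)) (v x) *\<^sub>R G x - G x) powr p) \<le> 2 powr p * norm (G x) powr p" for n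
      by (simp add: powr_mult)
  qed (use LpD(2)[OF G] in auto)
  then show "(\<lambda>n. \<integral>x. norm (trunc_deriv (real (Suc n)) (v x) *\<^sub>R G x - G x) powr p \<partial>M) \<longlonglongrightarrow> 0" by simp
qed

section \<open>The energy density\<close>

text \<open>The level set is closed, so a closest point to 0 exists. Two closest points could only
  be opposite to each other; by monotonicity 0 would then lie in the level set and be
  closer.\<close>

lemma beta_r_props:
  fixes \<beta> :: "real \<Rightarrow> real"
  assumes c: "continuous_on UNIV \<beta>" and m: "mono \<beta>"
  shows "\<beta> (beta_r \<beta> (\<beta> r)) = \<beta> r"
proof -
  have "closed {t. \<beta> t = \<beta> r}"
    using c by (simp add: closed_Collect_eq continuous_on_const)
  then obtain t where t: "\<beta> t = \<beta> r" "\<And>t'. \<beta> t' = \<beta> r \<Longrightarrow> \<bar>t\<bar> \<le> \<bar>t'\<bar>"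
    using distance_attains_inf[of "{t. \<beta> t = \<beta> r}" 0] by auto
  have "\<exists>!t. \<beta> t = \<beta> r \<and> (\<forall>t'. \<beta> t' = \<beta> r \<longrightarrow> \<bar>t\<bar> \<le> \<bar>t'\<bar>)"
  proof (intro ex_ex1I)
    fix t t' assume a: "\<beta> t = \<beta> r \<and> (\<forall>u. \<beta> u = \<beta> r \<longrightarrow> \<bar>t\<bar> \<le> \<bar>u\<bar>)"
      and b: "\<beta> t' = \<beta> r \<and> (\<forall>u. \<beta> u = \<beta> r \<longrightarrow> \<bar>t'\<bar> \<le> \<bar>u\<bar>)"
    show "t = t'"
    proof (rule ccontr)
      assume ne: "t \<noteq> t'"
      have abs: "\<bar>t\<bar> = \<bar>t'\<bar>" using a b by (meson order_antisym)
      then have "min t t' \<le> 0" "0 \<le> max t t'" using ne by linarith+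
      then have "\<beta> (min t t') \<le> \<beta> 0" "\<beta> 0 \<le> \<beta> (max t t')" using m by (auto simp: mono_def)
      then have "\<beta> 0 = \<beta> r" using a b by (auto simp: min_def max_def split: if_splits)
      then have "\<bar>t\<bar> \<le> \<bar>0\<bar>" using a by blast
      then show False using ne abs by auto
    qed
  qed (use t in blast)
  from theI'[OF this] show ?thesis unfolding beta_r_def by blast
qed

text \<open>\<open>Bfun\<close> is a primitive of the nondecreasing function \<open>h\<close>. The
  point \<open>s\<close> need not be \<open>beta_r \<beta> (\<beta> s)\<close> when \<beta> is flat,
  but a level strictly above \<open>\<beta> s\<close> is attained only at points beyond
  \<open>s\<close>, and a level strictly below only before \<open>s\<close>. So the integrand
  compares with \<open>\<zeta> s\<close> on the whole open interval between \<open>\<beta> s\<close>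
  and \<open>\<beta> r\<close>.\<close>

lemma Bfun_subgradient:
  fixes \<zeta> \<beta> :: "real \<Rightarrow> real"
  assumes c: "continuous_on UNIV \<beta>" and m: "mono \<beta>" and \<beta>0: "\<beta> 0 = 0" and mz: "mono \<zeta>"
  shows "\<zeta> s * (\<beta> r - \<beta> s) \<le> Bfun \<zeta> \<beta> (\<beta> r) - Bfun \<zeta> \<beta> (\<beta> s)"
proof -
  define h where "h \<sigma> = \<zeta> (beta_r \<beta> \<sigma>)" for \<sigma>
  have rc: "{a..b} \<subseteq> range \<beta>" if "a \<in> range \<beta>" "b \<in> range \<beta>" for a b
    using connected_contains_Icc[OF connected_continuous_image[OF c connected_UNIV]] that by blast
  have lt: "\<zeta> s \<le> h \<sigma>" if "\<sigma> \<in> range \<beta>" "\<beta> s < \<sigma>" for s \<sigma>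
  proof -
    have "\<beta> s < \<beta> (beta_r \<beta> \<sigma>)" using that beta_r_props[OF c m] by auto
    then have "s \<le> beta_r \<beta> \<sigma>" using monoD[OF m, of "beta_r \<beta> \<sigma>" s] by linarith
    then show ?thesis using mz by (auto simp: h_def mono_def)
  qed
  have gt: "h \<sigma> \<le> \<zeta> s" if "\<sigma> \<in> range \<beta>" "\<sigma> < \<beta> s" for s \<sigma>
  proof -
    have "\<beta> (beta_r \<beta> \<sigma>) < \<beta> s" using that beta_r_props[OF c m] by auto
    then have "beta_r \<beta> \<sigma> \<le> s" using monoD[OF m, of s "beta_r \<beta> \<sigma>"] by linarith
    then show ?thesis using mz by (auto simp: h_def mono_def)
  qed
  \<comment> \<open>Monotonicity yields measurability and bounds, hence integrability of
    \<open>h\<close> between any two values of \<beta>, although \<open>beta_r\<close> may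
    jump.\<close>
  have hm: "mono_on (range \<beta>) h"
  proof (rule mono_onI)
    fix x y assume xy: "x \<in> range \<beta>" "y \<in> range \<beta>" "x \<le> y"
    show "h x \<le> h y"
    proof (cases "x = y")
      case False
      then show ?thesis using lt[of y "beta_r \<beta> x"] xy beta_r_props[OF c m] by (auto simp: h_def)
    qed simp
  qed
  have int: "set_integrable lborel {a..b} h" if "a \<in> range \<beta>" "b \<in> range \<beta>" for a b
  proof (cases "a \<le> b")
    case True
    have mo: "mono_on {a..b} h" using hm rc[OF that] by (auto intro: mono_on_subset)
    have bd: "\<bar>h x\<bar> \<le> \<bar>h a\<bar> + \<bar>h b\<bar>" if "x \<in> {a..b}" for x
      using mono_onD[OF mo, of a x] mono_onD[OF mo, of x b] that True by auto
    have me: "h \<in> borel_measurable (restrict_space borel {a..b})"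
      by (rule borel_measurable_mono_on_fnc[OF mo])
    have "set_borel_measurable borel {a..b} h"
      unfolding set_borel_measurable_def
      using me by (subst (asm) borel_measurable_restrict_space_iff) (auto simp: mult.commute)
    then show ?thesis
      unfolding set_integrable_def set_borel_measurable_def
      by (intro integrableI_bounded_set[where A = "{a..b}" and B = "\<bar>h a\<bar> + \<bar>h b\<bar>"])
         (use bd True in \<open>auto simp: indicator_def intro!: AE_I2\<close>)
  qed (simp add: set_integrable_def)
  have int2: "set_integrable lborel {a<..<b} h" if "a \<in> range \<beta>" "b \<in> range \<beta>" for a b
    using int[OF that] by (rule set_integrable_subset) auto
  have ii: "interval_lebesgue_integrable lborel (ereal a) (ereal b) h" if "a \<in> range \<beta>" "b \<in> range \<beta>" for a b
    using int2[OF that] int2[OF that(2,1)] by (auto simp: interval_lebesgue_integrable_def)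
  have r0: "0 \<in> range \<beta>" using \<beta>0 by (metis rangeI)
  have "(LBINT \<sigma>=ereal 0..ereal (\<beta> s). h \<sigma>) + (LBINT \<sigma>=ereal (\<beta> s)..ereal (\<beta> r). h \<sigma>)
      = (LBINT \<sigma>=ereal 0..ereal (\<beta> r). h \<sigma>)"
  proof (rule interval_integral_sum)
    show "interval_lebesgue_integrable lborel (min (ereal 0) (min (ereal (\<beta> s)) (ereal (\<beta> r))))
        (max (ereal 0) (max (ereal (\<beta> s)) (ereal (\<beta> r)))) h"
      using ii[of "min 0 (min (\<beta> s) (\<beta> r))" "max 0 (max (\<beta> s) (\<beta> r))"] r0
      by (auto simp: min_def max_def split: if_splits)
  qed
  then have eq: "Bfun \<zeta> \<beta> (\<beta> r) - Bfun \<zeta> \<beta> (\<beta> s) = (LBINT \<sigma>=ereal (\<beta> s)..ereal (\<beta> r). h \<sigma>)"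
    unfolding Bfun_def h_def[symmetric] by (simp add: zero_ereal_def)
  have const: "(LBINT x:{a<..<b}. k) = k * (b - a)" if "a \<le> b" for a b k :: real
    using that by (simp add: set_lebesgue_integral_def)
  have ci: "set_integrable lborel {a<..<b} (\<lambda>_. k)" for a b k :: real
  proof -
    have "emeasure lborel {a<..<b} < \<infinity>" by (cases "a \<le> b") auto
    then show ?thesis
      unfolding set_integrable_def by (intro integrable_scaleR_left impI integrable_real_indicator) auto
  qed
  show ?thesis
  proof (cases "\<beta> s \<le> \<beta> r")
    case True
    have "(LBINT x:{\<beta> s<..<\<beta> r}. \<zeta> s) \<le> (LBINT x:{\<beta> s<..<\<beta> r}. h x)"
      using rc[of "\<beta> s" "\<beta> r"] by (intro set_integral_mono ci int2 lt) (auto intro: less_imp_le)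
    then show ?thesis
      unfolding eq using True by (simp add: interval_lebesgue_integral_def const)
  next
    case False
    have "(LBINT x:{\<beta> r<..<\<beta> s}. h x) \<le> (LBINT x:{\<beta> r<..<\<beta> s}. \<zeta> s)"
      using rc[of "\<beta> r" "\<beta> s"] by (intro set_integral_mono ci int2 gt) (auto intro: less_imp_le)
    then show ?thesis
      unfolding eq using False by (simp add: interval_lebesgue_integral_def const algebra_simps)
  qed
qed

lemma Bfun_nonneg:
  assumes c: "continuous_on UNIV \<beta>" and m: "mono \<beta>" and \<beta>0: "\<beta> 0 = 0" and mz: "mono \<zeta>" and z0: "\<zeta> 0 = 0"
  shows "Bfun \<zeta> \<beta> 0 = 0" "0 \<le> Bfun \<zeta> \<beta> (\<beta> r)"
proof -
  show 0: "Bfun \<zeta> \<beta> 0 = 0" by (simp add: Bfun_def zero_ereal_def)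
  show "0 \<le> Bfun \<zeta> \<beta> (\<beta> r)"
    using Bfun_subgradient[OF c m \<beta>0 mz, of 0 r] z0 \<beta>0 0 by simp
qed

text \<open>Exchanging the two arguments of the subgradient inequality bounds the increment from
  above as well, and both bounds vanish as \<open>r\<close> tends to \<open>s\<close>.\<close>

lemma Bfun_continuous:
  assumes c: "continuous_on UNIV \<beta>" and m: "mono \<beta>" and \<beta>0: "\<beta> 0 = 0" and mz: "mono \<zeta>"
    and cz: "continuous_on UNIV \<zeta>"
  shows "continuous_on UNIV (\<lambda>r. Bfun \<zeta> \<beta> (\<beta> r))"
  unfolding continuous_on_def
proof
  fix s
  have cb: "(\<beta> \<longlongrightarrow> \<beta> s) (at s)" and cz': "(\<zeta> \<longlongrightarrow> \<zeta> s) (at s)"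
    using c cz by (auto simp: continuous_on_def)
  have "((\<lambda>r. Bfun \<zeta> \<beta> (\<beta> r) - Bfun \<zeta> \<beta> (\<beta> s)) \<longlongrightarrow> 0) (at s)"
  proof (rule tendsto_sandwich)
    show "\<forall>\<^sub>F r in at s. \<zeta> s * (\<beta> r - \<beta> s) \<le> Bfun \<zeta> \<beta> (\<beta> r) - Bfun \<zeta> \<beta> (\<beta> s)"
      using Bfun_subgradient[OF c m \<beta>0 mz] by auto
    show "\<forall>\<^sub>F r in at s. Bfun \<zeta> \<beta> (\<beta> r) - Bfun \<zeta> \<beta> (\<beta> s) \<le> \<zeta> r * (\<beta> r - \<beta> s)"
    proof (rule always_eventually, rule allI)
      fix r show "Bfun \<zeta> \<beta> (\<beta> r) - Bfun \<zeta> \<beta> (\<beta> s) \<le> \<zeta> r * (\<beta> r - \<beta> s)"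
        using Bfun_subgradient[OF c m \<beta>0 mz, of r s] by (simp add: algebra_simps)
    qed
    show "((\<lambda>r. \<zeta> s * (\<beta> r - \<beta> s)) \<longlongrightarrow> 0) (at s)"
      using tendsto_mult[OF tendsto_const tendsto_diff[OF cb tendsto_const], of "\<zeta> s" "\<beta> s"] by simp
    show "((\<lambda>r. \<zeta> r * (\<beta> r - \<beta> s)) \<longlongrightarrow> 0) (at s)"
      using tendsto_mult[OF cz' tendsto_diff[OF cb tendsto_const], of "\<beta> s"] by simp
  qed
  then show "((\<lambda>r. Bfun \<zeta> \<beta> (\<beta> r)) \<longlongrightarrow> Bfun \<zeta> \<beta> (\<beta> s)) (at s within UNIV)"
    by (simp add: LIM_zero_iff)
qed

text \<open>The inequality is applied at a point \<open>s\<close> with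
  \<open>\<beta> s = \<beta> r / 2\<close>, where it gives the lower bound
  \<open>\<zeta> s * \<beta> r / 2\<close>. Since \<zeta> grows linearly and
  \<open>\<bar>\<beta> s\<bar> \<le> L * \<bar>s\<bar>\<close>, this is quadratic in
  \<open>\<beta> r\<close>.\<close>

lemma Bfun_coercive:
  assumes c: "continuous_on UNIV \<beta>" and m: "mono \<beta>" and \<beta>0: "\<beta> 0 = 0" and mz: "mono \<zeta>" and z0: "\<zeta> 0 = 0"
    and L: "L > 0" "L-lipschitz_on UNIV \<beta>"
    and M: "M0 > 0" "\<And>s. \<bar>\<zeta> s\<bar> \<ge> M0 * \<bar>s\<bar> - M1"
  obtains k C where "k > 0" "C \<ge> 0" "\<And>r. k * (\<beta> r)\<^sup>2 \<le> Bfun \<zeta> \<beta> (\<beta> r) + C"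
proof -
  have main: "(M0 / (2 * L) * \<bar>\<beta> r\<bar> - M1) * (\<bar>\<beta> r\<bar> / 2) \<le> Bfun \<zeta> \<beta> (\<beta> r)" for r
  proof -
    have "{0..\<beta> r} \<union> {\<beta> r..0} \<subseteq> range \<beta>"
      using connected_contains_Icc[OF connected_continuous_image[OF c connected_UNIV]] \<beta>0
      by (metis Un_least rangeI)
    moreover have "\<beta> r / 2 \<in> {0..\<beta> r} \<union> {\<beta> r..0}" by auto
    ultimately have "\<beta> r / 2 \<in> range \<beta>" by blast
    then obtain s where s: "\<beta> s = \<beta> r / 2" by (metis rangeE)
    have sg: "\<zeta> s * \<beta> r = \<bar>\<zeta> s\<bar> * \<bar>\<beta> r\<bar>"
    proof (cases "0 \<le> s")
      case True
      then have "0 \<le> \<zeta> s" "0 \<le> \<beta> s" using monoD[OF m, of 0 s] monoD[OF mz, of 0 s] \<beta>0 z0 by auto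
      then show ?thesis using s by simp
    next
      case False
      then have "\<zeta> s \<le> 0" "\<beta> s \<le> 0" using monoD[OF m, of s 0] monoD[OF mz, of s 0] \<beta>0 z0 by auto
      then show ?thesis using s by (simp add: abs_of_nonpos)
    qed
    have "\<bar>\<beta> s\<bar> \<le> L * \<bar>s\<bar>"
      using lipschitz_onD[OF L(2), of s 0] \<beta>0 by (simp add: dist_real_def)
    then have "\<bar>\<beta> r\<bar> / (2 * L) \<le> \<bar>s\<bar>" using s L by (simp add: field_simps abs_divide)
    then have "M0 * (\<bar>\<beta> r\<bar> / (2 * L)) - M1 \<le> \<bar>\<zeta> s\<bar>"
      using mult_left_mono[of "\<bar>\<beta> r\<bar> / (2 * L)" "\<bar>s\<bar>" M0] M(1) M(2)[of s] by linarith
    then have "(M0 / (2 * L) * \<bar>\<beta> r\<bar> - M1) * (\<bar>\<beta> r\<bar> / 2) \<le> \<bar>\<zeta> s\<bar> * (\<bar>\<beta> r\<bar> / 2)"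
      by (intro mult_right_mono) auto
    also have "\<dots> = \<zeta> s * (\<beta> r - \<beta> s)" unfolding s using sg by simp
    also have "\<dots> \<le> Bfun \<zeta> \<beta> (\<beta> r) - Bfun \<zeta> \<beta> (\<beta> s)"
      by (rule Bfun_subgradient[OF c m \<beta>0 mz])
    also have "\<dots> \<le> Bfun \<zeta> \<beta> (\<beta> r)" using Bfun_nonneg[OF c m \<beta>0 mz z0] by simp
    finally show ?thesis .
  qed
  \<comment> \<open>The quadratic coefficient in \<open>main\<close> is
    \<open>M0 / (4 * L) = 2 * k\<close>. One half is kept; the other absorbs the linear term by
    completing the square, which produces the constant \<open>M1\<^sup>2 / (16 * k)\<close>.\<close>
  define k where "k = M0 / (8 * L)"
  have k: "k > 0" using M L by (simp add: k_def)
  have "k * (\<beta> r)\<^sup>2 \<le> Bfun \<zeta> \<beta> (\<beta> r) + M1\<^sup>2 / (16 * k)" for r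
  proof -
    define b where "b = \<bar>\<beta> r\<bar>"
    have b2: "(\<beta> r)\<^sup>2 = b * b" by (simp add: b_def power2_eq_square)
    have "2 * k * (b * b) - M1 * b / 2 \<le> Bfun \<zeta> \<beta> (\<beta> r)"
      using main[of r] L by (simp add: k_def b_def[symmetric] field_simps)
    moreover have "M1 * b / 2 \<le> k * (b * b) + M1\<^sup>2 / (16 * k)"
    proof -
      have "0 \<le> (4 * k * b - M1)\<^sup>2 / (16 * k)" using k by simp
      also have "\<dots> = k * (b * b) + M1\<^sup>2 / (16 * k) - M1 * b / 2"
        using k by (simp add: power2_eq_square field_simps)
      finally show ?thesis by simp
    qed
    ultimately show ?thesis by (simp add: b2)
  qed
  then show thesis using that[OF k, of "M1\<^sup>2 / (16 * k)"] k by simp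
qed

section \<open>Strong convergence of gradients\<close>

text \<open>Almost everywhere convergence is available only along subsequences, whereas convergence
  of the whole sequence is wanted.\<close>

lemma tendsto_via_subseq:
  fixes x :: "nat \<Rightarrow> 'b::metric_space"
  assumes "\<And>r :: nat \<Rightarrow> nat. strict_mono r \<Longrightarrow> \<exists>s :: nat \<Rightarrow> nat. strict_mono s \<and> (\<lambda>n. x (r (s n))) \<longlonglongrightarrow> l"
  shows "x \<longlonglongrightarrow> l"
proof (rule ccontr)
  assume "\<not> x \<longlonglongrightarrow> l"
  then obtain e where e: "e > 0" "\<exists>\<^sub>F n in sequentially. e \<le> dist (x n) l"
    unfolding tendsto_iff by (auto simp: frequently_def not_le)
  then have inf: "infinite {n. e \<le> dist (x n) l}"
    by (simp add: frequently_cofinite flip: cofinite_eq_sequentially)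
  then obtain r :: "nat \<Rightarrow> nat" where r: "strict_mono r" "\<And>n. r n \<in> {n. e \<le> dist (x n) l}"
    using infinite_enumerate by blast
  obtain s :: "nat \<Rightarrow> nat" where "strict_mono s" "(\<lambda>n. x (r (s n))) \<longlonglongrightarrow> l" using assms[OF r(1)] by blast
  then have "\<forall>\<^sub>F n in sequentially. dist (x (r (s n))) l < e" using e(1) by (simp add: tendsto_iff)
  then show False using r(2) by (auto simp: eventually_sequentially not_less[symmetric])
qed

text \<open>Since (p - 1) q = p for the conjugate exponent q, the growth condition sends L^p fields
  to L^q fields.\<close>

lemma growth_conj_powr:
  assumes p: "p > 1" and a: "norm a \<le> \<alpha> + \<mu> * norm \<xi> powr (p - 1)" and \<mu>: "\<mu> > 0"
  shows "norm a powr conj_exp p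
    \<le> 2 powr conj_exp p * (\<bar>\<alpha>\<bar> powr conj_exp p + \<mu> powr conj_exp p * norm \<xi> powr p)"
proof -
  let ?q = "conj_exp p"
  note q = conj_exp_props[OF p]
  have "norm a \<le> norm (\<bar>\<alpha>\<bar> + \<mu> * norm \<xi> powr (p - 1))"
    using a \<mu> by simp
  then have "norm a powr ?q \<le> norm (\<bar>\<alpha>\<bar> + \<mu> * norm \<xi> powr (p - 1)) powr ?q"
    using q by (intro powr_mono2) auto
  also have "\<dots> \<le> 2 powr ?q * (norm \<bar>\<alpha>\<bar> powr ?q + norm (\<mu> * norm \<xi> powr (p - 1)) powr ?q)"
    using q by (intro norm_add_powr_le) auto
  also have "norm (\<mu> * norm \<xi> powr (p - 1)) powr ?q = \<mu> powr ?q * norm \<xi> powr p"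
    using \<mu> q by (simp add: powr_mult powr_powr)
  finally show ?thesis by simp
qed

text \<open>Expanding the monotonicity defect leaves the coercive term
  \<open>a \<bullet> \<xi>\<close> and three cross terms. Young's inequality charges al / 4 of
  \<open>norm \<xi> powr p\<close> to each of \<open>a \<bullet> \<eta>\<close> and
  \<open>b \<bullet> \<xi>\<close>, so half of the coercive term survives. The bound serves both for
  pointwise boundedness of the gradients and for their domination.\<close>

lemma coercive_monotone_bound:
  assumes p: "p > 1" and al: "al > 0" and \<mu>: "\<mu> > 0"
  obtains K where "K > 0"
    "\<And>\<alpha> \<xi> \<eta> a b. al * norm \<xi> powr p \<le> a \<bullet> \<xi> \<Longrightarrow> norm a \<le> \<alpha> + \<mu> * norm \<xi> powr (p - 1) \<Longrightarrow>
      norm b \<le> \<alpha> + \<mu> * norm \<eta> powr (p - 1) \<Longrightarrow>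
      0 \<le> (a - b) \<bullet> (\<xi> - \<eta>) \<Longrightarrow>
      norm (\<xi>::'c::euclidean_space) powr p \<le> K * ((a - b) \<bullet> (\<xi> - \<eta>) + \<bar>\<alpha>\<bar> powr conj_exp p + norm \<eta> powr p)"
proof -
  let ?q = "conj_exp p"
  note q = conj_exp_props[OF p]
  have qp: "1 / ?q + 1 / p = 1" using q by simp
  define c where "c = 2 powr ?q"
  define d where "d = \<mu> powr ?q"
  have cd: "c > 0" "d > 0" using \<mu> by (auto simp: c_def d_def)
  \<comment> \<open>\<open>norm a powr ?q\<close> contains \<open>norm \<xi> powr p\<close> with the
    factor \<open>c * d\<close>; this weight turns that factor into al / 4.\<close>
  define e1 where "e1 = al / (4 * c * d)"
  have e1: "e1 > 0" "e1 * (c * d) = al / 4" using al cd by (auto simp: e1_def)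
  obtain C1 where C1: "C1 > 0" "\<And>x y::'c. \<bar>x \<bullet> y\<bar> \<le> e1 * norm x powr ?q + C1 * norm y powr p"
    by (rule inner_le_Young_eps[OF q(1) p qp e1(1), where 'b='c]) blast
  obtain C2 where C2: "C2 > 0" "\<And>x y::'c. \<bar>x \<bullet> y\<bar> \<le> al / 4 * norm x powr p + C2 * norm y powr ?q"
    by (rule inner_le_Young_eps[OF p q(1) q(2), of "al / 4", where 'b='c]) (use al in auto)
  obtain C3 where C3: "C3 > 0" "\<And>x y::'c. \<bar>x \<bullet> y\<bar> \<le> 1 * norm x powr p + C3 * norm y powr ?q"
    by (rule inner_le_Young_eps[OF p q(1) q(2), of 1, where 'b='c]) auto
  define K0 where "K0 = 1 + e1 * c + C1 + 1 + (C2 + C3) * c * (1 + d)"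
  have K0: "K0 \<ge> 1" using e1 C1(1) C2(1) C3(1) cd by (simp add: K0_def)
  have "norm \<xi> powr p \<le> 2 / al * K0 * ((a - b) \<bullet> (\<xi> - \<eta>) + \<bar>\<alpha>\<bar> powr ?q + norm \<eta> powr p)"
    if h: "al * norm \<xi> powr p \<le> a \<bullet> \<xi>" "norm a \<le> \<alpha> + \<mu> * norm \<xi> powr (p - 1)"
      "norm b \<le> \<alpha> + \<mu> * norm \<eta> powr (p - 1)" "0 \<le> (a - b) \<bullet> (\<xi> - \<eta>)"
    for \<alpha> and \<xi> \<eta> a b :: 'c
  proof -
    define X where "X = norm \<xi> powr p"
    define Y where "Y = norm \<eta> powr p"
    define Z where "Z = \<bar>\<alpha>\<bar> powr ?q"
    define D where "D = (a - b) \<bullet> (\<xi> - \<eta>)"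
    have nn: "X \<ge> 0" "Y \<ge> 0" "Z \<ge> 0" by (auto simp: X_def Y_def Z_def)
    have a: "norm a powr ?q \<le> c * (Z + d * X)"
      using growth_conj_powr[OF p h(2) \<mu>] by (simp add: c_def d_def X_def Z_def)
    have b: "norm b powr ?q \<le> c * (Z + d * Y)"
      using growth_conj_powr[OF p h(3) \<mu>] by (simp add: c_def d_def Y_def Z_def)
    have "a \<bullet> \<xi> = D + a \<bullet> \<eta> + b \<bullet> \<xi> - b \<bullet> \<eta>"
      by (simp add: D_def inner_diff_left inner_diff_right)
    moreover have "a \<bullet> \<eta> \<le> e1 * (c * (Z + d * X)) + C1 * Y"
      using order_trans[OF abs_ge_self C1(2)[of a \<eta>]] mult_left_mono[OF a less_imp_le[OF e1(1)]] unfolding Y_def by linarith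
    moreover have "b \<bullet> \<xi> \<le> al / 4 * X + C2 * (c * (Z + d * Y))"
      using order_trans[OF abs_ge_self C2(2)[of \<xi> b]] mult_left_mono[OF b less_imp_le[OF C2(1)]]
      unfolding X_def inner_commute[of b] by linarith
    moreover have "- (b \<bullet> \<eta>) \<le> Y + C3 * (c * (Z + d * Y))"
      using order_trans[OF abs_ge_minus_self C3(2)[of \<eta> b]] mult_left_mono[OF b less_imp_le[OF C3(1)]]
      unfolding Y_def inner_commute[of b] by linarith
    moreover have "e1 * (c * (Z + d * X)) = e1 * c * Z + al / 4 * X"
      using e1(2) by (simp add: algebra_simps)
    ultimately have "al * X \<le> D + e1 * c * Z + al / 2 * X + C1 * Y + Y + (C2 * (c * (Z + d * Y)) + C3 * (c * (Z + d * Y)))"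
      using h(1)[folded X_def] by linarith
    then have 1: "al / 2 * X \<le> D + (e1 * c + (C2 + C3) * c) * Z + (C1 + 1 + (C2 + C3) * c * d) * Y"
      by (simp add: algebra_simps)
    have cZ: "(e1 * c + (C2 + C3) * c) * Z \<le> (K0 - 1) * Z"
      using nn C1(1) C2(1) C3(1) cd by (intro mult_right_mono) (auto simp: K0_def algebra_simps)
    have cY: "(C1 + 1 + (C2 + C3) * c * d) * Y \<le> (K0 - 1) * Y"
      using nn e1 C2(1) C3(1) cd by (intro mult_right_mono) (auto simp: K0_def algebra_simps)
    have "al / 2 * X \<le> K0 * (D + Z + Y)"
    proof -
      have "D \<le> K0 * D" using h(4) K0 by (simp add: D_def mult_le_cancel_right1)
      then show ?thesis using 1 cZ cY nn by (simp add: algebra_simps)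
    qed
    then have "2 / al * (al / 2 * X) \<le> 2 / al * (K0 * (D + Z + Y))"
      using al by (intro mult_left_mono) auto
    then show ?thesis using al by (simp add: X_def Y_def Z_def D_def)
  qed
  then show thesis using that[of "2 / al * K0"] al K0 by simp
qed

text \<open>Along a subsequence converging to some \<open>l\<close>, continuity sends the defect to
  \<open>(A s0 l - A s0 \<eta>) \<bullet> (l - \<eta>)\<close>, which is therefore 0; strict
  monotonicity leaves only \<open>l = \<eta>\<close>.\<close>

lemma monotone_pointwise_convergence:
  fixes \<xi> :: "nat \<Rightarrow> 'c::euclidean_space" and s :: "nat \<Rightarrow> real"
  assumes c: "continuous_on UNIV (\<lambda>(s, \<xi>). A s \<xi>)"
    and strict: "\<And>s \<xi> \<eta>. \<xi> \<noteq> \<eta> \<Longrightarrow> (A s \<xi> - A s \<eta>) \<bullet> (\<xi> - \<eta>) > 0"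
    and s: "s \<longlonglongrightarrow> s0" and b: "bounded (range \<xi>)"
    and D: "(\<lambda>n. (A (s n) (\<xi> n) - A (s n) \<eta>) \<bullet> (\<xi> n - \<eta>)) \<longlonglongrightarrow> 0"
  shows "\<xi> \<longlonglongrightarrow> \<eta>"
proof (rule tendsto_via_subseq)
  fix r :: "nat \<Rightarrow> nat" assume r: "strict_mono r"
  have "bounded (range (\<xi> \<circ> r))" using b by (rule bounded_subset) auto
  then obtain l s' where s': "strict_mono s'" "((\<xi> \<circ> r) \<circ> s') \<longlonglongrightarrow> l"
    using bounded_imp_convergent_subsequence by blast
  have rs: "strict_mono (r \<circ> s')" using r s'(1) by (rule strict_mono_o)
  have ss: "(\<lambda>n. s (r (s' n))) \<longlonglongrightarrow> s0" using LIMSEQ_subseq_LIMSEQ[OF s rs] by (simp add: o_def)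
  have l: "(\<lambda>n. \<xi> (r (s' n))) \<longlonglongrightarrow> l" using s'(2) by (simp add: o_def)
  have 1: "(\<lambda>n. A (s (r (s' n))) (\<xi> (r (s' n)))) \<longlonglongrightarrow> A s0 l"
    using continuous_on_tendsto_compose[OF c tendsto_Pair[OF ss l]] by simp
  have 2: "(\<lambda>n. A (s (r (s' n))) \<eta>) \<longlonglongrightarrow> A s0 \<eta>"
    using continuous_on_tendsto_compose[OF c tendsto_Pair[OF ss tendsto_const]] by simp
  have "(\<lambda>n. (A (s (r (s' n))) (\<xi> (r (s' n))) - A (s (r (s' n))) \<eta>) \<bullet> (\<xi> (r (s' n)) - \<eta>)) \<longlonglongrightarrow> (A s0 l - A s0 \<eta>) \<bullet> (l - \<eta>)"
    by (intro tendsto_intros 1 2 l)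
  moreover have "(\<lambda>n. (A (s (r (s' n))) (\<xi> (r (s' n))) - A (s (r (s' n))) \<eta>) \<bullet> (\<xi> (r (s' n)) - \<eta>)) \<longlonglongrightarrow> 0"
    using LIMSEQ_subseq_LIMSEQ[OF D rs] by (simp add: o_def)
  ultimately have "(A s0 l - A s0 \<eta>) \<bullet> (l - \<eta>) = 0" by (rule LIMSEQ_unique)
  then have "l = \<eta>" using strict[of l \<eta> s0] by force
  then show "\<exists>s'. strict_mono s' \<and> (\<lambda>n. \<xi> (r (s' n))) \<longlonglongrightarrow> \<eta>" using s'(1) l by blast
qed

lemma integral_inner_small:
  fixes F G :: "nat \<Rightarrow> 'b \<Rightarrow> 'c::euclidean_space"
  assumes pq: "p > 1" "q > 1" "1 / p + 1 / q = 1" and F: "\<And>n. F n \<in> Lp M p" and G: "\<And>n. G n \<in> Lp M q"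
    and B: "\<And>n. (\<integral>x. norm (F n x) powr p \<partial>M) \<le> B"
    and lim: "(\<lambda>n. \<integral>x. norm (G n x) powr q \<partial>M) \<longlonglongrightarrow> 0"
  shows "(\<lambda>n. \<integral>x. F n x \<bullet> G n x \<partial>M) \<longlonglongrightarrow> 0"
proof -
  have B0: "B \<ge> 0" using order_trans[OF integral_nonneg_AE B[of 0]] by auto
  have "(\<lambda>n. \<integral>x. \<bar>F n x \<bullet> G n x\<bar> \<partial>M) \<longlonglongrightarrow> 0"
  proof (rule tendsto_0_eventually_leI)
    fix e :: real assume e: "e > 0"
    \<comment> \<open>Weight that keeps the contribution of the bounded factor below e / 2 for all n
      at once.\<close>
    define d where "d = e / (2 * (B + 1))"
    have d: "d > 0" "d * B \<le> e / 2" using e B0 by (auto simp: d_def field_simps)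
    obtain C where C: "C > 0" "\<And>x y::'c. \<bar>x \<bullet> y\<bar> \<le> d * norm x powr p + C * norm y powr q"
      by (rule inner_le_Young_eps[OF pq d(1), where 'b='c]) blast
    have "\<forall>\<^sub>F n in sequentially. (\<integral>x. norm (G n x) powr q \<partial>M) < e / (2 * C)"
      using order_tendstoD(2)[OF lim, of "e / (2 * C)"] e C(1) by simp
    then show "\<forall>\<^sub>F n in sequentially. (\<integral>x. \<bar>F n x \<bullet> G n x\<bar> \<partial>M) \<le> e"
    proof eventually_elim
      case (elim n)
      have "(\<integral>x. \<bar>F n x \<bullet> G n x\<bar> \<partial>M) \<le> (\<integral>x. d * norm (F n x) powr p + C * norm (G n x) powr q \<partial>M)"
        using LpD(2)[OF F] LpD(2)[OF G] C(2) integrable_inner_Lp[OF pq F G] by (intro integral_mono) auto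
      also have "\<dots> = d * (\<integral>x. norm (F n x) powr p \<partial>M) + C * (\<integral>x. norm (G n x) powr q \<partial>M)"
        using LpD(2)[OF F] LpD(2)[OF G] by simp
      also have "\<dots> \<le> d * B + C * (e / (2 * C))"
        using B[of n] d C(1) elim by (intro add_mono mult_left_mono) auto
      also have "\<dots> \<le> e" using d C(1) by simp
      finally show ?case .
    qed
  qed auto
  then show ?thesis
    by (rule Lim_null_comparison[rotated]) (auto intro!: always_eventually order_trans[OF integral_abs_bound])
qed

text \<open>The integral of the defect \<open>D\<close> tends to 0: \<open>limsup\<close> bounds one
  part, and the other pairs a weakly convergent sequence with a strongly convergent one. Strict
  monotonicity then gives a.e. convergence of a subsequence, which coercivity upgrades to
  L^p.\<close>

lemma Leray_Lions_strong_convergence: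
  fixes A :: "'b \<Rightarrow> real \<Rightarrow> 'c::euclidean_space \<Rightarrow> 'c"
  assumes p: "p > 1"
    and cont: "AE y in M. continuous_on UNIV (\<lambda>(s, \<xi>). A y s \<xi>)"
    and al: "al > 0" and coer: "AE y in M. \<forall>s \<xi>. A y s \<xi> \<bullet> \<xi> \<ge> al * norm \<xi> powr p"
    and strict: "AE y in M. \<forall>s \<xi> \<eta>. \<xi> \<noteq> \<eta> \<longrightarrow> (A y s \<xi> - A y s \<eta>) \<bullet> (\<xi> - \<eta>) > 0"
    and ab: "ab \<in> Lp M (conj_exp p)" and \<mu>: "\<mu> > 0"
    and growth: "AE y in M. \<forall>s \<xi>. norm (A y s \<xi>) \<le> ab y + \<mu> * norm \<xi> powr (p - 1)"
    and meas: "\<And>s \<xi>. s \<in> borel_measurable M \<Longrightarrow> \<xi> \<in> borel_measurable M \<Longrightarrow> (\<lambda>y. A y (s y) (\<xi> y)) \<in> borel_measurable M"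
    and n: "\<And>m::nat. \<nu> m \<in> Lp M 1" "\<nu>0 \<in> Lp M 1" "(\<lambda>m. \<integral>y. norm (\<nu> m y - \<nu>0 y) powr 1 \<partial>M) \<longlonglongrightarrow> 0"
    and weak: "Lp_weak M p Gm G"
    and bnd: "\<And>m. (\<integral>y. norm (Gm m y) powr p \<partial>M) \<le> B"
    and limsup: "\<And>e. e > 0 \<Longrightarrow> \<forall>\<^sub>F m in sequentially. (\<integral>y. A y (\<nu> m y) (Gm m y) \<bullet> (Gm m y - G y) \<partial>M) \<le> e"
  shows "(\<lambda>m. \<integral>y. norm (Gm m y - G y) powr p \<partial>M) \<longlonglongrightarrow> 0"
proof (rule tendsto_via_subseq)
  let ?q = "conj_exp p"
  note q = conj_exp_props[OF p]
  have p0: "p \<ge> 0" "p > 0" and q0: "?q \<ge> 0" "?q > 0" using p q by auto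
  have qp: "1 / ?q + 1 / p = 1" using q by simp
  have Gm: "Gm m \<in> Lp M p" and G: "G \<in> Lp M p" for m using weak by (auto simp: Lp_weak_def)
  have wk: "g \<in> Lp M ?q \<Longrightarrow> (\<lambda>m. \<integral>x. Gm m x \<bullet> g x \<partial>M) \<longlonglongrightarrow> (\<integral>x. G x \<bullet> g x \<partial>M)" for g
    using weak by (auto simp: Lp_weak_def)
  note [measurable] = LpD(1)[OF Gm] LpD(1)[OF G] LpD(1)[OF n(1)] LpD(1)[OF n(2)] LpD(1)[OF ab]
  have Aq: "(\<lambda>y. A y (s y) (\<xi> y)) \<in> Lp M ?q" if "s \<in> borel_measurable M" "\<xi> \<in> Lp M p" for s \<xi>
  proof (rule Lp_bound)
    show "(\<lambda>y. A y (s y) (\<xi> y)) \<in> borel_measurable M" using meas that LpD by blast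
    show "integrable M (\<lambda>y. 2 powr ?q * (\<bar>ab y\<bar> powr ?q + \<mu> powr ?q * norm (\<xi> y) powr p))"
      using LpD(2)[OF ab] LpD(2)[OF that(2)] by auto
    show "AE y in M. norm (A y (s y) (\<xi> y)) powr ?q \<le> 2 powr ?q * (\<bar>ab y\<bar> powr ?q + \<mu> powr ?q * norm (\<xi> y) powr p)"
      using growth by eventually_elim (use growth_conj_powr[OF p _ \<mu>] in blast)
  qed
  have diffB: "(\<integral>y. norm (Gm m y - G y) powr p \<partial>M) \<le> 2 powr p * (B + (\<integral>y. norm (G y) powr p \<partial>M))" for m
  proof -
    have "(\<integral>y. norm (Gm m y - G y) powr p \<partial>M) \<le> (\<integral>y. 2 powr p * (norm (Gm m y) powr p + norm (G y) powr p) \<partial>M)"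
      using LpD(2)[OF Gm] LpD(2)[OF G] LpD(2)[OF Lp_diff[OF p0(1) Gm G]] norm_diff_powr_le[OF p0(1)]
      by (intro integral_mono) auto
    also have "\<dots> = 2 powr p * ((\<integral>y. norm (Gm m y) powr p \<partial>M) + (\<integral>y. norm (G y) powr p \<partial>M))"
      using LpD(2)[OF Gm] LpD(2)[OF G] by simp
    also have "\<dots> \<le> 2 powr p * (B + (\<integral>y. norm (G y) powr p \<partial>M))"
      using bnd by (intro mult_left_mono add_mono) auto
    finally show ?thesis .
  qed
  fix r :: "nat \<Rightarrow> nat" assume r: "strict_mono r"
  have "\<exists>r1::nat\<Rightarrow>nat. strict_mono r1 \<and> (AE y in M. (\<lambda>i. \<nu> (r (r1 i)) y - \<nu>0 y) \<longlonglongrightarrow> 0)"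
  proof (rule tendsto_L1_AE_subseq)
    show "integrable M (\<lambda>y. \<nu> (r i) y - \<nu>0 y)" for i
    proof -
      have "integrable M f" if "f \<in> Lp M 1" for f :: "_ \<Rightarrow> real"
        using LpD[OF that] by (subst integrable_norm_iff[symmetric]) auto
      then show ?thesis using n by auto
    qed
    show "(\<lambda>i. \<integral>y. norm (\<nu> (r i) y - \<nu>0 y) \<partial>M) \<longlonglongrightarrow> 0"
      using LIMSEQ_subseq_LIMSEQ[OF n(3) r] by (simp add: o_def)
  qed
  then obtain r1 :: "nat \<Rightarrow> nat" where r1: "strict_mono r1" "AE y in M. (\<lambda>i. \<nu> (r (r1 i)) y - \<nu>0 y) \<longlonglongrightarrow> 0" by blast
  define \<sigma> where "\<sigma> = r \<circ> r1"
  have \<sigma>: "strict_mono \<sigma>" unfolding \<sigma>_def using r r1(1) by (rule strict_mono_o)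
  have ae\<nu>: "AE y in M. (\<lambda>i. \<nu> (\<sigma> i) y) \<longlonglongrightarrow> \<nu>0 y"
    using r1(2) by eventually_elim (simp add: LIM_zero_iff \<sigma>_def)
  let ?A0 = "\<lambda>y. A y (\<nu>0 y) (G y)"
  let ?AG = "\<lambda>i y. A y (\<nu> (\<sigma> i) y) (G y)"
  let ?AA = "\<lambda>i y. A y (\<nu> (\<sigma> i) y) (Gm (\<sigma> i) y)"
  have A0: "?A0 \<in> Lp M ?q" and AG: "?AG i \<in> Lp M ?q" and AA: "?AA i \<in> Lp M ?q" for i
    using Aq G Gm by auto
  note [measurable] = LpD(1)[OF A0] LpD(1)[OF AG] LpD(1)[OF AA]
  \<comment> \<open>Weak convergence pairs with fixed fields only, so \<open>?AG i\<close> is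
    compared with \<open>?A0\<close>. The error tends to 0 in L^q by dominated convergence, because
    \<open>\<nu>\<close> converges a.e. along \<sigma>.\<close>
  define W where "W i y = ?AG i y - ?A0 y" for i y
  have W: "W i \<in> Lp M ?q" for i unfolding W_def by (rule Lp_diff[OF q0(1) AG A0])
  have "(\<lambda>i. \<integral>y. norm (W i y) powr ?q \<partial>M) \<longlonglongrightarrow> (\<integral>y. 0 \<partial>M)"
  proof (rule integral_dominated_convergence[where w = "\<lambda>y. 2 powr ?q * (2 * (2 powr ?q * (\<bar>ab y\<bar> powr ?q + \<mu> powr ?q * norm (G y) powr p)))"])
    show "AE y in M. (\<lambda>i. norm (W i y) powr ?q) \<longlonglongrightarrow> 0"
      using ae\<nu> cont
    proof eventually_elim
      case (elim y)
      have "(\<lambda>i. ?AG i y) \<longlonglongrightarrow> ?A0 y"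
        using continuous_on_tendsto_compose[OF elim(2) tendsto_Pair[OF elim(1) tendsto_const[of "G y"]]] by simp
      then have "(\<lambda>i. norm (W i y) powr ?q) \<longlonglongrightarrow> norm (?A0 y - ?A0 y) powr ?q"
        unfolding W_def using q0 by (intro tendsto_powr2 tendsto_intros) auto
      then show ?case using q0 by simp
    qed
    show "AE y in M. norm (norm (W i y) powr ?q) \<le> 2 powr ?q * (2 * (2 powr ?q * (\<bar>ab y\<bar> powr ?q + \<mu> powr ?q * norm (G y) powr p)))" for i
      using growth
    proof eventually_elim
      case (elim y)
      let ?R = "2 powr ?q * (\<bar>ab y\<bar> powr ?q + \<mu> powr ?q * norm (G y) powr p)"
      have "norm (?AG i y) powr ?q \<le> ?R" "norm (?A0 y) powr ?q \<le> ?R"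
        using growth_conj_powr[OF p _ \<mu>] elim by blast+
      then have R: "norm (?AG i y) powr ?q + norm (?A0 y) powr ?q \<le> 2 * ?R" by simp
      have "norm (?AG i y - ?A0 y) powr ?q \<le> 2 powr ?q * (2 * ?R)"
        by (rule order_trans[OF norm_diff_powr_le[OF q0(1)] mult_left_mono[OF R]]) simp
      then show ?case unfolding W_def by simp
    qed
    show "integrable M (\<lambda>y. 2 powr ?q * (2 * (2 powr ?q * (\<bar>ab y\<bar> powr ?q + \<mu> powr ?q * norm (G y) powr p))))"
      using LpD(2)[OF ab] LpD(2)[OF G] by auto
  qed (use LpD(1)[OF W] in auto)
  then have limW: "(\<lambda>i. \<integral>y. norm (W i y) powr ?q \<partial>M) \<longlonglongrightarrow> 0" by simp
  have dG: "(\<lambda>y. Gm m y - G y) \<in> Lp M p" for m by (rule Lp_diff[OF p0(1) Gm G])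
  have 1: "(\<lambda>i. \<integral>y. (Gm (\<sigma> i) y - G y) \<bullet> W i y \<partial>M) \<longlonglongrightarrow> 0"
    by (rule integral_inner_small[OF p q(1) q(2) dG W diffB limW])
  have 2: "(\<lambda>i. \<integral>y. (Gm (\<sigma> i) y - G y) \<bullet> ?A0 y \<partial>M) \<longlonglongrightarrow> 0"
  proof -
    have "(\<lambda>i. (\<integral>y. Gm (\<sigma> i) y \<bullet> ?A0 y \<partial>M) - (\<integral>y. G y \<bullet> ?A0 y \<partial>M)) \<longlonglongrightarrow> 0"
      using LIM_zero[OF LIMSEQ_subseq_LIMSEQ[OF wk[OF A0] \<sigma>]] by (simp add: o_def)
    moreover have "(\<integral>y. (Gm (\<sigma> i) y - G y) \<bullet> ?A0 y \<partial>M) = (\<integral>y. Gm (\<sigma> i) y \<bullet> ?A0 y \<partial>M) - (\<integral>y. G y \<bullet> ?A0 y \<partial>M)" for i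
      using integrable_inner_Lp[OF p q(1,2) Gm A0] integrable_inner_Lp[OF p q(1,2) G A0]
      by (simp add: inner_diff_left)
    ultimately show ?thesis by simp
  qed
  have 3: "(\<lambda>i. \<integral>y. ?AG i y \<bullet> (Gm (\<sigma> i) y - G y) \<partial>M) \<longlonglongrightarrow> 0"
  proof -
    have "(\<integral>y. ?AG i y \<bullet> (Gm (\<sigma> i) y - G y) \<partial>M) = (\<integral>y. (Gm (\<sigma> i) y - G y) \<bullet> W i y \<partial>M) + (\<integral>y. (Gm (\<sigma> i) y - G y) \<bullet> ?A0 y \<partial>M)" for i
      using integrable_inner_Lp[OF p q(1,2) dG W] integrable_inner_Lp[OF p q(1,2) dG A0]
      by (subst Bochner_Integration.integral_add[symmetric]) (auto simp: W_def inner_diff_right inner_commute)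
    then show ?thesis using tendsto_add[OF 1 2] by simp
  qed
  define D where "D i y = (?AA i y - ?AG i y) \<bullet> (Gm (\<sigma> i) y - G y)" for i y
  have Dnn: "AE y in M. 0 \<le> D i y" for i
    using strict
  proof eventually_elim
    case (elim y)
    then show ?case by (cases "Gm (\<sigma> i) y = G y") (auto simp: D_def less_imp_le)
  qed
  have iAA: "integrable M (\<lambda>y. ?AA i y \<bullet> (Gm (\<sigma> i) y - G y))" for i
    by (rule integrable_inner_Lp[OF q(1) p qp AA dG])
  have iAG: "integrable M (\<lambda>y. ?AG i y \<bullet> (Gm (\<sigma> i) y - G y))" for i
    by (rule integrable_inner_Lp[OF q(1) p qp AG dG])
  have iD: "integrable M (D i)" for i
    unfolding D_def using iAA iAG by (simp add: inner_diff_left)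
  have eqD: "(\<integral>y. D i y \<partial>M) = (\<integral>y. ?AA i y \<bullet> (Gm (\<sigma> i) y - G y) \<partial>M) - (\<integral>y. ?AG i y \<bullet> (Gm (\<sigma> i) y - G y) \<partial>M)" for i
    unfolding D_def inner_diff_left[of "?AA i _" "?AG i _"] using iAA iAG by simp
  \<comment> \<open>As \<open>D\<close> is nonnegative a.e., an upper bound for its integral already
    gives convergence in L^1.\<close>
  have limD: "(\<lambda>i. \<integral>y. norm (D i y) \<partial>M) \<longlonglongrightarrow> 0"
  proof (rule tendsto_0_eventually_leI)
    fix e :: real assume e: "e > 0"
    have "\<forall>\<^sub>F i in sequentially. - (e / 2) < (\<integral>y. ?AG i y \<bullet> (Gm (\<sigma> i) y - G y) \<partial>M)"
      using order_tendstoD(1)[OF 3, of "- (e / 2)"] e by simp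
    moreover have "\<forall>\<^sub>F i in sequentially. (\<integral>y. ?AA i y \<bullet> (Gm (\<sigma> i) y - G y) \<partial>M) \<le> e / 2"
      using eventually_subseq[OF \<sigma> limsup[of "e / 2"]] e by simp
    ultimately show "\<forall>\<^sub>F i in sequentially. (\<integral>y. norm (D i y) \<partial>M) \<le> e"
    proof eventually_elim
      case (elim i)
      have "(\<integral>y. norm (D i y) \<partial>M) = (\<integral>y. D i y \<partial>M)"
        using Dnn[of i] borel_measurable_integrable[OF iD] by (intro integral_cong_AE) auto
      then show ?case using elim eqD[of i] by simp
    qed
  qed auto
  obtain r2 :: "nat \<Rightarrow> nat" where r2: "strict_mono r2" "AE y in M. (\<lambda>i. D (r2 i) y) \<longlonglongrightarrow> 0"
    using tendsto_L1_AE_subseq[OF iD limD] by blast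
  obtain K where K: "K > 0"
    "\<And>\<alpha> \<xi> \<eta> a b. al * norm \<xi> powr p \<le> a \<bullet> \<xi> \<Longrightarrow> norm a \<le> \<alpha> + \<mu> * norm \<xi> powr (p - 1) \<Longrightarrow>
      norm b \<le> \<alpha> + \<mu> * norm \<eta> powr (p - 1) \<Longrightarrow> 0 \<le> (a - b) \<bullet> (\<xi> - \<eta>) \<Longrightarrow>
      norm (\<xi>::'c) powr p \<le> K * ((a - b) \<bullet> (\<xi> - \<eta>) + \<bar>\<alpha>\<bar> powr conj_exp p + norm \<eta> powr p)"
    by (rule coercive_monotone_bound[OF p al \<mu>, where 'c='c]) blast
  have Kb: "AE y in M. \<forall>i. norm (Gm (\<sigma> i) y) powr p \<le> K * (D i y + \<bar>ab y\<bar> powr ?q + norm (G y) powr p)"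
  proof -
    have "AE y in M. \<forall>i. 0 \<le> D i y" using Dnn by (simp add: AE_all_countable)
    then show ?thesis using coer growth
      by eventually_elim (auto simp: D_def intro!: K(2))
  qed
  have aeG: "AE y in M. (\<lambda>i. Gm (\<sigma> (r2 i)) y) \<longlonglongrightarrow> G y"
    using Kb r2(2) ae\<nu> cont strict
  proof eventually_elim
    case (elim y)
    obtain d where d: "\<And>i. \<bar>D (r2 i) y\<bar> \<le> d"
      using convergent_imp_bounded[OF elim(2)] by (auto simp: bounded_iff)
    define R where "R = K * (d + \<bar>ab y\<bar> powr ?q + norm (G y) powr p)"
    have "norm (Gm (\<sigma> (r2 i)) y) \<le> R powr (1 / p)" for i
    proof -
      have "norm (Gm (\<sigma> (r2 i)) y) powr p \<le> K * (D (r2 i) y + \<bar>ab y\<bar> powr ?q + norm (G y) powr p)"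
        using elim(1) by blast
      also have "\<dots> \<le> R" unfolding R_def using K(1) d[of i] by (intro mult_left_mono) auto
      finally have "(norm (Gm (\<sigma> (r2 i)) y) powr p) powr (1 / p) \<le> R powr (1 / p)"
        using p0 by (intro powr_mono2) auto
      then show ?thesis using p0 by (simp add: powr_powr)
    qed
    then have bdd: "bounded (range (\<lambda>i. Gm (\<sigma> (r2 i)) y))" unfolding bounded_iff by blast
    show ?case
    proof (rule monotone_pointwise_convergence[OF elim(4) _ _ bdd])
      show "(\<lambda>i. \<nu> (\<sigma> (r2 i)) y) \<longlonglongrightarrow> \<nu>0 y"
        using LIMSEQ_subseq_LIMSEQ[OF elim(3) r2(1)] by (simp add: o_def)
      show "(\<lambda>i. (A y (\<nu> (\<sigma> (r2 i)) y) (Gm (\<sigma> (r2 i)) y) - A y (\<nu> (\<sigma> (r2 i)) y) (G y)) \<bullet> (Gm (\<sigma> (r2 i)) y - G y)) \<longlonglongrightarrow> 0"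
        using elim(2) by (simp add: D_def)
    qed (use elim(5) in auto)
  qed
  \<comment> \<open>The bound \<open>H + c * D\<close> is not a fixed dominating function, but
    \<open>D\<close> tends to 0 in L^1. The part below \<open>H\<close> is treated by dominated
    convergence through \<open>min\<close>, and the excess is at most \<open>c * D\<close>.\<close>
  define H where "H y = 2 powr p * (K * (\<bar>ab y\<bar> powr ?q + norm (G y) powr p) + norm (G y) powr p)" for y
  define c where "c = 2 powr p * K"
  have Hint: "integrable M H" unfolding H_def using LpD(2)[OF ab] LpD(2)[OF G] by auto
  have Hnn: "H y \<ge> 0" for y using K(1) by (simp add: H_def)
  let ?X = "\<lambda>i y. norm (Gm (\<sigma> (r2 i)) y - G y) powr p"
  have le: "AE y in M. ?X i y \<le> min (?X i y) (H y) + c * D (r2 i) y" for i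
    using Kb Dnn[of "r2 i"]
  proof eventually_elim
    case (elim y)
    have "?X i y \<le> 2 powr p * (norm (Gm (\<sigma> (r2 i)) y) powr p + norm (G y) powr p)"
      by (rule norm_diff_powr_le[OF p0(1)])
    also have "\<dots> \<le> 2 powr p * (K * (D (r2 i) y + \<bar>ab y\<bar> powr ?q + norm (G y) powr p) + norm (G y) powr p)"
      using elim(1) by (intro mult_left_mono add_mono) auto
    also have "\<dots> = H y + c * D (r2 i) y" by (simp add: H_def c_def algebra_simps)
    finally have "?X i y \<le> H y + c * D (r2 i) y" .
    moreover have "c * D (r2 i) y \<ge> 0" using elim(2) K(1) by (simp add: c_def)
    ultimately show ?case by (auto simp: min_def)
  qed
  have iX: "integrable M (?X i)" for i by (rule LpD(2)[OF dG])
  have imin: "integrable M (\<lambda>y. min (?X i y) (H y))" for i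
    by (rule Bochner_Integration.integrable_bound[OF iX[of i]])
       (use Hint Hnn borel_measurable_integrable[OF Hint] in auto)
  have "(\<lambda>i. \<integral>y. min (?X i y) (H y) \<partial>M) \<longlonglongrightarrow> (\<integral>y. 0 \<partial>M)"
  proof (rule integral_dominated_convergence[OF _ _ Hint])
    show "AE y in M. (\<lambda>i. min (?X i y) (H y)) \<longlonglongrightarrow> 0"
      using aeG
    proof eventually_elim
      case (elim y)
      have "(\<lambda>i. ?X i y) \<longlonglongrightarrow> norm (G y - G y) powr p"
        using p0 elim by (intro tendsto_powr2 tendsto_intros) auto
      then have "(\<lambda>i. min (?X i y) (H y)) \<longlonglongrightarrow> min 0 (H y)"
        using p0 by (intro tendsto_min tendsto_const) auto
      then show ?case using Hnn[of y] by (simp add: min_def)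
    qed
    show "AE y in M. norm (min (?X i y) (H y)) \<le> H y" for i
      using Hnn by (intro AE_I2) (auto simp: min_def)
  qed (use borel_measurable_integrable[OF Hint] in auto)
  then have l1: "(\<lambda>i. \<integral>y. min (?X i y) (H y) \<partial>M) \<longlonglongrightarrow> 0" by simp
  have l2: "(\<lambda>i. \<integral>y. norm (D (r2 i) y) \<partial>M) \<longlonglongrightarrow> 0"
    using LIMSEQ_subseq_LIMSEQ[OF limD r2(1)] by (simp add: o_def)
  have "(\<lambda>i. \<integral>y. ?X i y \<partial>M) \<longlonglongrightarrow> 0"
  proof (rule tendsto_sandwich[OF _ _ tendsto_const])
    show "(\<lambda>i. (\<integral>y. min (?X i y) (H y) \<partial>M) + c * (\<integral>y. norm (D (r2 i) y) \<partial>M)) \<longlonglongrightarrow> 0"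
      using tendsto_add[OF l1 tendsto_mult[OF tendsto_const l2, of c]] by simp
    show "\<forall>\<^sub>F i in sequentially. (\<integral>y. ?X i y \<partial>M) \<le> (\<integral>y. min (?X i y) (H y) \<partial>M) + c * (\<integral>y. norm (D (r2 i) y) \<partial>M)"
    proof (intro always_eventually allI)
      fix i
      have "(\<integral>y. ?X i y \<partial>M) \<le> (\<integral>y. min (?X i y) (H y) + c * norm (D (r2 i) y) \<partial>M)"
      proof (rule integral_mono_AE[OF iX])
        show "integrable M (\<lambda>y. min (?X i y) (H y) + c * norm (D (r2 i) y))"
          using imin iD by auto
        show "AE y in M. ?X i y \<le> min (?X i y) (H y) + c * norm (D (r2 i) y)"
          using le[of i] Dnn[of "r2 i"] by eventually_elim auto
      qed
      also have "\<dots> = (\<integral>y. min (?X i y) (H y) \<partial>M) + c * (\<integral>y. norm (D (r2 i) y) \<partial>M)"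
        using imin iD by (simp del: real_norm_def)
      finally show "(\<integral>y. ?X i y \<partial>M) \<le> (\<integral>y. min (?X i y) (H y) \<partial>M) + c * (\<integral>y. norm (D (r2 i) y) \<partial>M)" .
    qed
  qed auto
  then show "\<exists>s. strict_mono s \<and> (\<lambda>n. \<integral>y. norm (Gm (r (s n)) y - G y) powr p \<partial>M) \<longlonglongrightarrow> 0"
    using strict_mono_o[OF r1(1) r2(1)] by (intro exI[of _ "r1 \<circ> r2"]) (simp add: \<sigma>_def)
qed

section \<open>Space-time gradient discretisations\<close>

lemma has_bochner_integral_slab:
  fixes F :: "'a::euclidean_space \<Rightarrow> 'c::euclidean_space"
  assumes F: "integrable (lebesgue_on \<Omega>) F" and \<Omega>: "open \<Omega>" and ab: "0 \<le> a" "a \<le> b" "b \<le> T"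
  shows "has_bochner_integral (lebesgue_on (\<Omega> \<times> {0<..<T})) (\<lambda>y. indicator {a<..b} (snd y) *\<^sub>R F (fst y))
    ((b - a) *\<^sub>R (\<integral>x. F x \<partial>lebesgue_on \<Omega>))"
proof -
  \<comment> \<open>The cylinder is open in time while the slab contains its right end; the
    intersection loses at most the point \<open>T\<close>.\<close>
  define A where "A = {a<..b} \<inter> {0<..<T}"
  have Q: "\<Omega> \<times> {0<..<T} \<in> sets lebesgue"
    using \<Omega> by (metis borel_open lebesgue_measurable_vimage_borel open_Times open_greaterThanLessThan sets_completionI_sets sets_lborel)
  have ae: "AE t in lborel. t \<in> A \<longleftrightarrow> t \<in> {a<..b}"
  proof -
    have "AE t in lborel. t \<noteq> T" by (rule AE_lborel_singleton)
    then show ?thesis by eventually_elim (use ab in \<open>auto simp: A_def\<close>)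
  qed
  have A: "A \<in> sets borel" "A \<subseteq> {0<..<T}" by (auto simp: A_def)
  have eA: "emeasure lborel A = ennreal (b - a)"
    using ab A(1) by (subst emeasure_eq_AE[OF ae]) auto
  then have mA: "measure lebesgue A = b - a" using ab A by (simp add: measure_def)
  have "has_bochner_integral (lebesgue_on (\<Omega> \<times> {0<..<T})) (\<lambda>y. indicator A (snd y) *\<^sub>R F (fst y))
      ((b - a) *\<^sub>R (\<integral>x. F x \<partial>lebesgue_on \<Omega>))"
    using has_bochner_integral_strip[OF F _ A(1) _ A(2) Q] \<Omega> eA mA by auto
  then show ?thesis
    by (rule has_bochner_integral_cong[THEN iffD1, rotated -1]) (auto simp: A_def indicator_def)
qed

text \<open>Bolzano-Weierstrass one coordinate at a time, refining the subsequence at each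
  step.\<close>

lemma common_convergent_subseq:
  fixes f :: "nat \<Rightarrow> 'i \<Rightarrow> real"
  assumes "finite I" "\<And>n i. i \<in> I \<Longrightarrow> \<bar>f n i\<bar> \<le> C"
  shows "\<exists>r l. strict_mono (r :: nat \<Rightarrow> nat) \<and> (\<forall>i\<in>I. (\<lambda>n. f (r n) i) \<longlonglongrightarrow> l i)"
  using assms
proof (induction I rule: finite_induct)
  case empty
  then show ?case by (intro exI[of _ id]) (auto simp: strict_mono_def)
next
  case (insert j I)
  then obtain r l where r: "strict_mono (r :: nat \<Rightarrow> nat)" "\<forall>i\<in>I. (\<lambda>n. f (r n) i) \<longlonglongrightarrow> l i" by auto
  have "bounded (range (\<lambda>n. f (r n) j))" using insert.prems by (auto simp: bounded_iff)
  then obtain l' s where s: "strict_mono s" "((\<lambda>n. f (r n) j) \<circ> s) \<longlonglongrightarrow> l'"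
    using bounded_imp_convergent_subsequence by blast
  have "(\<lambda>n. f (r (s n)) i) \<longlonglongrightarrow> (l(j := l')) i" if "i \<in> insert j I" for i
  proof (cases "i = j")
    case True then show ?thesis using s(2) by (simp add: o_def)
  next
    case False
    then have "i \<in> I" using that by simp
    then show ?thesis using False LIMSEQ_subseq_LIMSEQ[OF bspec[OF r(2)] s(1), of i] by (simp add: o_def)
  qed
  moreover have "strict_mono (r \<circ> s)" using r(1) s(1) by (rule strict_mono_o)
  ultimately show ?case by (intro exI[of _ "r \<circ> s"] exI[of _ "l(j := l')"]) (auto simp del: fun_upd_apply comp_apply simp: o_def)
qed

locale discretisation =
  fixes p :: real and \<Omega> :: "'a::euclidean_space set" and T :: real and D :: "'a stgd"
  assumes \<Omega>: "open \<Omega>" "bounded \<Omega>" and p: "p > 1" and T: "T > 0" and stgd: "is_stgd p \<Omega> T D"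
begin

abbreviation "L \<equiv> lebesgue_on \<Omega>"
abbreviation "Q \<equiv> lebesgue_on (\<Omega> \<times> {0<..<T})"
abbreviation "N \<equiv> gd_N D"
abbreviation "t \<equiv> gd_t D"

lemma p0: "p \<ge> 0" "p > 0" using p by auto

lemma finite_L: "finite_measure L"
  using \<Omega> by (intro finite_measure_lebesgue_on) (simp add: bounded_set_imp_lmeasurable)

lemma sets_Omega: "\<Omega> \<in> sets lebesgue"
  using \<Omega> by simp

lemma sets_Q: "\<Omega> \<times> {0<..<T} \<in> sets lebesgue"
proof -
  have "open (\<Omega> \<times> {0<..<T})" using \<Omega> by (intro open_Times) auto
  then show ?thesis by simp
qed

lemma space_Q: "y \<in> space Q \<longleftrightarrow> fst y \<in> \<Omega> \<and> 0 < snd y \<and> snd y < T"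
  by (cases y) auto

lemma D_props:
  "finite (gd_I D)" "\<And>i. i \<in> gd_I D \<Longrightarrow> gd_cell D i \<in> sets lebesgue"
  "disjoint_family_on (gd_cell D) (gd_I D)" "(\<Union>i\<in>gd_I D. gd_cell D i) = \<Omega>"
  "\<And>u. u \<in> gd_X D \<Longrightarrow> gd_grad D u \<in> Lp L p"
  "\<And>u v c1 c2. u \<in> gd_X D \<Longrightarrow> v \<in> gd_X D \<Longrightarrow>
     AE x in L. gd_grad D (\<lambda>i. c1 * u i + c2 * v i) x = c1 *\<^sub>R gd_grad D u x + c2 *\<^sub>R gd_grad D v x"
  "\<And>u. u \<in> gd_X D \<Longrightarrow> Lp_norm L p (gd_grad D u) = 0 \<Longrightarrow> u = (\<lambda>i. 0)"
  "\<And>\<phi>. \<phi> \<in> Lp L 2 \<Longrightarrow> gd_interp D \<phi> \<in> gd_X D"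
  "t 0 = 0" "\<And>n. n < N \<Longrightarrow> t n < t (Suc n)" "t N = T"
  using stgd unfolding is_stgd_def by blast+

lemma Pi_measurable [measurable]: "gd_Pi D u \<in> borel_measurable L"
proof -
  have "(\<lambda>x. indicat_real (gd_cell D i) x) \<in> borel_measurable L" if "i \<in> gd_I D" for i
    using D_props(2)[OF that] by (intro measurable_restrict_space1) auto
  then show ?thesis unfolding gd_Pi_def by auto
qed

lemma Pi_cell: "i \<in> gd_I D \<Longrightarrow> x \<in> gd_cell D i \<Longrightarrow> gd_Pi D u x = u i"
proof -
  assume i: "i \<in> gd_I D" "x \<in> gd_cell D i"
  have "indicat_real (gd_cell D j) x = (if j = i then 1 else 0)" if "j \<in> gd_I D" for j
    using i that D_props(3) by (auto simp: disjoint_family_on_def indicator_def)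
  then have "gd_Pi D u x = (\<Sum>j\<in>gd_I D. if j = i then u i else 0)"
    unfolding gd_Pi_def by (intro sum.cong) auto
  then show ?thesis using i D_props(1) by simp
qed

lemma Pi_app:
  assumes "x \<in> \<Omega>"
  shows "gd_Pi D (gd_app D \<eta> u n) x = \<eta> (gd_Pi D (u n) x)"
proof -
  obtain i where "i \<in> gd_I D" "x \<in> gd_cell D i" using assms D_props(4) by auto
  then show ?thesis by (simp add: Pi_cell gd_app_def)
qed

lemma Pi_abs_le: "\<bar>gd_Pi D u x\<bar> \<le> (\<Sum>i\<in>gd_I D. \<bar>u i\<bar>)"
  unfolding gd_Pi_def by (rule order_trans[OF sum_abs sum_mono]) (auto simp: indicator_def)

lemma Pi_lin: "gd_Pi D (\<lambda>i. c1 * u i + c2 * v i) x = c1 * gd_Pi D u x + c2 * gd_Pi D v x"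
  unfolding gd_Pi_def by (simp add: sum_distrib_left sum.distrib algebra_simps)

lemma Pi_zero: "gd_Pi D (\<lambda>i. 0) x = 0"
  unfolding gd_Pi_def by simp

lemma Pi_compose_Lp:
  assumes "q \<ge> 0" "continuous_on UNIV \<eta>"
  shows "(\<lambda>x. \<eta> (gd_Pi D u x)) \<in> Lp L q"
proof -
  interpret finite_measure L by (rule finite_L)
  have "bounded (\<eta> ` cball 0 (\<Sum>i\<in>gd_I D. \<bar>u i\<bar>))"
    using assms(2) by (intro compact_imp_bounded compact_continuous_image) (auto intro: continuous_on_subset)
  then obtain C where "\<forall>y\<in>\<eta> ` cball 0 (\<Sum>i\<in>gd_I D. \<bar>u i\<bar>). norm y \<le> C"
    unfolding bounded_iff by blast
  then have C: "\<bar>z\<bar> \<le> (\<Sum>i\<in>gd_I D. \<bar>u i\<bar>) \<Longrightarrow> norm (\<eta> z) \<le> C" for z by (simp add: dist_real_def)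
  have [measurable]: "\<eta> \<in> borel_measurable borel"
    using assms(2) by (rule borel_measurable_continuous_onI)
  show ?thesis
    by (rule Lp_bound[where h = "\<lambda>x. C powr q"])
       (use assms(1) C Pi_abs_le in \<open>auto intro!: AE_I2 powr_mono2\<close>)
qed

lemma Pi_Lp: "q \<ge> 0 \<Longrightarrow> gd_Pi D u \<in> Lp L q"
  using Pi_compose_Lp[of q "\<lambda>z. z"] by simp

lemma Pi_compose_integrable:
  fixes \<eta> :: "real \<Rightarrow> real"
  assumes "continuous_on UNIV \<eta>"
  shows "integrable L (\<lambda>x. \<eta> (gd_Pi D u x))"
  using LpD[OF Pi_compose_Lp[of 1, OF _ assms, of u]] by (subst integrable_norm_iff[symmetric]) auto

lemma app_X: "gd_app D \<eta> u n \<in> gd_X D"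
  by (simp add: gd_app_def gd_X_def)

lemma zero_X: "(\<lambda>i. 0) \<in> gd_X D"
  by (simp add: gd_X_def)

lemma lin_X: "u \<in> gd_X D \<Longrightarrow> v \<in> gd_X D \<Longrightarrow> (\<lambda>i. c1 * u i + c2 * v i) \<in> gd_X D"
  by (simp add: gd_X_def)

lemma grad_zero: "AE x in L. gd_grad D (\<lambda>i. 0) x = 0"
  using D_props(6)[OF zero_X zero_X, of 0 0] by simp

lemma t_mono: "i \<le> j \<Longrightarrow> j \<le> N \<Longrightarrow> t i \<le> t j"
proof (induction j rule: dec_induct)
  case (step n)
  then show ?case using D_props(10)[of n] by simp
qed simp

lemma t_strict: "i < j \<Longrightarrow> j \<le> N \<Longrightarrow> t i < t j"
  using D_props(10)[of i] t_mono[of "Suc i" j] by auto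

lemma t_range: "n \<le> N \<Longrightarrow> 0 \<le> t n \<and> t n \<le> T"
  using t_mono[of 0 n] t_mono[of n N] D_props(9,11) by auto

lemma N_pos: "0 < N"
  using D_props(9,11) T by (cases "N") auto

lemma step_eq:
  assumes "n < N" "t n < \<tau>" "\<tau> \<le> t (Suc n)"
  shows "gd_step D \<tau> = Suc n"
  unfolding gd_step_def
proof (rule Least_equality)
  fix k assume k: "\<tau> \<le> t k"
  show "Suc n \<le> k"
  proof (rule ccontr)
    assume "\<not> Suc n \<le> k"
    then have "t k \<le> t n" using assms(1) by (intro t_mono) auto
    then show False using k assms by simp
  qed
qed (use assms in auto)

lemma step_at: 
  assumes "n \<le> N"
  shows "gd_step D (t n) = n"
  unfolding gd_step_def
proof (rule Least_equality)
  fix k assume k: "t n \<le> t k"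
  show "n \<le> k" using t_strict[of k n] k assms by (cases "k < n") auto
qed simp

lemma step_props:
  assumes "0 < \<tau>" "\<tau> \<le> T"
  shows "gd_step D \<tau> \<in> {1..N}" "t (gd_step D \<tau> - 1) < \<tau>" "\<tau> \<le> t (gd_step D \<tau>)"
proof -
  have 1: "\<tau> \<le> t (gd_step D \<tau>)"
    unfolding gd_step_def by (rule LeastI[of _ N]) (use assms D_props(11) in auto)
  have 2: "gd_step D \<tau> \<le> N"
    unfolding gd_step_def by (rule Least_le) (use assms D_props(11) in auto)
  have 3: "gd_step D \<tau> \<noteq> 0" using 1 assms D_props(9) by (intro notI) auto
  show "\<tau> \<le> t (gd_step D \<tau>)" by (rule 1)
  show "gd_step D \<tau> \<in> {1..N}" using 2 3 by auto
  show "t (gd_step D \<tau> - 1) < \<tau>"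
    using not_less_Least[of "gd_step D \<tau> - 1" "\<lambda>n. \<tau> \<le> t n"] 3 unfolding gd_step_def by force
qed

lemma step_indicator:
  assumes "0 < \<tau>" "\<tau> \<le> T" "n \<in> {1..N}"
  shows "indicat_real {t (n - 1)<..t n} \<tau> = (if n = gd_step D \<tau> then 1 else 0)"
proof (cases "n = gd_step D \<tau>")
  case True then show ?thesis using step_props[OF assms(1,2)] by simp
next
  case False
  have "\<not> (t (n - 1) < \<tau> \<and> \<tau> \<le> t n)"
  proof
    assume a: "t (n - 1) < \<tau> \<and> \<tau> \<le> t n"
    have "n - 1 < N" "Suc (n - 1) = n" using assms(3) by auto
    then show False using step_eq[of "n - 1" \<tau>] a False by simp
  qed
  then show ?thesis using False by (simp add: indicator_def)
qed

text \<open>Inside the cylinder exactly one slab contains a given time. Measurability and integrals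
  of functions that are piecewise constant in time reduce to this finite sum.\<close>

lemma slab_sum:
  fixes F :: "nat \<Rightarrow> 'c::real_vector"
  assumes "y \<in> space Q"
  shows "(\<Sum>n=1..N. indicat_real {t (n - 1)<..t n} (snd y) *\<^sub>R F n) = F (gd_step D (snd y))"
proof -
  have y: "0 < snd y" "snd y \<le> T" using assms by (auto simp: space_Q)
  have "(\<Sum>n=1..N. indicat_real {t (n - 1)<..t n} (snd y) *\<^sub>R F n) = (\<Sum>n=1..N. if n = gd_step D (snd y) then F n else 0)"
  proof (intro sum.cong refl)
    fix n assume "n \<in> {1..N}"
    from step_indicator[OF y this] show "indicat_real {t (n - 1)<..t n} (snd y) *\<^sub>R F n = (if n = gd_step D (snd y) then F n else 0)"
      by simp
  qed
  also have "\<dots> = F (gd_step D (snd y))" using step_props(1)[OF y] by simp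
  finally show ?thesis .
qed

lemma has_bochner_integral_steps:
  fixes F :: "nat \<Rightarrow> 'a \<Rightarrow> 'c::euclidean_space"
  assumes F: "\<And>n. n \<in> {1..N} \<Longrightarrow> integrable L (F n)"
  shows "has_bochner_integral Q (\<lambda>y. F (gd_step D (snd y)) (fst y))
     (\<Sum>n=1..N. (t n - t (n - 1)) *\<^sub>R (\<integral>x. F n x \<partial>L))"
proof -
  have "has_bochner_integral Q (\<lambda>y. \<Sum>n=1..N. indicator {t (n - 1)<..t n} (snd y) *\<^sub>R F n (fst y))
     (\<Sum>n=1..N. (t n - t (n - 1)) *\<^sub>R (\<integral>x. F n x \<partial>L))"
  proof (intro has_bochner_integral_sum has_bochner_integral_slab F \<Omega>)
    fix n assume n: "n \<in> {1..N}"
    then show "0 \<le> t (n - 1)" "t (n - 1) \<le> t n" "t n \<le> T"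
      using t_range[of "n - 1"] t_range[of n] t_mono[of "n - 1" n] by auto
  qed
  then show ?thesis
  proof (rule has_bochner_integral_cong[THEN iffD1, rotated -1])
    fix y assume "y \<in> space Q"
    then show "(\<Sum>n=1..N. indicator {t (n - 1)<..t n} (snd y) *\<^sub>R F n (fst y)) = F (gd_step D (snd y)) (fst y)"
      by (rule slab_sum)
  qed auto
qed

lemma measurable_steps:
  fixes F :: "nat \<Rightarrow> 'a \<Rightarrow> 'c::euclidean_space"
  assumes F: "\<And>n. n \<in> {1..N} \<Longrightarrow> F n \<in> borel_measurable L"
  shows "(\<lambda>y. F (gd_step D (snd y)) (fst y)) \<in> borel_measurable Q"
proof -
  have "(\<lambda>y. indicat_real {a<..b} (snd y)) \<in> borel_measurable Q" for a b
  proof -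
    have "{y :: 'a \<times> real. a < snd y \<and> snd y \<le> b} \<in> sets lebesgue"
    proof -
      have "{y :: 'a \<times> real. a < snd y \<and> snd y \<le> b} = UNIV \<times> {a<..b}" by auto
      also have "\<dots> \<in> sets borel" by (intro borel_Times) auto
      finally have "{y :: 'a \<times> real. a < snd y \<and> snd y \<le> b} \<in> sets borel" .
      then show ?thesis by (simp only: sets_completionI_sets sets_lborel)
    qed
    then have "indicat_real {y :: 'a \<times> real. a < snd y \<and> snd y \<le> b} \<in> borel_measurable Q"
      by (intro measurable_restrict_space1) auto
    moreover have "indicat_real {y :: 'a \<times> real. a < snd y \<and> snd y \<le> b} = (\<lambda>y. indicat_real {a<..b} (snd y))"
      by (auto simp: indicator_def fun_eq_iff)
    ultimately show ?thesis by simp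
  qed
  then have "(\<lambda>y. \<Sum>n=1..N. indicat_real {t (n - 1)<..t n} (snd y) *\<^sub>R F n (fst y)) \<in> borel_measurable Q"
    using F by (intro borel_measurable_sum borel_measurable_scaleR borel_measurable_lebesgue_on_fst) auto
  then show ?thesis
  proof (rule measurable_cong[THEN iffD1, rotated])
    fix y assume "y \<in> space Q"
    then show "(\<Sum>n=1..N. indicator {t (n - 1)<..t n} (snd y) *\<^sub>R F n (fst y)) = F (gd_step D (snd y)) (fst y)"
      by (rule slab_sum)
  qed
qed

lemma Lp_steps:
  fixes F :: "nat \<Rightarrow> 'a \<Rightarrow> 'c::euclidean_space"
  assumes F: "\<And>n. n \<in> {1..N} \<Longrightarrow> F n \<in> Lp L q"
  shows "(\<lambda>y. F (gd_step D (snd y)) (fst y)) \<in> Lp Q q"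
    "(\<integral>y. norm (F (gd_step D (snd y)) (fst y)) powr q \<partial>Q) = (\<Sum>n=1..N. (t n - t (n - 1)) * (\<integral>x. norm (F n x) powr q \<partial>L))"
proof -
  have h: "has_bochner_integral Q (\<lambda>y. norm (F (gd_step D (snd y)) (fst y)) powr q)
     (\<Sum>n=1..N. (t n - t (n - 1)) *\<^sub>R (\<integral>x. norm (F n x) powr q \<partial>L))"
    using has_bochner_integral_steps[of "\<lambda>n x. norm (F n x) powr q"] LpD(2)[OF F] by simp
  then show "(\<lambda>y. F (gd_step D (snd y)) (fst y)) \<in> Lp Q q"
    unfolding Lp_def using measurable_steps[OF LpD(1)[OF F]] by (auto simp: has_bochner_integral_iff)
  show "(\<integral>y. norm (F (gd_step D (snd y)) (fst y)) powr q \<partial>Q) = (\<Sum>n=1..N. (t n - t (n - 1)) * (\<integral>x. norm (F n x) powr q \<partial>L))"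
    using h by (simp add: has_bochner_integral_iff)
qed

lemma gradST_Lp:
  assumes "\<And>n. n \<in> {1..N} \<Longrightarrow> v n \<in> gd_X D"
  shows "gd_gradST D v \<in> Lp Q p"
  using Lp_steps(1)[of "\<lambda>n. gd_grad D (v n)" p] D_props(5) assms
  by (simp add: gd_gradST_def split_beta')

lemma PiST_Lp: "q \<ge> 0 \<Longrightarrow> gd_PiST D v \<in> Lp Q q"
  using Lp_steps(1)[of "\<lambda>n. gd_Pi D (v n)" q] Pi_Lp by (simp add: gd_PiST_def split_beta')

text \<open>There are finitely many time steps, so their exceptional sets have a null union, and the
  cylinder over it is null in space-time.\<close>

lemma AE_steps:
  assumes "\<And>n. n \<in> {1..N} \<Longrightarrow> AE x in L. P n x"
  shows "AE y in Q. P (gd_step D (snd y)) (fst y)"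
proof -
  have "AE y in Q. \<forall>n\<in>{1..N}. P n (fst y)"
    using assms AE_lebesgue_on_fst[OF _ sets_Omega sets_Q] by (intro AE_finite_allI) auto
  moreover have "AE y in Q. y \<in> space Q" by (rule AE_space)
  ultimately show ?thesis
  proof eventually_elim
    case (elim y)
    then show ?case using step_props(1)[of "snd y"] by (auto simp: space_Q)
  qed
qed

end

section \<open>Coercivity and the discrete energy estimate\<close>

context discretisation
begin

definition unit_vec :: "nat \<Rightarrow> nat \<Rightarrow> real" where
  "unit_vec i = (\<lambda>j. if j = i then 1 else 0)"

lemma unit_vec_X: "i \<in> gd_I D \<Longrightarrow> unit_vec i \<in> gd_X D"
  by (auto simp: unit_vec_def gd_X_def)

text \<open>Linearity of \<open>gd_grad\<close> holds off a null set that depends on the vectors, so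
  the expansion adds one coordinate at a time and collects finitely many null sets.\<close>

lemma grad_expand:
  assumes u: "u \<in> gd_X D"
  shows "AE x in L. gd_grad D u x = (\<Sum>i\<in>gd_I D. u i *\<^sub>R gd_grad D (unit_vec i) x)"
proof -
  have "AE x in L. gd_grad D (\<lambda>j. if j \<in> J then u j else 0) x = (\<Sum>i\<in>J. u i *\<^sub>R gd_grad D (unit_vec i) x)"
    if "finite J" "J \<subseteq> gd_I D" for J
    using that
  proof (induction J rule: finite_induct)
    case empty
    then show ?case using grad_zero by simp
  next
    case (insert k J)
    have X: "(\<lambda>j. if j \<in> J then u j else 0) \<in> gd_X D" using u by (auto simp: gd_X_def)
    have eq: "(\<lambda>j. if j \<in> insert k J then u j else 0) = (\<lambda>j. 1 * (if j \<in> J then u j else 0) + u k * unit_vec k j)"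
      using insert.hyps by (auto simp: unit_vec_def)
    have "AE x in L. gd_grad D (\<lambda>j. if j \<in> J then u j else 0) x = (\<Sum>i\<in>J. u i *\<^sub>R gd_grad D (unit_vec i) x)"
      using insert by auto
    moreover have "k \<in> gd_I D" using insert.prems by auto
    from D_props(6)[OF X unit_vec_X[OF this], of 1 "u k"]
    have "AE x in L. gd_grad D (\<lambda>j. if j \<in> insert k J then u j else 0) x = 1 *\<^sub>R gd_grad D (\<lambda>j. if j \<in> J then u j else 0) x + u k *\<^sub>R gd_grad D (unit_vec k) x"
      unfolding eq .
    ultimately show ?case
      by eventually_elim (use insert.hyps in \<open>simp add: add.commute\<close>)
  qed
  from this[OF D_props(1) order_refl] have "AE x in L. gd_grad D (\<lambda>j. if j \<in> gd_I D then u j else 0) x = (\<Sum>i\<in>gd_I D. u i *\<^sub>R gd_grad D (unit_vec i) x)" .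
  moreover have "(\<lambda>j. if j \<in> gd_I D then u j else 0) = u" using u by (auto simp: gd_X_def)
  ultimately show ?thesis by simp
qed

lemma grad_powr_upper:
  obtains \<Gamma> where "\<Gamma> \<ge> 0" "\<And>u. u \<in> gd_X D \<Longrightarrow> (\<integral>x. norm (gd_grad D u x) powr p \<partial>L) \<le> (\<Sum>i\<in>gd_I D. \<bar>u i\<bar>) powr p * \<Gamma>"
proof -
  let ?g = "\<lambda>x. \<Sum>i\<in>gd_I D. norm (gd_grad D (unit_vec i) x)"
  have g: "?g \<in> Lp L p"
  proof (rule Lp_sum[OF p0(1)])
    fix i assume "i \<in> gd_I D"
    then have "gd_grad D (unit_vec i) \<in> Lp L p" by (intro D_props(5) unit_vec_X)
    then show "(\<lambda>x. norm (gd_grad D (unit_vec i) x)) \<in> Lp L p" by (auto simp: Lp_def)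
  qed
  have "(\<integral>x. norm (gd_grad D u x) powr p \<partial>L) \<le> (\<Sum>i\<in>gd_I D. \<bar>u i\<bar>) powr p * (\<integral>x. norm (?g x) powr p \<partial>L)"
    if u: "u \<in> gd_X D" for u
  proof -
    have "(\<integral>x. norm (gd_grad D u x) powr p \<partial>L) \<le> (\<integral>x. (\<Sum>i\<in>gd_I D. \<bar>u i\<bar>) powr p * norm (?g x) powr p \<partial>L)"
    proof (rule integral_mono_AE)
      show "AE x in L. norm (gd_grad D u x) powr p \<le> (\<Sum>i\<in>gd_I D. \<bar>u i\<bar>) powr p * norm (?g x) powr p"
        using grad_expand[OF u]
      proof eventually_elim
        case (elim x)
        have "norm (gd_grad D u x) \<le> (\<Sum>i\<in>gd_I D. \<bar>u i\<bar> * norm (gd_grad D (unit_vec i) x))"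
          unfolding elim by (rule order_trans[OF norm_sum]) simp
        also have "\<dots> \<le> (\<Sum>i\<in>gd_I D. (\<Sum>i\<in>gd_I D. \<bar>u i\<bar>) * norm (gd_grad D (unit_vec i) x))"
          using D_props(1) by (intro sum_mono mult_right_mono member_le_sum) auto
        also have "\<dots> = (\<Sum>i\<in>gd_I D. \<bar>u i\<bar>) * ?g x" by (simp add: sum_distrib_left)
        finally have "norm (gd_grad D u x) powr p \<le> ((\<Sum>i\<in>gd_I D. \<bar>u i\<bar>) * ?g x) powr p"
          using p0 by (intro powr_mono2) auto
        also have "\<dots> = (\<Sum>i\<in>gd_I D. \<bar>u i\<bar>) powr p * norm (?g x) powr p"
          by (simp add: powr_mult sum_nonneg abs_of_nonneg)
        finally show ?case .
      qed
    qed (use LpD[OF D_props(5)[OF u]] LpD[OF g] in auto)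
    then show ?thesis by simp
  qed
  then show thesis using that[of "\<integral>x. norm (?g x) powr p \<partial>L"] by simp
qed

text \<open>One half of the equivalence of norms in finite dimension, by contradiction: vectors with
  absolute coordinate sum 1 and gradients tending to 0 have a convergent subsequence, whose limit
  keeps the sum 1 but has gradient norm 0.\<close>

lemma grad_powr_lower:
  obtains \<delta> where "\<delta> > 0" "\<And>w. w \<in> gd_X D \<Longrightarrow> (\<Sum>i\<in>gd_I D. \<bar>w i\<bar>) = 1 \<Longrightarrow> \<delta> \<le> (\<integral>x. norm (gd_grad D w x) powr p \<partial>L)"
proof (rule ccontr)
  assume nt: "\<not> thesis"
  let ?N = "\<lambda>w. \<integral>x. norm (gd_grad D w x) powr p \<partial>L"
  have "\<exists>w. w \<in> gd_X D \<and> (\<Sum>i\<in>gd_I D. \<bar>w i\<bar>) = 1 \<and> ?N w < 1 / real (Suc n)" for n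
  proof (rule ccontr)
    assume a: "\<not> ?thesis"
    show False
      by (rule nt[THEN notE], rule that[of "1 / real (Suc n)"]) (use a in \<open>auto simp: not_less\<close>)
  qed
  then obtain w where w: "\<And>n. w n \<in> gd_X D" "\<And>n. (\<Sum>i\<in>gd_I D. \<bar>w n i\<bar>) = 1" "\<And>n. ?N (w n) < 1 / real (Suc n)"
    by metis
  have "\<bar>w n i\<bar> \<le> 1" if "i \<in> gd_I D" for n i
    using member_le_sum[OF that, of "\<lambda>i. \<bar>w n i\<bar>"] w(2)[of n] D_props(1) by auto
  then obtain r l where r: "strict_mono (r :: nat \<Rightarrow> nat)" "\<And>i. i \<in> gd_I D \<Longrightarrow> (\<lambda>n. w (r n) i) \<longlonglongrightarrow> l i"
    using common_convergent_subseq[OF D_props(1), of w 1] by blast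
  define v where "v i = (if i \<in> gd_I D then l i else 0)" for i
  have vX: "v \<in> gd_X D" by (simp add: v_def gd_X_def)
  have "(\<lambda>n. \<Sum>i\<in>gd_I D. \<bar>w (r n) i\<bar>) \<longlonglongrightarrow> (\<Sum>i\<in>gd_I D. \<bar>v i\<bar>)"
    using r(2) by (intro tendsto_sum tendsto_rabs) (auto simp: v_def)
  then have v1: "(\<Sum>i\<in>gd_I D. \<bar>v i\<bar>) = 1" using w(2) by (simp add: LIMSEQ_const_iff)
  obtain \<Gamma> where \<Gamma>: "\<Gamma> \<ge> 0" "\<And>u. u \<in> gd_X D \<Longrightarrow> ?N u \<le> (\<Sum>i\<in>gd_I D. \<bar>u i\<bar>) powr p * \<Gamma>"
    by (rule grad_powr_upper) blast
  have le: "?N v \<le> 2 powr p * (1 / real (Suc n) + (\<Sum>i\<in>gd_I D. \<bar>v i - w (r n) i\<bar>) powr p * \<Gamma>)" for n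
  proof -
    let ?d = "\<lambda>i. 1 * v i + (-1) * w (r n) i"
    have dX: "?d \<in> gd_X D" by (rule lin_X[OF vX w(1)])
    have ae: "AE x in L. gd_grad D v x = gd_grad D (w (r n)) x + gd_grad D ?d x"
      using D_props(6)[OF vX w(1)[of "r n"], of 1 "-1"] by eventually_elim simp
    have "?N v \<le> (\<integral>x. 2 powr p * (norm (gd_grad D (w (r n)) x) powr p + norm (gd_grad D ?d x) powr p) \<partial>L)"
    proof (rule integral_mono_AE)
      show "AE x in L. norm (gd_grad D v x) powr p \<le> 2 powr p * (norm (gd_grad D (w (r n)) x) powr p + norm (gd_grad D ?d x) powr p)"
        using ae by eventually_elim (simp only: norm_add_powr_le[OF p0(1)])
    qed (use LpD[OF D_props(5)[OF vX]] LpD[OF D_props(5)[OF w(1)]] LpD[OF D_props(5)[OF dX]] in auto)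
    also have "\<dots> = 2 powr p * (?N (w (r n)) + ?N ?d)"
      using LpD[OF D_props(5)[OF w(1)]] LpD[OF D_props(5)[OF dX]] by simp
    also have "\<dots> \<le> 2 powr p * (1 / real (Suc n) + (\<Sum>i\<in>gd_I D. \<bar>?d i\<bar>) powr p * \<Gamma>)"
    proof (intro mult_left_mono add_mono \<Gamma>(2) dX)
      have "?N (w (r n)) \<le> 1 / real (Suc (r n))" using w(3)[of "r n"] by simp
      also have "\<dots> \<le> 1 / real (Suc n)"
        using seq_suble[OF r(1), of n] by (intro divide_left_mono) auto
      finally show "?N (w (r n)) \<le> 1 / real (Suc n)" .
    qed auto
    finally show ?thesis by simp
  qed
  have "(\<lambda>n. 2 powr p * (1 / real (Suc n) + (\<Sum>i\<in>gd_I D. \<bar>v i - w (r n) i\<bar>) powr p * \<Gamma>)) \<longlonglongrightarrow> 2 powr p * (0 + (\<Sum>i\<in>gd_I D. \<bar>v i - v i\<bar>) powr p * \<Gamma>)"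
    using r(2) p0 by (intro tendsto_intros tendsto_powr2 LIMSEQ_Suc lim_const_over_n) (auto simp: v_def sum_nonneg)
  then have "(\<lambda>n. 2 powr p * (1 / real (Suc n) + (\<Sum>i\<in>gd_I D. \<bar>v i - w (r n) i\<bar>) powr p * \<Gamma>)) \<longlonglongrightarrow> 0"
    using p0 by simp
  then have "?N v \<le> 0" by (rule LIMSEQ_le_const) (use le in auto)
  moreover have "?N v \<ge> 0" by simp
  ultimately have "?N v = 0" by linarith
  then have "Lp_norm L p (gd_grad D v) = 0" using p0 by (simp add: Lp_norm_def)
  then have "v = (\<lambda>i. 0)" using D_props(7)[OF vX] by simp
  then show False using v1 by simp
qed

lemma Lp_norm_powr:
  "Lp_norm M p F powr p = (\<integral>x. norm (F x) powr p \<partial>M)"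
  using p0 by (simp add: Lp_norm_def powr_powr)

text \<open>
  The real supremum in \<open>gd_CD\<close> is only meaningful for a bounded set; the bound comes from the equivalence of
  norms on \<open>\<real>\<^sup>I\<close>.
\<close>

lemma Pi_powr_le_grad:
  obtains R where "R \<ge> 0" "\<And>v. v \<in> gd_X D \<Longrightarrow>
    (\<integral>x. norm (gd_Pi D v x) powr p \<partial>L) \<le> R * (\<integral>x. norm (gd_grad D v x) powr p \<partial>L)"
proof -
  interpret finite_measure L by (rule finite_L)
  let ?V = "measure L (space L)"
  obtain \<delta> where \<delta>: "\<delta> > 0" "\<And>w. w \<in> gd_X D \<Longrightarrow> (\<Sum>i\<in>gd_I D. \<bar>w i\<bar>) = 1 \<Longrightarrow> \<delta> \<le> (\<integral>x. norm (gd_grad D w x) powr p \<partial>L)"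
    by (rule grad_powr_lower) blast
  have "(\<integral>x. norm (gd_Pi D v x) powr p \<partial>L) \<le> ?V / \<delta> * (\<integral>x. norm (gd_grad D v x) powr p \<partial>L)" if v: "v \<in> gd_X D" for v
  proof -
    define S where "S = (\<Sum>i\<in>gd_I D. \<bar>v i\<bar>)"
    have S0: "S \<ge> 0" by (simp add: S_def sum_nonneg)
    have "(\<integral>x. norm (gd_Pi D v x) powr p \<partial>L) \<le> (\<integral>x. S powr p \<partial>L)"
      using p0 Pi_abs_le[of v] LpD(2)[OF Pi_Lp[OF p0(1)]] by (intro integral_mono powr_mono2) (auto simp: S_def)
    also have "\<dots> = S powr p * ?V" by simp
    also have "\<dots> \<le> ?V / \<delta> * (\<integral>x. norm (gd_grad D v x) powr p \<partial>L)"
    proof (cases "S = 0")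
      case True then show ?thesis using p0 \<delta> by simp
    next
      case False
      then have S: "S > 0" using S0 by simp
      define w where "w i = (1 / S) * v i + 0 * v i" for i
      have wX: "w \<in> gd_X D" unfolding w_def[abs_def] by (rule lin_X[OF v v])
      have "(\<Sum>i\<in>gd_I D. \<bar>w i\<bar>) = S / S"
      proof -
        have "(\<Sum>i\<in>gd_I D. \<bar>w i\<bar>) = (\<Sum>i\<in>gd_I D. \<bar>v i\<bar> / S)" using S by (simp add: w_def abs_mult)
        also have "\<dots> = (\<Sum>i\<in>gd_I D. \<bar>v i\<bar>) / S" by (simp only: sum_divide_distrib)
        finally show ?thesis by (simp only: S_def)
      qed
      then have "\<delta> \<le> (\<integral>x. norm (gd_grad D w x) powr p \<partial>L)" using S by (intro \<delta>(2) wX) simp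
      also have "\<dots> = (\<integral>x. (1 / S) powr p * norm (gd_grad D v x) powr p \<partial>L)"
      proof (rule integral_cong_AE)
        show "AE x in L. norm (gd_grad D w x) powr p = (1 / S) powr p * norm (gd_grad D v x) powr p"
          using D_props(6)[OF v v, of "1 / S" 0] unfolding w_def[abs_def]
          by eventually_elim (use S in \<open>simp add: powr_mult powr_divide\<close>)
      qed (use LpD[OF D_props(5)[OF wX]] LpD[OF D_props(5)[OF v]] in auto)
      also have "\<dots> = (1 / S) powr p * (\<integral>x. norm (gd_grad D v x) powr p \<partial>L)" by simp
      finally have "\<delta> * S powr p \<le> (\<integral>x. norm (gd_grad D v x) powr p \<partial>L)"
        using S by (simp add: powr_divide field_simps)
      then have "S powr p \<le> (\<integral>x. norm (gd_grad D v x) powr p \<partial>L) / \<delta>"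
        using \<delta>(1) by (simp add: field_simps)
      then have "S powr p * ?V \<le> (\<integral>x. norm (gd_grad D v x) powr p \<partial>L) / \<delta> * ?V"
        by (intro mult_right_mono) auto
      then show ?thesis by (simp add: mult.commute)
    qed
    finally show ?thesis .
  qed
  then show thesis using that[of "?V / \<delta>"] \<delta>(1) by simp
qed

text \<open>The constant is clipped at 0 because powers of it are taken, and a bound on
  \<open>gd_CD\<close> carries no sign when the discrete space has no nonzero vector. The zero
  vector is excluded from the quotients and is treated apart.\<close>

lemma coercive_bound:
  assumes C: "gd_CD p \<Omega> D \<le> C" and v: "v \<in> gd_X D"
  shows "(\<integral>x. norm (gd_Pi D v x) powr p \<partial>L) \<le> max C 0 powr p * (\<integral>x. norm (gd_grad D v x) powr p \<partial>L)"
proof (cases "v = (\<lambda>i. 0)")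
  case True
  then show ?thesis by (simp add: Pi_zero)
next
  case False
  let ?S = "{Lp_norm L p (gd_Pi D v) / Lp_norm L p (gd_grad D v) | v. v \<in> gd_X D \<and> v \<noteq> (\<lambda>i. 0)}"
  obtain R where R: "R \<ge> 0" "\<And>v. v \<in> gd_X D \<Longrightarrow>
    (\<integral>x. norm (gd_Pi D v x) powr p \<partial>L) \<le> R * (\<integral>x. norm (gd_grad D v x) powr p \<partial>L)"
    by (rule Pi_powr_le_grad) blast
  have nn: "Lp_norm L p F \<ge> 0" for F :: "'a \<Rightarrow> 'd::euclidean_space" by (simp add: Lp_norm_def)
  have "bdd_above ?S"
  proof (rule bdd_aboveI)
    fix q assume "q \<in> ?S"
    then obtain v where v: "v \<in> gd_X D" "q = Lp_norm L p (gd_Pi D v) / Lp_norm L p (gd_grad D v)" by blast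
    have "Lp_norm L p (gd_Pi D v) \<le> (R * (\<integral>x. norm (gd_grad D v x) powr p \<partial>L)) powr (1 / p)"
      unfolding Lp_norm_def using p0 R(2)[OF v(1)] by (intro powr_mono2) auto
    also have "\<dots> = R powr (1 / p) * Lp_norm L p (gd_grad D v)"
      unfolding Lp_norm_def using R(1) by (simp add: powr_mult)
    finally show "q \<le> R powr (1 / p)"
      using nn[of "gd_grad D v"] unfolding v(2) by (cases "Lp_norm L p (gd_grad D v) = 0") (auto simp: divide_le_eq)
  qed
  moreover have "Lp_norm L p (gd_Pi D v) / Lp_norm L p (gd_grad D v) \<in> ?S" using v False by blast
  ultimately have "Lp_norm L p (gd_Pi D v) / Lp_norm L p (gd_grad D v) \<le> C"
    using cSup_upper C unfolding gd_CD_def by (meson order_trans)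
  moreover have "Lp_norm L p (gd_grad D v) > 0" using D_props(7)[OF v] False nn[of "gd_grad D v"] by force
  ultimately have "Lp_norm L p (gd_Pi D v) \<le> C * Lp_norm L p (gd_grad D v)" by (simp add: divide_le_eq)
  also have "\<dots> \<le> max C 0 * Lp_norm L p (gd_grad D v)" using nn by (intro mult_right_mono) auto
  finally have "Lp_norm L p (gd_Pi D v) powr p \<le> (max C 0 * Lp_norm L p (gd_grad D v)) powr p"
    using p0 nn by (intro powr_mono2) auto
  then show ?thesis using nn[of "gd_grad D v"] by (simp add: powr_mult Lp_norm_powr)
qed

lemma coercive_bound_ST:
  assumes C: "gd_CD p \<Omega> D \<le> C" and v: "\<And>n. n \<in> {1..N} \<Longrightarrow> v n \<in> gd_X D"
  shows "(\<integral>y. norm (gd_PiST D v y) powr p \<partial>Q) \<le> max C 0 powr p * (\<integral>y. norm (gd_gradST D v y) powr p \<partial>Q)"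
proof -
  have "(\<integral>y. norm (gd_PiST D v y) powr p \<partial>Q) = (\<Sum>n=1..N. (t n - t (n - 1)) * (\<integral>x. norm (gd_Pi D (v n) x) powr p \<partial>L))"
    using Lp_steps(2)[of "\<lambda>n. gd_Pi D (v n)" p] Pi_Lp[OF p0(1)] by (simp add: gd_PiST_def split_beta')
  also have "\<dots> \<le> (\<Sum>n=1..N. (t n - t (n - 1)) * (max C 0 powr p * (\<integral>x. norm (gd_grad D (v n) x) powr p \<partial>L)))"
  proof (intro sum_mono mult_left_mono coercive_bound C v)
    fix n assume "n \<in> {1..N}"
    then show "0 \<le> t n - t (n - 1)" using t_mono[of "n - 1" n] by auto
  qed auto
  also have "\<dots> = max C 0 powr p * (\<integral>y. norm (gd_gradST D v y) powr p \<partial>Q)"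
    using Lp_steps(2)[of "\<lambda>n. gd_grad D (v n)" p] D_props(5)[OF v]
    by (simp add: gd_gradST_def split_beta' sum_distrib_left mult.left_commute)
  finally show ?thesis .
qed

end

text \<open>With simple functions as arguments, the composition is glued from finitely many
  compositions with constants; continuity in the last two arguments passes to the limit of simple
  functions.\<close>

lemma caratheodory_measurable:
  fixes A :: "'b::euclidean_space \<Rightarrow> real \<Rightarrow> 'c::euclidean_space \<Rightarrow> 'd::euclidean_space"
  assumes S: "S \<in> sets lebesgue"
    and A: "\<And>s \<xi>. (\<lambda>y. A y s \<xi>) \<in> borel_measurable (lebesgue_on S)"
    and c: "AE y in lebesgue_on S. continuous_on UNIV (\<lambda>(s, \<xi>). A y s \<xi>)"
    and s: "s \<in> borel_measurable (lebesgue_on S)" and \<xi>: "\<xi> \<in> borel_measurable (lebesgue_on S)"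
  shows "(\<lambda>y. A y (s y) (\<xi> y)) \<in> borel_measurable (lebesgue_on S)"
proof -
  let ?M = "lebesgue_on S"
  obtain Z where Z: "Z \<in> null_sets ?M" "\<And>y. y \<in> space ?M - Z \<Longrightarrow> continuous_on UNIV (\<lambda>(s, \<xi>). A y s \<xi>)"
    using AE_E3[OF c] by blast
  have Zs: "Z \<in> sets ?M" using Z(1) by auto
  \<comment> \<open>Set to 0 on the exceptional set, so that continuity holds at every point of the
    domain.\<close>
  define A' where "A' y h = (if y \<in> Z then 0 else A y (fst h) (snd h))" for y and h :: "real \<times> 'c"
  have A'm: "(\<lambda>y. A' y h) \<in> borel_measurable ?M" for h
    unfolding A'_def using A Zs by (intro measurable_If_set) auto
  have A'c: "y \<in> space ?M \<Longrightarrow> continuous_on UNIV (A' y)" for y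
    using Z(2)[of y] by (cases "y \<in> Z") (auto simp: A'_def[abs_def] split_beta')
  have "(\<lambda>y. (s y, \<xi> y)) \<in> borel_measurable ?M" using s \<xi> by measurable
  from borel_measurable_implies_sequence_metric[OF this, of "(0, 0)"]
  obtain F where F: "\<And>i. simple_function ?M (F i)" "\<And>y. y \<in> space ?M \<Longrightarrow> (\<lambda>i. F i y) \<longlonglongrightarrow> (s y, \<xi> y)"
    by blast
  have "(\<lambda>y. A' y (F i y)) \<in> borel_measurable ?M" for i
  proof (rule measurable_compose_countable'[where f = "\<lambda>h y. A' y h" and I = "F i ` space ?M"])
    show "F i \<in> measurable ?M (count_space (F i ` space ?M))"
      using simple_functionD(2)[OF F(1)] simple_functionD(1)[OF F(1)]
      by (intro measurable_count_space_eq2[THEN iffD2]) auto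
    show "countable (F i ` space ?M)" using simple_functionD(1)[OF F(1)] by (rule countable_finite)
  qed (rule A'm)
  then have "(\<lambda>y. A' y (s y, \<xi> y)) \<in> borel_measurable ?M"
  proof (rule borel_measurable_LIMSEQ_metric)
    fix y assume y: "y \<in> space ?M"
    show "(\<lambda>i. A' y (F i y)) \<longlonglongrightarrow> A' y (s y, \<xi> y)"
      using continuous_on_tendsto_compose[OF A'c[OF y] F(2)[OF y]] by simp
  qed
  then have m1: "(\<lambda>y. indicator S y *\<^sub>R A' y (s y, \<xi> y)) \<in> borel_measurable lebesgue"
    using S borel_measurable_restrict_space_iff[of S lebesgue "\<lambda>y. A' y (s y, \<xi> y)"] by simp
  have "AE y in ?M. y \<notin> Z" using Z(1) by (rule AE_not_in)
  then have "AE y in lebesgue. y \<in> S \<longrightarrow> y \<notin> Z" using S by (simp add: AE_restrict_space_iff)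
  then have "AE y in lebesgue. indicator S y *\<^sub>R A' y (s y, \<xi> y) = indicator S y *\<^sub>R A y (s y) (\<xi> y)"
    by eventually_elim (auto simp: A'_def indicator_def)
  from borel_measurable_AE[OF m1 this] show ?thesis
    using S borel_measurable_restrict_space_iff[of S lebesgue "\<lambda>y. A y (s y) (\<xi> y)"] by simp
qed

section \<open>Estimates for one solution of the scheme\<close>

locale scheme = discretisation +
  fixes \<zeta> \<beta> :: "real \<Rightarrow> real" and a :: "'a \<Rightarrow> real \<Rightarrow> 'a \<Rightarrow> 'a" and u_ini :: "'a \<Rightarrow> real"
    and f :: "'a \<times> real \<Rightarrow> real" and u :: "nat \<Rightarrow> nat \<Rightarrow> real"
  assumes H: "hyp_H \<Omega> T p \<zeta> \<beta> a u_ini f" and gs: "gs_solution \<Omega> T \<zeta> \<beta> a u_ini f D u"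
begin

abbreviation "q \<equiv> conj_exp p"
abbreviation "E \<equiv> \<lambda>r. Bfun \<zeta> \<beta> (\<beta> r)"
abbreviation "U \<equiv> \<lambda>n. gd_Pi D (u n)"
abbreviation "Zm \<equiv> gd_PiST D (gd_app D \<zeta> u)"
abbreviation "Gm \<equiv> gd_gradST D (gd_app D \<zeta> u)"
abbreviation "nm \<equiv> gd_PiST D (gd_app D (nu_fun \<zeta> \<beta>) u)"
definition am :: "'a \<times> real \<Rightarrow> 'a" where
  "am y = a (fst y) (nm y) (Gm y)"

lemma H_props:
  "continuous_on UNIV \<zeta>" "mono \<zeta>" "\<zeta> 0 = 0" "continuous_on UNIV \<beta>" "mono \<beta>" "\<beta> 0 = 0"
  "u_ini \<in> Lp L 2" "f \<in> Lp Q q"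
  using H unfolding hyp_H_def by blast+

lemma q_props: "q > 1" "1 / p + 1 / q = 1" "1 / q + 1 / p = 1" "q \<ge> 0"
  using conj_exp_props[OF p] by auto

lemma subgradient: "\<zeta> s * (\<beta> r - \<beta> s) \<le> E r - E s"
  by (rule Bfun_subgradient[OF H_props(4,5,6,2)])

lemma E_nonneg: "0 \<le> E r" "E 0 = 0"
  using Bfun_nonneg[OF H_props(4,5,6,2,3)] H_props(6) by auto

lemma E_continuous: "continuous_on UNIV E"
  by (rule Bfun_continuous[OF H_props(4,5,6,2,1)])

lemma u_0: "u 0 = gd_interp D u_ini"
  using gs unfolding gs_solution_def Let_def by auto

lemma Gm_Lp: "Gm \<in> Lp Q p"
  by (rule gradST_Lp) (rule app_X)

lemma Zm_Lp: "s \<ge> 0 \<Longrightarrow> Zm \<in> Lp Q s" and nm_Lp: "s \<ge> 0 \<Longrightarrow> nm \<in> Lp Q s"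
  by (rule PiST_Lp, simp)+

lemma a_measurable:
  assumes "s \<in> borel_measurable Q" "\<xi> \<in> borel_measurable Q"
  shows "(\<lambda>y. a (fst y) (s y) (\<xi> y)) \<in> borel_measurable Q"
proof (rule caratheodory_measurable[OF sets_Q _ _ assms])
  show "(\<lambda>y. a (fst y) s \<xi>) \<in> borel_measurable Q" for s \<xi>
    using H unfolding hyp_H_def by (intro borel_measurable_lebesgue_on_fst[of "\<lambda>x. a x s \<xi>"]) blast
  have "AE x in L. continuous_on UNIV (\<lambda>(s, \<xi>). a x s \<xi>)"
    using H unfolding hyp_H_def by blast
  from AE_lebesgue_on_fst[OF this sets_Omega sets_Q]
  show "AE y in Q. continuous_on UNIV (\<lambda>(s, \<xi>). a (fst y) s \<xi>)" .
qed

lemma am_bound: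
  assumes \<mu>: "\<mu> > 0" and ab: "AE x in L. \<forall>s \<xi>. norm (a x s \<xi>) \<le> abar x + \<mu> * norm \<xi> powr (p - 1)"
  shows "AE y in Q. norm (am y) powr q \<le> 2 powr q * (\<bar>abar (fst y)\<bar> powr q + \<mu> powr q * norm (Gm y) powr p)"
  using AE_lebesgue_on_fst[OF ab sets_Omega sets_Q]
  by eventually_elim (unfold am_def, rule growth_conj_powr[OF p _ \<mu>], blast)

lemma Lp_fst:
  fixes F :: "'a \<Rightarrow> 'c::euclidean_space"
  assumes "F \<in> Lp L r"
  shows "(\<lambda>y. F (fst y)) \<in> Lp Q r" "(\<integral>y. norm (F (fst y)) powr r \<partial>Q) = T * (\<integral>x. norm (F x) powr r \<partial>L)"
proof -
  have "has_bochner_integral Q (\<lambda>y. indicator {0<..T} (snd y) *\<^sub>R norm (F (fst y)) powr r) ((T - 0) *\<^sub>R (\<integral>x. norm (F x) powr r \<partial>L))"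
    using T by (intro has_bochner_integral_slab LpD(2)[OF assms] \<Omega>) auto
  then have *: "has_bochner_integral Q (\<lambda>y. norm (F (fst y)) powr r) (T * (\<integral>x. norm (F x) powr r \<partial>L))"
    by (subst (asm) has_bochner_integral_cong[of _ _ _ "\<lambda>y. norm (F (fst y)) powr r", OF refl _ refl]) auto
  then show "(\<integral>y. norm (F (fst y)) powr r \<partial>Q) = T * (\<integral>x. norm (F x) powr r \<partial>L)"
    by (rule has_bochner_integral_integral_eq)
  show "(\<lambda>y. F (fst y)) \<in> Lp Q r"
    unfolding Lp_def using * borel_measurable_lebesgue_on_fst[OF LpD(1)[OF assms]] by (auto simp: has_bochner_integral_iff)
qed

lemma am_Lp: "am \<in> Lp Q q"
proof -
  obtain abar \<mu> where ab: "abar \<in> Lp L q" "\<mu> > 0" "AE x in L. \<forall>s \<xi>. norm (a x s \<xi>) \<le> abar x + \<mu> * norm \<xi> powr (p - 1)"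
    using H unfolding hyp_H_def by blast
  show ?thesis
  proof (rule Lp_bound[OF _ _ am_bound[OF ab(2,3)]])
    show "am \<in> borel_measurable Q"
      unfolding am_def using a_measurable LpD(1)[OF nm_Lp[of 1]] LpD(1)[OF Gm_Lp] by auto
    show "integrable Q (\<lambda>y. 2 powr q * (\<bar>abar (fst y)\<bar> powr q + \<mu> powr q * norm (Gm y) powr p))"
      using LpD(2)[OF Lp_fst(1)[OF ab(1)]] LpD(2)[OF Gm_Lp] by auto
  qed
qed

lemma integrable_fPi: "integrable Q (\<lambda>y. f y * gd_PiST D v y)"
  using integrable_mult_Lp[OF q_props(1) p q_props(3) H_props(8) PiST_Lp[OF p0(1)]] .

lemma integrable_am:
  assumes "F \<in> Lp Q p"
  shows "integrable Q (\<lambda>y. am y \<bullet> F y)"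
  using integrable_inner_Lp[OF q_props(1) p q_props(3) am_Lp assms] .

lemma integrable_beta_Pi: "integrable L (\<lambda>x. \<beta> (gd_Pi D w x) * gd_Pi D v x)"
  using integrable_mult_Lp[of 2 2 "\<lambda>x. \<beta> (gd_Pi D w x)" L "gd_Pi D v"] Pi_compose_Lp[OF _ H_props(4), of 2] Pi_Lp[of 2] by simp

text \<open>The difference quotient is constant on a slab, so integration over the slab cancels the
  time step and leaves plain increments of \<beta>, ready for telescoping.\<close>

lemma tested_scheme:
  assumes v: "\<And>n. n \<in> {1..N} \<Longrightarrow> v n \<in> gd_X D"
  shows "(\<Sum>n=1..N. \<integral>x. (\<beta> (U n x) - \<beta> (U (n - 1) x)) * gd_Pi D (v n) x \<partial>L)
      + (\<integral>y. am y \<bullet> gd_gradST D v y \<partial>Q) = (\<integral>y. f y * gd_PiST D v y \<partial>Q)"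
proof -
  define F where "F n x = (1 / (t n - t (n - 1))) * ((\<beta> (U n x) - \<beta> (U (n - 1) x)) * gd_Pi D (v n) x)" for n x
  have Fi: "integrable L (F n)" for n
    unfolding F_def left_diff_distrib using integrable_beta_Pi by auto
  have d: "gd_Pi D (gd_delta D (gd_app D \<beta> u) (snd y)) (fst y) * gd_PiST D v y = F (gd_step D (snd y)) (fst y)"
    if "y \<in> space Q" for y
  proof -
    define n where "n = gd_step D (snd y)"
    define \<Delta> where "\<Delta> = t n - t (n - 1)"
    have x: "fst y \<in> \<Omega>" using that space_Q[of y] by blast
    have "gd_delta D (gd_app D \<beta> u) (snd y) = (\<lambda>i. (1 / \<Delta>) * gd_app D \<beta> u n i + (- 1 / \<Delta>) * gd_app D \<beta> u (n - 1) i)"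
      unfolding gd_delta_def Let_def n_def[symmetric] \<Delta>_def[symmetric] by (simp add: diff_divide_distrib)
    then have "gd_Pi D (gd_delta D (gd_app D \<beta> u) (snd y)) (fst y) = (1 / \<Delta>) * \<beta> (U n (fst y)) + (- 1 / \<Delta>) * \<beta> (U (n - 1) (fst y))"
      by (simp only: Pi_lin Pi_app[OF x])
    also have "\<dots> = (1 / \<Delta>) * (\<beta> (U n (fst y)) - \<beta> (U (n - 1) (fst y)))" by (simp add: diff_divide_distrib)
    moreover have "gd_PiST D v y = gd_Pi D (v n) (fst y)"
      by (simp add: gd_PiST_def n_def split_beta')
    ultimately show ?thesis by (simp add: F_def n_def \<Delta>_def)
  qed
  have hF: "has_bochner_integral Q (\<lambda>y. F (gd_step D (snd y)) (fst y)) (\<Sum>n=1..N. (t n - t (n - 1)) *\<^sub>R (\<integral>x. F n x \<partial>L))"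
    by (rule has_bochner_integral_steps) (rule Fi)
  have sumF: "(t n - t (n - 1)) *\<^sub>R (\<integral>x. F n x \<partial>L) = (\<integral>x. (\<beta> (U n x) - \<beta> (U (n - 1) x)) * gd_Pi D (v n) x \<partial>L)" if "n \<in> {1..N}" for n
  proof -
    have "t (n - 1) < t n" using t_strict[of "n - 1" n] that by auto
    then show ?thesis by (simp add: F_def[abs_def])
  qed
  have eq: "(\<integral>y. gd_Pi D (gd_delta D (gd_app D \<beta> u) (snd y)) (fst y) * gd_PiST D v y
           + a (fst y) (nm y) (Gm y) \<bullet> gd_gradST D v y \<partial>Q) = (\<integral>y. f y * gd_PiST D v y \<partial>Q)"
    using gs v unfolding gs_solution_def Let_def by auto
  have "(\<integral>y. gd_Pi D (gd_delta D (gd_app D \<beta> u) (snd y)) (fst y) * gd_PiST D v y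
           + a (fst y) (nm y) (Gm y) \<bullet> gd_gradST D v y \<partial>Q)
      = (\<integral>y. F (gd_step D (snd y)) (fst y) + am y \<bullet> gd_gradST D v y \<partial>Q)"
    by (rule Bochner_Integration.integral_cong) (simp_all only: d am_def)
  also have "\<dots> = (\<Sum>n=1..N. (t n - t (n - 1)) *\<^sub>R (\<integral>x. F n x \<partial>L)) + (\<integral>y. am y \<bullet> gd_gradST D v y \<partial>Q)"
    using hF integrable_am[OF gradST_Lp[OF v]] by (simp add: has_bochner_integral_iff)
  also have "(\<Sum>n=1..N. (t n - t (n - 1)) *\<^sub>R (\<integral>x. F n x \<partial>L)) = (\<Sum>n=1..N. \<integral>x. (\<beta> (U n x) - \<beta> (U (n - 1) x)) * gd_Pi D (v n) x \<partial>L)"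
    by (rule sum.cong) (simp_all only: sumF)
  finally show ?thesis using eq by simp
qed

lemma step_le_iff:
  assumes "0 < \<tau>" "\<tau> \<le> T" "k \<le> N"
  shows "gd_step D \<tau> \<le> k \<longleftrightarrow> \<tau> \<le> t k"
proof
  assume "gd_step D \<tau> \<le> k"
  then show "\<tau> \<le> t k" using step_props(3)[OF assms(1,2)] t_mono[of "gd_step D \<tau>" k] assms(3) by simp
next
  assume "\<tau> \<le> t k"
  then show "gd_step D \<tau> \<le> k" unfolding gd_step_def by (rule Least_le)
qed

text \<open>The test function is \<open>\<zeta>(u)\<close> up to step \<open>k\<close> and 0
  afterwards; the subgradient inequality is taken at the new value of each step. Arbitrary
  \<open>k\<close>, and not only the last one, gives a bound for \<beta> that is uniform in
  time.\<close>

lemma discrete_energy: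
  assumes k: "k \<le> N"
  shows "(\<integral>x. E (U k x) \<partial>L) + (\<integral>y. indicator {..t k} (snd y) * (am y \<bullet> Gm y) \<partial>Q)
    \<le> (\<integral>x. E (U 0 x) \<partial>L) + (\<integral>y. indicator {..t k} (snd y) * (f y * Zm y) \<partial>Q)"
proof -
  define v where "v n = (if n \<le> k then gd_app D \<zeta> u n else (\<lambda>i. 0))" for n
  have vX: "v n \<in> gd_X D" for n by (simp add: v_def app_X zero_X)
  have iE: "integrable L (\<lambda>x. E (U n x))" for n by (rule Pi_compose_integrable[OF E_continuous])
  have "(\<integral>x. E (U k x) \<partial>L) - (\<integral>x. E (U 0 x) \<partial>L) = (\<Sum>n=1..k. (\<integral>x. E (U n x) \<partial>L) - (\<integral>x. E (U (n - 1) x) \<partial>L))"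
    by (induction k) auto
  also have "\<dots> \<le> (\<Sum>n=1..k. \<integral>x. (\<beta> (U n x) - \<beta> (U (n - 1) x)) * gd_Pi D (v n) x \<partial>L)"
  proof (rule sum_mono)
    fix n assume n: "n \<in> {1..k}"
    have "(\<integral>x. E (U n x) \<partial>L) - (\<integral>x. E (U (n - 1) x) \<partial>L) = (\<integral>x. E (U n x) - E (U (n - 1) x) \<partial>L)"
      using iE by simp
    also have "\<dots> \<le> (\<integral>x. (\<beta> (U n x) - \<beta> (U (n - 1) x)) * gd_Pi D (v n) x \<partial>L)"
    proof (rule integral_mono)
      show "integrable L (\<lambda>x. (\<beta> (U n x) - \<beta> (U (n - 1) x)) * gd_Pi D (v n) x)"
        unfolding left_diff_distrib using integrable_beta_Pi by auto
      fix x assume "x \<in> space L"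
      then have "gd_Pi D (v n) x = \<zeta> (U n x)" using n Pi_app[of x \<zeta> u n] by (simp add: v_def)
      then show "E (U n x) - E (U (n - 1) x) \<le> (\<beta> (U n x) - \<beta> (U (n - 1) x)) * gd_Pi D (v n) x"
        using subgradient[of "U n x" "U (n - 1) x"] by (simp add: algebra_simps)
    qed (use iE in auto)
    finally show "(\<integral>x. E (U n x) \<partial>L) - (\<integral>x. E (U (n - 1) x) \<partial>L) \<le> (\<integral>x. (\<beta> (U n x) - \<beta> (U (n - 1) x)) * gd_Pi D (v n) x \<partial>L)" .
  qed
  also have "\<dots> = (\<Sum>n=1..N. \<integral>x. (\<beta> (U n x) - \<beta> (U (n - 1) x)) * gd_Pi D (v n) x \<partial>L)"
    using k by (intro sum.mono_neutral_left) (auto simp: v_def Pi_zero)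
  finally have 1: "(\<integral>x. E (U k x) \<partial>L) - (\<integral>x. E (U 0 x) \<partial>L) \<le> (\<Sum>n=1..N. \<integral>x. (\<beta> (U n x) - \<beta> (U (n - 1) x)) * gd_Pi D (v n) x \<partial>L)" .
  have ind: "gd_step D (snd y) \<le> k \<longleftrightarrow> snd y \<in> {..t k}" if "y \<in> space Q" for y
    using step_le_iff[of "snd y" k] that k by (auto simp: space_Q)
  have 2: "(\<integral>y. f y * gd_PiST D v y \<partial>Q) = (\<integral>y. indicator {..t k} (snd y) * (f y * Zm y) \<partial>Q)"
  proof (rule Bochner_Integration.integral_cong)
    fix y assume "y \<in> space Q"
    from ind[OF this] show "f y * gd_PiST D v y = indicator {..t k} (snd y) * (f y * Zm y)"
      by (auto simp: gd_PiST_def split_beta' v_def Pi_zero indicator_def)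
  qed simp
  \<comment> \<open>The gradient of the zero vector vanishes only almost everywhere, so the cut-off
    in time is an a.e. identity.\<close>
  have "AE y in Q. am y \<bullet> gd_gradST D v y = indicator {..t k} (snd y) * (am y \<bullet> Gm y)"
  proof -
    have "AE y in Q. gd_grad D (\<lambda>i. 0) (fst y) = 0"
      by (rule AE_lebesgue_on_fst[OF grad_zero sets_Omega sets_Q])
    then show ?thesis using AE_space
    proof eventually_elim
      case (elim y)
      then show ?case using ind[of y] by (auto simp: gd_gradST_def split_beta' v_def indicator_def)
    qed
  qed
  moreover have m: "(\<lambda>y. am y \<bullet> gd_gradST D v y) \<in> borel_measurable Q"
    using integrable_am[OF gradST_Lp[OF vX]] by (rule borel_measurable_integrable)
  moreover have "(\<lambda>y. indicator {..t k} (snd y) * (am y \<bullet> Gm y)) \<in> borel_measurable Q"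
  proof -
    have "(\<lambda>y. indicat_real {..k} (gd_step D (snd y))) \<in> borel_measurable Q"
      using measurable_steps[of "\<lambda>n x. indicat_real {..k} n"] by simp
    moreover have "(\<lambda>y. am y \<bullet> Gm y) \<in> borel_measurable Q"
      using integrable_am[OF Gm_Lp] by (rule borel_measurable_integrable)
    ultimately have "(\<lambda>y. indicat_real {..k} (gd_step D (snd y)) * (am y \<bullet> Gm y)) \<in> borel_measurable Q"
      by (rule borel_measurable_times)
    then show ?thesis
      by (rule measurable_cong[THEN iffD1, rotated]) (use ind in \<open>auto simp: indicator_def\<close>)
  qed
  ultimately have 3: "(\<integral>y. am y \<bullet> gd_gradST D v y \<partial>Q) = (\<integral>y. indicator {..t k} (snd y) * (am y \<bullet> Gm y) \<partial>Q)"
    by (intro integral_cong_AE)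
  show ?thesis using tested_scheme[of v, OF vX] 1 2 3 by linarith
qed

lemma discrete_energy_final:
  "(\<integral>x. E (U N x) \<partial>L) + (\<integral>y. am y \<bullet> Gm y \<partial>Q) \<le> (\<integral>x. E (U 0 x) \<partial>L) + (\<integral>y. f y * Zm y \<partial>Q)"
proof -
  have "(\<integral>y. indicator {..t N} (snd y) * (am y \<bullet> Gm y) \<partial>Q) = (\<integral>y. am y \<bullet> Gm y \<partial>Q)"
    "(\<integral>y. indicator {..t N} (snd y) * (f y * Zm y) \<partial>Q) = (\<integral>y. f y * Zm y \<partial>Q)"
    using D_props(11) by (auto intro!: Bochner_Integration.integral_cong)
  then show ?thesis using discrete_energy[of N] by simp
qed

end

section \<open>Passing to the limit\<close>

context discretisation
begin

lemma dtmax_ge: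
  assumes "n < N"
  shows "t (Suc n) - t n \<le> gd_dtmax D"
  unfolding gd_dtmax_def using assms by (intro Max_ge) auto

lemma step_near:
  assumes "0 < \<tau>" "\<tau> \<le> T"
  shows "\<tau> \<le> t (gd_step D \<tau>)" "t (gd_step D \<tau>) \<le> \<tau> + gd_dtmax D"
proof -
  note s = step_props[OF assms]
  show "\<tau> \<le> t (gd_step D \<tau>)" by (rule s)
  have "gd_step D \<tau> - 1 < N" "Suc (gd_step D \<tau> - 1) = gd_step D \<tau>" using s(1) by auto
  then show "t (gd_step D \<tau>) \<le> \<tau> + gd_dtmax D" using dtmax_ge[of "gd_step D \<tau> - 1"] s(2) by simp
qed

text \<open>Rounds a time down to the grid, whereas \<open>gd_step\<close> rounds up. The grid
  points in a window (s1, s2] are those with index above \<open>last_step s1\<close> and at most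
  \<open>last_step s2\<close>.\<close>

definition last_step :: "real \<Rightarrow> nat" where
  "last_step s = (GREATEST n. n \<le> N \<and> t n \<le> s)"

lemma last_step:
  assumes "0 \<le> s" "s \<le> T"
  shows "last_step s \<le> N" "\<And>n. n \<le> N \<Longrightarrow> t n \<le> s \<longleftrightarrow> n \<le> last_step s"
    "t (last_step s) \<le> s" "s - t (last_step s) \<le> gd_dtmax D"
proof -
  have g: "last_step s \<le> N \<and> t (last_step s) \<le> s"
    unfolding last_step_def by (rule GreatestI_nat[of _ 0 N]) (use assms D_props(9) in auto)
  then show 1: "last_step s \<le> N" "t (last_step s) \<le> s" by auto
  show 2: "t n \<le> s \<longleftrightarrow> n \<le> last_step s" if "n \<le> N" for n
  proof
    assume "t n \<le> s"
    then show "n \<le> last_step s"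
      unfolding last_step_def by (intro Greatest_le_nat[of _ _ N]) (use that in auto)
  next
    assume "n \<le> last_step s"
    then show "t n \<le> s" using t_mono[of n "last_step s"] 1 by simp
  qed
  show "s - t (last_step s) \<le> gd_dtmax D"
  proof (cases "last_step s = N")
    case True
    have "gd_dtmax D \<ge> 0" using dtmax_ge[of 0] N_pos t_strict[of 0 1] by simp
    then show ?thesis using True D_props(11) assms by simp
  next
    case False
    then have l: "last_step s < N" using 1 by simp
    then have "\<not> t (Suc (last_step s)) \<le> s" using 2[of "Suc (last_step s)"] by simp
    then show ?thesis using dtmax_ge[OF l] by simp
  qed
qed

end

section \<open>Bounds along the sequence of discretisations\<close>

lemma tendsto_imp_abs_bounded:
  fixes x :: "nat \<Rightarrow> real"
  assumes "x \<longlonglongrightarrow> l"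
  obtains B where "\<And>n. \<bar>x n\<bar> \<le> B"
proof -
  have "bounded (range x)" using assms by (rule convergent_imp_bounded)
  then show thesis using that by (auto simp: bounded_iff)
qed

locale gdm_sequence =
  fixes \<Omega> :: "'a::euclidean_space set" and T p :: real
    and \<zeta> \<beta> :: "real \<Rightarrow> real" and a :: "'a \<Rightarrow> real \<Rightarrow> 'a \<Rightarrow> 'a"
    and u_ini :: "'a \<Rightarrow> real" and f :: "'a \<times> real \<Rightarrow> real"
    and Ds :: "nat \<Rightarrow> 'a stgd" and us :: "nat \<Rightarrow> nat \<Rightarrow> nat \<Rightarrow> real"
    and ub :: "'a \<times> real \<Rightarrow> real" and w :: "real \<Rightarrow> 'a \<Rightarrow> real"
    and G :: "'a \<times> real \<Rightarrow> 'a" and Dt :: "real \<Rightarrow> ('a \<Rightarrow> real) \<Rightarrow> real"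
  assumes H: "hyp_H \<Omega> T p \<zeta> \<beta> a u_ini f"
    and D: "\<And>m. is_stgd p \<Omega> T (Ds m)"
    and coer: "seq_coercive p \<Omega> Ds"
    and cons: "seq_consistent p \<Omega> Ds"
    and gs: "\<And>m. gs_solution \<Omega> T \<zeta> \<beta> a u_ini f (Ds m) (us m)"
    and sol: "cont_solution \<Omega> T p \<zeta> \<beta> a u_ini f ub w G Dt"
    and conv_beta: "\<forall>\<phi> \<in> Lp (lebesgue_on \<Omega>) 2.
        uniform_limit {0..T}
          (\<lambda>m t. \<integral>x. gd_PiST (Ds m) (gd_app (Ds m) \<beta> (us m)) (x, t) * \<phi> x \<partial>lebesgue_on \<Omega>)
          (\<lambda>t. \<integral>x. w t x * \<phi> x \<partial>lebesgue_on \<Omega>) sequentially"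
    and conv_zeta: "Lp_weak (lebesgue_on (\<Omega> \<times> {0<..<T})) p
        (\<lambda>m. gd_PiST (Ds m) (gd_app (Ds m) \<zeta> (us m))) (\<lambda>y. \<zeta> (ub y))"
    and conv_grad: "Lp_weak (lebesgue_on (\<Omega> \<times> {0<..<T})) p
        (\<lambda>m. gd_gradST (Ds m) (gd_app (Ds m) \<zeta> (us m))) G"
begin

sublocale S: scheme p \<Omega> T "Ds m" \<zeta> \<beta> a u_ini f "us m" for m
proof
  show "open \<Omega>" "bounded \<Omega>" "1 < p" "0 < T" using H unfolding hyp_H_def by blast+
qed (rule D H gs)+

abbreviation "LL \<equiv> lebesgue_on \<Omega>"
abbreviation "QQ \<equiv> lebesgue_on (\<Omega> \<times> {0<..<T})"
abbreviation "qq \<equiv> conj_exp p"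
abbreviation "En \<equiv> \<lambda>r. Bfun \<zeta> \<beta> (\<beta> r)"
abbreviation "Um \<equiv> \<lambda>m n. gd_Pi (Ds m) (us m n)"
abbreviation "Zs \<equiv> \<lambda>m. gd_PiST (Ds m) (gd_app (Ds m) \<zeta> (us m))"
abbreviation "Gs \<equiv> \<lambda>m. gd_gradST (Ds m) (gd_app (Ds m) \<zeta> (us m))"
abbreviation "As \<equiv> \<lambda>m. S.am m"

lemma lipschitz_consts:
  obtains K where "K > 0" "\<And>r. \<bar>\<zeta> r\<bar> \<le> K * \<bar>r\<bar>" "\<And>r s. \<bar>\<beta> r - \<beta> s\<bar> \<le> K * \<bar>r - s\<bar>" "\<And>r. \<bar>\<beta> r\<bar> \<le> K * \<bar>r\<bar>"
proof -
  obtain L1 L2 where L: "L1 > 0" "L1-lipschitz_on UNIV \<zeta>" "L2 > 0" "L2-lipschitz_on UNIV \<beta>"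
    using H unfolding hyp_H_def by blast
  have z: "\<bar>\<zeta> r\<bar> \<le> max L1 L2 * \<bar>r\<bar>" for r
  proof -
    have "\<bar>\<zeta> r\<bar> \<le> L1 * \<bar>r\<bar>"
      using lipschitz_onD[OF L(2), of r 0] S.H_props(3) by (simp add: dist_real_def)
    also have "\<dots> \<le> max L1 L2 * \<bar>r\<bar>" by (intro mult_right_mono) auto
    finally show ?thesis .
  qed
  have b: "\<bar>\<beta> r - \<beta> s\<bar> \<le> max L1 L2 * \<bar>r - s\<bar>" for r s
  proof -
    have "\<bar>\<beta> r - \<beta> s\<bar> \<le> L2 * \<bar>r - s\<bar>"
      using lipschitz_onD[OF L(4), of r s] by (simp add: dist_real_def)
    also have "\<dots> \<le> max L1 L2 * \<bar>r - s\<bar>" by (intro mult_right_mono) auto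
    finally show ?thesis .
  qed
  show thesis using that[of "max L1 L2"] z b b[of _ 0] S.H_props(6) L(1) by auto
qed

lemma zeta_u_ini_Lp: "(\<lambda>x. \<zeta> (u_ini x)) \<in> Lp LL 2"
proof -
  obtain K where K: "K > 0" "\<And>r. \<bar>\<zeta> r\<bar> \<le> K * \<bar>r\<bar>" by (rule lipschitz_consts) blast
  have [measurable]: "\<zeta> \<in> borel_measurable borel"
    using S.H_props(1) by (rule borel_measurable_continuous_onI)
  note [measurable] = LpD(1)[OF S.H_props(7)]
  show ?thesis
  proof (rule Lp_bound[OF _ integrable_mult_right[OF LpD(2)[OF S.H_props(7)], of "K powr 2"]])
    have "norm (\<zeta> (u_ini x)) powr 2 \<le> (K * norm (u_ini x)) powr 2" for x
      using K(2) by (intro powr_mono2) auto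
    then show "AE x in LL. norm (\<zeta> (u_ini x)) powr 2 \<le> K powr 2 * norm (u_ini x) powr 2"
      using K(1) by (simp add: powr_mult)
  qed measurable
qed

text \<open>The subgradient inequality at \<open>u_ini x\<close> against 0 bounds the energy by
  \<open>\<zeta> (u_ini x) * \<beta> (u_ini x)\<close>, which is quadratic in a square integrable
  function.\<close>

lemma E_u_ini_integrable: "integrable LL (\<lambda>x. En (u_ini x))"
proof -
  obtain K where K: "K > 0" "\<And>r. \<bar>\<zeta> r\<bar> \<le> K * \<bar>r\<bar>" "\<And>r. \<bar>\<beta> r\<bar> \<le> K * \<bar>r\<bar>" by (rule lipschitz_consts) blast
  have [measurable]: "En \<in> borel_measurable borel"
    using S.E_continuous by (rule borel_measurable_continuous_onI)
  note [measurable] = LpD(1)[OF S.H_props(7)]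
  show ?thesis
  proof (rule Bochner_Integration.integrable_bound[OF integrable_mult_right[OF LpD(2)[OF S.H_props(7)], of "K * K"]])
    have "\<bar>En (u_ini x)\<bar> \<le> K * K * norm (u_ini x) powr 2" for x
    proof -
      have "En (u_ini x) \<le> \<zeta> (u_ini x) * \<beta> (u_ini x)"
        using S.subgradient[of "u_ini x" 0] S.E_nonneg S.H_props(6) by (simp add: algebra_simps)
      also have "\<dots> \<le> \<bar>\<zeta> (u_ini x)\<bar> * \<bar>\<beta> (u_ini x)\<bar>" by (metis abs_ge_self abs_mult)
      also have "\<dots> \<le> (K * \<bar>u_ini x\<bar>) * (K * \<bar>u_ini x\<bar>)"
        using K by (intro mult_mono) auto
      also have "\<dots> = K * K * (\<bar>u_ini x\<bar> * \<bar>u_ini x\<bar>)" by (simp only: mult_ac)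
      finally show ?thesis using S.E_nonneg(1)[of "u_ini x"] by (simp add: power2_eq_square)
    qed
    then show "AE x in LL. norm (En (u_ini x)) \<le> norm (K * K * norm (u_ini x) powr 2)"
      using K(1) by auto
  qed measurable
qed

text \<open>An upper bound is enough, so the inequality is taken at the discrete value U. The
  increment is at most \<open>K * K\<close> times |U| |U - u_ini|, and the interpolated data
  converge in L^2.\<close>

lemma initial_energy:
  obtains X where "X \<longlonglongrightarrow> 0" "\<And>m. (\<integral>x. En (Um m 0 x) \<partial>LL) \<le> (\<integral>x. En (u_ini x) \<partial>LL) + X m"
proof -
  obtain K where K: "K > 0" "\<And>r. \<bar>\<zeta> r\<bar> \<le> K * \<bar>r\<bar>" "\<And>r s. \<bar>\<beta> r - \<beta> s\<bar> \<le> K * \<bar>r - s\<bar>" by (rule lipschitz_consts) blast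
  let ?d = "\<lambda>m x. \<bar>Um m 0 x - u_ini x\<bar>"
  have U: "Um m 0 \<in> Lp LL 2" for m by (rule S.Pi_Lp) simp
  have d: "?d m \<in> Lp LL 2" for m
    using LpD[OF Lp_diff[OF _ U S.H_props(7), of m]] by (auto simp: Lp_def)
  have u: "(\<lambda>x. \<bar>u_ini x\<bar>) \<in> Lp LL 2" using LpD[OF S.H_props(7)] by (auto simp: Lp_def)
  have "(\<lambda>m. Lp_norm LL 2 (\<lambda>x. Um m 0 x - u_ini x)) \<longlonglongrightarrow> 0"
    using cons S.H_props(7) S.u_0 unfolding seq_consistent_def by simp
  then have l: "(\<lambda>m. \<integral>x. norm (?d m x) powr 2 \<partial>LL) \<longlonglongrightarrow> 0"
    by (subst (asm) Lp_norm_tendsto_0_iff) auto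
  have l2: "(\<lambda>m. \<integral>x. \<bar>u_ini x\<bar> \<bullet> ?d m x \<partial>LL) \<longlonglongrightarrow> 0"
    by (rule integral_inner_small[of 2 2 "\<lambda>m x. \<bar>u_ini x\<bar>" LL _ "\<integral>x. norm \<bar>u_ini x\<bar> powr 2 \<partial>LL", OF _ _ _ u d _ l]) auto
  define X where "X m = K * K * ((\<integral>x. norm (?d m x) powr 2 \<partial>LL) + (\<integral>x. \<bar>u_ini x\<bar> \<bullet> ?d m x \<partial>LL))" for m
  have "X \<longlonglongrightarrow> K * K * (0 + 0)" unfolding X_def by (intro tendsto_intros l l2)
  moreover have "(\<integral>x. En (Um m 0 x) \<partial>LL) \<le> (\<integral>x. En (u_ini x) \<partial>LL) + X m" for m
  proof -
    have iu: "integrable LL (\<lambda>x. \<bar>u_ini x\<bar> * ?d m x)" using integrable_mult_Lp[OF _ _ _ u d] by auto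
    have "(\<integral>x. En (Um m 0 x) \<partial>LL) \<le> (\<integral>x. En (u_ini x) + K * K * (norm (?d m x) powr 2 + \<bar>u_ini x\<bar> * ?d m x) \<partial>LL)"
    proof (rule integral_mono)
      show "integrable LL (\<lambda>x. En (Um m 0 x))" by (rule S.Pi_compose_integrable[OF S.E_continuous])
      show "integrable LL (\<lambda>x. En (u_ini x) + K * K * (norm (?d m x) powr 2 + \<bar>u_ini x\<bar> * ?d m x))"
        using E_u_ini_integrable LpD(2)[OF d[of m]] iu by auto
      fix x
      let ?U = "Um m 0 x" and ?u = "u_ini x"
      have "En ?U - En ?u \<le> \<zeta> ?U * (\<beta> ?U - \<beta> ?u)"
        using S.subgradient[of ?U ?u] by (simp add: algebra_simps)
      also have "\<dots> \<le> \<bar>\<zeta> ?U\<bar> * \<bar>\<beta> ?U - \<beta> ?u\<bar>" by (metis abs_ge_self abs_mult)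
      also have "\<dots> \<le> (K * \<bar>?U\<bar>) * (K * ?d m x)" using K by (intro mult_mono) auto
      also have "\<dots> \<le> (K * (?d m x + \<bar>?u\<bar>)) * (K * ?d m x)"
        using K(1) by (intro mult_right_mono mult_left_mono) auto
      also have "\<dots> = K * K * (norm (?d m x) powr 2 + \<bar>?u\<bar> * ?d m x)"
        by (simp add: power2_eq_square algebra_simps)
      finally show "En ?U \<le> En ?u + K * K * (norm (?d m x) powr 2 + \<bar>?u\<bar> * ?d m x)" by simp
    qed
    also have "\<dots> = (\<integral>x. En (u_ini x) \<partial>LL) + X m"
      unfolding X_def using E_u_ini_integrable LpD(2)[OF d[of m]] iu by simp
    finally show ?thesis .
  qed
  ultimately show thesis using that[of X] by simp
qed

lemma am_Gm_coercive:
  obtains al where "al > 0" "\<And>m. AE y in QQ. al * norm (Gs m y) powr p \<le> As m y \<bullet> Gs m y"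
proof -
  obtain al where al: "al > 0" "AE x in LL. \<forall>s \<xi>. a x s \<xi> \<bullet> \<xi> \<ge> al * norm \<xi> powr p"
    using H unfolding hyp_H_def by blast
  have "AE y in QQ. al * norm (Gs m y) powr p \<le> As m y \<bullet> Gs m y" for m
    using AE_lebesgue_on_fst[OF al(2) S.sets_Omega S.sets_Q] by eventually_elim (simp add: S.am_def)
  then show thesis using that al(1) by blast
qed

text \<open>The source term is bounded because \<open>Zs m\<close> converges weakly, so nothing has
  to be absorbed into the coercive term.\<close>

lemma Gs_bound:
  obtains B where "\<And>m. (\<integral>y. norm (Gs m y) powr p \<partial>QQ) \<le> B"
proof -
  obtain X where X: "X \<longlonglongrightarrow> 0" "\<And>m. (\<integral>x. En (Um m 0 x) \<partial>LL) \<le> (\<integral>x. En (u_ini x) \<partial>LL) + X m"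
    by (rule initial_energy) blast
  obtain BX where BX: "\<And>m. \<bar>X m\<bar> \<le> BX" by (rule tendsto_imp_abs_bounded[OF X(1)]) blast
  have "(\<lambda>m. \<integral>y. Zs m y \<bullet> f y \<partial>QQ) \<longlonglongrightarrow> (\<integral>y. \<zeta> (ub y) \<bullet> f y \<partial>QQ)"
    using conv_zeta S.H_props(8) unfolding Lp_weak_def by blast
  then obtain BF where BF: "\<And>m. \<bar>\<integral>y. Zs m y \<bullet> f y \<partial>QQ\<bar> \<le> BF" by (rule tendsto_imp_abs_bounded) blast
  obtain al where al: "al > 0" "\<And>m. AE y in QQ. al * norm (Gs m y) powr p \<le> As m y \<bullet> Gs m y"
    by (rule am_Gm_coercive) blast
  have "al * (\<integral>y. norm (Gs m y) powr p \<partial>QQ) \<le> (\<integral>x. En (u_ini x) \<partial>LL) + BX + BF" for m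
  proof -
    have "al * (\<integral>y. norm (Gs m y) powr p \<partial>QQ) = (\<integral>y. al * norm (Gs m y) powr p \<partial>QQ)" by simp
    also have "\<dots> \<le> (\<integral>y. As m y \<bullet> Gs m y \<partial>QQ)"
      by (rule integral_mono_AE[OF _ _ al(2)]) (use LpD(2)[OF S.Gm_Lp] S.integrable_am[OF S.Gm_Lp] in auto)
    also have "\<dots> \<le> (\<integral>x. En (Um m 0 x) \<partial>LL) + (\<integral>y. f y * Zs m y \<partial>QQ)"
    proof -
      have "0 \<le> (\<integral>x. En (Um m (gd_N (Ds m)) x) \<partial>LL)" using S.E_nonneg(1) by simp
      then show ?thesis using S.discrete_energy_final[of m] by linarith
    qed
    also have "(\<integral>y. f y * Zs m y \<partial>QQ) = (\<integral>y. Zs m y \<bullet> f y \<partial>QQ)" by (simp add: mult.commute)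
    finally show ?thesis using X(2)[of m] BX[of m] BF[of m] by linarith
  qed
  then have "(\<integral>y. norm (Gs m y) powr p \<partial>QQ) \<le> ((\<integral>x. En (u_ini x) \<partial>LL) + BX + BF) / al" for m
    using al(1) by (simp add: field_simps)
  then show thesis using that by blast
qed

lemma As_bound:
  obtains B where "\<And>m. (\<integral>y. norm (As m y) powr qq \<partial>QQ) \<le> B"
proof -
  obtain BG where BG: "\<And>m. (\<integral>y. norm (Gs m y) powr p \<partial>QQ) \<le> BG" by (rule Gs_bound) blast
  obtain abar \<mu> where ab: "abar \<in> Lp LL qq" "\<mu> > 0" "AE x in LL. \<forall>s \<xi>. norm (a x s \<xi>) \<le> abar x + \<mu> * norm \<xi> powr (p - 1)"
    using H unfolding hyp_H_def by blast
  have "(\<integral>y. norm (As m y) powr qq \<partial>QQ) \<le> 2 powr qq * ((\<integral>y. norm (abar (fst y)) powr qq \<partial>QQ) + \<mu> powr qq * BG)" for m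
  proof -
    have "(\<integral>y. norm (As m y) powr qq \<partial>QQ) \<le> (\<integral>y. 2 powr qq * (\<bar>abar (fst y)\<bar> powr qq + \<mu> powr qq * norm (Gs m y) powr p) \<partial>QQ)"
      by (rule integral_mono_AE[OF _ _ S.am_bound[OF ab(2,3)]])
         (use LpD(2)[OF S.am_Lp] LpD(2)[OF S.Lp_fst(1)[OF ab(1)]] LpD(2)[OF S.Gm_Lp] in auto)
    also have "\<dots> = 2 powr qq * ((\<integral>y. norm (abar (fst y)) powr qq \<partial>QQ) + \<mu> powr qq * (\<integral>y. norm (Gs m y) powr p \<partial>QQ))"
      using LpD(2)[OF S.Lp_fst(1)[OF ab(1)]] LpD(2)[OF S.Gm_Lp] by simp
    also have "\<dots> \<le> 2 powr qq * ((\<integral>y. norm (abar (fst y)) powr qq \<partial>QQ) + \<mu> powr qq * BG)"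
      using BG[of m] by (intro mult_left_mono add_left_mono) auto
    finally show ?thesis .
  qed
  then show thesis using that by blast
qed

lemma coercive_const:
  obtains C where "C \<ge> 0" "\<And>m v. (\<And>n. n \<in> {1..gd_N (Ds m)} \<Longrightarrow> v n \<in> gd_X (Ds m)) \<Longrightarrow>
    (\<integral>y. norm (gd_PiST (Ds m) v y) powr p \<partial>QQ) \<le> C * (\<integral>y. norm (gd_gradST (Ds m) v y) powr p \<partial>QQ)"
proof -
  obtain C where C: "\<And>m. gd_CD p \<Omega> (Ds m) \<le> C" using coer unfolding seq_coercive_def by blast
  show thesis using that[of "max C 0 powr p"] S.coercive_bound_ST[OF C] by simp
qed

text \<open>The source term is now cut at a grid time that varies with m and n, so weak convergence
  does not bound it directly. Young's inequality does, with \<open>Zs\<close> controlled by its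
  gradient through coercivity. Quadratic growth of the energy in \<beta> then yields the bound at
  every time level.\<close>

lemma beta_bound:
  obtains B where "\<And>m n. n \<le> gd_N (Ds m) \<Longrightarrow> (\<integral>x. norm (\<beta> (Um m n x)) powr 2 \<partial>LL) \<le> B"
proof -
  interpret finite_measure LL by (rule S.finite_L)
  obtain X where X: "X \<longlonglongrightarrow> 0" "\<And>m. (\<integral>x. En (Um m 0 x) \<partial>LL) \<le> (\<integral>x. En (u_ini x) \<partial>LL) + X m"
    by (rule initial_energy) blast
  obtain BX where BX: "\<And>m. \<bar>X m\<bar> \<le> BX" by (rule tendsto_imp_abs_bounded[OF X(1)]) blast
  obtain BG where BG: "\<And>m. (\<integral>y. norm (Gs m y) powr p \<partial>QQ) \<le> BG" by (rule Gs_bound) blast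
  obtain C where C: "C \<ge> 0" "\<And>m v. (\<And>n. n \<in> {1..gd_N (Ds m)} \<Longrightarrow> v n \<in> gd_X (Ds m)) \<Longrightarrow>
    (\<integral>y. norm (gd_PiST (Ds m) v y) powr p \<partial>QQ) \<le> C * (\<integral>y. norm (gd_gradST (Ds m) v y) powr p \<partial>QQ)"
    by (rule coercive_const) blast
  obtain C1 where C1: "C1 > 0" "\<And>x y::real. \<bar>x \<bullet> y\<bar> \<le> 1 * norm x powr p + C1 * norm y powr qq"
    by (rule inner_le_Young_eps[OF S.p S.q_props(1,2), of 1, where 'b=real]) auto
  obtain al where al: "al > 0" "\<And>m. AE y in QQ. al * norm (Gs m y) powr p \<le> As m y \<bullet> Gs m y"
    by (rule am_Gm_coercive) blast
  define BE where "BE = (\<integral>x. En (u_ini x) \<partial>LL) + BX + (C * BG + C1 * (\<integral>y. norm (f y) powr qq \<partial>QQ))"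
  have E: "(\<integral>x. En (Um m n x) \<partial>LL) \<le> BE" if n: "n \<le> gd_N (Ds m)" for m n
  proof -
    have Z: "(\<integral>y. norm (Zs m y) powr p \<partial>QQ) \<le> C * BG"
      by (rule order_trans[OF C(2) mult_left_mono[OF BG C(1)]]) (rule S.app_X)
    have ifZ: "integrable QQ (\<lambda>y. f y * Zs m y)" by (rule S.integrable_fPi)
    have "(\<integral>y. indicator {..gd_t (Ds m) n} (snd y) * (f y * Zs m y) \<partial>QQ) \<le> (\<integral>y. 1 * norm (Zs m y) powr p + C1 * norm (f y) powr qq \<partial>QQ)"
    proof (rule integral_mono_AE')
      show "integrable QQ (\<lambda>y. 1 * norm (Zs m y) powr p + C1 * norm (f y) powr qq)"
        using LpD(2)[OF S.Zm_Lp[OF S.p0(1)]] LpD(2)[OF S.H_props(8)] by auto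
      show "AE y in QQ. indicator {..gd_t (Ds m) n} (snd y) * (f y * Zs m y) \<le> 1 * norm (Zs m y) powr p + C1 * norm (f y) powr qq"
      proof (intro AE_I2)
        fix y
        have "f y * Zs m y \<le> 1 * norm (Zs m y) powr p + C1 * norm (f y) powr qq"
          using order_trans[OF abs_ge_self C1(2)[of "Zs m y" "f y"]] by (simp add: mult.commute)
        moreover have "0 \<le> 1 * norm (Zs m y) powr p + C1 * norm (f y) powr qq" using C1(1) by simp
        ultimately show "indicator {..gd_t (Ds m) n} (snd y) * (f y * Zs m y) \<le> 1 * norm (Zs m y) powr p + C1 * norm (f y) powr qq"
          by (auto simp: indicator_def)
      qed
      show "AE y in QQ. 0 \<le> 1 * norm (Zs m y) powr p + C1 * norm (f y) powr qq" using C1(1) by simp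
    qed
    also have "\<dots> = (\<integral>y. norm (Zs m y) powr p \<partial>QQ) + C1 * (\<integral>y. norm (f y) powr qq \<partial>QQ)"
      using LpD(2)[OF S.Zm_Lp[OF S.p0(1)]] LpD(2)[OF S.H_props(8)] by simp
    finally have 1: "(\<integral>y. indicator {..gd_t (Ds m) n} (snd y) * (f y * Zs m y) \<partial>QQ) \<le> C * BG + C1 * (\<integral>y. norm (f y) powr qq \<partial>QQ)"
      using Z by linarith
    have "AE y in QQ. 0 \<le> indicator {..gd_t (Ds m) n} (snd y) * (As m y \<bullet> Gs m y)"
      using al(2)[of m]
    proof eventually_elim
      case (elim y)
      have "0 \<le> al * norm (Gs m y) powr p" using al(1) by simp
      then have "0 \<le> As m y \<bullet> Gs m y" using elim by linarith
      then show ?case by simp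
    qed
    then have 2: "0 \<le> (\<integral>y. indicator {..gd_t (Ds m) n} (snd y) * (As m y \<bullet> Gs m y) \<partial>QQ)"
      by (rule integral_nonneg_AE)
    show ?thesis unfolding BE_def using S.discrete_energy[OF n] X(2)[of m] BX[of m] 1 2 by linarith
  qed
  obtain L2 where L2: "L2 > 0" "L2-lipschitz_on UNIV \<beta>" using H unfolding hyp_H_def by blast
  obtain M0 M1 where M: "M0 > 0" "\<And>s. \<bar>\<zeta> s\<bar> \<ge> M0 * \<bar>s\<bar> - M1" using H unfolding hyp_H_def by blast
  obtain k c where k: "k > 0" "c \<ge> 0" "\<And>r. k * (\<beta> r)\<^sup>2 \<le> En r + c"
    by (rule Bfun_coercive[OF S.H_props(4,5,6,2,3) L2 M]) blast
  have "(\<integral>x. norm (\<beta> (Um m n x)) powr 2 \<partial>LL) \<le> (BE + c * measure LL (space LL)) / k" if n: "n \<le> gd_N (Ds m)" for m n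
  proof -
    have "k * (\<integral>x. norm (\<beta> (Um m n x)) powr 2 \<partial>LL) = (\<integral>x. k * norm (\<beta> (Um m n x)) powr 2 \<partial>LL)" by simp
    also have "\<dots> \<le> (\<integral>x. En (Um m n x) + c \<partial>LL)"
      using k(3) S.Pi_compose_integrable[OF S.E_continuous] LpD(2)[OF S.Pi_compose_Lp[OF _ S.H_props(4), of 2]]
      by (intro integral_mono) auto
    also have "\<dots> \<le> BE + c * measure LL (space LL)"
      using E[OF n] S.Pi_compose_integrable[OF S.E_continuous] by (simp add: mult.commute)
    finally show ?thesis using k(1) by (simp add: field_simps)
  qed
  then show thesis using that by blast
qed

end

section \<open>Limit of the scheme against one test function on a time window\<close>

context gdm_sequence
begin

lemma sol_props:
  "ub \<in> borel_measurable QQ" "G \<in> Lp QQ p" "AE t in lebesgue_on {0<..<T}. W0 p \<Omega> (\<lambda>x. \<zeta> (ub (x, t))) (\<lambda>x. G (x, t))"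
  "AE t in lebesgue_on {0<..<T}. integrable LL (\<lambda>x. En (ub (x, t)))"
  "\<And>t. t \<in> {0..T} \<Longrightarrow> w t \<in> Lp LL 2" "\<And>\<phi>. \<phi> \<in> Lp LL 2 \<Longrightarrow> continuous_on {0..T} (\<lambda>t. \<integral>x. w t x * \<phi> x \<partial>LL)"
  "AE y in QQ. w (snd y) (fst y) = \<beta> (ub y)" "AE x in LL. w 0 x = \<beta> (u_ini x)"
proof -
  note s = sol[unfolded cont_solution_def Let_def]
  show "ub \<in> borel_measurable QQ" "G \<in> Lp QQ p" "AE t in lebesgue_on {0<..<T}. W0 p \<Omega> (\<lambda>x. \<zeta> (ub (x, t))) (\<lambda>x. G (x, t))"
    "\<And>t. t \<in> {0..T} \<Longrightarrow> w t \<in> Lp LL 2" "\<And>\<phi>. \<phi> \<in> Lp LL 2 \<Longrightarrow> continuous_on {0..T} (\<lambda>t. \<integral>x. w t x * \<phi> x \<partial>LL)"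
    "AE y in QQ. w (snd y) (fst y) = \<beta> (ub y)" "AE x in LL. w 0 x = \<beta> (u_ini x)"
    using s by blast+
  obtain C where "AE t in lebesgue_on {0<..<T}. integrable LL (\<lambda>x. En (ub (x, t))) \<and> (\<integral>x. \<bar>En (ub (x, t))\<bar> \<partial>LL) \<le> C"
    using s by blast
  then show "AE t in lebesgue_on {0<..<T}. integrable LL (\<lambda>x. En (ub (x, t)))" by eventually_elim auto
qed

lemma AE_snd_neq: "AE y in QQ. snd y \<noteq> (c::real)"
proof -
  have "negligible {y::'a \<times> real. (0, 1) \<bullet> y = c}"
    by (rule negligible_hyperplane) (simp add: zero_prod_def)
  then have "AE y in lebesgue. \<not> ((0::'a, 1::real) \<bullet> y = c)"
    using AE_not_in[of "{y::'a \<times> real. (0, 1) \<bullet> y = c}" lebesgue] by (simp add: negligible_iff_null_sets)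
  then show ?thesis
    using S.sets_Q by (auto simp: AE_restrict_space_iff inner_prod_def elim!: eventually_mono)
qed

lemma indicator_snd_measurable: "(\<lambda>y. indicat_real {s1<..s2} (snd y)) \<in> borel_measurable QQ"
proof -
  have "{y :: 'a \<times> real. s1 < snd y \<and> snd y \<le> s2} = UNIV \<times> {s1<..s2}" by auto
  also have "\<dots> \<in> sets borel" by (intro borel_Times) auto
  finally have "{y :: 'a \<times> real. s1 < snd y \<and> snd y \<le> s2} \<in> sets lebesgue"
    by (simp only: sets_completionI_sets sets_lborel)
  then have "indicat_real {y :: 'a \<times> real. s1 < snd y \<and> snd y \<le> s2} \<in> borel_measurable QQ"
    by (intro measurable_restrict_space1) auto
  moreover have "indicat_real {y :: 'a \<times> real. s1 < snd y \<and> snd y \<le> s2} = (\<lambda>y. indicat_real {s1<..s2} (snd y))"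
    by (auto simp: indicator_def fun_eq_iff)
  ultimately show ?thesis by simp
qed

lemma indicator_Lp:
  fixes F :: "'a \<Rightarrow> 'c::euclidean_space"
  assumes "F \<in> Lp LL r"
  shows "(\<lambda>y. indicat_real {s1<..s2} (snd y) *\<^sub>R F (fst y)) \<in> Lp QQ r"
proof (rule Lp_bound[OF _ LpD(2)[OF S.Lp_fst(1)[OF assms]]])
  show "(\<lambda>y. indicat_real {s1<..s2} (snd y) *\<^sub>R F (fst y)) \<in> borel_measurable QQ"
    using indicator_snd_measurable LpD(1)[OF S.Lp_fst(1)[OF assms]] by (rule borel_measurable_scaleR)
qed (auto simp: indicator_def)

text \<open>The indicator of (s1, s2] at the right end of the time slab containing \<tau>. It is
  constant on slabs, hence a legitimate time profile of a discrete test function.\<close>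

definition step_ind :: "real \<Rightarrow> real \<Rightarrow> nat \<Rightarrow> real \<Rightarrow> real" where
  "step_ind s1 s2 m \<tau> = (if s1 < gd_t (Ds m) (gd_step (Ds m) \<tau>) \<and> gd_t (Ds m) (gd_step (Ds m) \<tau>) \<le> s2 then 1 else 0)"

lemma step_ind_measurable: "(\<lambda>y. step_ind s1 s2 m (snd y)) \<in> borel_measurable QQ"
  using S.measurable_steps[of m "\<lambda>n x. if s1 < gd_t (Ds m) n \<and> gd_t (Ds m) n \<le> s2 then 1 else (0::real)"]
  by (simp add: step_ind_def[abs_def])

lemma dtmax_tendsto: "(\<lambda>m. gd_dtmax (Ds m)) \<longlonglongrightarrow> 0"
  using cons unfolding seq_consistent_def by blast

lemma step_ind_tendsto:
  assumes "0 < \<tau>" "\<tau> < T" "\<tau> \<noteq> s1" "\<tau> \<noteq> s2"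
  shows "(\<lambda>m. step_ind s1 s2 m \<tau>) \<longlonglongrightarrow> indicator {s1<..s2} \<tau>"
proof (rule tendsto_eventually)
  have near: "\<tau> \<le> gd_t (Ds m) (gd_step (Ds m) \<tau>)" "gd_t (Ds m) (gd_step (Ds m) \<tau>) \<le> \<tau> + gd_dtmax (Ds m)" for m
    using S.step_near[of \<tau> m] assms by auto
  \<comment> \<open>Rounding up moves \<tau> to the right by at most \<open>gd_dtmax\<close>. Once
    this is less than the distance to an endpoint lying ahead, that endpoint is not crossed.\<close>
  have s: "\<forall>\<^sub>F m in sequentially. c < 0 \<or> gd_dtmax (Ds m) < c" if "c \<noteq> 0" for c :: real
    using order_tendstoD(2)[OF dtmax_tendsto, of c] that by (cases "c > 0") (auto elim!: eventually_mono)
  have "\<forall>\<^sub>F m in sequentially. s1 - \<tau> < 0 \<or> gd_dtmax (Ds m) < s1 - \<tau>"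
    "\<forall>\<^sub>F m in sequentially. s2 - \<tau> < 0 \<or> gd_dtmax (Ds m) < s2 - \<tau>"
    by (rule s, use assms in simp)+
  then show "\<forall>\<^sub>F m in sequentially. step_ind s1 s2 m \<tau> = indicator {s1<..s2} \<tau>"
  proof eventually_elim
    case (elim m)
    then show ?case using near[of m] assms(3,4) by (auto simp: step_ind_def indicator_def)
  qed
qed

lemma step_ind_Lp_tendsto:
  fixes F :: "'a \<Rightarrow> 'c::euclidean_space"
  assumes F: "F \<in> Lp LL r" and r: "r > 0"
  shows "(\<lambda>y. (step_ind s1 s2 m (snd y) - indicator {s1<..s2} (snd y)) *\<^sub>R F (fst y)) \<in> Lp QQ r"
    "(\<lambda>m. \<integral>y. norm ((step_ind s1 s2 m (snd y) - indicator {s1<..s2} (snd y)) *\<^sub>R F (fst y)) powr r \<partial>QQ) \<longlonglongrightarrow> 0"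
proof -
  let ?h = "\<lambda>m y. (step_ind s1 s2 m (snd y) - indicator {s1<..s2} (snd y)) *\<^sub>R F (fst y)"
  note Fq = LpD[OF S.Lp_fst(1)[OF F]]
  have [measurable]: "?h m \<in> borel_measurable QQ" for m
    using step_ind_measurable indicator_snd_measurable Fq(1)
    by (intro borel_measurable_scaleR borel_measurable_diff)
  have le: "norm (?h m y) powr r \<le> norm (F (fst y)) powr r" for m y
    using r by (intro powr_mono2) (auto simp: step_ind_def indicator_def)
  show "?h m \<in> Lp QQ r" for m
    by (rule Lp_bound[OF _ Fq(2)]) (use le in auto)
  have "(\<lambda>m. \<integral>y. norm (?h m y) powr r \<partial>QQ) \<longlonglongrightarrow> (\<integral>y. 0 \<partial>QQ)"
  proof (rule integral_dominated_convergence[OF _ _ Fq(2)])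
    show "AE y in QQ. (\<lambda>m. norm (?h m y) powr r) \<longlonglongrightarrow> 0"
      using AE_snd_neq[of s1] AE_snd_neq[of s2] AE_space
    proof eventually_elim
      case (elim y)
      then have y: "0 < snd y" "snd y < T" using S.space_Q[of y] by auto
      have "(\<lambda>m. norm (?h m y) powr r) \<longlonglongrightarrow> norm ((indicat_real {s1<..s2} (snd y) - indicator {s1<..s2} (snd y)) *\<^sub>R F (fst y)) powr r"
        using r by (intro tendsto_powr2 tendsto_intros step_ind_tendsto y elim(1,2)) auto
      then show ?case using r by simp
    qed
    show "AE y in QQ. norm (norm (?h m y) powr r) \<le> norm (F (fst y)) powr r" for m
      using le by auto
    show "(\<lambda>y. norm (?h m y) powr r) \<in> borel_measurable QQ" for m by measurable
  qed auto
  then show "(\<lambda>m. \<integral>y. norm (?h m y) powr r \<partial>QQ) \<longlonglongrightarrow> 0" by simp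
qed

lemma step_ind_times_Lp_tendsto:
  fixes F :: "nat \<Rightarrow> 'a \<Rightarrow> 'c::euclidean_space"
  assumes F: "\<And>m. F m \<in> Lp LL r" and r: "r > 0" and lim: "(\<lambda>m. \<integral>x. norm (F m x) powr r \<partial>LL) \<longlonglongrightarrow> 0"
  shows "(\<lambda>y. step_ind s1 s2 m (snd y) *\<^sub>R F m (fst y)) \<in> Lp QQ r"
    "(\<lambda>m. \<integral>y. norm (step_ind s1 s2 m (snd y) *\<^sub>R F m (fst y)) powr r \<partial>QQ) \<longlonglongrightarrow> 0"
proof -
  let ?h = "\<lambda>m y. step_ind s1 s2 m (snd y) *\<^sub>R F m (fst y)"
  have le: "norm (?h m y) powr r \<le> norm (F m (fst y)) powr r" for m y
    using r by (intro powr_mono2) (auto simp: step_ind_def)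
  show h: "?h m \<in> Lp QQ r" for m
    by (rule Lp_bound[OF _ LpD(2)[OF S.Lp_fst(1)[OF F[of m]]]])
       (use le in \<open>auto intro!: borel_measurable_scaleR step_ind_measurable LpD(1)[OF S.Lp_fst(1)[OF F]]\<close>)
  show "(\<lambda>m. \<integral>y. norm (?h m y) powr r \<partial>QQ) \<longlonglongrightarrow> 0"
  proof (rule tendsto_sandwich[OF _ _ tendsto_const])
    show "(\<lambda>m. T * (\<integral>x. norm (F m x) powr r \<partial>LL)) \<longlonglongrightarrow> 0"
      using tendsto_mult[OF tendsto_const lim, of T] by simp
    have "(\<integral>y. norm (?h m y) powr r \<partial>QQ) \<le> (\<integral>y. norm (F m (fst y)) powr r \<partial>QQ)" for m
      using le LpD(2)[OF h] LpD(2)[OF S.Lp_fst(1)[OF F]] by (intro integral_mono) auto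
    then show "\<forall>\<^sub>F m in sequentially. (\<integral>y. norm (?h m y) powr r \<partial>QQ) \<le> T * (\<integral>x. norm (F m x) powr r \<partial>LL)"
      by (simp add: S.Lp_fst(2)[OF F])
  qed auto
qed

text \<open>Near minimisers of the consistency error; the slack 1 / (m + 1) avoids asking whether
  the infimum is attained. The exponent \<open>max p 2\<close> yields convergence in L^p for the
  source term and in L^2 for the pairing with \<beta>.\<close>

lemma interpolant:
  assumes \<phi>: "\<phi> \<in> Lp LL 2" and W: "W0 p \<Omega> \<phi> g"
  obtains v where "\<And>m. v m \<in> gd_X (Ds m)"
    "(\<lambda>m. \<integral>x. norm (gd_Pi (Ds m) (v m) x - \<phi> x) powr p \<partial>LL) \<longlonglongrightarrow> 0"
    "(\<lambda>m. \<integral>x. norm (gd_Pi (Ds m) (v m) x - \<phi> x) powr 2 \<partial>LL) \<longlonglongrightarrow> 0"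
    "(\<lambda>m. \<integral>x. norm (gd_grad (Ds m) (v m) x - g x) powr p \<partial>LL) \<longlonglongrightarrow> 0"
proof -
  let ?r = "max p 2"
  let ?e = "\<lambda>m v. Lp_norm LL ?r (\<lambda>x. gd_Pi (Ds m) v x - \<phi> x) + Lp_norm LL p (\<lambda>x. gd_grad (Ds m) v x - g x)"
  have S0: "(\<lambda>m. gd_Shat p \<Omega> (Ds m) \<phi> g) \<longlonglongrightarrow> 0"
    using cons \<phi> W unfolding seq_consistent_def by blast
  have "\<forall>m. \<exists>v. v \<in> gd_X (Ds m) \<and> ?e m v < gd_Shat p \<Omega> (Ds m) \<phi> g + 1 / real (Suc m)"
  proof
    fix m
    have "Inf {?e m v | v. v \<in> gd_X (Ds m)} < gd_Shat p \<Omega> (Ds m) \<phi> g + 1 / real (Suc m)"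
      unfolding gd_Shat_def by simp
    then show "\<exists>v. v \<in> gd_X (Ds m) \<and> ?e m v < gd_Shat p \<Omega> (Ds m) \<phi> g + 1 / real (Suc m)"
      using cInf_lessD[of "{?e m v | v. v \<in> gd_X (Ds m)}"] S.zero_X[of m] by blast
  qed
  from choice[OF this] obtain v where v: "\<And>m. v m \<in> gd_X (Ds m)" "\<And>m. ?e m (v m) < gd_Shat p \<Omega> (Ds m) \<phi> g + 1 / real (Suc m)"
    by blast
  have nn: "Lp_norm LL r F \<ge> 0" for r and F :: "'a \<Rightarrow> 'd::euclidean_space" by (simp add: Lp_norm_def)
  have up: "(\<lambda>m. gd_Shat p \<Omega> (Ds m) \<phi> g + 1 / real (Suc m)) \<longlonglongrightarrow> 0"
    using tendsto_add[OF S0 LIMSEQ_Suc[OF lim_const_over_n[of 1]]] by simp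
  have a: "(\<lambda>m. Lp_norm LL ?r (\<lambda>x. gd_Pi (Ds m) (v m) x - \<phi> x)) \<longlonglongrightarrow> 0"
  proof (rule tendsto_sandwich[OF _ _ tendsto_const up])
    show "\<forall>\<^sub>F m in sequentially. Lp_norm LL ?r (\<lambda>x. gd_Pi (Ds m) (v m) x - \<phi> x) \<le> gd_Shat p \<Omega> (Ds m) \<phi> g + 1 / real (Suc m)"
    proof (intro always_eventually allI)
      fix m show "Lp_norm LL ?r (\<lambda>x. gd_Pi (Ds m) (v m) x - \<phi> x) \<le> gd_Shat p \<Omega> (Ds m) \<phi> g + 1 / real (Suc m)"
        using v(2)[of m] nn[of p "\<lambda>x. gd_grad (Ds m) (v m) x - g x"] by linarith
    qed
  qed (simp add: nn)
  have b: "(\<lambda>m. Lp_norm LL p (\<lambda>x. gd_grad (Ds m) (v m) x - g x)) \<longlonglongrightarrow> 0"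
  proof (rule tendsto_sandwich[OF _ _ tendsto_const up])
    show "\<forall>\<^sub>F m in sequentially. Lp_norm LL p (\<lambda>x. gd_grad (Ds m) (v m) x - g x) \<le> gd_Shat p \<Omega> (Ds m) \<phi> g + 1 / real (Suc m)"
    proof (intro always_eventually allI)
      fix m show "Lp_norm LL p (\<lambda>x. gd_grad (Ds m) (v m) x - g x) \<le> gd_Shat p \<Omega> (Ds m) \<phi> g + 1 / real (Suc m)"
        using v(2)[of m] nn[of ?r "\<lambda>x. gd_Pi (Ds m) (v m) x - \<phi> x"] by linarith
    qed
  qed (simp add: nn)
  have \<phi>r: "\<phi> \<in> Lp LL ?r" using \<phi> W by (auto simp: W0_def max_def)
  have d: "(\<lambda>x. gd_Pi (Ds m) (v m) x - \<phi> x) \<in> Lp LL ?r" for m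
    using Lp_diff[OF _ S.Pi_Lp \<phi>r] by simp
  have a': "(\<lambda>m. \<integral>x. norm (gd_Pi (Ds m) (v m) x - \<phi> x) powr ?r \<partial>LL) \<longlonglongrightarrow> 0"
    using a S.p0 by (subst (asm) Lp_norm_tendsto_0_iff) auto
  show thesis
  proof (rule that[of v])
    show "v m \<in> gd_X (Ds m)" for m by (rule v)
    show "(\<lambda>m. \<integral>x. norm (gd_Pi (Ds m) (v m) x - \<phi> x) powr p \<partial>LL) \<longlonglongrightarrow> 0"
      by (rule Lp_tendsto_mono_exponent[OF S.finite_L S.p0(2) _ d a']) simp
    show "(\<lambda>m. \<integral>x. norm (gd_Pi (Ds m) (v m) x - \<phi> x) powr 2 \<partial>LL) \<longlonglongrightarrow> 0"
      by (rule Lp_tendsto_mono_exponent[OF S.finite_L _ _ d a']) simp_all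
    show "(\<lambda>m. \<integral>x. norm (gd_grad (Ds m) (v m) x - g x) powr p \<partial>LL) \<longlonglongrightarrow> 0"
      using b S.p0 by (subst (asm) Lp_norm_tendsto_0_iff) auto
  qed
qed

text \<open>The grid time \<open>?\<tau> m\<close> moves with m. Uniformity of the weak convergence
  replaces the discrete value by \<open>w\<close> at \<open>?\<tau> m\<close>, and weak continuity
  of \<open>w\<close> moves that time to \<open>s\<close>. Exchanging \<phi> for its interpolant is
  harmless because \<beta> is bounded in L^2 at every level.\<close>

lemma beta_last_step_tendsto:
  assumes s: "0 \<le> s" "s \<le> T" and \<phi>: "\<phi> \<in> Lp LL 2"
    and v2: "(\<lambda>m. \<integral>x. norm (gd_Pi (Ds m) (v m) x - \<phi> x) powr 2 \<partial>LL) \<longlonglongrightarrow> 0"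
  shows "(\<lambda>m. \<integral>x. \<beta> (Um m (S.last_step m s) x) * gd_Pi (Ds m) (v m) x \<partial>LL) \<longlonglongrightarrow> (\<integral>x. w s x * \<phi> x \<partial>LL)"
proof -
  let ?n = "\<lambda>m. S.last_step m s"
  let ?\<tau> = "\<lambda>m. gd_t (Ds m) (?n m)"
  obtain B where B: "\<And>m n. n \<le> gd_N (Ds m) \<Longrightarrow> (\<integral>x. norm (\<beta> (Um m n x)) powr 2 \<partial>LL) \<le> B"
    by (rule beta_bound) blast
  have n: "?n m \<le> gd_N (Ds m)" for m by (rule S.last_step[OF s])
  have b2: "(\<lambda>x. \<beta> (Um m (?n m) x)) \<in> Lp LL 2" for m by (rule S.Pi_compose_Lp[OF _ S.H_props(4)]) simp
  have d2: "(\<lambda>x. gd_Pi (Ds m) (v m) x - \<phi> x) \<in> Lp LL 2" for m by (rule Lp_diff[OF _ S.Pi_Lp \<phi>]) auto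
  have 1: "(\<lambda>m. \<integral>x. \<beta> (Um m (?n m) x) \<bullet> (gd_Pi (Ds m) (v m) x - \<phi> x) \<partial>LL) \<longlonglongrightarrow> 0"
    by (rule integral_inner_small[OF _ _ _ b2 d2 B[OF n] v2]) auto
  have \<tau>0: "(\<lambda>m. ?\<tau> m) \<longlonglongrightarrow> s"
  proof (rule tendsto_sandwich)
    show "(\<lambda>m. s - gd_dtmax (Ds m)) \<longlonglongrightarrow> s" using tendsto_diff[OF tendsto_const dtmax_tendsto, of s] by simp
    show "\<forall>\<^sub>F m in sequentially. s - gd_dtmax (Ds m) \<le> ?\<tau> m"
      using S.last_step(4)[OF s] by (intro always_eventually allI) (simp add: algebra_simps)
    show "\<forall>\<^sub>F m in sequentially. ?\<tau> m \<le> s" using S.last_step(3)[OF s] by auto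
  qed auto
  have \<tau>in: "?\<tau> m \<in> {0..T}" for m using S.t_range[OF n] by auto
  have "((\<lambda>t. \<integral>x. w t x * \<phi> x \<partial>LL) \<longlongrightarrow> (\<integral>x. w s x * \<phi> x \<partial>LL)) (at s within {0..T})"
    using sol_props(6)[OF \<phi>] s by (auto simp: continuous_on_def)
  then have 2: "(\<lambda>m. \<integral>x. w (?\<tau> m) x * \<phi> x \<partial>LL) \<longlonglongrightarrow> (\<integral>x. w s x * \<phi> x \<partial>LL)"
    using sol_props(6)[OF \<phi>] \<tau>0 \<tau>in s by (intro continuous_on_tendsto_compose[OF sol_props(6)[OF \<phi>]]) auto
  have eq: "(\<integral>x. gd_PiST (Ds m) (gd_app (Ds m) \<beta> (us m)) (x, ?\<tau> m) * \<phi> x \<partial>LL) = (\<integral>x. \<beta> (Um m (?n m) x) * \<phi> x \<partial>LL)" for m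
    by (rule Bochner_Integration.integral_cong)
       (auto simp: gd_PiST_def S.step_at[OF n] S.Pi_app)
  have 3: "(\<lambda>m. (\<integral>x. \<beta> (Um m (?n m) x) * \<phi> x \<partial>LL) - (\<integral>x. w (?\<tau> m) x * \<phi> x \<partial>LL)) \<longlonglongrightarrow> 0"
    unfolding tendsto_iff
  proof (intro allI impI)
    fix e :: real assume "e > 0"
    then have "\<forall>\<^sub>F m in sequentially. \<forall>t\<in>{0..T}. dist (\<integral>x. gd_PiST (Ds m) (gd_app (Ds m) \<beta> (us m)) (x, t) * \<phi> x \<partial>LL) (\<integral>x. w t x * \<phi> x \<partial>LL) < e"
      using conv_beta \<phi> unfolding uniform_limit_iff by blast
    then show "\<forall>\<^sub>F m in sequentially. dist ((\<integral>x. \<beta> (Um m (?n m) x) * \<phi> x \<partial>LL) - (\<integral>x. w (?\<tau> m) x * \<phi> x \<partial>LL)) 0 < e"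
    proof eventually_elim
      case (elim m)
      from bspec[OF elim \<tau>in[of m]] show ?case unfolding eq by (simp add: dist_real_def)
    qed
  qed
  have split: "(\<integral>x. \<beta> (Um m (?n m) x) * gd_Pi (Ds m) (v m) x \<partial>LL)
      = (\<integral>x. \<beta> (Um m (?n m) x) \<bullet> (gd_Pi (Ds m) (v m) x - \<phi> x) \<partial>LL) + (\<integral>x. \<beta> (Um m (?n m) x) * \<phi> x \<partial>LL)" for m
  proof -
    have "integrable LL (\<lambda>x. \<beta> (Um m (?n m) x) * (gd_Pi (Ds m) (v m) x - \<phi> x))" "integrable LL (\<lambda>x. \<beta> (Um m (?n m) x) * \<phi> x)"
      using integrable_mult_Lp[OF _ _ _ b2 d2] integrable_mult_Lp[OF _ _ _ b2 \<phi>] by auto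
    then show ?thesis
      by (subst Bochner_Integration.integral_add[symmetric]) (auto simp: algebra_simps)
  qed
  show ?thesis
    using tendsto_add[OF 1 tendsto_add[OF 3 2]] by (simp add: split)
qed

text \<open>The test function is one interpolant in space, switched on at the grid points of (s1,
  s2], so the discrete time derivative telescopes to the two ends of the window. This gives the
  limit of the flux against a single step without identifying a weak limit of the flux
  itself.\<close>

lemma test_step:
  assumes \<phi>: "\<phi> \<in> Lp LL 2" and W: "W0 p \<Omega> \<phi> g" and s: "0 \<le> s1" "s1 < s2" "s2 \<le> T"
  obtains v where "\<And>m n. v m n \<in> gd_X (Ds m)"
    "(\<lambda>m. \<integral>y. norm (gd_PiST (Ds m) (v m) y - indicat_real {s1<..s2} (snd y) *\<^sub>R \<phi> (fst y)) powr p \<partial>QQ) \<longlonglongrightarrow> 0"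
    "(\<lambda>m. \<integral>y. norm (gd_gradST (Ds m) (v m) y - indicat_real {s1<..s2} (snd y) *\<^sub>R g (fst y)) powr p \<partial>QQ) \<longlonglongrightarrow> 0"
    "(\<lambda>m. \<integral>y. As m y \<bullet> (indicat_real {s1<..s2} (snd y) *\<^sub>R g (fst y)) \<partial>QQ)
      \<longlonglongrightarrow> (\<integral>y. f y * (indicat_real {s1<..s2} (snd y) *\<^sub>R \<phi> (fst y)) \<partial>QQ) - (\<integral>x. (w s2 x - w s1 x) * \<phi> x \<partial>LL)"
proof -
  obtain W where W': "\<And>m. W m \<in> gd_X (Ds m)"
    "(\<lambda>m. \<integral>x. norm (gd_Pi (Ds m) (W m) x - \<phi> x) powr p \<partial>LL) \<longlonglongrightarrow> 0"
    "(\<lambda>m. \<integral>x. norm (gd_Pi (Ds m) (W m) x - \<phi> x) powr 2 \<partial>LL) \<longlonglongrightarrow> 0"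
    "(\<lambda>m. \<integral>x. norm (gd_grad (Ds m) (W m) x - g x) powr p \<partial>LL) \<longlonglongrightarrow> 0"
    by (rule interpolant[OF \<phi> W]) blast
  have \<phi>p: "\<phi> \<in> Lp LL p" and gp: "g \<in> Lp LL p" using W by (auto simp: W0_def)
  have s': "0 \<le> s2" "s1 \<le> T" using s by auto
  let ?I = "indicat_real {s1<..s2}"
  let ?\<iota> = "step_ind s1 s2"
  define v where "v m n = (if s1 < gd_t (Ds m) n \<and> gd_t (Ds m) n \<le> s2 then W m else (\<lambda>i. 0))" for m n
  have vX: "v m n \<in> gd_X (Ds m)" for m n by (simp add: v_def W' S.zero_X)
  have Pi: "gd_PiST (Ds m) (v m) y = ?\<iota> m (snd y) *\<^sub>R gd_Pi (Ds m) (W m) (fst y)" for m y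
    by (simp add: gd_PiST_def split_beta' v_def step_ind_def S.Pi_zero)
  have gr: "AE y in QQ. gd_gradST (Ds m) (v m) y = ?\<iota> m (snd y) *\<^sub>R gd_grad (Ds m) (W m) (fst y)" for m
    using AE_lebesgue_on_fst[OF S.grad_zero S.sets_Omega S.sets_Q, of m]
    by eventually_elim (simp add: gd_gradST_def split_beta' v_def step_ind_def)
  have dP: "(\<lambda>x. gd_Pi (Ds m) (W m) x - \<phi> x) \<in> Lp LL p" for m
    by (rule Lp_diff[OF S.p0(1) S.Pi_Lp[OF S.p0(1)] \<phi>p])
  have dG: "(\<lambda>x. gd_grad (Ds m) (W m) x - g x) \<in> Lp LL p" for m
    by (rule Lp_diff[OF S.p0(1) S.D_props(5)[OF W'(1)] gp])
  have cP: "(\<lambda>m. \<integral>y. norm (gd_PiST (Ds m) (v m) y - ?I (snd y) *\<^sub>R \<phi> (fst y)) powr p \<partial>QQ) \<longlonglongrightarrow> 0"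
  proof -
    have "(\<lambda>m. \<integral>y. norm (?\<iota> m (snd y) *\<^sub>R (gd_Pi (Ds m) (W m) (fst y) - \<phi> (fst y)) + (?\<iota> m (snd y) - ?I (snd y)) *\<^sub>R \<phi> (fst y)) powr p \<partial>QQ) \<longlonglongrightarrow> 0"
      by (rule Lp_tendsto_add[OF S.p0(1) step_ind_times_Lp_tendsto(1)[OF dP S.p0(2) W'(2)] step_ind_Lp_tendsto(1)[OF \<phi>p S.p0(2)]
        step_ind_times_Lp_tendsto(2)[OF dP S.p0(2) W'(2)] step_ind_Lp_tendsto(2)[OF \<phi>p S.p0(2)]])
    then show ?thesis by (simp add: Pi algebra_simps)
  qed
  have grL: "gd_gradST (Ds m) (v m) \<in> Lp QQ p" for m by (rule S.gradST_Lp[OF vX])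
  have IgL: "(\<lambda>y. ?I (snd y) *\<^sub>R g (fst y)) \<in> Lp QQ p" by (rule indicator_Lp[OF gp])
  have I\<phi>L: "(\<lambda>y. ?I (snd y) *\<^sub>R \<phi> (fst y)) \<in> Lp QQ p" by (rule indicator_Lp[OF \<phi>p])
  have dgL: "(\<lambda>y. gd_gradST (Ds m) (v m) y - ?I (snd y) *\<^sub>R g (fst y)) \<in> Lp QQ p" for m
    by (rule Lp_diff[OF S.p0(1) grL IgL])
  have cG: "(\<lambda>m. \<integral>y. norm (gd_gradST (Ds m) (v m) y - ?I (snd y) *\<^sub>R g (fst y)) powr p \<partial>QQ) \<longlonglongrightarrow> 0"
  proof -
    let ?h = "\<lambda>m y. ?\<iota> m (snd y) *\<^sub>R (gd_grad (Ds m) (W m) (fst y) - g (fst y)) + (?\<iota> m (snd y) - ?I (snd y)) *\<^sub>R g (fst y)"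
    have hL: "?h m \<in> Lp QQ p" for m
      by (rule Lp_add[OF S.p0(1) step_ind_times_Lp_tendsto(1)[OF dG S.p0(2) W'(4)] step_ind_Lp_tendsto(1)[OF gp S.p0(2)]])
    have "(\<lambda>m. \<integral>y. norm (?h m y) powr p \<partial>QQ) \<longlonglongrightarrow> 0"
      by (rule Lp_tendsto_add[OF S.p0(1) step_ind_times_Lp_tendsto(1)[OF dG S.p0(2) W'(4)] step_ind_Lp_tendsto(1)[OF gp S.p0(2)]
        step_ind_times_Lp_tendsto(2)[OF dG S.p0(2) W'(4)] step_ind_Lp_tendsto(2)[OF gp S.p0(2)]])
    moreover have "(\<integral>y. norm (gd_gradST (Ds m) (v m) y - ?I (snd y) *\<^sub>R g (fst y)) powr p \<partial>QQ) = (\<integral>y. norm (?h m y) powr p \<partial>QQ)" for m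
    proof (rule integral_cong_AE)
      show "AE y in QQ. norm (gd_gradST (Ds m) (v m) y - ?I (snd y) *\<^sub>R g (fst y)) powr p = norm (?h m y) powr p"
        using gr[of m] by eventually_elim (simp add: algebra_simps)
    qed (use borel_measurable_integrable[OF LpD(2)[OF dgL[of m]]] borel_measurable_integrable[OF LpD(2)[OF hL[of m]]] in auto)
    ultimately show ?thesis by simp
  qed
  let ?S = "\<lambda>m. \<Sum>n=1..gd_N (Ds m). \<integral>x. (\<beta> (Um m n x) - \<beta> (Um m (n - 1) x)) * gd_Pi (Ds m) (v m n) x \<partial>LL"
  let ?b = "\<lambda>m n. \<integral>x. \<beta> (Um m n x) * gd_Pi (Ds m) (W m) x \<partial>LL"
  have tele: "?S m = ?b m (S.last_step m s2) - ?b m (S.last_step m s1)" for m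
  proof -
    let ?n1 = "S.last_step m s1" and ?n2 = "S.last_step m s2"
    note l1 = S.last_step[OF s(1) s'(2), where m = m] and l2 = S.last_step[OF s'(1) s(3), where m = m]
    have n12: "?n1 \<le> ?n2" using l2(2)[OF l1(1)] l1(3) s by simp
    have "?S m = (\<Sum>n=1..gd_N (Ds m). if n \<in> {Suc ?n1..?n2} then ?b m n - ?b m (n - 1) else 0)"
    proof (rule sum.cong[OF refl])
      fix n assume n: "n \<in> {1..gd_N (Ds m)}"
      have "(s1 < gd_t (Ds m) n \<and> gd_t (Ds m) n \<le> s2) \<longleftrightarrow> n \<in> {Suc ?n1..?n2}"
        using l1(2)[of n] l2(2)[of n] n by auto
      then show "(\<integral>x. (\<beta> (Um m n x) - \<beta> (Um m (n - 1) x)) * gd_Pi (Ds m) (v m n) x \<partial>LL)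
        = (if n \<in> {Suc ?n1..?n2} then ?b m n - ?b m (n - 1) else 0)"
        by (simp add: v_def S.Pi_zero left_diff_distrib S.integrable_beta_Pi)
    qed
    also have "\<dots> = (\<Sum>n\<in>{Suc ?n1..?n2}. ?b m n - ?b m (n - 1))"
      using l2(1) by (subst sum.inter_restrict[symmetric]) (auto intro!: sum.cong)
    also have "\<dots> = ?b m ?n2 - ?b m ?n1"
      using n12 by (induction rule: dec_induct) auto
    finally show ?thesis .
  qed
  have cS: "?S \<longlonglongrightarrow> (\<integral>x. w s2 x * \<phi> x \<partial>LL) - (\<integral>x. w s1 x * \<phi> x \<partial>LL)"
    unfolding tele using tendsto_diff[OF beta_last_step_tendsto[OF s'(1) s(3) \<phi> W'(3)] beta_last_step_tendsto[OF s(1) s'(2) \<phi> W'(3)]] .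
  have iw: "integrable LL (\<lambda>x. w s x * \<phi> x)" if "0 \<le> s" "s \<le> T" for s
    using integrable_mult_Lp[OF _ _ _ sol_props(5) \<phi>, of s] that by auto
  have lim_w: "(\<integral>x. w s2 x * \<phi> x \<partial>LL) - (\<integral>x. w s1 x * \<phi> x \<partial>LL) = (\<integral>x. (w s2 x - w s1 x) * \<phi> x \<partial>LL)"
    using iw[of s1] iw[of s2] s s' by (simp add: left_diff_distrib)
  have cf: "(\<lambda>m. \<integral>y. f y * gd_PiST (Ds m) (v m) y \<partial>QQ) \<longlonglongrightarrow> (\<integral>y. f y * (?I (snd y) *\<^sub>R \<phi> (fst y)) \<partial>QQ)"
  proof -
    have dL: "(\<lambda>y. gd_PiST (Ds m) (v m) y - ?I (snd y) *\<^sub>R \<phi> (fst y)) \<in> Lp QQ p" for m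
      by (rule Lp_diff[OF S.p0(1) S.PiST_Lp[OF S.p0(1)] I\<phi>L])
    have "(\<lambda>m. \<integral>y. f y \<bullet> (gd_PiST (Ds m) (v m) y - ?I (snd y) *\<^sub>R \<phi> (fst y)) \<partial>QQ) \<longlonglongrightarrow> 0"
      by (rule integral_inner_small[OF S.q_props(1) S.p S.q_props(3) S.H_props(8) dL order_refl cP])
    moreover have "(\<integral>y. f y \<bullet> (gd_PiST (Ds m) (v m) y - ?I (snd y) *\<^sub>R \<phi> (fst y)) \<partial>QQ)
       = (\<integral>y. f y * gd_PiST (Ds m) (v m) y \<partial>QQ) - (\<integral>y. f y * (?I (snd y) *\<^sub>R \<phi> (fst y)) \<partial>QQ)" for m
      using S.integrable_fPi[of m "v m"] integrable_mult_Lp[OF S.q_props(1) S.p S.q_props(3) S.H_props(8) I\<phi>L]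
      by (simp add: right_diff_distrib)
    ultimately show ?thesis by (simp add: LIM_zero_iff)
  qed
  obtain BA where BA: "\<And>m. (\<integral>y. norm (As m y) powr qq \<partial>QQ) \<le> BA" by (rule As_bound) blast
  have cA: "(\<lambda>m. \<integral>y. As m y \<bullet> (gd_gradST (Ds m) (v m) y - ?I (snd y) *\<^sub>R g (fst y)) \<partial>QQ) \<longlonglongrightarrow> 0"
    by (rule integral_inner_small[OF S.q_props(1) S.p S.q_props(3) S.am_Lp dgL BA cG])
  have "(\<integral>y. As m y \<bullet> (?I (snd y) *\<^sub>R g (fst y)) \<partial>QQ)
     = (\<integral>y. f y * gd_PiST (Ds m) (v m) y \<partial>QQ) - ?S m - (\<integral>y. As m y \<bullet> (gd_gradST (Ds m) (v m) y - ?I (snd y) *\<^sub>R g (fst y)) \<partial>QQ)" for m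
  proof -
    have "(\<integral>y. As m y \<bullet> (gd_gradST (Ds m) (v m) y - ?I (snd y) *\<^sub>R g (fst y)) \<partial>QQ)
      = (\<integral>y. As m y \<bullet> gd_gradST (Ds m) (v m) y \<partial>QQ) - (\<integral>y. As m y \<bullet> (?I (snd y) *\<^sub>R g (fst y)) \<partial>QQ)"
      unfolding inner_diff_right using S.integrable_am[OF grL] S.integrable_am[OF IgL] by (rule Bochner_Integration.integral_diff)
    then show ?thesis using S.tested_scheme[of m "v m", OF vX] by linarith
  qed
  then have cc: "(\<lambda>m. \<integral>y. As m y \<bullet> (?I (snd y) *\<^sub>R g (fst y)) \<partial>QQ)
      \<longlonglongrightarrow> (\<integral>y. f y * (?I (snd y) *\<^sub>R \<phi> (fst y)) \<partial>QQ) - (\<integral>x. (w s2 x - w s1 x) * \<phi> x \<partial>LL)"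
    using tendsto_diff[OF tendsto_diff[OF cf cS] cA] lim_w by simp
  show thesis by (rule that[OF vX cP cG cc])
qed

end

section \<open>Step functions in time and the energy balance\<close>

lemma Lp_tendsto_sum:
  assumes p: "p > 0" and F: "\<And>i m. i \<in> I \<Longrightarrow> F i m \<in> Lp M p"
    and l: "\<And>i. i \<in> I \<Longrightarrow> (\<lambda>m::nat. \<integral>x. norm (F i m x) powr p \<partial>M) \<longlonglongrightarrow> 0"
  shows "(\<lambda>m. \<integral>x. norm (\<Sum>i\<in>I. F i m x) powr p \<partial>M) \<longlonglongrightarrow> 0"
  using F l
proof (induction I rule: infinite_finite_induct)
  case (insert i I)
  have "(\<lambda>m. \<integral>x. norm (F i m x + (\<Sum>i\<in>I. F i m x)) powr p \<partial>M) \<longlonglongrightarrow> 0"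
    using insert p by (intro Lp_tendsto_add Lp_sum) auto
  then show ?case using insert.hyps by simp
qed (use p in auto)

context gdm_sequence
begin

text \<open>Times that may serve as nodes. A slice at a single time has no meaning for an a.e.
  class, so whatever is evaluated at a node is demanded here.\<close>

definition good_time :: "real \<Rightarrow> bool" where
  "good_time t \<longleftrightarrow> W0 p \<Omega> (\<lambda>x. \<zeta> (ub (x, t))) (\<lambda>x. G (x, t)) \<and> integrable LL (\<lambda>x. En (ub (x, t)))
     \<and> (AE x in LL. w t x = \<beta> (ub (x, t)))"

lemma AE_good_time: "AE t in lebesgue_on {0<..<T}. good_time t"
proof -
  have "AE y in lebesgue. y \<in> \<Omega> \<times> {0<..<T} \<longrightarrow> w (snd y) (fst y) = \<beta> (ub y)"
    using sol_props(7) S.sets_Q by (simp add: AE_restrict_space_iff)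
  from AE_lebesgue_prod_slice[OF this]
  have "AE t in lebesgue_on {0<..<T}. AE x in lebesgue. (x, t) \<in> \<Omega> \<times> {0<..<T} \<longrightarrow> w t x = \<beta> (ub (x, t))"
    by (subst AE_restrict_space_iff) (auto elim!: eventually_mono)
  then have "AE t in lebesgue_on {0<..<T}. AE x in LL. w t x = \<beta> (ub (x, t))"
    using AE_space
    by eventually_elim (use S.sets_Omega in \<open>auto simp: AE_restrict_space_iff elim!: eventually_mono\<close>)
  then show ?thesis using sol_props(3,4) by eventually_elim (simp add: good_time_def)
qed

text \<open>The quotient \<open>trunc K z / z\<close> at \<open>z = \<zeta> (ub (x, t))\<close>, in
  a form that takes the value 1 at \<open>z = 0\<close>.\<close>

definition \<rho> :: "real \<Rightarrow> real \<Rightarrow> 'a \<Rightarrow> real" where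
  "\<rho> K t x = 1 / (1 + (\<zeta> (ub (x, t)) / K)\<^sup>2)"

lemma \<rho>_bounds: "0 \<le> \<rho> K t x" "\<rho> K t x \<le> 1"
  by (simp_all add: \<rho>_def one_plus_sq_pos)

lemma trunc_\<rho>: "trunc K (\<zeta> (ub (x, t))) = \<rho> K t x * \<zeta> (ub (x, t))"
  by (simp add: trunc_def \<rho>_def)

lemma \<rho>_measurable: "good_time t \<Longrightarrow> \<rho> K t \<in> borel_measurable LL"
proof -
  assume "good_time t"
  then have [measurable]: "(\<lambda>x. \<zeta> (ub (x, t))) \<in> borel_measurable LL"
    by (auto simp: good_time_def W0_def Lp_def)
  show ?thesis unfolding \<rho>_def[abs_def] by measurable
qed

lemma integrable_\<rho>:
  assumes "good_time t" "integrable LL h"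
  shows "integrable LL (\<lambda>x. \<rho> K t x * h x)"
proof (rule Bochner_Integration.integrable_bound[OF assms(2)])
  show "(\<lambda>x. \<rho> K t x * h x) \<in> borel_measurable LL"
    using \<rho>_measurable[OF assms(1)] borel_measurable_integrable[OF assms(2)] by (rule borel_measurable_times)
  show "AE x in LL. norm (\<rho> K t x * h x) \<le> norm (h x)"
    using \<rho>_bounds[of K t] by (auto simp: abs_mult mult_left_le_one_le)
qed

lemma integral_\<rho>_tendsto:
  assumes t: "good_time t" and h: "integrable LL h"
  shows "(\<lambda>n. \<integral>x. \<rho> (real (Suc n)) t x * h x \<partial>LL) \<longlonglongrightarrow> (\<integral>x. h x \<partial>LL)"
proof (rule integral_dominated_convergence[where w = "\<lambda>x. norm (h x)"])
  show "AE x in LL. (\<lambda>n. \<rho> (real (Suc n)) t x * h x) \<longlonglongrightarrow> h x"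
  proof (intro AE_I2)
    fix x
    show "(\<lambda>n. \<rho> (real (Suc n)) t x * h x) \<longlonglongrightarrow> h x"
      unfolding \<rho>_def using tendsto_mult[OF trunc_tendsto(3)[of "\<zeta> (ub (x, t))"] tendsto_const[of "h x"]] by simp
  qed
  show "AE x in LL. norm (\<rho> (real (Suc n)) t x * h x) \<le> norm (h x)" for n
    using \<rho>_bounds[of "real (Suc n)" t] by (auto simp: abs_mult mult_left_le_one_le)
  show "(\<lambda>x. \<rho> (real (Suc n)) t x * h x) \<in> borel_measurable LL" for n
    using integrable_\<rho>[OF t h] by (rule borel_measurable_integrable)
qed (use h in auto)

text \<open>
  A truncated form of the initial energy minus the energy at time \<open>s 1\<close>, which is its limit as \<open>K\<close> tends
  to infinity.
\<close>

definition energy_gap :: "real \<Rightarrow> nat \<Rightarrow> (nat \<Rightarrow> real) \<Rightarrow> real" where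
  "energy_gap K n s = (\<integral>x. En (u_ini x) \<partial>LL) - (\<integral>x. \<rho> K (s n) x * En (ub (x, s n)) \<partial>LL)
     + (\<Sum>k=1..<n. \<integral>x. \<rho> K (s k) x * (En (ub (x, s (Suc k))) - En (ub (x, s k))) \<partial>LL)"

text \<open>The weights depend on the node, so the sum telescopes only in the limit, where dominated
  convergence turns all of them into 1.\<close>

lemma energy_gap_tendsto:
  assumes n: "1 \<le> n" and g: "\<And>k. k \<in> {1..n} \<Longrightarrow> good_time (s k)"
  shows "(\<lambda>j. energy_gap (real (Suc j)) n s) \<longlonglongrightarrow> (\<integral>x. En (u_ini x) \<partial>LL) - (\<integral>x. En (ub (x, s 1)) \<partial>LL)"
proof -
  have i: "integrable LL (\<lambda>x. En (ub (x, s k)))" if "k \<in> {1..n}" for k using g[OF that] by (simp add: good_time_def)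
  have "(\<lambda>j. energy_gap (real (Suc j)) n s) \<longlonglongrightarrow> (\<integral>x. En (u_ini x) \<partial>LL) - (\<integral>x. En (ub (x, s n)) \<partial>LL)
     + (\<Sum>k=1..<n. \<integral>x. (En (ub (x, s (Suc k))) - En (ub (x, s k))) \<partial>LL)"
    unfolding energy_gap_def
    using n by (intro tendsto_intros integral_\<rho>_tendsto g i Bochner_Integration.integrable_diff) auto
  moreover have "(\<Sum>k=1..<n. \<integral>x. (En (ub (x, s (Suc k))) - En (ub (x, s k))) \<partial>LL)
      = (\<Sum>k=1..<n. (\<integral>x. En (ub (x, s (Suc k))) \<partial>LL) - (\<integral>x. En (ub (x, s k)) \<partial>LL))"
    by (intro sum.cong refl Bochner_Integration.integral_diff i) auto
  moreover have "\<dots> = (\<integral>x. En (ub (x, s n)) \<partial>LL) - (\<integral>x. En (ub (x, s 1)) \<partial>LL)"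
    using n by (induction rule: dec_induct) auto
  ultimately show ?thesis by simp
qed

text \<open>The subgradient inequality at \<open>u_ini\<close> leaves the increment of
  \<open>w\<close> paired with the fixed function \<open>\<zeta> (u_ini x)\<close> of L^2; weak
  continuity makes this small for small times.\<close>

lemma initial_gap:
  assumes g: "good_time t" and t: "0 < t" "t < T"
  shows "(\<integral>x. En (u_ini x) \<partial>LL) - (\<integral>x. En (ub (x, t)) \<partial>LL)
    \<le> (\<integral>x. w 0 x * \<zeta> (u_ini x) \<partial>LL) - (\<integral>x. w t x * \<zeta> (u_ini x) \<partial>LL)"
proof -
  have i: "integrable LL (\<lambda>x. w 0 x * \<zeta> (u_ini x))" "integrable LL (\<lambda>x. w t x * \<zeta> (u_ini x))"
    using integrable_mult_Lp[OF _ _ _ sol_props(5) zeta_u_ini_Lp] t S.T by auto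
  have iE: "integrable LL (\<lambda>x. En (ub (x, t)))" using g by (simp add: good_time_def)
  have "(\<integral>x. En (u_ini x) - En (ub (x, t)) \<partial>LL) \<le> (\<integral>x. w 0 x * \<zeta> (u_ini x) - w t x * \<zeta> (u_ini x) \<partial>LL)"
  proof (rule integral_mono_AE)
    have "AE x in LL. w t x = \<beta> (ub (x, t))" using g by (simp add: good_time_def)
    then show "AE x in LL. En (u_ini x) - En (ub (x, t)) \<le> w 0 x * \<zeta> (u_ini x) - w t x * \<zeta> (u_ini x)"
      using sol_props(8)
    proof eventually_elim
      case (elim x)
      then show ?case using S.subgradient[of "u_ini x" "ub (x, t)"] by (simp add: algebra_simps)
    qed
  qed (use i iE E_u_ini_integrable in auto)
  then show ?thesis using i iE E_u_ini_integrable by simp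
qed

lemma trunc_Lp2:
  assumes "good_time t" "K > 0"
  shows "(\<lambda>x. trunc K (\<zeta> (ub (x, t)))) \<in> Lp LL 2"
proof (rule Lp_bound[where h = "\<lambda>x. K powr 2"])
  interpret finite_measure LL by (rule S.finite_L)
  have [measurable]: "(\<lambda>x. \<zeta> (ub (x, t))) \<in> borel_measurable LL"
    using assms by (auto simp: good_time_def W0_def Lp_def)
  show "(\<lambda>x. trunc K (\<zeta> (ub (x, t)))) \<in> borel_measurable LL" by measurable
  show "integrable LL (\<lambda>x. K powr 2)" by simp
  show "AE x in LL. norm (trunc K (\<zeta> (ub (x, t)))) powr 2 \<le> K powr 2"
    using abs_trunc_bounded[OF assms(2)] by (intro AE_I2 powr_mono2) auto
qed

text \<open>The balance for one grid and one truncation level. The discrete energy bounds the flux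
  against \<open>Gs\<close> from above, \<open>test_step\<close> summed over the intervals gives the
  limit of the flux against \<open>GK\<close>, and \<open>energy_gap\<close> collects what
  remains.\<close>

lemma limsup_test:
  assumes n: "1 \<le> n" and g: "\<And>k. k \<in> {1..n} \<Longrightarrow> 0 < s k \<and> s k < T \<and> good_time (s k)"
    and s: "\<And>k. k \<in> {1..n} \<Longrightarrow> s k < s (Suc k)" "s (Suc n) = T" and K: "K > 0"
    and vK: "vK = (\<lambda>y. \<Sum>k=1..n. indicat_real {s k<..s (Suc k)} (snd y) *\<^sub>R trunc K (\<zeta> (ub (fst y, s k))))"
    and GK: "GK = (\<lambda>y. \<Sum>k=1..n. indicat_real {s k<..s (Suc k)} (snd y) *\<^sub>R
                 (trunc_deriv K (\<zeta> (ub (fst y, s k))) *\<^sub>R G (fst y, s k)))"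
  obtains V where "vK \<in> Lp QQ p" "GK \<in> Lp QQ p" "\<And>m i. V m i \<in> gd_X (Ds m)"
    "(\<lambda>m. \<integral>y. norm (gd_PiST (Ds m) (V m) y - vK y) powr p \<partial>QQ) \<longlonglongrightarrow> 0"
    "(\<lambda>m. \<integral>y. norm (gd_gradST (Ds m) (V m) y - GK y) powr p \<partial>QQ) \<longlonglongrightarrow> 0"
    "\<And>e. e > 0 \<Longrightarrow> \<forall>\<^sub>F m in sequentially. (\<integral>y. As m y \<bullet> (Gs m y - GK y) \<partial>QQ)
        \<le> energy_gap K n s + (\<integral>y. f y * (\<zeta> (ub y) - vK y) \<partial>QQ) + e"
proof -
  define \<phi> where "\<phi> k x = trunc K (\<zeta> (ub (x, s k)))" for k x
  define \<gamma> where "\<gamma> k x = trunc_deriv K (\<zeta> (ub (x, s k))) *\<^sub>R G (x, s k)" for k x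
  let ?I = "\<lambda>k. indicat_real {s k<..s (Suc k)}"
  have W: "W0 p \<Omega> (\<phi> k) (\<gamma> k)" if "k \<in> {1..n}" for k
    unfolding \<phi>_def[abs_def] \<gamma>_def[abs_def] using g[OF that] by (intro W0_trunc S.\<Omega> S.p) (simp add: good_time_def)
  have \<phi>2: "\<phi> k \<in> Lp LL 2" if "k \<in> {1..n}" for k
    unfolding \<phi>_def[abs_def] using g[OF that] K by (intro trunc_Lp2) auto
  have \<phi>p: "\<phi> k \<in> Lp LL p" "\<gamma> k \<in> Lp LL p" if "k \<in> {1..n}" for k using W[OF that] by (auto simp: W0_def)
  have sT: "s (Suc k) \<le> T" if "k \<in> {1..n}" for k
    using g[of "Suc k"] s(2) that by (cases "k = n") auto
  have vK': "vK = (\<lambda>y. \<Sum>k=1..n. ?I k (snd y) *\<^sub>R \<phi> k (fst y))" by (simp add: vK \<phi>_def)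
  have GK': "GK = (\<lambda>y. \<Sum>k=1..n. ?I k (snd y) *\<^sub>R \<gamma> k (fst y))" by (simp add: GK \<gamma>_def)
  have IL: "(\<lambda>y. ?I k (snd y) *\<^sub>R \<phi> k (fst y)) \<in> Lp QQ p" "(\<lambda>y. ?I k (snd y) *\<^sub>R \<gamma> k (fst y)) \<in> Lp QQ p"
    if "k \<in> {1..n}" for k
    by (rule indicator_Lp[OF \<phi>p(1)[OF that]], rule indicator_Lp[OF \<phi>p(2)[OF that]])
  have vKL: "vK \<in> Lp QQ p" and GKL: "GK \<in> Lp QQ p"
    unfolding vK' GK' by (rule Lp_sum[OF S.p0(1)], rule IL, assumption)+
  \<comment> \<open>Increment of \<open>w\<close> over the k-th interval, paired with the value
    frozen at its left end.\<close>
  let ?w = "\<lambda>k. \<integral>x. (w (s (Suc k)) x - w (s k) x) * \<phi> k x \<partial>LL"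
  have "\<forall>k. \<exists>v. k \<in> {1..n} \<longrightarrow> (\<forall>m i. v m i \<in> gd_X (Ds m)) \<and>
    (\<lambda>m. \<integral>y. norm (gd_PiST (Ds m) (v m) y - ?I k (snd y) *\<^sub>R \<phi> k (fst y)) powr p \<partial>QQ) \<longlonglongrightarrow> 0 \<and>
    (\<lambda>m. \<integral>y. norm (gd_gradST (Ds m) (v m) y - ?I k (snd y) *\<^sub>R \<gamma> k (fst y)) powr p \<partial>QQ) \<longlonglongrightarrow> 0 \<and>
    (\<lambda>m. \<integral>y. As m y \<bullet> (?I k (snd y) *\<^sub>R \<gamma> k (fst y)) \<partial>QQ) \<longlonglongrightarrow> (\<integral>y. f y * (?I k (snd y) *\<^sub>R \<phi> k (fst y)) \<partial>QQ) - ?w k"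
    (is "\<forall>k. \<exists>v. k \<in> _ \<longrightarrow> ?P k v")
  proof
    fix k
    show "\<exists>v. k \<in> {1..n} \<longrightarrow> ?P k v"
    proof (cases "k \<in> {1..n}")
      case True
      have "0 \<le> s k" using g[OF True] by simp
      show ?thesis
      proof (rule test_step[OF \<phi>2[OF True] W[OF True] \<open>0 \<le> s k\<close> s(1)[OF True] sT[OF True]])
        fix v
        assume "\<And>m i. v m i \<in> gd_X (Ds m)"
          "(\<lambda>m. \<integral>y. norm (gd_PiST (Ds m) (v m) y - ?I k (snd y) *\<^sub>R \<phi> k (fst y)) powr p \<partial>QQ) \<longlonglongrightarrow> 0"
          "(\<lambda>m. \<integral>y. norm (gd_gradST (Ds m) (v m) y - ?I k (snd y) *\<^sub>R \<gamma> k (fst y)) powr p \<partial>QQ) \<longlonglongrightarrow> 0"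
          "(\<lambda>m. \<integral>y. As m y \<bullet> (?I k (snd y) *\<^sub>R \<gamma> k (fst y)) \<partial>QQ) \<longlonglongrightarrow> (\<integral>y. f y * (?I k (snd y) *\<^sub>R \<phi> k (fst y)) \<partial>QQ) - ?w k"
        then have "?P k v" by (intro conjI allI)
        then show ?thesis by (intro exI[of _ v] impI)
      qed
    qed auto
  qed
  from choice[OF this] obtain v where v: "\<And>k. k \<in> {1..n} \<Longrightarrow> ?P k (v k)" by blast
  have vX: "v k m i \<in> gd_X (Ds m)" if "k \<in> {1..n}" for k m i using v[OF that] by blast
  have vP: "(\<lambda>m. \<integral>y. norm (gd_PiST (Ds m) (v k m) y - ?I k (snd y) *\<^sub>R \<phi> k (fst y)) powr p \<partial>QQ) \<longlonglongrightarrow> 0"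
    and vG: "(\<lambda>m. \<integral>y. norm (gd_gradST (Ds m) (v k m) y - ?I k (snd y) *\<^sub>R \<gamma> k (fst y)) powr p \<partial>QQ) \<longlonglongrightarrow> 0"
    and vA: "(\<lambda>m. \<integral>y. As m y \<bullet> (?I k (snd y) *\<^sub>R \<gamma> k (fst y)) \<partial>QQ) \<longlonglongrightarrow> (\<integral>y. f y * (?I k (snd y) *\<^sub>R \<phi> k (fst y)) \<partial>QQ) - ?w k"
    if "k \<in> {1..n}" for k using v[OF that] by blast+
  \<comment> \<open>One discrete function for the whole step function. Its reconstruction is exactly
    the sum of the pieces, its gradient only almost everywhere.\<close>
  define V where "V m i j = (\<Sum>k=1..n. v k m i j)" for m i j
  have VX: "V m i \<in> gd_X (Ds m)" for m i
    using vX by (auto simp: V_def gd_X_def)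
  have PiV: "gd_PiST (Ds m) (V m) y = (\<Sum>k=1..n. gd_PiST (Ds m) (v k m) y)" for m y
    unfolding gd_PiST_def split_beta' gd_Pi_def V_def sum_distrib_left by (rule sum.swap)
  have grV: "AE y in QQ. gd_gradST (Ds m) (V m) y = (\<Sum>k=1..n. gd_gradST (Ds m) (v k m) y)" for m
  proof -
    have "AE x in LL. gd_grad (Ds m) (\<lambda>j. \<Sum>k\<in>J. v k m i j) x = (\<Sum>k\<in>J. gd_grad (Ds m) (v k m i) x)"
      if "finite J" "J \<subseteq> {1..n}" for J i
      using that
    proof (induction J rule: finite_induct)
      case empty then show ?case using S.grad_zero by simp
    next
      case (insert k J)
      have X: "(\<lambda>j. \<Sum>k\<in>J. v k m i j) \<in> gd_X (Ds m)"
        using vX insert.prems by (auto simp: gd_X_def intro!: sum.neutral)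
      have "AE x in LL. gd_grad (Ds m) (\<lambda>j. 1 * v k m i j + 1 * (\<Sum>k\<in>J. v k m i j)) x
          = 1 *\<^sub>R gd_grad (Ds m) (v k m i) x + 1 *\<^sub>R gd_grad (Ds m) (\<lambda>j. \<Sum>k\<in>J. v k m i j) x"
        using insert.prems by (intro S.D_props(6) vX X) auto
      moreover have "AE x in LL. gd_grad (Ds m) (\<lambda>j. \<Sum>k\<in>J. v k m i j) x = (\<Sum>k\<in>J. gd_grad (Ds m) (v k m i) x)"
        using insert by auto
      ultimately show ?case using insert.hyps by (auto elim!: eventually_elim2)
    qed
    then have "AE x in LL. gd_grad (Ds m) (V m i) x = (\<Sum>k=1..n. gd_grad (Ds m) (v k m i) x)" for i
      unfolding V_def[abs_def] by auto
    from S.AE_steps[OF this] show ?thesis by (simp add: gd_gradST_def split_beta')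
  qed
  have cP: "(\<lambda>m. \<integral>y. norm (gd_PiST (Ds m) (V m) y - vK y) powr p \<partial>QQ) \<longlonglongrightarrow> 0"
  proof -
    have "(\<lambda>m. \<integral>y. norm (\<Sum>k=1..n. gd_PiST (Ds m) (v k m) y - ?I k (snd y) *\<^sub>R \<phi> k (fst y)) powr p \<partial>QQ) \<longlonglongrightarrow> 0"
      by (rule Lp_tendsto_sum[OF S.p0(2) Lp_diff[OF S.p0(1) S.PiST_Lp[OF S.p0(1)] IL(1)] vP])
    then show ?thesis by (simp add: PiV vK' sum_subtractf)
  qed
  have grVL: "gd_gradST (Ds m) (V m) \<in> Lp QQ p" for m by (rule S.gradST_Lp[OF VX])
  have cG: "(\<lambda>m. \<integral>y. norm (gd_gradST (Ds m) (V m) y - GK y) powr p \<partial>QQ) \<longlonglongrightarrow> 0"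
  proof -
    let ?h = "\<lambda>m y. \<Sum>k=1..n. gd_gradST (Ds m) (v k m) y - ?I k (snd y) *\<^sub>R \<gamma> k (fst y)"
    have kL: "(\<lambda>y. gd_gradST (Ds m) (v k m) y - ?I k (snd y) *\<^sub>R \<gamma> k (fst y)) \<in> Lp QQ p" if "k \<in> {1..n}" for k m
      by (rule Lp_diff[OF S.p0(1) S.gradST_Lp[OF vX[OF that]] IL(2)[OF that]])
    have hL: "?h m \<in> Lp QQ p" for m by (rule Lp_sum[OF S.p0(1) kL])
    have "(\<lambda>m. \<integral>y. norm (?h m y) powr p \<partial>QQ) \<longlonglongrightarrow> 0"
      by (rule Lp_tendsto_sum[OF S.p0(2) kL vG])
    moreover have "(\<integral>y. norm (gd_gradST (Ds m) (V m) y - GK y) powr p \<partial>QQ) = (\<integral>y. norm (?h m y) powr p \<partial>QQ)" for m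
    proof (rule integral_cong_AE)
      show "AE y in QQ. norm (gd_gradST (Ds m) (V m) y - GK y) powr p = norm (?h m y) powr p"
        using grV[of m] by eventually_elim (simp add: GK' sum_subtractf)
    qed (use borel_measurable_integrable[OF LpD(2)[OF Lp_diff[OF S.p0(1) grVL[of m] GKL]]]
          borel_measurable_integrable[OF LpD(2)[OF hL[of m]]] in auto)
    ultimately show ?thesis by simp
  qed
  let ?AG = "\<lambda>m. \<integral>y. As m y \<bullet> GK y \<partial>QQ"
  have cA: "?AG \<longlonglongrightarrow> (\<integral>y. f y * vK y \<partial>QQ) - (\<Sum>k=1..n. ?w k)"
  proof -
    have "?AG m = (\<Sum>k=1..n. \<integral>y. As m y \<bullet> (?I k (snd y) *\<^sub>R \<gamma> k (fst y)) \<partial>QQ)" for m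
      unfolding GK' inner_sum_right by (rule Bochner_Integration.integral_sum) (rule S.integrable_am[OF IL(2)])
    moreover have "(\<integral>y. f y * vK y \<partial>QQ) = (\<Sum>k=1..n. \<integral>y. f y * (?I k (snd y) *\<^sub>R \<phi> k (fst y)) \<partial>QQ)"
      unfolding vK' sum_distrib_left
      by (rule Bochner_Integration.integral_sum) (rule integrable_mult_Lp[OF S.q_props(1) S.p S.q_props(3) S.H_props(8) IL(1)])
    ultimately show ?thesis
      using tendsto_sum[OF vA, of "{1..n}" "\<lambda>k. k"] by (simp add: sum_subtractf)
  qed
  have nn: "n \<in> {1..n}" using n by simp
  have En_n: "integrable LL (\<lambda>x. En (ub (x, s k)))" if "k \<in> {1..n}" for k using g[OF that] by (simp add: good_time_def)
  let ?UN = "\<lambda>m. Um m (gd_N (Ds m))"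
  let ?b = "\<lambda>m. \<integral>x. \<beta> (?UN m x) * \<phi> n x \<partial>LL"
  have iw: "integrable LL (\<lambda>x. w t x * \<phi> k x)" if "k \<in> {1..n}" "0 \<le> t" "t \<le> T" for t k
    using integrable_mult_Lp[OF _ _ _ sol_props(5) \<phi>2[OF that(1)], of t] that by auto
  \<comment> \<open>\<open>T\<close> is a grid point of every discretisation, so the uniform weak
    convergence applies to the final value directly.\<close>
  have cb: "?b \<longlonglongrightarrow> (\<integral>x. w T x * \<phi> n x \<partial>LL)"
  proof -
    have "(\<lambda>m. \<integral>x. gd_PiST (Ds m) (gd_app (Ds m) \<beta> (us m)) (x, T) * \<phi> n x \<partial>LL) \<longlonglongrightarrow> (\<integral>x. w T x * \<phi> n x \<partial>LL)"
      using conv_beta \<phi>2[OF nn] S.T by (intro tendsto_uniform_limitI[where S = "{0..T}"]) auto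
    moreover have "(\<integral>x. gd_PiST (Ds m) (gd_app (Ds m) \<beta> (us m)) (x, T) * \<phi> n x \<partial>LL) = ?b m" for m
      using S.step_at[of "gd_N (Ds m)" m] S.D_props(11)[of m]
      by (intro Bochner_Integration.integral_cong) (auto simp: gd_PiST_def S.Pi_app)
    ultimately show ?thesis by simp
  qed
  let ?e0 = "\<integral>x. \<rho> K (s n) x * En (ub (x, s n)) \<partial>LL"
  \<comment> \<open>The final discrete energy is compared with the energy at the last node by the
    inequality at \<open>ub (x, s n)\<close> multiplied by \<rho>. On the discrete side the weight
    is dropped, since it is at most 1 and the energy is nonnegative.\<close>
  have low: "?e0 + ?b m - (\<integral>x. w (s n) x * \<phi> n x \<partial>LL) \<le> (\<integral>x. En (?UN m x) \<partial>LL)" for m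
  proof -
    have i1: "integrable LL (\<lambda>x. \<rho> K (s n) x * En (ub (x, s n)))"
      using integrable_\<rho>[OF _ En_n[OF nn]] g[OF nn] by auto
    have i2: "integrable LL (\<lambda>x. \<beta> (?UN m x) * \<phi> n x)"
      using integrable_mult_Lp[OF _ _ _ S.Pi_compose_Lp[OF _ S.H_props(4), of 2 m "us m (gd_N (Ds m))"] \<phi>2[OF nn]] by auto
    have i3: "integrable LL (\<lambda>x. w (s n) x * \<phi> n x)" using iw[OF nn, of "s n"] g[OF nn] by auto
    have "?e0 + ?b m - (\<integral>x. w (s n) x * \<phi> n x \<partial>LL)
        = (\<integral>x. \<rho> K (s n) x * En (ub (x, s n)) + \<beta> (?UN m x) * \<phi> n x - w (s n) x * \<phi> n x \<partial>LL)"
      using i1 i2 i3 by simp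
    also have "\<dots> \<le> (\<integral>x. En (?UN m x) \<partial>LL)"
    proof (rule integral_mono_AE)
      show "integrable LL (\<lambda>x. En (?UN m x))" by (rule S.Pi_compose_integrable[OF S.E_continuous])
      have "AE x in LL. w (s n) x = \<beta> (ub (x, s n))" using g[OF nn] by (simp add: good_time_def)
      then show "AE x in LL. \<rho> K (s n) x * En (ub (x, s n)) + \<beta> (?UN m x) * \<phi> n x - w (s n) x * \<phi> n x \<le> En (?UN m x)"
      proof eventually_elim
        case (elim x)
        let ?r = "\<rho> K (s n) x"
        have "?r * (\<zeta> (ub (x, s n)) * (\<beta> (?UN m x) - \<beta> (ub (x, s n)))) \<le> ?r * (En (?UN m x) - En (ub (x, s n)))"
          by (intro mult_left_mono S.subgradient \<rho>_bounds)
        moreover have "?r * En (?UN m x) \<le> En (?UN m x)"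
          using \<rho>_bounds[of K "s n" x] S.E_nonneg(1) by (intro mult_left_le_one_le) auto
        ultimately show ?case unfolding elim \<phi>_def trunc_\<rho> by (simp add: algebra_simps)
      qed
    qed (use i1 i2 i3 in auto)
    finally show ?thesis .
  qed
  obtain X where X: "X \<longlonglongrightarrow> 0" "\<And>m. (\<integral>x. En (Um m 0 x) \<partial>LL) \<le> (\<integral>x. En (u_ini x) \<partial>LL) + X m"
    by (rule initial_energy) blast
  let ?fZ = "\<lambda>m. \<integral>y. f y * Zs m y \<partial>QQ"
  have cfZ: "?fZ \<longlonglongrightarrow> (\<integral>y. f y * \<zeta> (ub y) \<partial>QQ)"
    using conv_zeta S.H_props(8) unfolding Lp_weak_def by (auto simp: mult.commute)
  define Y where "Y m = (\<integral>x. En (u_ini x) \<partial>LL) + X m + ?fZ m - (?e0 + ?b m - (\<integral>x. w (s n) x * \<phi> n x \<partial>LL)) - ?AG m" for m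
  have YA: "(\<integral>y. As m y \<bullet> (Gs m y - GK y) \<partial>QQ) \<le> Y m" for m
  proof -
    have "(\<integral>y. As m y \<bullet> (Gs m y - GK y) \<partial>QQ) = (\<integral>y. As m y \<bullet> Gs m y \<partial>QQ) - ?AG m"
      unfolding inner_diff_right using S.integrable_am[OF S.Gm_Lp] S.integrable_am[OF GKL] by (rule Bochner_Integration.integral_diff)
    then show ?thesis unfolding Y_def using S.discrete_energy_final[of m] X(2)[of m] low[of m] by linarith
  qed
  define Yl where "Yl = (\<integral>x. En (u_ini x) \<partial>LL) + 0 + (\<integral>y. f y * \<zeta> (ub y) \<partial>QQ)
     - (?e0 + (\<integral>x. w T x * \<phi> n x \<partial>LL) - (\<integral>x. w (s n) x * \<phi> n x \<partial>LL)) - ((\<integral>y. f y * vK y \<partial>QQ) - (\<Sum>k=1..n. ?w k))"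
  have cY: "Y \<longlonglongrightarrow> Yl" unfolding Y_def Yl_def by (intro tendsto_intros X(1) cfZ cb cA)
  have zL: "(\<lambda>y. \<zeta> (ub y)) \<in> Lp QQ p" using conv_zeta by (simp add: Lp_weak_def)
  have Yle: "Yl \<le> energy_gap K n s + (\<integral>y. f y * (\<zeta> (ub y) - vK y) \<partial>QQ)"
  proof -
    have f1: "(\<integral>y. f y * (\<zeta> (ub y) - vK y) \<partial>QQ) = (\<integral>y. f y * \<zeta> (ub y) \<partial>QQ) - (\<integral>y. f y * vK y \<partial>QQ)"
      unfolding right_diff_distrib
      using integrable_mult_Lp[OF S.q_props(1) S.p S.q_props(3) S.H_props(8) zL]
        integrable_mult_Lp[OF S.q_props(1) S.p S.q_props(3) S.H_props(8) vKL] by (rule Bochner_Integration.integral_diff)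
    \<comment> \<open>This increment cancels the terms in \<open>w T\<close> and
      \<open>w (s n)\<close> that come from \<open>low\<close>, so only increments between nodes
      remain.\<close>
    have wn: "?w n = (\<integral>x. w T x * \<phi> n x \<partial>LL) - (\<integral>x. w (s n) x * \<phi> n x \<partial>LL)"
      using iw[OF nn, of T] iw[OF nn, of "s n"] g[OF nn] S.T s(2) by (simp add: left_diff_distrib)
    have "{1..n} = insert n {1..<n}" using n by auto
    then have sw: "(\<Sum>k=1..n. ?w k) = ?w n + (\<Sum>k=1..<n. ?w k)" by simp
    \<comment> \<open>The favourable direction is due to freezing at the left end:
      \<open>\<phi> k\<close> is the weight times \<zeta> at the earlier of the two nodes.\<close>
    have "?w k \<le> (\<integral>x. \<rho> K (s k) x * (En (ub (x, s (Suc k))) - En (ub (x, s k))) \<partial>LL)" if k: "k \<in> {1..<n}" for k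
    proof (rule integral_mono_AE)
      have k1: "k \<in> {1..n}" and k2: "Suc k \<in> {1..n}" using k by auto
      show "integrable LL (\<lambda>x. (w (s (Suc k)) x - w (s k) x) * \<phi> k x)"
        unfolding left_diff_distrib using iw[OF k1, of "s (Suc k)"] iw[OF k1, of "s k"] g[OF k1] g[OF k2] by auto
      show "integrable LL (\<lambda>x. \<rho> K (s k) x * (En (ub (x, s (Suc k))) - En (ub (x, s k))))"
        using g[OF k1] En_n[OF k1] En_n[OF k2] by (intro integrable_\<rho>) auto
      have "AE x in LL. w (s k) x = \<beta> (ub (x, s k))" "AE x in LL. w (s (Suc k)) x = \<beta> (ub (x, s (Suc k)))"
        using g[OF k1] g[OF k2] by (auto simp: good_time_def)
      then show "AE x in LL. (w (s (Suc k)) x - w (s k) x) * \<phi> k x \<le> \<rho> K (s k) x * (En (ub (x, s (Suc k))) - En (ub (x, s k)))"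
      proof eventually_elim
        case (elim x)
        have "\<rho> K (s k) x * (\<zeta> (ub (x, s k)) * (\<beta> (ub (x, s (Suc k))) - \<beta> (ub (x, s k)))) \<le> \<rho> K (s k) x * (En (ub (x, s (Suc k))) - En (ub (x, s k)))"
          by (intro mult_left_mono S.subgradient \<rho>_bounds)
        then show ?case unfolding elim \<phi>_def trunc_\<rho> by (simp add: algebra_simps)
      qed
    qed
    then have "(\<Sum>k=1..<n. ?w k) \<le> (\<Sum>k=1..<n. \<integral>x. \<rho> K (s k) x * (En (ub (x, s (Suc k))) - En (ub (x, s k))) \<partial>LL)"
      by (rule sum_mono)
    then show ?thesis unfolding Yl_def energy_gap_def f1 sw wn by linarith
  qed
  have ev: "\<forall>\<^sub>F m in sequentially. (\<integral>y. As m y \<bullet> (Gs m y - GK y) \<partial>QQ)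
        \<le> energy_gap K n s + (\<integral>y. f y * (\<zeta> (ub y) - vK y) \<partial>QQ) + e" if "e > 0" for e
  proof -
    have "\<forall>\<^sub>F m in sequentially. Y m < Yl + e" using order_tendstoD(2)[OF cY, of "Yl + e"] that by simp
    then show ?thesis
    proof eventually_elim
      case (elim m)
      then show ?case using YA[of m] Yle by linarith
    qed
  qed
  show thesis by (rule that[OF vKL GKL VX cP cG ev])
qed

end

section \<open>Upper limit of the flux and strong convergence\<close>

context gdm_sequence
begin

lemma zeta_ub_Lp: "(\<lambda>y. \<zeta> (ub y)) \<in> Lp QQ p"
  using conv_zeta by (simp add: Lp_weak_def)

text \<open>The function and its gradient are bundled so that a single grid approximates
  both.\<close>

lemma pair_Lp: "(\<lambda>y. (\<zeta> (ub y), G y)) \<in> Lp QQ p"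
proof -
  have "(\<lambda>y. (\<zeta> (ub y), 0::'a)) \<in> Lp QQ p" "(\<lambda>y. (0::real, G y)) \<in> Lp QQ p"
    using LpD[OF zeta_ub_Lp] LpD[OF sol_props(2)] by (auto simp: Lp_def norm_Pair)
  from Lp_add[OF S.p0(1) this] show ?thesis by simp
qed

text \<open>The grid is fixed first, then the truncation level, and only then does m tend to
  infinity. The discrete functions \<open>V\<close> are exported for the strong convergence of the
  functions, where coercivity calls for a discrete approximant of
  \<open>\<zeta> (ub y)\<close>.\<close>

lemma approximation:
  assumes e: "e > 0"
  obtains v Gv V where "v \<in> Lp QQ p" "Gv \<in> Lp QQ p" "\<And>m i. V m i \<in> gd_X (Ds m)"
    "(\<integral>y. norm (\<zeta> (ub y) - v y) powr p \<partial>QQ) \<le> e" "(\<integral>y. norm (G y - Gv y) powr p \<partial>QQ) \<le> e"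
    "(\<lambda>m. \<integral>y. norm (gd_PiST (Ds m) (V m) y - v y) powr p \<partial>QQ) \<longlonglongrightarrow> 0"
    "(\<lambda>m. \<integral>y. norm (gd_gradST (Ds m) (V m) y - Gv y) powr p \<partial>QQ) \<longlonglongrightarrow> 0"
    "\<forall>\<^sub>F m in sequentially. (\<integral>y. As m y \<bullet> (Gs m y - Gv y) \<partial>QQ) \<le> (\<integral>y. f y * (\<zeta> (ub y) - v y) \<partial>QQ) + e"
proof -
  \<comment> \<open>Two errors of size \<open>c\<close>, from the step function and from the
    truncation, add up to \<open>e\<close> after one use of
    \<open>norm_diff_powr_le\<close>.\<close>
  define c where "c = e / (2 * 2 powr p)"
  have c: "c > 0" "2 powr p * (c + c) = e" using e by (auto simp: c_def)
  have "((\<lambda>t. \<integral>x. w t x * \<zeta> (u_ini x) \<partial>LL) \<longlongrightarrow> (\<integral>x. w 0 x * \<zeta> (u_ini x) \<partial>LL)) (at 0 within {0..T})"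
    using sol_props(6)[OF zeta_u_ini_Lp] S.T by (auto simp: continuous_on_def)
  then have "\<forall>\<^sub>F t in at 0 within {0..T}. dist (\<integral>x. w t x * \<zeta> (u_ini x) \<partial>LL) (\<integral>x. w 0 x * \<zeta> (u_ini x) \<partial>LL) < e / 4"
    using e by (intro tendstoD) auto
  \<comment> \<open>The first node will be placed before \<open>d\<close>, which makes the bound of
    \<open>initial_gap\<close> less than e / 4.\<close>
  then obtain d where d: "d > 0" "\<And>t. t \<in> {0..T} \<Longrightarrow> t \<noteq> 0 \<Longrightarrow> dist t 0 < d \<Longrightarrow>
      dist (\<integral>x. w t x * \<zeta> (u_ini x) \<partial>LL) (\<integral>x. w 0 x * \<zeta> (u_ini x) \<partial>LL) < e / 4"
    unfolding eventually_at by blast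
  have e': "min c d > 0" using c d by simp
  obtain n s where n: "1 \<le> (n::nat)" and s1: "0 < s 1" "s 1 < min c d"
    and s: "\<And>k. k \<in> {1..n} \<Longrightarrow> s k < s (Suc k)" "s (Suc n) = T"
    and g: "\<And>k. k \<in> {1..n} \<Longrightarrow> 0 < s k \<and> s k < T \<and> good_time (s k)"
    and approx: "(\<integral>\<^sup>+y. norm ((\<zeta> (ub y), G y) - (\<Sum>k=1..n. indicator {s k<..s (Suc k)} (snd y) *\<^sub>R (\<zeta> (ub (fst y, s k)), G (fst y, s k)))) powr p \<partial>QQ) \<le> ennreal (min c d)"
    by (rule step_function_approx[OF S.\<Omega>(1) S.T less_imp_le[OF S.p] pair_Lp AE_good_time e']) blast
  let ?I = "\<lambda>k. indicat_real {s k<..s (Suc k)}"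
  have Wk: "(\<lambda>x. \<zeta> (ub (x, s k))) \<in> Lp LL p" "(\<lambda>x. G (x, s k)) \<in> Lp LL p" if "k \<in> {1..n}" for k
    using g[OF that] by (auto simp: good_time_def W0_def)
  define v0 where "v0 y = (\<Sum>k=1..n. ?I k (snd y) *\<^sub>R \<zeta> (ub (fst y, s k)))" for y
  define G0 where "G0 y = (\<Sum>k=1..n. ?I k (snd y) *\<^sub>R G (fst y, s k))" for y
  have v0L: "v0 \<in> Lp QQ p" and G0L: "G0 \<in> Lp QQ p"
    unfolding v0_def[abs_def] G0_def[abs_def]
    by (rule Lp_sum[OF S.p0(1)], erule indicator_Lp[OF Wk(1)], rule Lp_sum[OF S.p0(1)], erule indicator_Lp[OF Wk(2)])
  have pair: "(\<Sum>k=1..n. ?I k (snd y) *\<^sub>R (\<zeta> (ub (fst y, s k)), G (fst y, s k))) = (v0 y, G0 y)" for y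
    by (simp add: v0_def G0_def prod_eq_iff fst_sum snd_sum)
  have dv: "(\<lambda>y. \<zeta> (ub y) - v0 y) \<in> Lp QQ p" and dG: "(\<lambda>y. G y - G0 y) \<in> Lp QQ p"
    by (rule Lp_diff[OF S.p0(1) zeta_ub_Lp v0L], rule Lp_diff[OF S.p0(1) sol_props(2) G0L])
  have av: "(\<integral>y. norm (\<zeta> (ub y) - v0 y) powr p \<partial>QQ) \<le> c" and aG: "(\<integral>y. norm (G y - G0 y) powr p \<partial>QQ) \<le> c"
  proof -
    have c0: "(\<integral>\<^sup>+y. norm ((\<zeta> (ub y), G y) - (v0 y, G0 y)) powr p \<partial>QQ) \<le> ennreal c"
      using approx unfolding pair by (rule order_trans) (simp add: ennreal_leI)
    have le: "norm a powr p \<le> norm (a, b) powr p" "norm b powr p \<le> norm (a, b) powr p" for a :: real and b :: 'a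
      using S.p0 norm_fst_le[of a b] norm_snd_le[of b a] by (auto intro!: powr_mono2)
    have "ennreal (\<integral>y. norm (\<zeta> (ub y) - v0 y) powr p \<partial>QQ) = (\<integral>\<^sup>+y. norm (\<zeta> (ub y) - v0 y) powr p \<partial>QQ)"
      using LpD(2)[OF dv] by (intro nn_integral_eq_integral[symmetric]) auto
    also have "\<dots> \<le> (\<integral>\<^sup>+y. norm ((\<zeta> (ub y), G y) - (v0 y, G0 y)) powr p \<partial>QQ)"
      using le(1) by (intro nn_integral_mono ennreal_leI) simp
    also note c0
    finally show "(\<integral>y. norm (\<zeta> (ub y) - v0 y) powr p \<partial>QQ) \<le> c" using c(1) by (simp add: ennreal_le_iff)
    have "ennreal (\<integral>y. norm (G y - G0 y) powr p \<partial>QQ) = (\<integral>\<^sup>+y. norm (G y - G0 y) powr p \<partial>QQ)"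
      using LpD(2)[OF dG] by (intro nn_integral_eq_integral[symmetric]) auto
    also have "\<dots> \<le> (\<integral>\<^sup>+y. norm ((\<zeta> (ub y), G y) - (v0 y, G0 y)) powr p \<partial>QQ)"
      using le(2) by (intro nn_integral_mono ennreal_leI) simp
    also note c0
    finally show "(\<integral>y. norm (G y - G0 y) powr p \<partial>QQ) \<le> c" using c(1) by (simp add: ennreal_le_iff)
  qed
  define vK where "vK K = (\<lambda>y. \<Sum>k=1..n. ?I k (snd y) *\<^sub>R trunc K (\<zeta> (ub (fst y, s k))))" for K
  define GK where "GK K = (\<lambda>y. \<Sum>k=1..n. ?I k (snd y) *\<^sub>R (trunc_deriv K (\<zeta> (ub (fst y, s k))) *\<^sub>R G (fst y, s k)))" for K
  \<comment> \<open>Truncation commutes with forming the step function: at most one indicator is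
    nonzero at a given time, and where all of them vanish so do \<open>trunc K 0\<close> and
    \<open>G0\<close>. The limit in \<open>K\<close> thus concerns the fixed pair \<open>v0\<close>,
    \<open>G0\<close>.\<close>
  have eqK: "vK K y = trunc K (v0 y) \<and> GK K y = trunc_deriv K (v0 y) *\<^sub>R G0 y" for K y
  proof (cases "\<exists>j\<in>{1..n}. snd y \<in> {s j<..s (Suc j)}")
    case True
    then obtain j where j: "j \<in> {1..n}" "snd y \<in> {s j<..s (Suc j)}" by blast
    have mono: "s a \<le> s b" if "1 \<le> a" "a \<le> b" "b \<le> Suc n" for a b
      using that(2,1,3)
    proof (induction rule: dec_induct)
      case (step i)
      then show ?case using s(1)[of i] by simp
    qed simp
    have I: "?I k (snd y) = (if k = j then 1 else 0)" if "k \<in> {1..n}" for k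
    proof (cases k j rule: linorder_cases)
      case less
      then have "s (Suc k) \<le> s j" using that j by (intro mono) auto
      then show ?thesis using j less by simp
    next
      case greater
      then have "s (Suc j) \<le> s k" using that j by (intro mono) auto
      then show ?thesis using j greater by simp
    qed (use j in simp)
    have sum: "(\<Sum>k=1..n. ?I k (snd y) *\<^sub>R h k) = h j" for h :: "nat \<Rightarrow> 'd::real_vector"
    proof -
      have "(\<Sum>k=1..n. ?I k (snd y) *\<^sub>R h k) = (\<Sum>k=1..n. if k = j then h k else 0)"
        using I by (intro sum.cong refl) (simp del: indicator_simps)
      also have "\<dots> = h j" using j by simp
      finally show ?thesis .
    qed
    show ?thesis unfolding vK_def GK_def v0_def G0_def sum by simp
  next
    case False
    then have "?I k (snd y) = 0" if "k \<in> {1..n}" for k using that by (auto simp: indicator_def)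
    then have sum: "(\<Sum>k=1..n. ?I k (snd y) *\<^sub>R h k) = 0" for h :: "nat \<Rightarrow> 'd::real_vector"
      by (intro sum.neutral ballI) (simp del: indicator_simps)
    show ?thesis unfolding vK_def GK_def v0_def G0_def sum by simp
  qed
  have "\<forall>\<^sub>F j in sequentially. (\<integral>y. norm (vK (real (Suc j)) y - v0 y) powr p \<partial>QQ) < c"
    using order_tendstoD(2)[OF trunc_Lp_tendsto(1)[OF S.p0(2) v0L G0L] c(1)] by (simp add: eqK)
  moreover have "\<forall>\<^sub>F j in sequentially. (\<integral>y. norm (GK (real (Suc j)) y - G0 y) powr p \<partial>QQ) < c"
    using order_tendstoD(2)[OF trunc_Lp_tendsto(2)[OF S.p0(2) v0L G0L] c(1)] by (simp add: eqK)
  moreover have "\<forall>\<^sub>F j in sequentially. energy_gap (real (Suc j)) n s < e / 2"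
  proof (rule order_tendstoD(2)[OF energy_gap_tendsto[OF n]])
    show "good_time (s k)" if "k \<in> {1..n}" for k using g[OF that] by simp
    have 1: "good_time (s 1)" "0 < s 1" "s 1 < T" using g[of 1] n by auto
    have "dist (\<integral>x. w (s 1) x * \<zeta> (u_ini x) \<partial>LL) (\<integral>x. w 0 x * \<zeta> (u_ini x) \<partial>LL) < e / 4"
      using 1 s1 by (intro d(2)) auto
    then show "(\<integral>x. En (u_ini x) \<partial>LL) - (\<integral>x. En (ub (x, s 1)) \<partial>LL) < e / 2"
      using initial_gap[OF 1] e by (simp add: dist_real_def abs_if split: if_splits)
  qed
  ultimately have "\<forall>\<^sub>F j in sequentially. (\<integral>y. norm (vK (real (Suc j)) y - v0 y) powr p \<partial>QQ) < c
      \<and> (\<integral>y. norm (GK (real (Suc j)) y - G0 y) powr p \<partial>QQ) < c \<and> energy_gap (real (Suc j)) n s < e / 2"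
    by eventually_elim auto
  then obtain j where j: "(\<integral>y. norm (vK (real (Suc j)) y - v0 y) powr p \<partial>QQ) < c"
      "(\<integral>y. norm (GK (real (Suc j)) y - G0 y) powr p \<partial>QQ) < c" "energy_gap (real (Suc j)) n s < e / 2"
    by (auto simp: eventually_sequentially)
  define K where "K = real (Suc j)"
  have K: "K > 0" by (simp add: K_def)
  note j = j[folded K_def]
  show thesis
  proof (rule limsup_test[OF n g s K vK_def GK_def])
    fix V
    assume L: "vK K \<in> Lp QQ p" "GK K \<in> Lp QQ p" and VX: "\<And>m i. V m i \<in> gd_X (Ds m)"
      and cP: "(\<lambda>m. \<integral>y. norm (gd_PiST (Ds m) (V m) y - vK K y) powr p \<partial>QQ) \<longlonglongrightarrow> 0"
      and cG: "(\<lambda>m. \<integral>y. norm (gd_gradST (Ds m) (V m) y - GK K y) powr p \<partial>QQ) \<longlonglongrightarrow> 0"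
      and ev: "\<And>e. e > 0 \<Longrightarrow> \<forall>\<^sub>F m in sequentially. (\<integral>y. As m y \<bullet> (Gs m y - GK K y) \<partial>QQ)
        \<le> energy_gap K n s + (\<integral>y. f y * (\<zeta> (ub y) - vK K y) \<partial>QQ) + e"
    have tri: "(\<integral>y. norm (F y - H y) powr p \<partial>QQ) \<le> e"
      if h: "F \<in> Lp QQ p" "F0 \<in> Lp QQ p" "H \<in> Lp QQ p"
        "(\<integral>y. norm (F y - F0 y) powr p \<partial>QQ) \<le> c" "(\<integral>y. norm (H y - F0 y) powr p \<partial>QQ) < c"
      for F F0 H :: "'a \<times> real \<Rightarrow> 'd::euclidean_space"
    proof -
      note i = LpD(2)[OF Lp_diff[OF S.p0(1) h(1) h(2)]] LpD(2)[OF Lp_diff[OF S.p0(1) h(3) h(2)]] LpD(2)[OF Lp_diff[OF S.p0(1) h(1) h(3)]]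
      have "(\<integral>y. norm (F y - H y) powr p \<partial>QQ) \<le> (\<integral>y. 2 powr p * (norm (F y - F0 y) powr p + norm (H y - F0 y) powr p) \<partial>QQ)"
      proof (rule integral_mono[OF i(3)])
        show "norm (F y - H y) powr p \<le> 2 powr p * (norm (F y - F0 y) powr p + norm (H y - F0 y) powr p)" for y
          using norm_diff_powr_le[OF S.p0(1), of "F y - F0 y" "H y - F0 y"] by simp
      qed (use i in auto)
      also have "\<dots> = 2 powr p * ((\<integral>y. norm (F y - F0 y) powr p \<partial>QQ) + (\<integral>y. norm (H y - F0 y) powr p \<partial>QQ))"
        using i by simp
      also have "\<dots> \<le> 2 powr p * (c + c)" using h(4,5) by (intro mult_left_mono add_mono) auto
      finally show ?thesis using c(2) by simp
    qed
    have "\<forall>\<^sub>F m in sequentially. (\<integral>y. As m y \<bullet> (Gs m y - GK K y) \<partial>QQ) \<le> (\<integral>y. f y * (\<zeta> (ub y) - vK K y) \<partial>QQ) + e"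
      using ev[of "e / 2"] e j(3) by (auto elim!: eventually_mono)
    then show thesis
      using tri[OF zeta_ub_Lp v0L L(1) av j(1)] tri[OF sol_props(2) G0L L(2) aG j(2)]
      by (intro that[OF L VX _ _ cP cG])
  qed
qed

text \<open>\<open>As m\<close> and \<open>f\<close> are only bounded in L^q, but
  \<open>G - Gv\<close> and \<open>\<zeta> (ub y) - v y\<close> are small in L^p, so the exchange of
  \<open>Gv\<close> for \<open>G\<close> costs an amount controlled uniformly in m.\<close>

lemma limsup_A:
  assumes e: "e > 0"
  shows "\<forall>\<^sub>F m in sequentially. (\<integral>y. As m y \<bullet> (Gs m y - G y) \<partial>QQ) \<le> e"
proof -
  obtain BA where BA: "\<And>m. (\<integral>y. norm (As m y) powr qq \<partial>QQ) \<le> BA" by (rule As_bound) blast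
  let ?F = "\<integral>y. norm (f y) powr qq \<partial>QQ"
  have nn: "0 \<le> BA" "0 \<le> ?F" using order_trans[OF _ BA[of 0], of 0] by auto
  define B where "B = BA + ?F + 1"
  \<comment> \<open>Each of the two bounded factors then contributes at most e / 4; the summand 1 in
    \<open>B\<close> keeps the denominator positive.\<close>
  define d where "d = e / (4 * B)"
  have d: "d > 0" "d * BA \<le> e / 4" "d * ?F \<le> e / 4"
  proof -
    have D0: "B > 0" "BA \<le> B" "?F \<le> B" unfolding B_def using nn by linarith+
    show d0: "d > 0" using e D0 by (simp add: d_def)
    have "d * B = e / 4" using D0 by (simp add: d_def)
    then show "d * BA \<le> e / 4" "d * ?F \<le> e / 4"
      using mult_left_mono[OF D0(2) less_imp_le[OF d0]] mult_left_mono[OF D0(3) less_imp_le[OF d0]] by linarith+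
  qed
  obtain C where C: "C > 0" "\<And>x y::'a. \<bar>x \<bullet> y\<bar> \<le> d * norm x powr qq + C * norm y powr p"
    by (rule inner_le_Young_eps[OF S.q_props(1) S.p S.q_props(3) d(1), where 'b='a]) blast
  obtain C' where C': "C' > 0" "\<And>x y::real. \<bar>x \<bullet> y\<bar> \<le> d * norm x powr qq + C' * norm y powr p"
    by (rule inner_le_Young_eps[OF S.q_props(1) S.p S.q_props(3) d(1), where 'b=real]) blast
  \<comment> \<open>Collects the factors of the three approximation errors, which together receive
    another quarter of \<open>e\<close>.\<close>
  define R where "R = C + C' + 1"
  define e' where "e' = e / (4 * R)"
  have D1: "R > 0" using C(1) C'(1) by (simp add: R_def)
  have e': "e' > 0" using e D1 by (simp add: e'_def)
  have sum_e': "C * e' + C' * e' + e' = e / 4"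
  proof -
    have "C * e' + C' * e' + e' = R * e'" by (simp add: R_def algebra_simps)
    then show ?thesis using D1 by (simp add: e'_def)
  qed
  show ?thesis
  proof (rule approximation[OF e'])
    fix v Gv V
    assume L: "v \<in> Lp QQ p" "Gv \<in> Lp QQ p"
      and av: "(\<integral>y. norm (\<zeta> (ub y) - v y) powr p \<partial>QQ) \<le> e'" and aG: "(\<integral>y. norm (G y - Gv y) powr p \<partial>QQ) \<le> e'"
      and ev: "\<forall>\<^sub>F m in sequentially. (\<integral>y. As m y \<bullet> (Gs m y - Gv y) \<partial>QQ) \<le> (\<integral>y. f y * (\<zeta> (ub y) - v y) \<partial>QQ) + e'"
    have dvL: "(\<lambda>y. \<zeta> (ub y) - v y) \<in> Lp QQ p" by (rule Lp_diff[OF S.p0(1) zeta_ub_Lp L(1)])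
    have dGL: "(\<lambda>y. G y - Gv y) \<in> Lp QQ p" by (rule Lp_diff[OF S.p0(1) sol_props(2) L(2)])
    have fv: "(\<integral>y. f y * (\<zeta> (ub y) - v y) \<partial>QQ) \<le> d * ?F + C' * e'"
    proof -
      have "(\<integral>y. f y * (\<zeta> (ub y) - v y) \<partial>QQ) \<le> (\<integral>y. d * norm (f y) powr qq + C' * norm (\<zeta> (ub y) - v y) powr p \<partial>QQ)"
      proof (rule integral_mono)
        show "integrable QQ (\<lambda>y. f y * (\<zeta> (ub y) - v y))" by (rule integrable_mult_Lp[OF S.q_props(1) S.p S.q_props(3) S.H_props(8) dvL])
        show "f y * (\<zeta> (ub y) - v y) \<le> d * norm (f y) powr qq + C' * norm (\<zeta> (ub y) - v y) powr p" for y
          using order_trans[OF abs_ge_self C'(2)[of "f y" "\<zeta> (ub y) - v y"]] by simp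
      qed (use LpD(2)[OF S.H_props(8)] LpD(2)[OF dvL] in auto)
      also have "\<dots> = d * ?F + C' * (\<integral>y. norm (\<zeta> (ub y) - v y) powr p \<partial>QQ)"
        using LpD(2)[OF S.H_props(8)] LpD(2)[OF dvL] by simp
      also have "\<dots> \<le> d * ?F + C' * e'" using av C'(1) by simp
      finally show ?thesis .
    qed
    have aa: "(\<integral>y. As m y \<bullet> (G y - Gv y) \<partial>QQ) \<ge> - (d * BA + C * e')" for m
    proof -
      have "- (\<integral>y. As m y \<bullet> (G y - Gv y) \<partial>QQ) = (\<integral>y. - (As m y \<bullet> (G y - Gv y)) \<partial>QQ)" by simp
      also have "\<dots> \<le> (\<integral>y. d * norm (As m y) powr qq + C * norm (G y - Gv y) powr p \<partial>QQ)"
      proof (rule integral_mono)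
        show "integrable QQ (\<lambda>y. - (As m y \<bullet> (G y - Gv y)))" using S.integrable_am[OF dGL] by simp
        show "- (As m y \<bullet> (G y - Gv y)) \<le> d * norm (As m y) powr qq + C * norm (G y - Gv y) powr p" for y
          using order_trans[OF abs_ge_minus_self C(2)[of "As m y" "G y - Gv y"]] by simp
      qed (use LpD(2)[OF S.am_Lp] LpD(2)[OF dGL] in auto)
      also have "\<dots> = d * (\<integral>y. norm (As m y) powr qq \<partial>QQ) + C * (\<integral>y. norm (G y - Gv y) powr p \<partial>QQ)"
        using LpD(2)[OF S.am_Lp] LpD(2)[OF dGL] by simp
      also have "\<dots> \<le> d * BA + C * e'" using aG BA[of m] C(1) d(1) by (intro add_mono mult_left_mono) auto
      finally show ?thesis by simp
    qed
    have split: "(\<integral>y. As m y \<bullet> (Gs m y - G y) \<partial>QQ) = (\<integral>y. As m y \<bullet> (Gs m y - Gv y) \<partial>QQ) - (\<integral>y. As m y \<bullet> (G y - Gv y) \<partial>QQ)" for m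
    proof -
      have "(\<lambda>y. As m y \<bullet> (Gs m y - G y)) = (\<lambda>y. As m y \<bullet> (Gs m y - Gv y) - As m y \<bullet> (G y - Gv y))"
        by (simp add: inner_diff_right)
      then show ?thesis
        using Bochner_Integration.integral_diff[OF S.integrable_am[OF Lp_diff[OF S.p0(1) S.Gm_Lp L(2)], of m] S.integrable_am[OF dGL, of m]]
        by simp
    qed
    show ?thesis using ev
    proof eventually_elim
      case (elim m)
      then show ?case using split[of m] aa[of m] fv d(2,3) sum_e' e by linarith
    qed
  qed
qed

text \<open>Coercivity bounds discrete functions only, and the limit is not one. It is replaced by
  the reconstruction of \<open>V\<close>, whose gradient is also close to \<open>G\<close>; the
  difference \<open>D\<close> is discrete and has a small gradient.\<close>

lemma zeta_strong_from_gradient: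
  assumes G: "(\<lambda>m. \<integral>y. norm (Gs m y - G y) powr p \<partial>QQ) \<longlonglongrightarrow> 0"
  shows "(\<lambda>m. \<integral>y. norm (Zs m y - \<zeta> (ub y)) powr p \<partial>QQ) \<longlonglongrightarrow> 0"
proof (rule tendsto_0_eventually_leI)
  fix e :: real assume e: "e > 0"
  obtain C where C: "C \<ge> 0" "\<And>m v. (\<And>n. n \<in> {1..gd_N (Ds m)} \<Longrightarrow> v n \<in> gd_X (Ds m)) \<Longrightarrow>
    (\<integral>y. norm (gd_PiST (Ds m) v y) powr p \<partial>QQ) \<le> C * (\<integral>y. norm (gd_gradST (Ds m) v y) powr p \<partial>QQ)"
    by (rule coercive_const) blast
  have tri: "(\<integral>y. norm (F1 y - F3 y) powr p \<partial>QQ) \<le> 2 powr p * ((\<integral>y. norm (F1 y - F2 y) powr p \<partial>QQ) + (\<integral>y. norm (F2 y - F3 y) powr p \<partial>QQ))"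
    if h: "F1 \<in> Lp QQ p" "F2 \<in> Lp QQ p" "F3 \<in> Lp QQ p" for F1 F2 F3 :: "'a \<times> real \<Rightarrow> 'd::euclidean_space"
  proof -
    note i = LpD(2)[OF Lp_diff[OF S.p0(1) h(1) h(2)]] LpD(2)[OF Lp_diff[OF S.p0(1) h(2) h(3)]] LpD(2)[OF Lp_diff[OF S.p0(1) h(1) h(3)]]
    have "(\<integral>y. norm (F1 y - F3 y) powr p \<partial>QQ) \<le> (\<integral>y. 2 powr p * (norm (F1 y - F2 y) powr p + norm (F2 y - F3 y) powr p) \<partial>QQ)"
    proof (rule integral_mono[OF i(3)])
      show "norm (F1 y - F3 y) powr p \<le> 2 powr p * (norm (F1 y - F2 y) powr p + norm (F2 y - F3 y) powr p)" for y
        using norm_add_powr_le[OF S.p0(1), of "F1 y - F2 y" "F2 y - F3 y"] by simp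
    qed (use i in auto)
    then show ?thesis using i by simp
  qed
  define c where "c = 2 powr p"
  \<comment> \<open>A crude bound: \<open>4 * M\<close> dominates the factor accumulated in the
    nested triangle inequalities, which explains the choice of \<open>e'\<close>.\<close>
  define M where "M = c * (c + 1) * (C + 1) * (c + 1)"
  have c1: "c \<ge> 1" unfolding c_def using S.p0 by (intro ge_one_powr_ge_zero) auto
  have M: "M > 0" using C(1) c1 by (simp add: M_def)
  define e' where "e' = e / (4 * M)"
  have e': "e' > 0" using e M by (simp add: e'_def)
  show "\<forall>\<^sub>F m in sequentially. (\<integral>y. norm (Zs m y - \<zeta> (ub y)) powr p \<partial>QQ) \<le> e"
  proof (rule approximation[OF e'])
    fix v Gv V
    assume L: "v \<in> Lp QQ p" "Gv \<in> Lp QQ p" and VX: "\<And>m i. V m i \<in> gd_X (Ds m)"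
      and av: "(\<integral>y. norm (\<zeta> (ub y) - v y) powr p \<partial>QQ) \<le> e'" and aG: "(\<integral>y. norm (G y - Gv y) powr p \<partial>QQ) \<le> e'"
      and cP: "(\<lambda>m. \<integral>y. norm (gd_PiST (Ds m) (V m) y - v y) powr p \<partial>QQ) \<longlonglongrightarrow> 0"
      and cG: "(\<lambda>m. \<integral>y. norm (gd_gradST (Ds m) (V m) y - Gv y) powr p \<partial>QQ) \<longlonglongrightarrow> 0"
    show ?thesis
      using order_tendstoD(2)[OF cP e'] order_tendstoD(2)[OF cG e'] order_tendstoD(2)[OF G e']
    proof eventually_elim
      case (elim m)
      let ?PV = "gd_PiST (Ds m) (V m)" and ?GV = "gd_gradST (Ds m) (V m)"
      have PVL: "?PV \<in> Lp QQ p" by (rule S.PiST_Lp[OF S.p0(1)])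
      have GVL: "?GV \<in> Lp QQ p" by (rule S.gradST_Lp[OF VX])
      define D where "D i j = 1 * gd_app (Ds m) \<zeta> (us m) i j + (-1) * V m i j" for i j
      have DX: "D i \<in> gd_X (Ds m)" for i unfolding D_def[abs_def] by (rule S.lin_X[OF S.app_X VX])
      have PD: "gd_PiST (Ds m) D y = Zs m y - ?PV y" for y
        unfolding gd_PiST_def split_beta' D_def[abs_def] S.Pi_lin by simp
      have "AE x in LL. gd_grad (Ds m) (D i) x = 1 *\<^sub>R gd_grad (Ds m) (gd_app (Ds m) \<zeta> (us m) i) x + (-1) *\<^sub>R gd_grad (Ds m) (V m i) x" for i
        unfolding D_def[abs_def] by (rule S.D_props(6)[OF S.app_X VX])
      from S.AE_steps[OF this] have "AE y in QQ. gd_gradST (Ds m) D y = Gs m y - ?GV y"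
        unfolding gd_gradST_def split_beta' by simp
      then have GD: "(\<integral>y. norm (gd_gradST (Ds m) D y) powr p \<partial>QQ) = (\<integral>y. norm (Gs m y - ?GV y) powr p \<partial>QQ)"
        using borel_measurable_integrable[OF LpD(2)[OF S.gradST_Lp[of m D, OF DX]]]
          borel_measurable_integrable[OF LpD(2)[OF Lp_diff[OF S.p0(1) S.Gm_Lp GVL]]]
        by (intro integral_cong_AE) auto
      define A1 where "A1 = (\<integral>y. norm (Gs m y - ?GV y) powr p \<partial>QQ)"
      have A1: "A1 \<le> c * (e' + c * (e' + e'))"
      proof -
        have "(\<integral>y. norm (Gv y - ?GV y) powr p \<partial>QQ) \<le> e'"
          using elim(2) by (simp add: norm_minus_commute)
        then have "(\<integral>y. norm (G y - ?GV y) powr p \<partial>QQ) \<le> c * (e' + e')"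
          using aG c1 unfolding c_def by (intro order_trans[OF tri[OF sol_props(2) L(2) GVL]] mult_left_mono add_mono) auto
        then show ?thesis
          unfolding A1_def using elim(3) c1 unfolding c_def
          by (intro order_trans[OF tri[OF S.Gm_Lp sol_props(2) GVL]] mult_left_mono add_mono) auto
      qed
      have A2: "(\<integral>y. norm (Zs m y - ?PV y) powr p \<partial>QQ) \<le> C * A1"
        using C(2)[of m D, OF DX] unfolding PD GD A1_def .
      have "(\<integral>y. norm (v y - \<zeta> (ub y)) powr p \<partial>QQ) \<le> e'" using av by (simp add: abs_minus_commute)
      then have A3: "(\<integral>y. norm (?PV y - \<zeta> (ub y)) powr p \<partial>QQ) \<le> c * (e' + e')"
        using elim(1) c1 unfolding c_def by (intro order_trans[OF tri[OF PVL L(1) zeta_ub_Lp]] mult_left_mono add_mono) auto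
      have "(\<integral>y. norm (Zs m y - \<zeta> (ub y)) powr p \<partial>QQ) \<le> c * (C * A1 + c * (e' + e'))"
        using A2 A3 c1 unfolding c_def by (intro order_trans[OF tri[OF S.Zm_Lp[OF S.p0(1)] PVL zeta_ub_Lp]] mult_left_mono add_mono) auto
      also have "\<dots> \<le> c * (C * (c * (e' + c * (e' + e'))) + c * (e' + e'))"
        using A1 C(1) c1 by (intro mult_left_mono add_mono) auto
      also have "\<dots> \<le> 4 * M * e'"
      proof -
        have "c * (C * (c * (e' + c * (e' + e'))) + c * (e' + e')) = e' * (c * (C * (c * (1 + 2 * c)) + 2 * c))"
          by (simp add: algebra_simps)
        also have "\<dots> \<le> e' * (4 * M)"
        proof (rule mult_left_mono)
          have "C * (c * (1 + 2 * c)) + 2 * c \<le> 4 * ((c + 1) * (C + 1) * (c + 1))"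
            using C(1) c1 by (simp add: algebra_simps)
          then have "c * (C * (c * (1 + 2 * c)) + 2 * c) \<le> c * (4 * ((c + 1) * (C + 1) * (c + 1)))"
            using c1 by (intro mult_left_mono) auto
          then show "c * (C * (c * (1 + 2 * c)) + 2 * c) \<le> 4 * M" by (simp add: M_def algebra_simps)
        qed (use e' in simp)
        finally show ?thesis by (simp add: mult.commute)
      qed
      also have "\<dots> = e" using M by (simp add: e'_def)
      finally show ?case .
    qed
  qed
qed auto

lemma gradient_strong:
  assumes conv_nu: "Lp_strong QQ 1 (\<lambda>m. gd_PiST (Ds m) (gd_app (Ds m) (nu_fun \<zeta> \<beta>) (us m))) (\<lambda>y. nu_fun \<zeta> \<beta> (ub y))"
    and strict: "AE x in LL. \<forall>s \<xi> \<eta>. \<xi> \<noteq> \<eta> \<longrightarrow> (a x s \<xi> - a x s \<eta>) \<bullet> (\<xi> - \<eta>) > 0"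
  shows "(\<lambda>m. \<integral>y. norm (Gs m y - G y) powr p \<partial>QQ) \<longlonglongrightarrow> 0"
proof -
  obtain BG where BG: "\<And>m. (\<integral>y. norm (Gs m y) powr p \<partial>QQ) \<le> BG" by (rule Gs_bound) blast
  obtain abar \<mu> where ab: "abar \<in> Lp LL qq" "\<mu> > 0" "AE x in LL. \<forall>s \<xi>. norm (a x s \<xi>) \<le> abar x + \<mu> * norm \<xi> powr (p - 1)"
    using H unfolding hyp_H_def by blast
  obtain al where al: "al > 0" "AE x in LL. \<forall>s \<xi>. a x s \<xi> \<bullet> \<xi> \<ge> al * norm \<xi> powr p"
    using H unfolding hyp_H_def by blast
  have co: "AE x in LL. continuous_on UNIV (\<lambda>(s, \<xi>). a x s \<xi>)" using H unfolding hyp_H_def by blast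
  note lift = AE_lebesgue_on_fst[OF _ S.sets_Omega S.sets_Q]
  note nu = conv_nu[unfolded Lp_strong_def]
  show ?thesis
  proof (rule Leray_Lions_strong_convergence[where A = "\<lambda>y. a (fst y)", OF S.p lift[OF co] al(1) lift[OF al(2)] lift[OF strict]
        S.Lp_fst(1)[OF ab(1)] ab(2) lift[OF ab(3)] S.a_measurable _ _ _ conv_grad BG])
    show "gd_PiST (Ds m) (gd_app (Ds m) (nu_fun \<zeta> \<beta>) (us m)) \<in> Lp QQ 1" for m using nu by blast
    show "(\<lambda>y. nu_fun \<zeta> \<beta> (ub y)) \<in> Lp QQ 1" using nu by blast
    show "(\<lambda>m. \<integral>y. norm (gd_PiST (Ds m) (gd_app (Ds m) (nu_fun \<zeta> \<beta>) (us m)) y - nu_fun \<zeta> \<beta> (ub y)) powr 1 \<partial>QQ) \<longlonglongrightarrow> 0"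
      using nu Lp_norm_tendsto_0_iff[of 1 QQ "\<lambda>m y. gd_PiST (Ds m) (gd_app (Ds m) (nu_fun \<zeta> \<beta>) (us m)) y - nu_fun \<zeta> \<beta> (ub y)" sequentially] by simp
    show "\<forall>\<^sub>F m in sequentially. (\<integral>y. a (fst y) (gd_PiST (Ds m) (gd_app (Ds m) (nu_fun \<zeta> \<beta>) (us m)) y) (Gs m y) \<bullet> (Gs m y - G y) \<partial>QQ) \<le> e"
      if "e > 0" for e using limsup_A[OF that] by (simp add: S.am_def)
  qed
qed

end

theorem theorem2p12:
  fixes \<Omega> :: "'a::euclidean_space set" and T p :: real
    and \<zeta> \<beta> :: "real \<Rightarrow> real" and a :: "'a \<Rightarrow> real \<Rightarrow> 'a \<Rightarrow> 'a"
    and u_ini :: "'a \<Rightarrow> real" and f :: "'a \<times> real \<Rightarrow> real"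
    and Ds :: "nat \<Rightarrow> 'a stgd" and us :: "nat \<Rightarrow> nat \<Rightarrow> nat \<Rightarrow> real"
    and ub :: "'a \<times> real \<Rightarrow> real" and w :: "real \<Rightarrow> 'a \<Rightarrow> real"
    and G :: "'a \<times> real \<Rightarrow> 'a" and Dt :: "real \<Rightarrow> ('a \<Rightarrow> real) \<Rightarrow> real"
  assumes H: "hyp_H \<Omega> T p \<zeta> \<beta> a u_ini f"
    and D: "\<forall>m. is_stgd p \<Omega> T (Ds m)"
    and coer: "seq_coercive p \<Omega> Ds"
    and cons: "seq_consistent p \<Omega> Ds"
    and limconf: "seq_limit_conforming p \<Omega> Ds"
    and comp: "seq_compact_gd p \<Omega> Ds"
    and gs: "\<forall>m. gs_solution \<Omega> T \<zeta> \<beta> a u_ini f (Ds m) (us m)"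
    and sol: "cont_solution \<Omega> T p \<zeta> \<beta> a u_ini f ub w G Dt"
    and conv_beta: "\<forall>\<phi> \<in> Lp (lebesgue_on \<Omega>) 2.
        uniform_limit {0..T}
          (\<lambda>m t. \<integral>x. gd_PiST (Ds m) (gd_app (Ds m) \<beta> (us m)) (x, t) * \<phi> x \<partial>lebesgue_on \<Omega>)
          (\<lambda>t. \<integral>x. w t x * \<phi> x \<partial>lebesgue_on \<Omega>) sequentially"
    and conv_nu: "Lp_strong (lebesgue_on (\<Omega> \<times> {0<..<T})) 1
        (\<lambda>m. gd_PiST (Ds m) (gd_app (Ds m) (nu_fun \<zeta> \<beta>) (us m))) (\<lambda>y. nu_fun \<zeta> \<beta> (ub y))"
    and conv_zeta: "Lp_weak (lebesgue_on (\<Omega> \<times> {0<..<T})) p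
        (\<lambda>m. gd_PiST (Ds m) (gd_app (Ds m) \<zeta> (us m))) (\<lambda>y. \<zeta> (ub y))"
    and conv_grad: "Lp_weak (lebesgue_on (\<Omega> \<times> {0<..<T})) p
        (\<lambda>m. gd_gradST (Ds m) (gd_app (Ds m) \<zeta> (us m))) G"
    and strict_mono_a: "AE x in lebesgue_on \<Omega>. \<forall>s \<xi> \<eta>. \<xi> \<noteq> \<eta> \<longrightarrow> (a x s \<xi> - a x s \<eta>) \<bullet> (\<xi> - \<eta>) > 0"
  shows "Lp_strong (lebesgue_on (\<Omega> \<times> {0<..<T})) p
           (\<lambda>m. gd_PiST (Ds m) (gd_app (Ds m) \<zeta> (us m))) (\<lambda>y. \<zeta> (ub y))
       \<and> Lp_strong (lebesgue_on (\<Omega> \<times> {0<..<T})) p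
           (\<lambda>m. gd_gradST (Ds m) (gd_app (Ds m) \<zeta> (us m))) G"
proof -
  interpret gdm_sequence \<Omega> T p \<zeta> \<beta> a u_ini f Ds us ub w G Dt
    by unfold_locales (use H D coer cons gs sol conv_beta conv_zeta conv_grad in blast)+
  have grad: "(\<lambda>m. \<integral>y. norm (Gs m y - G y) powr p \<partial>QQ) \<longlonglongrightarrow> 0"
    by (rule gradient_strong[OF conv_nu strict_mono_a])
  show ?thesis
    using conv_zeta conv_grad grad zeta_strong_from_gradient[OF grad]
    unfolding Lp_strong_def Lp_weak_def Lp_norm_tendsto_0_iff[OF S.p0(2)] by blast
qed

end
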